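(* Let $\mathcal{A}$ be a cluster algebra such that $V(\mathcal{A},\Bbbk)$ has no deep points for every field $\Bbbk$ (or equivalently, such that the deep ideal $\mathsf{D}(\mathcal{A})$ is trivial, i.e. $1\in\mathsf{D}(\mathcal{A})$). Then: (1) $\mathcal{A}$ is non-singular. (2) $\mathcal{A}$ is finitely generated (as a ring). (3) $\mathcal{A}$ is equal to its upper cluster algebra. (4) $\mathcal{A}$ is a locally acyclic cluster algebra.
   Context: "Cluster algebra" means a skew-symmetrizable cluster algebra of geometric type over $\mathbb{Z}$ in the sense of Fomin--Zelevinsky: the subring of the ambient field of rational functions generated by all cluster variables obtained from an initial seed by iterated mutation, together with the frozen variables and the inverses of the frozen variables (frozen variables are allowed, and their inverses are included). A cluster $\{x_1,\dots,x_n\}$ means the set of mutable variables of a seed together with all frozen variables. By the Laurent phenomenon, $\mathcal{A}[x_1^{-1},\dots,x_n^{-1}]=\mathbb{Z}[x_1^{\pm1},\dots,x_n^{\pm1}]$ for every cluster. The upper cluster algebra $\mathcal{U}$ is the intersection, inside the ambient field, of the rings $\mathbb{Z}[x_1^{\pm1},\dots,x_n^{\pm1}]$ over all clusters. For a field $\Bbbk$, the cluster variety is $V(\mathcal{A},\Bbbk)=\mathrm{Hom}_{\mathrm{Ring}}(\mathcal{A},\Bbbk)$ with the Zariski topology (closed sets are the sets of homomorphisms killing a fixed ideal). A point $p\in V(\mathcal{A},\Bbbk)$ is deep if for every cluster $\{x_1,\dots,x_n\}$ there is some $x_i$ in it with $p(x_i)=0$. The deep ideal is $\mathsf{D}(\mathcal{A})=\sum_{\text{clusters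 }\{x_1,\dots,x_n\}}\mathcal{A}\,x_1x_2\cdots x_n$. "$\mathcal{A}$ is non-singular" means that $V(\mathcal{A},\Bbbk)$ is non-singular for all fields $\Bbbk$ (a point $p$ being non-singular if the local ring of $\mathcal{A}\otimes_{\mathbb{Z}}\Bbbk$ at the corresponding maximal ideal is regular). Locally acyclic: freezing some mutable variables $x_{1},\dots,x_{k}$ of a seed of $\mathcal{A}$ gives a new seed with cluster algebra $\mathcal{A}^\dagger$; if $\mathcal{A}^\dagger=\mathcal{A}[x_1^{-1},\dots,x_k^{-1}]$ then $\mathcal{A}^\dagger$ is called a cluster localization of $\mathcal{A}$. A cluster algebra is acyclic if it has a seed whose mutable part (directed graph on the mutable indices determined by signs of the exchange matrix) has no directed cycles; in particular, a cluster algebra with no mutable variables is acyclic. $\mathcal{A}$ is locally acyclic if there are acyclic cluster localizations $\mathcal{A}_i$ of $\mathcal{A}$ such that every prime ideal $P$ of $\mathcal{A}$ satisfies $P\mathcal{A}_i\neq\mathcal{A}_i$ for some $i$ (equivalently, the $\mathrm{Spec}(\mathcal{A}_i)$ cover $\mathrm{Spec}(\mathcal{A})$). *)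

theory Defs
  imports
    "HOL-Algebra.Algebra"
    "HOL-Algebra.Ring_Divisibility"
    "HOL-Algebra.Algebraic_Closure_Type"
    "HOL-Library.Poly_Mapping"
    "HOL-Library.Extended_Nat"
    "HOL-Library.Infinite_Typeclass"
begin

section \<open>Commutative algebra\<close>

definition krull_dim :: "('a, 'm) ring_scheme \<Rightarrow> enat" where
  "krull_dim R = Sup {enat n | n.
     \<exists>P. (\<forall>i\<le>n. primeideal (P i) R) \<and> (\<forall>i<n. P i \<subset> P (Suc i))}"

definition regular_local_ring :: "('a, 'm) ring_scheme \<Rightarrow> bool" where
  "regular_local_ring R \<longleftrightarrow>
     cring R \<and> noetherian_ring R \<and>
     (\<exists>M. maximalideal M R \<and> (\<forall>M'. maximalideal M' R \<longrightarrow> M' = M) \<and>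
        (\<exists>S. finite S \<and> S \<subseteq> carrier R \<and> M = Idl\<^bsub>R\<^esub> S \<and> enat (card S) = krull_dim R))"

text \<open>The localization of \<open>R\<close> at a prime ideal \<open>P\<close>: classes of fractions \<open>(r, s)\<close> with
  \<open>r \<in> R\<close> and \<open>s \<in> R - P\<close>. The ring \<open>R\<close> is not assumed to be a domain, hence the factor \<open>t\<close>.\<close>

definition fraction_rel :: "('a, 'm) ring_scheme \<Rightarrow> 'a set \<Rightarrow> (('a \<times> 'a) \<times> ('a \<times> 'a)) set" where
  "fraction_rel R P = {((r, s), (r', s')) | r s r' s'.
     r \<in> carrier R \<and> r' \<in> carrier R \<and> s \<in> carrier R - P \<and> s' \<in> carrier R - P \<and>
     (\<exists>t \<in> carrier R - P. t \<otimes>\<^bsub>R\<^esub> ((r \<otimes>\<^bsub>R\<^esub> s') \<ominus>\<^bsub>R\<^esub> (r' \<otimes>\<^bsub>R\<^esub> s)) = \<zero>\<^bsub>R\<^esub>)}"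

definition localization_at :: "('a, 'm) ring_scheme \<Rightarrow> 'a set \<Rightarrow> ('a \<times> 'a) set ring" where
  "localization_at R P =
     \<lparr> carrier = (carrier R \<times> (carrier R - P)) // fraction_rel R P,
       monoid.mult = (\<lambda>U V. \<Union>(r, s) \<in> U. \<Union>(r', s') \<in> V.
                 fraction_rel R P `` {(r \<otimes>\<^bsub>R\<^esub> r', s \<otimes>\<^bsub>R\<^esub> s')}),
       one = fraction_rel R P `` {(\<one>\<^bsub>R\<^esub>, \<one>\<^bsub>R\<^esub>)},
       ring.zero = fraction_rel R P `` {(\<zero>\<^bsub>R\<^esub>, \<one>\<^bsub>R\<^esub>)},
       add = (\<lambda>U V. \<Union>(r, s) \<in> U. \<Union>(r', s') \<in> V.
                fraction_rel R P `` {((r \<otimes>\<^bsub>R\<^esub> s') \<oplus>\<^bsub>R\<^esub> (r' \<otimes>\<^bsub>R\<^esub> s), s \<otimes>\<^bsub>R\<^esub> s')}) \<rparr>"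

text \<open>The tensor product of commutative rings over the integers is the free abelian group on
  the pairs \<open>(a, b)\<close>, made into a ring by \<open>(a, b) (a', b') = (a a', b b')\<close>, modulo the
  biadditivity relations.\<close>

definition pair_ring ::
    "('a, 'm) ring_scheme \<Rightarrow> ('b, 'n) ring_scheme \<Rightarrow> (('a \<times> 'b) \<Rightarrow>\<^sub>0 int) ring" where
  "pair_ring A B =
     \<lparr> carrier = {u. Poly_Mapping.keys u \<subseteq> carrier A \<times> carrier B},
       monoid.mult = (\<lambda>u v. frag_extend (\<lambda>(a, b).
                 frag_extend (\<lambda>(a', b'). frag_of (a \<otimes>\<^bsub>A\<^esub> a', b \<otimes>\<^bsub>B\<^esub> b')) v) u),
       one = frag_of (\<one>\<^bsub>A\<^esub>, \<one>\<^bsub>B\<^esub>),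
       ring.zero = 0,
       add = (+) \<rparr>"

definition tensor_ideal ::
    "('a, 'm) ring_scheme \<Rightarrow> ('b, 'n) ring_scheme \<Rightarrow> (('a \<times> 'b) \<Rightarrow>\<^sub>0 int) set" where
  "tensor_ideal A B = Idl\<^bsub>pair_ring A B\<^esub>
     ({frag_of (a \<oplus>\<^bsub>A\<^esub> a', b) - frag_of (a, b) - frag_of (a', b) | a a' b.
         a \<in> carrier A \<and> a' \<in> carrier A \<and> b \<in> carrier B} \<union>
      {frag_of (a, b \<oplus>\<^bsub>B\<^esub> b') - frag_of (a, b) - frag_of (a, b') | a b b'.
         a \<in> carrier A \<and> b \<in> carrier B \<and> b' \<in> carrier B})"

definition tensor_ring ::
    "('a, 'm) ring_scheme \<Rightarrow> ('b, 'n) ring_scheme \<Rightarrow> (('a \<times> 'b) \<Rightarrow>\<^sub>0 int) set ring" where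
  "tensor_ring A B = pair_ring A B Quot tensor_ideal A B"

text \<open>For a homomorphism \<open>p\<close> from \<open>A\<close> to a field \<open>K\<close>, the corresponding maximal ideal of
  the tensor product is the kernel of the map to \<open>K\<close> sending \<open>a \<otimes> c\<close> to \<open>p a * c\<close>.
  Below, \<open>pair_eval\<close> is the lift of this map to the free abelian group.\<close>

definition pair_eval :: "('b, 'n) ring_scheme \<Rightarrow> ('a \<Rightarrow> 'b) \<Rightarrow> (('a \<times> 'b) \<Rightarrow>\<^sub>0 int) \<Rightarrow> 'b" where
  "pair_eval K p u = finsum K
     (\<lambda>(a, c). add_pow K (Poly_Mapping.lookup u (a, c)) (p a \<otimes>\<^bsub>K\<^esub> c)) (Poly_Mapping.keys u)"

definition point_ideal ::
    "('a, 'm) ring_scheme \<Rightarrow> ('b, 'n) ring_scheme \<Rightarrow> ('a \<Rightarrow> 'b) \<Rightarrow> (('a \<times> 'b) \<Rightarrow>\<^sub>0 int) set set" where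
  "point_ideal A K p =
     {tensor_ideal A K +>\<^bsub>pair_ring A K\<^esub> u | u.
        u \<in> carrier (pair_ring A K) \<and> pair_eval K p u = \<zero>\<^bsub>K\<^esub>}"

section \<open>Seeds and their mutations\<close>

text \<open>Polynomials in variables indexed by \<open>'i\<close> with rational coefficients are finitely supported
  maps from exponent vectors to \<open>rat\<close>.\<close>

definition poly_value :: "('i \<Rightarrow> 'f::field_char_0) \<Rightarrow> (('i \<Rightarrow>\<^sub>0 nat) \<Rightarrow>\<^sub>0 rat) \<Rightarrow> 'f" where
  "poly_value x q = (\<Sum>m \<in> Poly_Mapping.keys q.
     of_rat (Poly_Mapping.lookup q m) * (\<Prod>i \<in> Poly_Mapping.keys m. x i ^ Poly_Mapping.lookup m i))"

definition polys_in :: "'i set \<Rightarrow> (('i \<Rightarrow>\<^sub>0 nat) \<Rightarrow>\<^sub>0 rat) set" where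
  "polys_in I = {q. \<forall>m \<in> Poly_Mapping.keys q. Poly_Mapping.keys m \<subseteq> I}"

text \<open>The type \<open>'f\<close> is the field of rational functions over the rationals in the independent
  variables \<open>x i\<close>, \<open>i \<in> I\<close>.\<close>

definition free_generators :: "'i set \<Rightarrow> ('i \<Rightarrow> 'f::field_char_0) \<Rightarrow> bool" where
  "free_generators I x \<longleftrightarrow>
     (\<forall>q \<in> polys_in I. poly_value x q = 0 \<longrightarrow> q = 0) \<and>
     (\<forall>y. \<exists>q \<in> polys_in I. \<exists>r \<in> polys_in I. poly_value x r \<noteq> 0 \<and> y = poly_value x q / poly_value x r)"

text \<open>The indices in \<open>ind s - mut s\<close> are frozen. The extended exchange matrix is the
  restriction of \<open>mat s\<close> to rows in \<open>ind s\<close> and columns in \<open>mut s\<close>; other entries, and values of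
  \<open>var s\<close> outside \<open>ind s\<close>, are irrelevant.\<close>

record ('i, 'f) seed =
  ind :: "'i set"
  mut :: "'i set"
  var :: "'i \<Rightarrow> 'f"
  mat :: "'i \<Rightarrow> 'i \<Rightarrow> int"

definition skew_symmetrizable :: "'i set \<Rightarrow> ('i \<Rightarrow> 'i \<Rightarrow> int) \<Rightarrow> bool" where
  "skew_symmetrizable M B \<longleftrightarrow>
     (\<exists>d :: 'i \<Rightarrow> int. (\<forall>i\<in>M. d i > 0) \<and> (\<forall>i\<in>M. \<forall>j\<in>M. d i * B i j = - (d j * B j i)))"

definition is_seed :: "('i, 'f::field_char_0) seed \<Rightarrow> bool" where
  "is_seed s \<longleftrightarrow>
     finite (ind s) \<and> mut s \<subseteq> ind s \<and>
     free_generators (ind s) (var s) \<and> skew_symmetrizable (mut s) (mat s)"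

definition mutate :: "'i \<Rightarrow> ('i, 'f::field_char_0) seed \<Rightarrow> ('i, 'f) seed" where
  "mutate k s = s
     \<lparr> var := (var s)(k :=
         ((\<Prod>i \<in> ind s. var s i ^ nat (mat s i k)) +
          (\<Prod>i \<in> ind s. var s i ^ nat (- mat s i k))) / var s k),
       mat := (\<lambda>i j. if i = k \<or> j = k then - mat s i j
         else mat s i j + max 0 (mat s i k) * max 0 (mat s k j)
                        - max 0 (- mat s i k) * max 0 (- mat s k j)) \<rparr>"

inductive_set seeds_of :: "('i, 'f::field_char_0) seed \<Rightarrow> ('i, 'f) seed set"
  for s :: "('i, 'f) seed" where
  initial: "s \<in> seeds_of s"
| mutation: "t \<in> seeds_of s \<Longrightarrow> k \<in> mut t \<Longrightarrow> mutate k t \<in> seeds_of s"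

definition cluster :: "('i, 'f::field_char_0) seed \<Rightarrow> 'f set" where
  "cluster s = var s ` ind s"

section \<open>Cluster algebras and upper cluster algebras\<close>

abbreviation subring_gen :: "'f::field_char_0 set \<Rightarrow> 'f set" where
  "subring_gen G \<equiv> generate_ring ring_of_type_algebra G"

definition cluster_algebra :: "('i, 'f::field_char_0) seed \<Rightarrow> 'f set" where
  "cluster_algebra s = subring_gen
     ((\<Union>t \<in> seeds_of s. cluster t) \<union> (\<lambda>i. inverse (var s i)) ` (ind s - mut s))"

definition cluster_ring :: "('i, 'f::field_char_0) seed \<Rightarrow> 'f ring" where
  "cluster_ring s = ring_of_type_algebra \<lparr> carrier := cluster_algebra s \<rparr>"

definition laurent_ring :: "('i, 'f::field_char_0) seed \<Rightarrow> 'f set" where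
  "laurent_ring t = subring_gen (cluster t \<union> inverse ` cluster t)"

definition upper_cluster_algebra :: "('i, 'f::field_char_0) seed \<Rightarrow> 'f set" where
  "upper_cluster_algebra s = (\<Inter>t \<in> seeds_of s. laurent_ring t)"

definition finitely_generated_ring :: "'f::field_char_0 set \<Rightarrow> bool" where
  "finitely_generated_ring A \<longleftrightarrow> (\<exists>G. finite G \<and> G \<subseteq> A \<and> A = subring_gen G)"

section \<open>Cluster varieties\<close>

definition cluster_variety :: "('i, 'f::field_char_0) seed \<Rightarrow> 'k ring \<Rightarrow> ('f \<Rightarrow> 'k) set" where
  "cluster_variety s K = ring_hom (cluster_ring s) K"

definition deep_point :: "('i, 'f::field_char_0) seed \<Rightarrow> 'k ring \<Rightarrow> ('f \<Rightarrow> 'k) \<Rightarrow> bool" where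
  "deep_point s K p \<longleftrightarrow>
     p \<in> cluster_variety s K \<and> (\<forall>t \<in> seeds_of s. \<exists>x \<in> cluster t. p x = \<zero>\<^bsub>K\<^esub>)"

text \<open>The quantifier ranges over the fields whose carrier is a set of elements of a given type.
  Cluster algebras are countable, so a deep point over any field is one over a countable
  subfield; hence every infinite type yields the same notion.\<close>

definition no_deep_points :: "'k::infinite itself \<Rightarrow> ('i, 'f::field_char_0) seed \<Rightarrow> bool" where
  "no_deep_points _ s \<longleftrightarrow> (\<forall>K :: 'k ring. field K \<longrightarrow> \<not> (\<exists>p. deep_point s K p))"

definition deep_ideal :: "('i, 'f::field_char_0) seed \<Rightarrow> 'f set" where
  "deep_ideal s = Idl\<^bsub>cluster_ring s\<^esub> {\<Prod>x \<in> cluster t. x | t. t \<in> seeds_of s}"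

definition nonsingular_point :: "('i, 'f::field_char_0) seed \<Rightarrow> 'k ring \<Rightarrow> ('f \<Rightarrow> 'k) \<Rightarrow> bool" where
  "nonsingular_point s K p \<longleftrightarrow>
     regular_local_ring
       (localization_at (tensor_ring (cluster_ring s) K) (point_ideal (cluster_ring s) K p))"

definition nonsingular_variety :: "('i, 'f::field_char_0) seed \<Rightarrow> 'k ring \<Rightarrow> bool" where
  "nonsingular_variety s K \<longleftrightarrow> (\<forall>p \<in> cluster_variety s K. nonsingular_point s K p)"

section \<open>Local acyclicity\<close>

definition freeze :: "'i set \<Rightarrow> ('i, 'f::field_char_0) seed \<Rightarrow> ('i, 'f) seed" where
  "freeze S t = t \<lparr> mut := mut t - S \<rparr>"

definition cluster_localizations :: "('i, 'f::field_char_0) seed \<Rightarrow> ('i, 'f) seed set" where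
  "cluster_localizations s = {freeze S t | S t.
     t \<in> seeds_of s \<and> S \<subseteq> mut t \<and>
     cluster_algebra (freeze S t) =
       subring_gen (cluster_algebra s \<union> (\<lambda>i. inverse (var t i)) ` S)}"

definition acyclic_cluster_algebra :: "('i, 'f::field_char_0) seed \<Rightarrow> bool" where
  "acyclic_cluster_algebra s \<longleftrightarrow>
     (\<exists>t \<in> seeds_of s. acyclic {(i, j). i \<in> mut t \<and> j \<in> mut t \<and> mat t i j > 0})"

definition locally_acyclic :: "('i, 'f::field_char_0) seed \<Rightarrow> bool" where
  "locally_acyclic s \<longleftrightarrow>
     (\<exists>L \<subseteq> cluster_localizations s.
        (\<forall>t \<in> L. acyclic_cluster_algebra t) \<and>
        (\<forall>P. primeideal P (cluster_ring s) \<longrightarrow>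
           (\<exists>t \<in> L. Idl\<^bsub>cluster_ring t\<^esub> P \<noteq> carrier (cluster_ring t))))"

end

theory Submission
  imports Defs
begin

text \<open>
  If the deep ideal is trivial, then \<open>1\<close> is a combination of finitely many cluster monomials, with coefficients in the cluster
  algebra \<open>A\<close>. Geometrically, the variety of \<open>A\<close> is covered by the tori of finitely many clusters, and all four conclusions are
  local statements that hold on a torus.

  \<^item> The deep ideal is trivial iff there are no deep points: a maximal ideal that contains the deep ideal is a deep point over its
    residue field, which is countable and hence fits into every infinite type (\<open>no_deep_points_iff\<close>).
  \<^item> Let \<open>B\<close> be a subring that contains the coefficients and the variables of the clusters in the partition of unity. An
    element of the upper cluster algebra is multiplied into \<open>B\<close> by a power of each of these cluster monomials, hence by a power of \<open>1\<close>
    (\<open>upper_subset_of_covering\<close>). For \<open>B = A\<close> this shows that \<open>A\<close> is its upper cluster algebra; for the smallest such \<open>B\<close> it shows that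
    \<open>A\<close> is finitely generated.
  \<^item> Freezing all variables of a cluster localizes \<open>A\<close> to the Laurent ring of the cluster, which is acyclic. Every prime ideal misses a
    cluster monomial and survives in the corresponding Laurent ring (\<open>locally_acyclic_if_no_deep\<close>).
  \<^item> A point over a field \<open>K\<close> avoids the zeros of some cluster monomial, and the local ring there is that of a rational point of a torus over
    \<open>K\<close> (\<open>regular_at_torus_point\<close>).

  All of this rests on the Laurent phenomenon: \<open>A\<close> is contained in the Laurent ring of each of its clusters (\<open>laurent_phenomenon\<close>). It is proved
  for exchange matrices of full rank by induction on the mutation sequence. The induction compares two representations of a cluster
  variable whose denominators have no common factor; that they have none is expressed by a regularity property modulo a principal ideal, which
  for binomials in a Laurent polynomial ring over the integers can be checked by hand (\<open>regular_binomial\<close>). The general case follows by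
  specialising principal coefficients to \<open>1\<close>.

  Regularity at a point of the torus is checked against the definition. The local ring is Noetherian by Hilbert's basis theorem.
  Its dimension is bounded above by the number \<open>n\<close> of coordinates, because elements that witness a strictly increasing chain of primes are
  algebraically independent, while any \<open>n + 1\<close> polynomials in \<open>n\<close> elements are dependent (\<open>prime_chain_length\<close>). It is bounded below by the chain
  of the ideals of the subtori on which the first \<open>j\<close> coordinates agree with those of the point. These ideals are prime as kernels of
  homomorphisms into a group algebra over \<open>K\<close>, and the \<open>n\<close> shifted coordinates generate the maximal ideal.
\<close>

section \<open>Laurent polynomials and their evaluation in a field\<close>

type_synonym 'i laurent = "('i \<Rightarrow>\<^sub>0 int) \<Rightarrow>\<^sub>0 int"

abbreviation mterm :: "'e \<Rightarrow> 'c::zero \<Rightarrow> 'e \<Rightarrow>\<^sub>0 'c" where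
  "mterm \<equiv> Poly_Mapping.single"

lemma mterm_sum:
  fixes g :: "'a \<Rightarrow> 'c::comm_monoid_add"
  shows "mterm e (\<Sum>x\<in>S. g x) = (\<Sum>x\<in>S. mterm e (g x))"
  by (induction S rule: infinite_finite_induct) (auto simp: single_add)

lemma poly_mapping_expansion:
  fixes p :: "'e \<Rightarrow>\<^sub>0 'c::comm_monoid_add"
  shows "p = (\<Sum>e\<in>Poly_Mapping.keys p. mterm e (Poly_Mapping.lookup p e))"
proof (rule poly_mapping_eqI)
  fix k
  have "Poly_Mapping.lookup (\<Sum>e\<in>Poly_Mapping.keys p. mterm e (Poly_Mapping.lookup p e)) k =
     (\<Sum>e\<in>Poly_Mapping.keys p. if e = k then Poly_Mapping.lookup p k else 0)"
    unfolding lookup_sum by (rule sum.cong) (auto simp: lookup_single)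
  thus "Poly_Mapping.lookup p k =
      Poly_Mapping.lookup (\<Sum>e\<in>Poly_Mapping.keys p. mterm e (Poly_Mapping.lookup p e)) k"
    by (simp add: in_keys_iff)
qed

lemma poly_mapping_mterm_induct [case_names single sum]:
  fixes p :: "'e \<Rightarrow>\<^sub>0 'c::comm_monoid_add"
  assumes single: "\<And>a c. P (mterm a c)" and sum: "\<And>p q. P p \<Longrightarrow> P q \<Longrightarrow> P (p + q)"
  shows "P p"
proof -
  have "P (\<Sum>e\<in>S. mterm e (Poly_Mapping.lookup p e))" for S
    by (induction S rule: infinite_finite_induct) (use single[of _ 0] in \<open>auto intro: single sum\<close>)
  thus ?thesis using poly_mapping_expansion[of p] by metis
qed

text \<open>The value of the Laurent monomial with exponent vector \<open>e\<close>.\<close>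

definition monval :: "('i \<Rightarrow> 'f::field) \<Rightarrow> ('i \<Rightarrow>\<^sub>0 int) \<Rightarrow> 'f" where
  "monval v e = (\<Prod>i\<in>Poly_Mapping.keys e. v i powi Poly_Mapping.lookup e i)"

definition laurent_eval :: "('i \<Rightarrow> 'f::field) \<Rightarrow> 'i laurent \<Rightarrow> 'f" where
  "laurent_eval v p = (\<Sum>e\<in>Poly_Mapping.keys p. of_int (Poly_Mapping.lookup p e) * monval v e)"

lemma mon_superset:
  assumes "finite S" "Poly_Mapping.keys e \<subseteq> S"
  shows "monval v e = (\<Prod>i\<in>S. v i powi Poly_Mapping.lookup e i)"
  unfolding monval_def
  by (rule prod.mono_neutral_left) (use assms in \<open>auto simp: in_keys_iff\<close>)

lemma mon_zero [simp]: "monval v 0 = 1"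
  by (simp add: monval_def)

lemma mon_frag_of [simp]: "monval v (frag_of i) = v i"
  by (simp add: monval_def keys_frag_of)

lemma mon_add:
  assumes "\<And>i. v i \<noteq> 0"
  shows "monval v (a + b) = monval v a * monval v b"
proof -
  let ?S = "Poly_Mapping.keys a \<union> Poly_Mapping.keys b"
  have "monval v (a + b) = (\<Prod>i\<in>?S. v i powi Poly_Mapping.lookup (a + b) i)"
    using Poly_Mapping.keys_add[of a b] by (intro mon_superset) auto
  also have "\<dots> = (\<Prod>i\<in>?S. v i powi Poly_Mapping.lookup a i * v i powi Poly_Mapping.lookup b i)"
    by (simp add: lookup_add power_int_add assms)
  also have "\<dots> = monval v a * monval v b"
    by (simp add: prod.distrib mon_superset[of ?S a] mon_superset[of ?S b])
  finally show ?thesis .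
qed

lemma mon_nonzero:
  assumes "\<And>i. v i \<noteq> 0"
  shows "monval v a \<noteq> 0"
  unfolding monval_def by (simp add: assms)

lemma mon_uminus:
  assumes "\<And>i. v i \<noteq> 0"
  shows "monval v (- a) = inverse (monval v a)"
proof -
  have "monval v (- a) * monval v a = 1"
    by (subst mon_add[symmetric]) (use assms in auto)
  thus ?thesis by (metis inverse_unique mult.commute)
qed

lemma mon_cmul_frag_of:
  "monval v (frag_cmul k (frag_of i)) = v i powi k"
proof (cases "k = 0")
  case False
  hence "Poly_Mapping.keys (frag_cmul k (frag_of i)) = {i}" by (auto simp: keys_frag_of)
  thus ?thesis unfolding monval_def by simp
qed simp

lemma laurent_eval_superset:
  assumes "finite S" "Poly_Mapping.keys p \<subseteq> S"
  shows "laurent_eval v p = (\<Sum>e\<in>S. of_int (Poly_Mapping.lookup p e) * monval v e)"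
  unfolding laurent_eval_def
  by (rule sum.mono_neutral_left) (use assms in \<open>auto simp: in_keys_iff\<close>)

lemma laurent_eval_zero [simp]: "laurent_eval v 0 = 0"
  by (simp add: laurent_eval_def)

lemma laurent_eval_single [simp]: "laurent_eval v (mterm e c) = of_int c * monval v e"
  by (cases "c = 0") (simp_all add: laurent_eval_def)

lemma laurent_eval_add: "laurent_eval v (p + q) = laurent_eval v p + laurent_eval v q"
proof -
  let ?S = "Poly_Mapping.keys p \<union> Poly_Mapping.keys q"
  have "laurent_eval v (p + q) = (\<Sum>e\<in>?S. of_int (Poly_Mapping.lookup (p + q) e) * monval v e)"
    using Poly_Mapping.keys_add[of p q] by (intro laurent_eval_superset) auto
  also have "\<dots> = laurent_eval v p + laurent_eval v q"
    by (simp add: lookup_add ring_distribs sum.distrib laurent_eval_superset[of ?S p] laurent_eval_superset[of ?S q])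
  finally show ?thesis .
qed

lemma laurent_eval_uminus: "laurent_eval v (- p) = - laurent_eval v p"
  using laurent_eval_add[of v p "- p"] by (simp add: add_eq_0_iff)

lemma laurent_eval_diff: "laurent_eval v (p - q) = laurent_eval v p - laurent_eval v q"
  using laurent_eval_add[of v p "- q"] by (simp add: laurent_eval_uminus)

lemma laurent_eval_sum: "laurent_eval v (\<Sum>x\<in>S. g x) = (\<Sum>x\<in>S. laurent_eval v (g x))"
  by (induction S rule: infinite_finite_induct) (auto simp: laurent_eval_add)

lemma laurent_eval_one [simp]: "laurent_eval v 1 = 1"
  using laurent_eval_single[of v 0 1] by (simp del: laurent_eval_single add: single_one)

lemma laurent_eval_mult:
  assumes "\<And>i. v i \<noteq> 0"
  shows "laurent_eval v (p * q) = laurent_eval v p * laurent_eval v q"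
proof (induction p rule: poly_mapping_mterm_induct)
  case (single a c)
  show ?case
  proof (induction q rule: poly_mapping_mterm_induct)
    case (single b d)
    show ?case by (simp add: mult_single mon_add assms)
  next
    case (sum f g)
    thus ?case by (simp add: laurent_eval_add ring_distribs)
  qed
next
  case (sum f g)
  thus ?case by (simp add: laurent_eval_add ring_distribs)
qed

lemma laurent_eval_power:
  assumes "\<And>i. v i \<noteq> 0"
  shows "laurent_eval v (p ^ n) = laurent_eval v p ^ n"
  by (induction n) (auto simp: laurent_eval_mult assms)

lemma laurent_eval_prod:
  assumes "\<And>i. v i \<noteq> 0"
  shows "laurent_eval v (\<Prod>x\<in>S. g x) = (\<Prod>x\<in>S. laurent_eval v (g x))"
  by (induction S rule: infinite_finite_induct) (auto simp: laurent_eval_mult assms)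

lemma lookup_mterm_times:
  fixes e :: "'e::cancel_comm_monoid_add" and p :: "'e \<Rightarrow>\<^sub>0 'c::comm_semiring_1"
  shows "Poly_Mapping.lookup (mterm e c * p) (e + m) = c * Poly_Mapping.lookup p m"
proof (induction p rule: poly_mapping_mterm_induct)
  case (single a d)
  show ?case by (simp add: mult_single lookup_single when_def)
next
  case (sum f g)
  thus ?case by (simp add: lookup_add ring_distribs)
qed

subsection \<open>Laurent polynomials in a subset of the variables\<close>

definition laurent_in :: "'i set \<Rightarrow> 'i laurent set" where
  "laurent_in I = {p. \<forall>e\<in>Poly_Mapping.keys p. Poly_Mapping.keys e \<subseteq> I}"

lemma laurent_in_add: "p \<in> laurent_in I \<Longrightarrow> q \<in> laurent_in I \<Longrightarrow> p + q \<in> laurent_in I"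
  using Poly_Mapping.keys_add[of p q] unfolding laurent_in_def by blast

lemma laurent_in_uminus: "p \<in> laurent_in I \<Longrightarrow> - p \<in> laurent_in I"
  unfolding laurent_in_def by simp

lemma laurent_in_zero [simp]: "0 \<in> laurent_in I"
  unfolding laurent_in_def by simp

lemma laurent_in_single: "Poly_Mapping.keys e \<subseteq> I \<Longrightarrow> mterm e c \<in> laurent_in I"
  unfolding laurent_in_def by auto

lemma laurent_in_one [simp]: "1 \<in> laurent_in I"
  unfolding laurent_in_def by simp

lemma laurent_in_mult: 
  assumes "p \<in> laurent_in I" "q \<in> laurent_in I" 
  shows "p * q \<in> laurent_in I"
  unfolding laurent_in_def
proof (intro CollectI ballI)
  fix e assume "e \<in> Poly_Mapping.keys (p * q)"
  then obtain a b where "e = a + b" "a \<in> Poly_Mapping.keys p" "b \<in> Poly_Mapping.keys q"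
    using Poly_Mapping.keys_mult[of p q] by blast
  thus "Poly_Mapping.keys e \<subseteq> I"
    using assms Poly_Mapping.keys_add[of a b] unfolding laurent_in_def by blast
qed

lemma laurent_in_sum: "(\<And>x. x \<in> S \<Longrightarrow> g x \<in> laurent_in I) \<Longrightarrow> (\<Sum>x\<in>S. g x) \<in> laurent_in I"
  by (induction S rule: infinite_finite_induct) (auto intro: laurent_in_add)

lemma laurent_in_power: "p \<in> laurent_in I \<Longrightarrow> p ^ n \<in> laurent_in I"
  by (induction n) (auto intro: laurent_in_mult)

lemma laurent_in_mono: "I \<subseteq> J \<Longrightarrow> laurent_in I \<subseteq> laurent_in J"
  unfolding laurent_in_def by blast

lemma keys_sub: "Poly_Mapping.keys (a - b) \<subseteq> Poly_Mapping.keys a \<union> Poly_Mapping.keys (b::'i \<Rightarrow>\<^sub>0 int)"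
  by (auto simp: in_keys_iff lookup_minus)

text \<open>Linear independence of the Laurent monomials over the integers, that is, algebraic independence of the values \<open>v i\<close>, \<open>i \<in> I\<close>.\<close>

definition lindep :: "'i set \<Rightarrow> ('i \<Rightarrow> 'f::field) \<Rightarrow> bool" where
  "lindep I v \<longleftrightarrow> (\<forall>p\<in>laurent_in I. laurent_eval v p = 0 \<longrightarrow> p = 0)"

lemma lindepD: 
  assumes "lindep I v" "p \<in> laurent_in I" "q \<in> laurent_in I" "laurent_eval v p = laurent_eval v q" 
  shows "p = q"
proof -
  have "p + (- q) \<in> laurent_in I" using assms by (intro laurent_in_add laurent_in_uminus)
  moreover have "laurent_eval v (p + (- q)) = 0" using assms by (simp add: laurent_eval_diff)
  ultimately show ?thesis using assms(1) unfolding lindep_def by fastforce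
qed

subsection \<open>Binomials that are regular modulo another binomial\<close>

lemma binomial_dvd_aux:
  fixes \<beta> :: "'i \<Rightarrow>\<^sub>0 int"
  shows "(1 + mterm \<beta> 1) dvd mterm (frag_cmul k \<beta>) (1::int) - (if even k then 1 else - 1)"
proof (induction k rule: int_induct[where k = 0])
  case base
  show ?case by (simp add: single_one)
next
  case (step1 k)
  have "mterm (frag_cmul (k + 1) \<beta>) (1::int) = mterm (frag_cmul k \<beta>) 1 * mterm \<beta> 1"
    by (simp add: mult_single frag_cmul_distrib)
  hence "mterm (frag_cmul (k + 1) \<beta>) (1::int) - (if even (k + 1) then 1 else - 1) =
      mterm (frag_cmul k \<beta>) 1 * (1 + mterm \<beta> 1) - (mterm (frag_cmul k \<beta>) (1::int) - (if even k then 1 else - 1))"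
    by (simp add: algebra_simps)
  thus ?case using step1(2) by (metis dvd_diff dvd_triv_right)
next
  case (step2 k)
  have "mterm (frag_cmul k \<beta>) (1::int) = mterm (frag_cmul (k - 1) \<beta>) 1 * mterm \<beta> 1"
    by (simp add: mult_single frag_cmul_diff_distrib)
  hence "mterm (frag_cmul (k - 1) \<beta>) (1::int) - (if even (k - 1) then 1 else - 1) =
      mterm (frag_cmul (k - 1) \<beta>) 1 * (1 + mterm \<beta> 1) - (mterm (frag_cmul k \<beta>) (1::int) - (if even k then 1 else - 1))"
    by (simp add: algebra_simps)
  thus ?case using step2(2) by (metis dvd_diff dvd_triv_right)
qed

text \<open>Modulo \<open>1 + mterm \<beta> 1\<close> the monomial with exponent \<open>\<beta>\<close> becomes \<open>-1\<close>, so the quotient ring is free on the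
  cosets of the multiples of \<open>\<beta>\<close>. The number \<open>alt_sum \<beta> p m\<close> is the coefficient of the class of \<open>p\<close> at the coset of \<open>m\<close>,
  with \<open>m\<close> as the representative.\<close>

definition alt_char :: "('i \<Rightarrow>\<^sub>0 int) \<Rightarrow> ('i \<Rightarrow>\<^sub>0 int) \<Rightarrow> int" where
  "alt_char \<beta> d = (if \<exists>k. d = frag_cmul k \<beta> then if \<exists>k. even k \<and> d = frag_cmul k \<beta> then 1 else - 1 else 0)"

definition alt_sum :: "('i \<Rightarrow>\<^sub>0 int) \<Rightarrow> 'i laurent \<Rightarrow> ('i \<Rightarrow>\<^sub>0 int) \<Rightarrow> int" where
  "alt_sum \<beta> p m = (\<Sum>e\<in>Poly_Mapping.keys p. Poly_Mapping.lookup p e * alt_char \<beta> (e - m))"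

lemma frag_cmul_cancel: "\<beta> \<noteq> 0 \<Longrightarrow> frag_cmul k \<beta> = frag_cmul l \<beta> \<longleftrightarrow> k = l"
  by (metis frag_cmul_diff_distrib frag_cmul_eq_0_iff right_minus_eq)

lemma alt_char_cmul: 
  assumes "\<beta> \<noteq> 0" 
  shows "alt_char \<beta> (frag_cmul k \<beta>) = (if even k then 1 else - 1)"
  unfolding alt_char_def by (auto simp: frag_cmul_cancel[OF assms])

lemma alt_char_add:
  assumes "\<beta> \<noteq> 0" 
  shows "alt_char \<beta> (d + \<beta>) = - alt_char \<beta> d"
proof (cases "\<exists>k. d = frag_cmul k \<beta>")
  case True
  then obtain k where k: "d = frag_cmul k \<beta>" by blast
  have "d + \<beta> = frag_cmul (k + 1) \<beta>" by (simp add: k frag_cmul_distrib)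
  thus ?thesis using alt_char_cmul[OF assms] k by auto
next
  case False
  hence "\<nexists>k. d + \<beta> = frag_cmul k \<beta>"
    by (metis add_diff_cancel frag_cmul_diff_distrib frag_cmul_one)
  thus ?thesis using False unfolding alt_char_def by simp
qed

lemma alt_sum_add: "alt_sum \<beta> (p + q) m = alt_sum \<beta> p m + alt_sum \<beta> q m"
proof -
  let ?S = "Poly_Mapping.keys p \<union> Poly_Mapping.keys q"
  have *: "alt_sum \<beta> r m = (\<Sum>e\<in>?S. Poly_Mapping.lookup r e * alt_char \<beta> (e - m))"
    if "Poly_Mapping.keys r \<subseteq> ?S" for r
    unfolding alt_sum_def
    by (rule sum.mono_neutral_left) (use that in \<open>auto simp: in_keys_iff\<close>)
  show ?thesis using Poly_Mapping.keys_add[of p q]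
    by (simp add: * lookup_add ring_distribs sum.distrib)
qed

lemma alt_sum_single: "alt_sum \<beta> (mterm e c) m = c * alt_char \<beta> (e - m)"
  by (cases "c = 0") (simp_all add: alt_sum_def)

lemma alt_sum_mterm_times:
  "alt_sum \<beta> (f * mterm \<gamma> c) m = c * alt_sum \<beta> f (m - \<gamma>)"
proof (induction f rule: poly_mapping_mterm_induct)
  case (single a d)
  show ?case by (simp add: mult_single alt_sum_single algebra_simps)
next
  case (sum f g)
  thus ?case by (simp add: alt_sum_add ring_distribs)
qed

lemma alt_sum_binomial_times:
  assumes "\<beta> \<noteq> 0"
  shows "alt_sum \<beta> ((1 + mterm \<beta> 1) * h) m = 0"
proof -
  have "alt_sum \<beta> h (m - \<beta>) = - alt_sum \<beta> h m"
  proof (induction h rule: poly_mapping_mterm_induct)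
    case (single a d)
    have "a - (m - \<beta>) = (a - m) + \<beta>" by simp
    thus ?case by (simp only: alt_sum_single alt_char_add[OF assms])
  next
    case (sum f g)
    thus ?case by (simp add: alt_sum_add)
  qed
  moreover have "(1 + mterm \<beta> 1) * h = h + h * mterm \<beta> 1" by (simp add: algebra_simps)
  ultimately show ?thesis by (simp add: alt_sum_add alt_sum_mterm_times)
qed

text \<open>Moving every exponent of \<open>f\<close> to a chosen representative of its coset changes \<open>f\<close> by a multiple of the
  binomial, and afterwards the coefficients are the numbers \<open>alt_sum\<close>.\<close>

lemma binomial_dvd_if_alt_sum_zero:
  assumes "\<beta> \<noteq> 0" and z: "\<And>m. alt_sum \<beta> f m = 0"
  shows "(1 + mterm \<beta> 1) dvd f"
proof -
  define r where "r e = (SOME m. \<exists>k. m = e + frag_cmul k \<beta>)" for e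
  have r: "\<exists>k. r e = e + frag_cmul k \<beta>" for e
    unfolding r_def by (rule someI_ex) (metis)
  have r_eq: "r e = r e'" if "e' = e + frag_cmul k \<beta>" for e e' k
  proof -
    have "(\<lambda>m. \<exists>k. m = e + frag_cmul k \<beta>) = (\<lambda>m. \<exists>k. m = e' + frag_cmul k \<beta>)"
    proof (intro ext iffI)
      fix m assume "\<exists>k. m = e + frag_cmul k \<beta>"
      then obtain l where "m = e + frag_cmul l \<beta>" by blast
      hence "m = e' + frag_cmul (l - k) \<beta>" using that by (simp add: frag_cmul_diff_distrib)
      thus "\<exists>k. m = e' + frag_cmul k \<beta>" by blast
    next
      fix m assume "\<exists>k. m = e' + frag_cmul k \<beta>"
      then obtain l where "m = e' + frag_cmul l \<beta>" by blast
      hence "m = e + frag_cmul (k + l) \<beta>" using that by (simp add: frag_cmul_distrib)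
      thus "\<exists>k. m = e + frag_cmul k \<beta>" by blast
    qed
    thus ?thesis unfolding r_def by simp
  qed
  let ?K = "Poly_Mapping.keys f"
  define c where "c e = Poly_Mapping.lookup f e" for e
  have f: "f = (\<Sum>e\<in>?K. mterm e (c e))"
    unfolding c_def by (rule poly_mapping_expansion)
  have eq0: "(\<Sum>e\<in>?K. mterm (r e) (c e * alt_char \<beta> (e - r e))) = 0"
  proof -
    have "(\<Sum>e\<in>?K. mterm (r e) (c e * alt_char \<beta> (e - r e))) =
       (\<Sum>y\<in>r ` ?K. \<Sum>e\<in>{e \<in> ?K. r e = y}. mterm (r e) (c e * alt_char \<beta> (e - r e)))"
      by (rule sum.image_gen) simp
    also have "\<dots> = (\<Sum>y\<in>r ` ?K. mterm y (alt_sum \<beta> f y))"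
    proof (rule sum.cong[OF refl])
      fix y assume "y \<in> r ` ?K"
      then obtain e0 where e0: "y = r e0" by blast
      have "(\<Sum>e\<in>{e \<in> ?K. r e = y}. mterm (r e) (c e * alt_char \<beta> (e - r e))) =
            (\<Sum>e\<in>{e \<in> ?K. r e = y}. mterm y (c e * alt_char \<beta> (e - y)))"
        by (rule sum.cong) auto
      also have "\<dots> = mterm y (\<Sum>e\<in>{e \<in> ?K. r e = y}. c e * alt_char \<beta> (e - y))"
        by (rule mterm_sum[symmetric])
      also have "(\<Sum>e\<in>{e \<in> ?K. r e = y}. c e * alt_char \<beta> (e - y)) = alt_sum \<beta> f y"
        unfolding alt_sum_def c_def
      proof (rule sum.mono_neutral_left)
        show "\<forall>e\<in>?K - {e \<in> ?K. r e = y}. Poly_Mapping.lookup f e * alt_char \<beta> (e - y) = 0"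
        proof
          fix e assume "e \<in> ?K - {e \<in> ?K. r e = y}"
          hence ne: "r e \<noteq> y" by auto
          have "\<nexists>k. e - y = frag_cmul k \<beta>"
          proof
            assume "\<exists>k. e - y = frag_cmul k \<beta>"
            then obtain k where k: "e - y = frag_cmul k \<beta>" by blast
            have "e = y + frag_cmul k \<beta>" unfolding k[symmetric] by simp
            moreover obtain l where "y = e0 + frag_cmul l \<beta>" using e0 r[of e0] by blast
            ultimately have "e = e0 + frag_cmul (l + k) \<beta>" by (simp add: frag_cmul_distrib)
            thus False using r_eq[of e e0 "l + k"] e0 ne by simp
          qed
          thus "Poly_Mapping.lookup f e * alt_char \<beta> (e - y) = 0"
            unfolding alt_char_def by simp
        qed
      qed auto
      finally show "(\<Sum>e\<in>{e \<in> ?K. r e = y}. mterm (r e) (c e * alt_char \<beta> (e - r e))) =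
         mterm y (alt_sum \<beta> f y)" .
    qed
    also have "\<dots> = 0" using z by simp
    finally show ?thesis .
  qed
  have "(1 + mterm \<beta> 1) dvd mterm e (c e) - mterm (r e) (c e * alt_char \<beta> (e - r e))" for e
  proof -
    obtain k where k: "r e = e + frag_cmul k \<beta>" using r by blast
    have e: "e = r e + frag_cmul (- k) \<beta>" unfolding k by (simp add: minus_frag_cmul[symmetric] del: minus_frag_cmul)
    have "e - r e = frag_cmul (- k) \<beta>" unfolding k by simp
    hence a: "alt_char \<beta> (e - r e) = (if even k then 1 else - 1)"
      by (simp add: alt_char_cmul[OF assms(1)])
    have "mterm e (c e) - mterm (r e) (c e * alt_char \<beta> (e - r e)) = 
      mterm (r e) (c e) * (mterm (frag_cmul (- k) \<beta>) 1 - (if even (- k) then 1 else - 1))"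
    proof -
      have "mterm (r e) (c e) * mterm (frag_cmul (- k) \<beta>) 1 = mterm e (c e)"
        by (simp add: mult_single flip: e)
      thus ?thesis by (auto simp: a ring_distribs single_uminus)
    qed
    thus ?thesis using binomial_dvd_aux[of \<beta> "- k"] by (metis dvd_mult)
  qed
  hence "(1 + mterm \<beta> 1) dvd (\<Sum>e\<in>?K. mterm e (c e) - mterm (r e) (c e * alt_char \<beta> (e - r e)))"
    by (intro dvd_sum) 
  thus ?thesis using f eq0 by (simp add: sum_subtractf)
qed

text \<open>If the product vanishes modulo \<open>1 + mterm \<beta> 1\<close>, then the coefficients of the class of \<open>f\<close> satisfy
  \<open>a m = - c * a (m - \<gamma>)\<close>. A single nonzero one would therefore produce nonzero ones at infinitely many cosets, which are
  distinct because \<open>\<beta>\<close> and \<open>\<gamma>\<close> are independent; but \<open>f\<close> has finitely many monomials.\<close>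

lemma regular_binomial:
  fixes f :: "'i laurent"
  assumes indep: "\<And>k l. frag_cmul k \<beta> + frag_cmul l \<gamma> = 0 \<Longrightarrow> k = 0 \<and> l = 0"
    and "c \<noteq> 0" 
    and dvd: "(1 + mterm \<beta> 1) dvd f * (1 + mterm \<gamma> c)"
  shows "(1 + mterm \<beta> 1) dvd f"
proof (rule binomial_dvd_if_alt_sum_zero)
  show "\<beta> \<noteq> 0" using indep[of 1 0] by auto
  fix m
  show "alt_sum \<beta> f m = 0"
  proof (rule ccontr)
    assume nz: "alt_sum \<beta> f m \<noteq> 0"
    obtain h where h: "f * (1 + mterm \<gamma> c) = (1 + mterm \<beta> 1) * h" using dvd by (elim dvdE)
    have "alt_sum \<beta> (f * (1 + mterm \<gamma> c)) m = 0" for m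
      unfolding h by (rule alt_sum_binomial_times[OF \<open>\<beta> \<noteq> 0\<close>])
    moreover have "f * (1 + mterm \<gamma> c) = f + f * mterm \<gamma> c" by (simp add: ring_distribs)
    ultimately have "alt_sum \<beta> f m + c * alt_sum \<beta> f (m - \<gamma>) = 0" for m
      by (metis alt_sum_add alt_sum_mterm_times)
    hence rec: "alt_sum \<beta> f m = - (c * alt_sum \<beta> f (m - \<gamma>))" for m
      by (metis eq_neg_iff_add_eq_0)
    have nz': "alt_sum \<beta> f (m - frag_cmul (int n) \<gamma>) \<noteq> 0" for n
    proof (induction n)
      case (Suc n)
      have "m - frag_cmul (int (Suc n)) \<gamma> = m - frag_cmul (int n) \<gamma> - \<gamma>"
        by (simp add: frag_cmul_distrib algebra_simps)
      thus ?case using Suc rec[of "m - frag_cmul (int n) \<gamma>"] by (metis add.inverse_neutral mult_zero_right)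
    qed (use nz in simp)
    have "\<exists>e\<in>Poly_Mapping.keys f. \<exists>k. e - (m - frag_cmul (int n) \<gamma>) = frag_cmul k \<beta>" (is "?E n") for n
    proof (rule ccontr)
      assume "\<not> ?E n"
      hence "alt_char \<beta> (e - (m - frag_cmul (int n) \<gamma>)) = 0" if "e \<in> Poly_Mapping.keys f" for e
        using that unfolding alt_char_def by auto
      hence "alt_sum \<beta> f (m - frag_cmul (int n) \<gamma>) = 0" unfolding alt_sum_def by simp
      thus False using nz'[of n] by simp
    qed
    then obtain g where g: "\<And>n. g n \<in> Poly_Mapping.keys f" 
      "\<And>n. \<exists>k. g n - (m - frag_cmul (int n) \<gamma>) = frag_cmul k \<beta>" by metis
    have "\<not> inj g"
      using g(1) by (metis finite_imageD finite_keys finite_subset image_subsetI infinite_UNIV_nat)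
    then obtain n n' where n: "g n = g n'" "n \<noteq> n'" unfolding inj_def by blast
    obtain k k' where k: "g n - (m - frag_cmul (int n) \<gamma>) = frag_cmul k \<beta>"
      "g n' - (m - frag_cmul (int n') \<gamma>) = frag_cmul k' \<beta>" using g(2) by metis
    have "frag_cmul (k - k') \<beta> + frag_cmul (int n' - int n) \<gamma> = 0"
      unfolding frag_cmul_diff_distrib k[symmetric] n(1) by (simp add: algebra_simps)
    thus False using indep n(2) by fastforce
  qed
qed

section \<open>Algebraic independence of Laurent monomials\<close>

lemma lookup_mterm_times':
  fixes m :: "'i \<Rightarrow>\<^sub>0 int" and p :: "'i laurent"
  shows "Poly_Mapping.lookup (mterm a c * p) m = c * Poly_Mapping.lookup p (m - a)"
  using lookup_mterm_times[of a c p "m - a"] by simp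

text \<open>Different powers of the \<open>k\<close>-th variable cannot cancel if the coefficients do not involve it.\<close>

lemma graded_sum_zero:
  fixes g :: "int \<Rightarrow> 'i laurent"
  assumes "finite S" and g: "\<And>D. D \<in> S \<Longrightarrow> g D \<in> laurent_in (I - {k})"
    and z: "(\<Sum>D\<in>S. mterm (frag_cmul (- D) (frag_of k)) 1 * g D) = 0" and "D \<in> S"
  shows "g D = 0"
proof (rule poly_mapping_eqI)
  fix e
  have nk: "Poly_Mapping.lookup (g D') e = 0" if "D' \<in> S" "Poly_Mapping.lookup e k \<noteq> 0" for D' e
  proof (rule ccontr)
    assume "Poly_Mapping.lookup (g D') e \<noteq> 0"
    hence "Poly_Mapping.keys e \<subseteq> I - {k}" using g[OF that(1)] unfolding laurent_in_def
      by (auto simp: in_keys_iff)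
    thus False using that(2) by (auto simp: in_keys_iff)
  qed
  show "Poly_Mapping.lookup (g D) e = Poly_Mapping.lookup 0 e"
  proof (cases "Poly_Mapping.lookup e k = 0")
    case True
    let ?m = "frag_cmul (- D) (frag_of k) + e"
    have "0 = Poly_Mapping.lookup (\<Sum>D\<in>S. mterm (frag_cmul (- D) (frag_of k)) 1 * g D) ?m"
      using z by simp
    also have "\<dots> = (\<Sum>D'\<in>S. Poly_Mapping.lookup (g D') (?m - frag_cmul (- D') (frag_of k)))"
      by (simp add: lookup_sum lookup_mterm_times')
    also have "\<dots> = (\<Sum>D'\<in>S. if D' = D then Poly_Mapping.lookup (g D) e else 0)"
    proof (rule sum.cong[OF refl])
      fix D' assume D': "D' \<in> S"
      show "Poly_Mapping.lookup (g D') (?m - frag_cmul (- D') (frag_of k)) =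
          (if D' = D then Poly_Mapping.lookup (g D) e else 0)"
      proof (cases "D' = D")
        case False
        have "Poly_Mapping.lookup (?m - frag_cmul (- D') (frag_of k)) k \<noteq> 0"
          using False True by (simp add: lookup_add lookup_minus)
        thus ?thesis using nk[OF D'] False by simp
      qed simp
    qed
    also have "\<dots> = Poly_Mapping.lookup (g D) e" using assms(1,4) by simp
    finally show ?thesis by simp
  qed (use nk assms(4) in simp)
qed

text \<open>Sort a Laurent polynomial in the new variables by the degree in the \<open>k\<close>-th one and multiply it by a large power of
  \<open>q\<close>: this gives a Laurent polynomial in the old variables in which the parts are separated by their degree, each of them
  multiplied by a power of \<open>q\<close>.\<close>

lemma lindep_mutate:
  fixes v :: "'i \<Rightarrow> 'f::field"
  assumes ind: "lindep I v" and nz: "\<And>i. v i \<noteq> 0" and k: "k \<in> I"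
    and q: "q \<in> laurent_in (I - {k})" "laurent_eval v q \<noteq> 0"
  shows "lindep I (v(k := laurent_eval v q / v k))"
  unfolding lindep_def
proof (intro ballI impI)
  fix p assume p: "p \<in> laurent_in I" and pz: "laurent_eval (v(k := laurent_eval v q / v k)) p = 0"
  define v' where "v' = v(k := laurent_eval v q / v k)"
  define u where "u = frag_of k"
  define d where "d e = Poly_Mapping.lookup e k" for e :: "'i \<Rightarrow>\<^sub>0 int"
  define r where "r e = e - frag_cmul (d e) u" for e
  have nz': "v' i \<noteq> 0" for i using nz q(2) by (auto simp: v'_def)
  have r_keys: "Poly_Mapping.keys (r e) \<subseteq> I - {k}" if "Poly_Mapping.keys e \<subseteq> I" for e
  proof -
    have "Poly_Mapping.lookup (r e) k = 0" by (simp add: r_def d_def u_def lookup_minus)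
    moreover have "Poly_Mapping.keys (r e) \<subseteq> I"
      using keys_sub[of e "frag_cmul (d e) u"] keys_cmul[of "d e" u] that k
      unfolding r_def u_def by (auto simp: keys_frag_of)
    ultimately show ?thesis by (auto simp: in_keys_iff)
  qed
  have mv': "monval v' e = monval v (r e) * (laurent_eval v q / v k) powi d e" for e
  proof -
    have e: "e = r e + frag_cmul (d e) u" by (simp add: r_def)
    have "monval v' (r e) = monval v (r e)"
      unfolding monval_def
      by (rule prod.cong) (auto simp: v'_def in_keys_iff r_def d_def u_def lookup_minus)
    moreover have "monval v' e = monval v' (r e) * monval v' (frag_cmul (d e) u)"
      by (subst e, rule mon_add[OF nz'])
    ultimately show ?thesis by (simp add: u_def mon_cmul_frag_of v'_def)
  qed
  obtain N :: nat where N: "\<And>e. e \<in> Poly_Mapping.keys p \<Longrightarrow> d e + int N \<ge> 0"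
  proof -
    have "\<exists>N::nat. \<forall>e\<in>S. d e + int N \<ge> 0" if "finite S" for S
      using that
    proof induction
      case (insert x F)
      then obtain N :: nat where N: "\<forall>e\<in>F. d e + int N \<ge> 0" by blast
      show ?case by (rule exI[of _ "N + nat (- d x)"]) (use N in force)
    qed simp
    thus ?thesis using that finite_keys by metis
  qed
  let ?P = "laurent_eval v q"
  define pD where "pD D = (\<Sum>e\<in>{e \<in> Poly_Mapping.keys p. d e = D}. mterm (r e) (Poly_Mapping.lookup p e))" for D
  define g where "g D = pD D * q ^ nat (D + int N)" for D
  have pD_in: "pD D \<in> laurent_in (I - {k})" for D
    unfolding pD_def using p r_keys
    by (intro laurent_in_sum laurent_in_single) (auto simp: laurent_in_def)
  define Q where "Q = (\<Sum>D\<in>d ` Poly_Mapping.keys p. mterm (frag_cmul (- D) u) 1 * g D)"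
  have "laurent_eval v Q = ?P ^ N * laurent_eval v' p"
  proof -
    have "?P ^ N * laurent_eval v' p = (\<Sum>e\<in>Poly_Mapping.keys p.
       ?P ^ N * (of_int (Poly_Mapping.lookup p e) * monval v' e))"
      unfolding laurent_eval_def[of v' p] by (simp add: sum_distrib_left)
    also have "\<dots> = (\<Sum>D\<in>d ` Poly_Mapping.keys p. \<Sum>e\<in>{e \<in> Poly_Mapping.keys p. d e = D}.
       ?P ^ N * (of_int (Poly_Mapping.lookup p e) * monval v' e))"
      by (rule sum.image_gen) simp
    also have "\<dots> = (\<Sum>D\<in>d ` Poly_Mapping.keys p. laurent_eval v (mterm (frag_cmul (- D) u) 1 * g D))"
    proof (rule sum.cong[OF refl])
      fix D assume "D \<in> d ` Poly_Mapping.keys p"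
      hence D: "D + int N \<ge> 0" using N by auto
      have *: "?P ^ N * (of_int (Poly_Mapping.lookup p e) * monval v' e) =
         v k powi (- D) * ?P ^ nat (D + int N) * (of_int (Poly_Mapping.lookup p e) * monval v (r e))"
        if "d e = D" for e
      proof -
        have P: "?P ^ N * (?P / v k) powi D = v k powi (- D) * ?P ^ nat (D + int N)"
        proof -
          have "?P ^ N * ?P powi D = ?P powi (D + int N)"
            using q(2) by (simp add: power_int_add)
          also have "\<dots> = ?P ^ nat (D + int N)" using D by (simp add: power_int_def)
          finally have PN: "?P ^ N * ?P powi D = ?P ^ nat (D + int N)" .
          have "(?P / v k) powi D = ?P powi D * v k powi (- D)"
            by (subst power_int_divide_distrib) (simp add: power_int_minus divide_inverse)
          thus ?thesis using PN by (simp only: mult_ac) 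
        qed
        have "?P ^ N * (of_int (Poly_Mapping.lookup p e) * monval v' e) =
          (?P ^ N * (?P / v k) powi D) * (of_int (Poly_Mapping.lookup p e) * monval v (r e))"
          unfolding mv' that by (simp only: mult_ac)
        thus ?thesis unfolding P .
      qed
      have "(\<Sum>e\<in>{e \<in> Poly_Mapping.keys p. d e = D}. ?P ^ N * (of_int (Poly_Mapping.lookup p e) * monval v' e)) =
         (\<Sum>e\<in>{e \<in> Poly_Mapping.keys p. d e = D}. v k powi (- D) * ?P ^ nat (D + int N) * (of_int (Poly_Mapping.lookup p e) * monval v (r e)))"
        by (rule sum.cong) (use * in auto)
      also have "\<dots> = v k powi (- D) * ?P ^ nat (D + int N) * laurent_eval v (pD D)"
        by (simp add: sum_distrib_left pD_def laurent_eval_sum)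
      also have "\<dots> = laurent_eval v (mterm (frag_cmul (- D) u) 1 * g D)"
        by (simp add: g_def laurent_eval_mult laurent_eval_power nz u_def mon_cmul_frag_of mult_ac)
      finally show "(\<Sum>e\<in>{e \<in> Poly_Mapping.keys p. d e = D}. ?P ^ N * (of_int (Poly_Mapping.lookup p e) * monval v' e)) =
        laurent_eval v (mterm (frag_cmul (- D) u) 1 * g D)" .
    qed
    finally show ?thesis by (simp add: Q_def laurent_eval_sum)
  qed
  hence "laurent_eval v Q = 0" using pz by (simp add: v'_def)
  have g_in: "g D \<in> laurent_in (I - {k})" for D
    unfolding g_def by (intro laurent_in_mult laurent_in_power pD_in q)
  have "Q \<in> laurent_in I"
    unfolding Q_def
  proof (intro laurent_in_sum laurent_in_mult laurent_in_single)
    fix D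
    show "Poly_Mapping.keys (frag_cmul (- D) u) \<subseteq> I" using k by (auto simp: u_def)
    show "g D \<in> laurent_in I" using g_in laurent_in_mono[of "I - {k}" I] by blast
  qed
  hence "Q = 0" using ind \<open>laurent_eval v Q = 0\<close> unfolding lindep_def by blast
  have pD0: "pD D = 0" if D: "D \<in> d ` Poly_Mapping.keys p" for D
  proof -
    have "g D = 0"
      by (rule graded_sum_zero[where S = "d ` Poly_Mapping.keys p" and I = I and k = k])
         (use g_in D \<open>Q = 0\<close> in \<open>auto simp: Q_def u_def\<close>)
    hence "laurent_eval v (pD D) * ?P ^ nat (D + int N) = 0"
      unfolding g_def by (metis laurent_eval_mult laurent_eval_power laurent_eval_zero nz)
    hence "laurent_eval v (pD D) = 0" using q(2) by simp
    thus ?thesis using ind pD_in[of D] laurent_in_mono[of "I - {k}" I] unfolding lindep_def by blast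
  qed
  show "p = 0"
  proof (rule ccontr)
    assume "p \<noteq> 0"
    then obtain e where e: "e \<in> Poly_Mapping.keys p" by (metis keys_eq_empty equals0I)
    have "0 = Poly_Mapping.lookup (pD (d e)) (r e)" using pD0 e by simp
    also have "\<dots> = (\<Sum>e'\<in>{e' \<in> Poly_Mapping.keys p. d e' = d e}. if e' = e then Poly_Mapping.lookup p e else 0)"
      unfolding pD_def lookup_sum
    proof (rule sum.cong[OF refl])
      fix e' assume "e' \<in> {e' \<in> Poly_Mapping.keys p. d e' = d e}"
      hence "r e' = r e \<longleftrightarrow> e' = e" by (auto simp: r_def)
      thus "Poly_Mapping.lookup (mterm (r e') (Poly_Mapping.lookup p e')) (r e) =
        (if e' = e then Poly_Mapping.lookup p e else 0)"
        by (auto simp: lookup_single)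
    qed
    also have "\<dots> = Poly_Mapping.lookup p e" using e by simp
    finally show False using e by (simp add: in_keys_iff)
  qed
qed

lemma poly_value_superset:
  assumes "finite S" "Poly_Mapping.keys q \<subseteq> S"
  shows "poly_value x q = (\<Sum>m\<in>S. of_rat (Poly_Mapping.lookup q m) * 
     (\<Prod>i \<in> Poly_Mapping.keys m. x i ^ Poly_Mapping.lookup m i))"
  unfolding poly_value_def
  by (rule sum.mono_neutral_left) (use assms in \<open>auto simp: in_keys_iff\<close>)

lemma free_generators_nonzero:
  assumes "free_generators I x" "i \<in> I"
  shows "x i \<noteq> 0"
proof
  assume "x i = 0"
  let ?q = "mterm (mterm i 1) 1 :: ('a \<Rightarrow>\<^sub>0 nat) \<Rightarrow>\<^sub>0 rat"
  have "?q \<in> polys_in I" using assms(2) by (simp add: polys_in_def)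
  moreover have "poly_value x ?q = 0" using \<open>x i = 0\<close> by (simp add: poly_value_def)
  ultimately have "?q = 0" using assms(1) unfolding free_generators_def by blast
  thus False by (metis single_zero lookup_single_eq zero_neq_one lookup_zero)
qed

text \<open>Multiplication by a large monomial turns a Laurent relation into a polynomial one.\<close>

lemma lindep_free_generators:
  fixes x :: "'i \<Rightarrow> 'f::field_char_0"
  assumes free: "free_generators I x" and fin: "finite I"
  shows "lindep I (\<lambda>i. if i \<in> I then x i else 1)"
  unfolding lindep_def
proof (intro ballI impI)
  let ?v = "\<lambda>i. if i \<in> I then x i else 1"
  fix p assume p: "p \<in> laurent_in I" "laurent_eval ?v p = 0"
  have nz: "x i \<noteq> 0" if "i \<in> I" for i using free_generators_nonzero[OF free that] .
  let ?K = "Poly_Mapping.keys p"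
  obtain N :: nat where N: "\<And>e i. e \<in> ?K \<Longrightarrow> i \<in> I \<Longrightarrow> Poly_Mapping.lookup e i + int N \<ge> 0"
  proof -
    have "\<exists>N::nat. \<forall>(e, i)\<in>S. Poly_Mapping.lookup e i + int N \<ge> 0" 
      if "finite S" for S :: "(('i \<Rightarrow>\<^sub>0 int) \<times> 'i) set"
      using that
    proof induction
      case (insert y F)
      then obtain N :: nat where N: "\<forall>(e, i)\<in>F. Poly_Mapping.lookup e i + int N \<ge> 0" by blast
      show ?case 
        by (rule exI[of _ "N + nat (- Poly_Mapping.lookup (fst y) (snd y))"]) (use N in force)
    qed simp
    from this[of "?K \<times> I"] show ?thesis using that fin by auto
  qed
  define E where "E e = (\<Sum>i\<in>I. mterm i (nat (Poly_Mapping.lookup e i + int N)))" for e :: "'i \<Rightarrow>\<^sub>0 int"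
  have lookup_E: "Poly_Mapping.lookup (E e) i = (if i \<in> I then nat (Poly_Mapping.lookup e i + int N) else 0)" for e i
    unfolding E_def lookup_sum using fin by (simp add: lookup_single when_def)
  have keys_E: "Poly_Mapping.keys (E e) \<subseteq> I" for e 
    by (auto simp: in_keys_iff lookup_E split: if_splits)
  have inj: "inj_on E ?K"
  proof (rule inj_onI)
    fix e e' assume e: "e \<in> ?K" "e' \<in> ?K" and eq: "E e = E e'"
    show "e = e'"
    proof (rule poly_mapping_eqI)
      fix i
      show "Poly_Mapping.lookup e i = Poly_Mapping.lookup e' i"
      proof (cases "i \<in> I")
        case True
        have "nat (Poly_Mapping.lookup e i + int N) = nat (Poly_Mapping.lookup e' i + int N)"
          using lookup_E[of e i] lookup_E[of e' i] eq True by simp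
        thus ?thesis using N[OF e(1) True] N[OF e(2) True] by linarith
      next
        case False
        hence "i \<notin> Poly_Mapping.keys e" "i \<notin> Poly_Mapping.keys e'"
          using p(1) e unfolding laurent_in_def by auto
        thus ?thesis by (simp add: in_keys_iff)
      qed
    qed
  qed
  define q where "q = (\<Sum>e\<in>?K. mterm (E e) (of_int (Poly_Mapping.lookup p e) :: rat))"
  have lookup_q: "Poly_Mapping.lookup q (E e) = of_int (Poly_Mapping.lookup p e)" if "e \<in> ?K" for e
  proof -
    have "Poly_Mapping.lookup q (E e) = (\<Sum>e'\<in>?K. if e' = e then of_int (Poly_Mapping.lookup p e) else 0)"
      unfolding q_def lookup_sum
      by (rule sum.cong) (use that inj in \<open>auto simp: lookup_single inj_on_def when_def\<close>)
    thus ?thesis using that by simp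
  qed
  have keys_q: "Poly_Mapping.keys q \<subseteq> E ` ?K"
  proof
    fix m assume "m \<in> Poly_Mapping.keys q"
    hence "(\<Sum>e\<in>?K. Poly_Mapping.lookup (mterm (E e) (of_int (Poly_Mapping.lookup p e) :: rat)) m) \<noteq> 0"
      by (simp add: in_keys_iff q_def lookup_sum)
    then obtain e where "e \<in> ?K" "Poly_Mapping.lookup (mterm (E e) (of_int (Poly_Mapping.lookup p e) :: rat)) m \<noteq> 0"
      by (meson sum.neutral)
    thus "m \<in> E ` ?K" by (auto simp: lookup_single when_def split: if_splits)
  qed
  have "q \<in> polys_in I" using keys_q keys_E unfolding polys_in_def by blast
  moreover have "poly_value x q = 0"
  proof -
    have "poly_value x q = (\<Sum>m\<in>E ` ?K. of_rat (Poly_Mapping.lookup q m) * 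
     (\<Prod>i \<in> Poly_Mapping.keys m. x i ^ Poly_Mapping.lookup m i))"
      by (rule poly_value_superset) (use keys_q in auto)
    also have "\<dots> = (\<Sum>e\<in>?K. of_int (Poly_Mapping.lookup p e) * ((\<Prod>i\<in>I. x i) ^ N * monval ?v e))"
    proof (subst sum.reindex[OF inj], rule sum.cong[OF refl])
      fix e assume e: "e \<in> ?K"
      have "(\<Prod>i \<in> Poly_Mapping.keys (E e). x i ^ Poly_Mapping.lookup (E e) i) = 
            (\<Prod>i \<in> I. x i ^ Poly_Mapping.lookup (E e) i)"
        by (rule prod.mono_neutral_left) (use fin keys_E in \<open>auto simp: in_keys_iff\<close>)
      also have "\<dots> = (\<Prod>i \<in> I. x i ^ N * ?v i powi Poly_Mapping.lookup e i)"
      proof (rule prod.cong[OF refl])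
        fix i assume i: "i \<in> I"
        have "x i ^ Poly_Mapping.lookup (E e) i = x i powi (int N + Poly_Mapping.lookup e i)"
          using i N[OF e i] by (simp add: lookup_E power_int_def add.commute)
        also have "\<dots> = x i ^ N * ?v i powi Poly_Mapping.lookup e i"
          using i nz[OF i] by (simp add: power_int_add)
        finally show "x i ^ Poly_Mapping.lookup (E e) i = x i ^ N * ?v i powi Poly_Mapping.lookup e i" .
      qed
      also have "\<dots> = (\<Prod>i\<in>I. x i) ^ N * monval ?v e"
      proof -
        have "monval ?v e = (\<Prod>i\<in>I. ?v i powi Poly_Mapping.lookup e i)"
          by (rule mon_superset) (use fin p(1) e in \<open>auto simp: laurent_in_def\<close>)
        thus ?thesis by (simp add: prod.distrib prod_power_distrib)
      qed
      finally show "((\<lambda>m. of_rat (Poly_Mapping.lookup q m) * (\<Prod>i \<in> Poly_Mapping.keys m. x i ^ Poly_Mapping.lookup m i)) \<circ> E) e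
        = of_int (Poly_Mapping.lookup p e) * ((\<Prod>i\<in>I. x i) ^ N * monval ?v e)"
        by (simp add: lookup_q e)
    qed
    also have "\<dots> = (\<Prod>i\<in>I. x i) ^ N * laurent_eval ?v p"
      by (simp add: laurent_eval_def sum_distrib_left mult_ac)
    finally show ?thesis using p(2) by simp
  qed
  ultimately have "q = 0" using free unfolding free_generators_def by blast
  show "p = 0"
  proof (rule ccontr)
    assume "p \<noteq> 0"
    then obtain e where e: "e \<in> ?K" by (metis keys_eq_empty equals0I)
    hence "of_int (Poly_Mapping.lookup p e) = (0::rat)" using lookup_q[OF e] \<open>q = 0\<close> by simp
    thus False using e by (simp add: in_keys_iff)
  qed
qed

section \<open>Subrings of a field, units, and relative primality\<close>

text \<open>Subrings of a field as plain sets: most of the argument compares elements of one ambient field, for which the type class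
  operations are more convenient than ring records.\<close>

definition sring :: "'f::field set \<Rightarrow> bool" where
  "sring L \<longleftrightarrow> 1 \<in> L \<and> (\<forall>x\<in>L. \<forall>y\<in>L. x + y \<in> L \<and> x * y \<in> L) \<and> (\<forall>x\<in>L. - x \<in> L)"

context
  fixes L :: "'f::field set"
  assumes L: "sring L"
begin

lemma sring_one: "1 \<in> L"
  and sring_add: "x \<in> L \<Longrightarrow> y \<in> L \<Longrightarrow> x + y \<in> L"
  and sring_mult: "x \<in> L \<Longrightarrow> y \<in> L \<Longrightarrow> x * y \<in> L"
  and sring_uminus: "x \<in> L \<Longrightarrow> - x \<in> L"
  using L unfolding sring_def by blast+

lemma sring_zero: "0 \<in> L"
  using sring_add[OF sring_one sring_uminus[OF sring_one]] by simp

lemma sring_diff: "x \<in> L \<Longrightarrow> y \<in> L \<Longrightarrow> x - y \<in> L"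
  using sring_add[of x "- y"] sring_uminus by simp

lemma sring_power: "x \<in> L \<Longrightarrow> x ^ n \<in> L"
  by (induction n) (auto intro: sring_one sring_mult)

lemma sring_of_nat: "of_nat n \<in> L"
  by (induction n) (auto intro: sring_one sring_zero sring_add)

lemma sring_of_int: "of_int n \<in> L"
  by (cases n rule: int_cases2) (auto intro: sring_of_nat sring_uminus)

lemma sring_sum: "(\<And>x. x \<in> S \<Longrightarrow> g x \<in> L) \<Longrightarrow> (\<Sum>x\<in>S. g x) \<in> L"
  by (induction S rule: infinite_finite_induct) (auto intro: sring_zero sring_add)

lemma sring_prod: "(\<And>x. x \<in> S \<Longrightarrow> g x \<in> L) \<Longrightarrow> (\<Prod>x\<in>S. g x) \<in> L"
  by (induction S rule: infinite_finite_induct) (auto intro: sring_one sring_mult)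

definition lunit :: "'f \<Rightarrow> bool" where
  "lunit u \<longleftrightarrow> u \<in> L \<and> inverse u \<in> L \<and> u \<noteq> 0"

lemma lunit_one: "lunit 1"
  by (simp add: lunit_def sring_one)

lemma lunit_mult: "lunit u \<Longrightarrow> lunit u' \<Longrightarrow> lunit (u * u')"
  by (auto simp: lunit_def inverse_mult_distrib intro: sring_mult)

lemma lunit_inverse: "lunit u \<Longrightarrow> lunit (inverse u)"
  by (auto simp: lunit_def)

lemma lunit_divide: "lunit u \<Longrightarrow> lunit u' \<Longrightarrow> lunit (u / u')"
  by (simp add: divide_inverse lunit_mult lunit_inverse)

lemma lunit_power: "lunit u \<Longrightarrow> lunit (u ^ n)"
  by (induction n) (auto intro: lunit_mult lunit_one)

lemma lunit_prod: "(\<And>x. x \<in> S \<Longrightarrow> lunit (g x)) \<Longrightarrow> lunit (\<Prod>x\<in>S. g x)"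
  by (induction S rule: infinite_finite_induct) (auto intro: lunit_one lunit_mult)

lemma lunitD: "lunit u \<Longrightarrow> u \<in> L" "lunit u \<Longrightarrow> inverse u \<in> L" "lunit u \<Longrightarrow> u \<noteq> 0"
  by (auto simp: lunit_def)

text \<open>Multiplication by \<open>w\<close> is injective modulo \<open>z\<close>. This is the part of relative primality of \<open>z\<close> and \<open>w\<close> that the
  Laurent phenomenon uses; unlike unique factorization it is available in every ring.\<close>

definition regular_mod :: "'f \<Rightarrow> 'f \<Rightarrow> bool" where
  "regular_mod z w \<longleftrightarrow> (\<forall>f\<in>L. \<forall>h\<in>L. f * w = z * h \<longrightarrow> (\<exists>h'\<in>L. f = z * h'))"

lemma regular_mod_unit: 
  assumes "lunit w" 
  shows "regular_mod z w"
  unfolding regular_mod_def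
proof (intro ballI impI)
  fix f h assume fh: "f \<in> L" "h \<in> L" "f * w = z * h"
  have "f = z * (h * inverse w)" using fh(3) lunitD(3)[OF assms] by (simp add: field_simps)
  thus "\<exists>h'\<in>L. f = z * h'" using fh(2) lunitD(2)[OF assms] by (metis sring_mult)
qed

lemma regular_mod_mult: "regular_mod z w \<Longrightarrow> regular_mod z w' \<Longrightarrow> w \<in> L \<Longrightarrow> regular_mod z (w * w')"
  unfolding regular_mod_def by (metis mult.assoc sring_mult)

lemma regular_mod_power: "regular_mod z w \<Longrightarrow> w \<in> L \<Longrightarrow> regular_mod z (w ^ n)"
  by (induction n) (auto intro: regular_mod_mult regular_mod_unit lunit_one)

lemma regular_mod_add_mult:
  assumes "regular_mod z w" "r \<in> L"
  shows "regular_mod z (w + z * r)"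
  unfolding regular_mod_def
proof (intro ballI impI)
  fix f h assume fh: "f \<in> L" "h \<in> L" "f * (w + z * r) = z * h"
  have "f * w = z * (h - f * r)" using fh(3) by (simp add: algebra_simps)
  moreover have "h - f * r \<in> L" using fh assms(2) by (intro sring_diff sring_mult)
  ultimately show "\<exists>h'\<in>L. f = z * h'" using fh(1) assms(1) unfolding regular_mod_def by blast
qed

lemma regular_mod_scale_left:
  assumes "regular_mod z w" "lunit u"
  shows "regular_mod (u * z) w"
  unfolding regular_mod_def
proof (intro ballI impI)
  fix f h assume fh: "f \<in> L" "h \<in> L" "f * w = u * z * h"
  have "f * w = z * (u * h)" using fh(3) by (simp add: mult_ac)
  then obtain h' where h': "h' \<in> L" "f = z * h'"
    using assms(1) fh(1) sring_mult[OF lunitD(1)[OF assms(2)] fh(2)] unfolding regular_mod_def by blast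
  have "f = u * z * (inverse u * h')" using lunitD(3)[OF assms(2)] h'(2) by simp
  thus "\<exists>h'\<in>L. f = u * z * h'" using sring_mult[OF lunitD(2)[OF assms(2)] h'(1)] by blast
qed

text \<open>An element whose denominator divides both \<open>w\<close> and a power of \<open>z\<close> has no denominator: cancel the factors \<open>z\<close> one at a time.\<close>

lemma regular_mod_conclude:
  assumes "regular_mod z w" "z \<noteq> 0" "z \<in> L" "x * w \<in> L" "x * z ^ a \<in> L"
  shows "x \<in> L"
  using assms(5)
proof (induction a)
  case (Suc a)
  have "(x * z ^ Suc a) * w = z * ((x * w) * z ^ a)" by (simp add: mult_ac)
  moreover have "(x * w) * z ^ a \<in> L" by (rule sring_mult[OF assms(4) sring_power[OF assms(3)]])
  ultimately obtain h where h: "h \<in> L" "x * z ^ Suc a = z * h"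
    using Suc.prems assms(1) unfolding regular_mod_def by blast
  have "z * (x * z ^ a) = z * h" using h(2) by (simp add: mult_ac)
  hence "x * z ^ a = h" using assms(2) by simp
  thus ?case using Suc.IH h(1) by simp
qed simp

text \<open>The binomial theorem up to second order.\<close>

lemma power_expand_two:
  assumes "u \<in> L" "D \<in> L"
  shows "\<exists>r\<in>L. (u + D) ^ Suc n = D ^ Suc n + of_nat (Suc n) * D ^ n * u + u ^ 2 * r"
proof (induction n)
  case 0
  show ?case by (rule bexI[of _ 0]) (simp_all add: sring_zero)
next
  case (Suc n)
  then obtain r where r: "r \<in> L" "(u + D) ^ Suc n = D ^ Suc n + of_nat (Suc n) * D ^ n * u + u ^ 2 * r"
    by blast
  have "(u + D) ^ Suc (Suc n) = (u + D) * (D ^ Suc n + of_nat (Suc n) * D ^ n * u + u ^ 2 * r)"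
    using r(2) by simp
  also have "\<dots> = D ^ Suc (Suc n) + of_nat (Suc (Suc n)) * D ^ Suc n * u + 
      u ^ 2 * (of_nat (Suc n) * D ^ n + (u + D) * r)"
    by (simp add: algebra_simps power2_eq_square)
  finally have "(u + D) ^ Suc (Suc n) = D ^ Suc (Suc n) + of_nat (Suc (Suc n)) * D ^ Suc n * u + 
      u ^ 2 * (of_nat (Suc n) * D ^ n + (u + D) * r)" .
  moreover have "of_nat (Suc n) * D ^ n + (u + D) * r \<in> L"
    using assms r(1) by (intro sring_add sring_mult sring_power sring_of_nat)
  ultimately show ?case by blast
qed

lemma expand_aux:
  fixes B :: "'f"
  assumes "iB * B = 1"
  shows "ix * (E * iB * (D * d) * xj + E * (n * d * C * y + C\<^sup>2 * y * (z * y) * r)) =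
    ix * E * iB * d * (D * xj + n * C * B * y) + z * ((y * y) * (ix * E * C\<^sup>2 * r))"
proof -
  have "ix * E * iB * d * (n * C * B * y) = ix * E * d * n * C * y * (iB * B)" by (simp only: mult_ac)
  thus ?thesis unfolding assms by (simp add: algebra_simps power2_eq_square)
qed

lemma expand_aux2:
  fixes B :: "'f"
  assumes "iB * B = 1"
  shows "E * (d + t + t') + A * E * d * iB * x = E * iB * d * (A * x + B) + E * (t + t')"
proof -
  have "E * iB * d * B = E * d * (iB * B)" by (simp only: mult_ac)
  thus ?thesis unfolding assms by (simp add: algebra_simps)
qed

text \<open>The heart of the Laurent phenomenon. The elements \<open>z\<close>, \<open>w\<close>, \<open>v\<close> are the new cluster variables of three mutations, at
  \<open>j\<close>, \<open>k\<close> and \<open>j\<close> again, in a seed where the other variables are treated as units. The first two are visibly Laurent.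
  Substituting them into the third relation and expanding up to second order in \<open>C * z ^ b\<close>, the relation \<open>rel\<close> makes the
  right-hand side divisible by \<open>z\<close>, so \<open>v\<close> is Laurent too. Modulo \<open>z\<close> the element \<open>w\<close> is a unit and \<open>v\<close> is a unit times
  \<open>D * xj + c * C * B * z ^ (b - 1)\<close>; this is again a unit modulo \<open>z\<close> if \<open>b > 1\<close>, while \<open>b = 1\<close> needs the hypothesis \<open>cop1\<close>.\<close>

lemma rank_two_exchange:
  assumes units: "lunit xj" "lunit xk" "lunit A" "lunit B" "lunit C" "lunit D" "lunit E" "lunit G"
    and bc: "b > 0" "c > 0" and "z \<noteq> 0"
    and z: "z * xj = A * xk ^ c + B" and w: "w * xk = C * z ^ b + D" and v: "z * v = E * w ^ c + G"
    and rel: "G * B = A * E * D ^ c"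
    and cop1: "b = 1 \<Longrightarrow> regular_mod z (D * xj + of_nat c * C * B)"
  shows "z \<in> L \<and> w \<in> L \<and> v \<in> L \<and> regular_mod z w \<and> regular_mod z v"
proof -
  note mem = units[THEN lunitD(1)] units[THEN lunitD(2)]
  note nz = units[THEN lunitD(3)]
  note cl = sring_add sring_mult sring_power sring_of_nat mem
  have "z = (A * xk ^ c + B) * inverse xj" using z nz by (simp add: field_simps)
  hence zL: "z \<in> L" by (auto intro!: cl)
  have w': "w = (C * z ^ b + D) * inverse xk" using w nz by (simp add: field_simps)
  hence wL: "w \<in> L" using zL by (auto intro!: cl)
  obtain b' where b': "b = Suc b'" using bc by (cases b) auto
  obtain c' where c': "c = Suc c'" using bc by (cases c) auto
  have "w = D * inverse xk + z * (C * z ^ b' * inverse xk)"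
    unfolding w' b' by (simp add: algebra_simps)
  moreover have "regular_mod z (D * inverse xk + z * (C * z ^ b' * inverse xk))"
    using zL units by (intro regular_mod_add_mult regular_mod_unit lunit_mult lunit_inverse cl) 
  ultimately have cw: "regular_mod z w" by simp
  obtain r where r: "r \<in> L" "(C * z ^ b + D) ^ c = D ^ c + of_nat c * D ^ c' * (C * z ^ b) + (C * z ^ b) ^ 2 * r"
    using power_expand_two[of "C * z ^ b" D c'] zL unfolding c' by (auto intro!: cl)
  let ?s = "inverse (xk ^ c) * E * inverse B * D ^ c'"
  let ?r = "inverse (xk ^ c) * E * C ^ 2 * r"
  have s: "lunit ?s" using units by (intro lunit_mult lunit_inverse lunit_power)
  have ixc: "inverse (xk ^ c) \<in> L" using lunit_power[OF units(2)] lunitD(2) by blast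
  have rL: "?r \<in> L" using r(1) ixc by (auto intro!: cl)
  have v': "v = ?s * (D * xj + of_nat c * C * B * z ^ b') + z * (z ^ (2 * b') * ?r)"
  proof -
    have G: "G = A * E * D ^ c * inverse B" using rel nz by (simp add: field_simps)
    have "w ^ c * xk ^ c = (C * z ^ b + D) ^ c" using w by (metis power_mult_distrib)
    hence "z * v * xk ^ c = E * (C * z ^ b + D) ^ c + G * xk ^ c"
      unfolding v by (simp add: algebra_simps)
    also have "\<dots> = E * inverse B * D ^ c * (A * xk ^ c + B) + E * (of_nat c * D ^ c' * (C * z ^ b) + (C * z ^ b) ^ 2 * r)"
      unfolding r(2) G by (rule expand_aux2) (use nz in simp)
    also have "\<dots> = z * (E * inverse B * D ^ c * xj + E * (of_nat c * D ^ c' * C * z ^ b' + C ^ 2 * z ^ b' * z ^ b * r))"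
      unfolding z[symmetric] b' by (simp add: algebra_simps power2_eq_square)
    finally have "v * xk ^ c = E * inverse B * D ^ c * xj + E * (of_nat c * D ^ c' * C * z ^ b' + C ^ 2 * z ^ b' * z ^ b * r)"
      using \<open>z \<noteq> 0\<close> by simp
    moreover have "v = inverse (xk ^ c) * (v * xk ^ c)" using nz by simp
    ultimately have "v = inverse (xk ^ c) * (E * inverse B * D ^ c * xj + E * (of_nat c * D ^ c' * C * z ^ b' + C ^ 2 * z ^ b' * z ^ b * r))"
      by simp
    also have "\<dots> = ?s * (D * xj + of_nat c * C * B * z ^ b') + z * (z ^ (2 * b') * ?r)"
      using expand_aux[of "inverse B" B "inverse (xk ^ c)" E D "D ^ c'" xj "of_nat c" C "z ^ b'" z r] nz
      by (simp add: c' b' mult_2 power_add)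
    finally show ?thesis .
  qed
  have zrL: "z ^ (2 * b') * ?r \<in> L" by (rule sring_mult[OF sring_power[OF zL] rL])
  have "D * xj + of_nat c * C * B * z ^ b' \<in> L" by (intro cl zL)
  hence vL: "v \<in> L" unfolding v' 
    by (rule sring_add[OF sring_mult[OF lunitD(1)[OF s]] sring_mult[OF zL zrL]])
  have cv: "regular_mod z v"
  proof (cases b')
    case 0
    have "regular_mod z (?s * (D * xj + of_nat c * C * B * z ^ b'))"
      using cop1 0 b' by (intro regular_mod_mult[OF regular_mod_unit[OF s] _ lunitD(1)[OF s]]) simp
    hence "regular_mod z (?s * (D * xj + of_nat c * C * B * z ^ b') + z * (z ^ (2 * b') * ?r))"
      by (rule regular_mod_add_mult[OF _ zrL])
    thus ?thesis using v' by simp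
  next
    case (Suc b'')
    have "v = ?s * (D * xj) + z * (?s * of_nat c * C * B * z ^ b'' + z ^ (2 * b') * ?r)"
      unfolding v' Suc by (simp add: algebra_simps)
    moreover have "?s * of_nat c * C * B * z ^ b'' + z ^ (2 * b') * ?r \<in> L"
      by (rule sring_add[OF _ zrL]) (intro sring_mult[OF sring_mult[OF sring_mult[OF sring_mult[OF lunitD(1)[OF s]]]]] cl zL)
    moreover have "regular_mod z (?s * (D * xj))"
      by (intro regular_mod_unit lunit_mult[OF s] lunit_mult units)
    ultimately have "regular_mod z v" using regular_mod_add_mult by metis
    thus ?thesis .
  qed
  show ?thesis using zL wL vL cw cv by simp
qed

end

section \<open>Seeds with algebraically independent clusters\<close>

lemma ind_mutate [simp]: "ind (mutate k t) = ind t"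
  and mut_mutate [simp]: "mut (mutate k t) = mut t"
  by (simp_all add: mutate_def)

lemma mat_mutate: "mat (mutate k t) i j = (if i = k \<or> j = k then - mat t i j
         else mat t i j + max 0 (mat t i k) * max 0 (mat t k j)
                        - max 0 (- mat t i k) * max 0 (- mat t k j))"
  by (simp add: mutate_def)

definition pplus :: "('i, 'f::field_char_0) seed \<Rightarrow> 'i \<Rightarrow> 'f" where
  "pplus t k = (\<Prod>i \<in> ind t. var t i ^ nat (mat t i k))"

definition pminus :: "('i, 'f::field_char_0) seed \<Rightarrow> 'i \<Rightarrow> 'f" where
  "pminus t k = (\<Prod>i \<in> ind t. var t i ^ nat (- mat t i k))"

lemma var_mutate_same: "var (mutate k t) k = (pplus t k + pminus t k) / var t k"
  by (simp add: mutate_def pplus_def pminus_def)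

lemma var_mutate_other [simp]: "i \<noteq> k \<Longrightarrow> var (mutate k t) i = var t i"
  by (simp add: mutate_def)

text \<open>Indices that do not belong to the seed get the value 1, so that evaluation is defined on all exponent vectors.\<close>

definition padded_var :: "('i, 'f::field_char_0) seed \<Rightarrow> 'i \<Rightarrow> 'f" where
  "padded_var t i = (if i \<in> ind t then var t i else 1)"

text \<open>The Laurent polynomial ring of a cluster, as a subring of the ambient field.\<close>

definition laurents :: "('i, 'f::field_char_0) seed \<Rightarrow> 'f set" where
  "laurents t = laurent_eval (padded_var t) ` laurent_in (ind t)"

text \<open>The invariant of mutation that replaces \<open>is_seed\<close>: cluster variables stay algebraically independent. It speaks only of the
  Laurent ring of the cluster and not of the ambient field, so it also applies to the seeds with principal coefficients below.\<close>

definition good :: "('i, 'f::field_char_0) seed \<Rightarrow> bool" where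
  "good t \<longleftrightarrow> finite (ind t) \<and> mut t \<subseteq> ind t \<and> lindep (ind t) (padded_var t) \<and> skew_symmetrizable (mut t) (mat t)"

definition expo :: "'i set \<Rightarrow> ('i \<Rightarrow> int) \<Rightarrow> ('i \<Rightarrow>\<^sub>0 int)" where
  "expo S f = (\<Sum>i\<in>S. frag_cmul (f i) (frag_of i))"

lemma lookup_expo: "finite S \<Longrightarrow> Poly_Mapping.lookup (expo S f) i = (if i \<in> S then f i else 0)"
proof -
  assume S: "finite S"
  have "Poly_Mapping.lookup (expo S f) i = (\<Sum>j\<in>S. if j = i then f i else 0)"
    unfolding expo_def lookup_sum by (rule sum.cong) auto
  thus ?thesis using S by simp
qed

lemma keys_expo: 
  assumes "finite S"
  shows "Poly_Mapping.keys (expo S f) \<subseteq> S"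
proof
  fix i assume "i \<in> Poly_Mapping.keys (expo S f)"
  hence "(if i \<in> S then f i else 0) \<noteq> 0" unfolding in_keys_iff lookup_expo[OF assms] .
  thus "i \<in> S" by presburger
qed

lemma monval_expo:
  assumes "finite S"
  shows "monval v (expo S f) = (\<Prod>i\<in>S. v i powi f i)"
  using mon_superset[OF assms keys_expo[OF assms], of v f] by (simp add: lookup_expo assms)

lemma goodD:
  assumes "good t"
  shows "finite (ind t)" "mut t \<subseteq> ind t" "lindep (ind t) (padded_var t)" "skew_symmetrizable (mut t) (mat t)"
  using assms by (auto simp: good_def)

lemma good_nonzero:
  assumes "good t" "i \<in> ind t"
  shows "var t i \<noteq> 0"
proof
  assume "var t i = 0"
  have "laurent_eval (padded_var t) (mterm (frag_of i) 1) = 0" using \<open>var t i = 0\<close> assms by (simp add: padded_var_def)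
  moreover have "mterm (frag_of i) 1 \<in> laurent_in (ind t)" 
    using assms by (intro laurent_in_single) (simp add: keys_frag_of)
  ultimately have "frag_of (frag_of i) = 0" using goodD(3)[OF assms(1)] unfolding lindep_def by blast
  thus False by simp
qed

lemma padded_var_nonzero: "good t \<Longrightarrow> padded_var t i \<noteq> 0"
  by (simp add: padded_var_def good_nonzero)

lemma good_mat_diag:
  assumes "good t" "k \<in> mut t"
  shows "mat t k k = 0"
proof -
  obtain d :: "'a \<Rightarrow> int" where "\<forall>i\<in>mut t. d i > 0" "\<forall>i\<in>mut t. \<forall>j\<in>mut t. d i * mat t i j = - (d j * mat t j i)"
    using goodD(4)[OF assms(1)] unfolding skew_symmetrizable_def by blast
  hence "d k > 0" "d k * mat t k k = - (d k * mat t k k)" using assms(2) by blast+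
  thus ?thesis by simp
qed

lemma good_mat_sign:
  assumes "good t" "k \<in> mut t" "j \<in> mut t"
  shows "mat t j k > 0 \<longleftrightarrow> mat t k j < 0" "mat t j k = 0 \<longleftrightarrow> mat t k j = 0"
proof -
  obtain d :: "'a \<Rightarrow> int" where "\<forall>i\<in>mut t. d i > 0" "\<forall>i\<in>mut t. \<forall>j\<in>mut t. d i * mat t i j = - (d j * mat t j i)"
    using goodD(4)[OF assms(1)] unfolding skew_symmetrizable_def by blast
  hence d: "d k > 0" "d j > 0" "d k * mat t k j = - (d j * mat t j k)" using assms(2,3) by blast+
  show "mat t j k = 0 \<longleftrightarrow> mat t k j = 0" using d by auto
  show "mat t j k > 0 \<longleftrightarrow> mat t k j < 0"
  proof -
    have "mat t j k > 0 \<longleftrightarrow> d j * mat t j k > 0" using d(2) by (simp add: zero_less_mult_iff)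
    also have "\<dots> \<longleftrightarrow> d k * mat t k j < 0" using d(3) by linarith
    also have "\<dots> \<longleftrightarrow> mat t k j < 0" using d(1) by (simp add: mult_less_0_iff)
    finally show ?thesis .
  qed
qed

lemma sring_laurents:
  assumes "good t"
  shows "sring (laurents t)"
proof -
  note nz = padded_var_nonzero[OF assms]
  have "1 \<in> laurents t" unfolding laurents_def by (rule image_eqI[of _ _ 1]) auto
  moreover have "x + y \<in> laurents t \<and> x * y \<in> laurents t" if xy: "x \<in> laurents t" "y \<in> laurents t" for x y
  proof -
    obtain p q where pq: "p \<in> laurent_in (ind t)" "q \<in> laurent_in (ind t)" "x = laurent_eval (padded_var t) p" "y = laurent_eval (padded_var t) q"
      using xy unfolding laurents_def by blast
    have "x + y = laurent_eval (padded_var t) (p + q)" "x * y = laurent_eval (padded_var t) (p * q)" using pq by (simp_all add: laurent_eval_add laurent_eval_mult nz)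
    thus ?thesis using pq laurent_in_add laurent_in_mult unfolding laurents_def by blast
  qed
  moreover have "- x \<in> laurents t" if x: "x \<in> laurents t" for x
  proof -
    obtain p where "p \<in> laurent_in (ind t)" "x = laurent_eval (padded_var t) p" using x unfolding laurents_def by blast
    hence "- p \<in> laurent_in (ind t)" "- x = laurent_eval (padded_var t) (- p)" by (simp_all add: laurent_in_uminus laurent_eval_uminus)
    thus ?thesis unfolding laurents_def by blast
  qed
  ultimately show ?thesis unfolding sring_def by blast
qed

lemma monval_in_laurents: "Poly_Mapping.keys e \<subseteq> ind t \<Longrightarrow> monval (padded_var t) e \<in> laurents t"
  unfolding laurents_def by (rule image_eqI[of _ _ "mterm e 1"]) (auto intro: laurent_in_single)

lemma lunit_monval: 
  assumes "good t" "Poly_Mapping.keys e \<subseteq> ind t"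
  shows "lunit (laurents t) (monval (padded_var t) e)"
proof -
  have "monval (padded_var t) (- e) \<in> laurents t" using assms(2) by (intro monval_in_laurents) simp
  thus ?thesis unfolding lunit_def[OF sring_laurents[OF assms(1)]]
    using monval_in_laurents[OF assms(2)] mon_nonzero[OF padded_var_nonzero[OF assms(1)]]
    by (simp add: mon_uminus[OF padded_var_nonzero[OF assms(1)]])
qed

lemma lunit_var:
  assumes "good t" "i \<in> ind t"
  shows "lunit (laurents t) (var t i)"
  using lunit_monval[OF assms(1), of "frag_of i"] assms(2) by (simp add: keys_frag_of padded_var_def)

text \<open>Transfers \<open>regular_binomial\<close> to the ambient field, where Laurent polynomials have unique representations.\<close>

lemma regular_mod_basic:
  assumes t: "good t" and keys: "Poly_Mapping.keys \<beta> \<subseteq> ind t" "Poly_Mapping.keys \<gamma> \<subseteq> ind t"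
    and indep: "\<And>k l. frag_cmul k \<beta> + frag_cmul l \<gamma> = 0 \<Longrightarrow> k = 0 \<and> l = 0" and "c \<noteq> 0"
  shows "regular_mod (laurents t) (1 + monval (padded_var t) \<beta>) (1 + of_int c * monval (padded_var t) \<gamma>)"
  unfolding regular_mod_def[OF sring_laurents[OF t]]
proof (intro ballI impI)
  note nz = padded_var_nonzero[OF t]
  fix f h assume f: "f \<in> laurents t" and h: "h \<in> laurents t" 
    and eq: "f * (1 + of_int c * monval (padded_var t) \<gamma>) = (1 + monval (padded_var t) \<beta>) * h"
  obtain p q where pq: "p \<in> laurent_in (ind t)" "q \<in> laurent_in (ind t)" "f = laurent_eval (padded_var t) p" "h = laurent_eval (padded_var t) q"
    using f h unfolding laurents_def by blast
  have "laurent_eval (padded_var t) (p * (1 + mterm \<gamma> c)) = laurent_eval (padded_var t) ((1 + mterm \<beta> 1) * q)"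
    using eq pq by (simp add: laurent_eval_mult laurent_eval_add nz)
  hence "p * (1 + mterm \<gamma> c) = (1 + mterm \<beta> 1) * q"
    using pq keys
    by (intro lindepD[OF goodD(3)[OF t]] laurent_in_mult laurent_in_add laurent_in_one laurent_in_single)
  hence "(1 + mterm \<beta> 1) dvd p" using regular_binomial[OF indep \<open>c \<noteq> 0\<close>] by (metis dvd_triv_left)
  then obtain r where r: "p = (1 + mterm \<beta> 1) * r" by (elim dvdE)
  \<comment> \<open>variables outside the cluster are evaluated at 1, so any quotient evaluates into the Laurent ring\<close>
  have "laurent_eval (padded_var t) r \<in> laurents t"
  proof -
    have "monval (padded_var t) e \<in> laurents t" for e
    proof -
      have "monval (padded_var t) e = monval (padded_var t) (expo (ind t) (Poly_Mapping.lookup e))"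
      proof -
        have "monval (padded_var t) e = (\<Prod>i\<in>ind t \<union> Poly_Mapping.keys e. padded_var t i powi Poly_Mapping.lookup e i)"
          using goodD(1)[OF t] by (intro mon_superset) auto
        also have "\<dots> = (\<Prod>i\<in>ind t. padded_var t i powi Poly_Mapping.lookup e i)"
          using goodD(1)[OF t] by (intro prod.mono_neutral_right) (auto simp: padded_var_def)
        finally show ?thesis by (simp add: monval_expo goodD(1)[OF t])
      qed
      thus ?thesis using monval_in_laurents keys_expo[OF goodD(1)[OF t]] by metis
    qed
    thus ?thesis unfolding laurent_eval_def
      by (intro sring_sum[OF sring_laurents[OF t]] sring_mult[OF sring_laurents[OF t]] sring_of_int[OF sring_laurents[OF t]])
  qed
  moreover have "f = (1 + monval (padded_var t) \<beta>) * laurent_eval (padded_var t) r"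
    using pq(3) r by (simp add: laurent_eval_mult laurent_eval_add nz)
  ultimately show "\<exists>h'\<in>laurents t. f = (1 + monval (padded_var t) \<beta>) * h'" by blast
qed

lemma exchange_numerator_laurent:
  assumes t: "good t" and k: "k \<in> mut t"
  shows "\<exists>q\<in>laurent_in (ind t - {k}). laurent_eval (padded_var t) q = pplus t k + pminus t k \<and> q \<noteq> 0"
proof -
  let ?I = "ind t - {k}"
  let ?e1 = "expo ?I (\<lambda>i. int (nat (mat t i k)))" and ?e2 = "expo ?I (\<lambda>i. int (nat (- mat t i k)))"
  have fin: "finite ?I" using goodD(1)[OF t] by simp
  have kI: "k \<in> ind t" using k goodD(2)[OF t] by auto
  have "mterm ?e1 1 + mterm ?e2 1 \<in> laurent_in ?I"
    by (intro laurent_in_add laurent_in_single keys_expo fin)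
  moreover have "laurent_eval (padded_var t) (mterm ?e1 1 + mterm ?e2 1) = pplus t k + pminus t k"
  proof -
    have *: "monval (padded_var t) (expo ?I (\<lambda>i. int (nat (f i)))) = (\<Prod>i\<in>ind t. var t i ^ nat (f i))" if "f k = 0" for f
    proof -
      have "monval (padded_var t) (expo ?I (\<lambda>i. int (nat (f i)))) = (\<Prod>i\<in>?I. var t i ^ nat (f i))"
        unfolding monval_expo[OF fin] by (rule prod.cong) (auto simp: padded_var_def power_int_def)
      also have "\<dots> = (\<Prod>i\<in>ind t. var t i ^ nat (f i))"
        using goodD(1)[OF t] that by (intro prod.mono_neutral_left) auto
      finally show ?thesis .
    qed
    show ?thesis using *[of "\<lambda>i. mat t i k"] *[of "\<lambda>i. - mat t i k"] good_mat_diag[OF t k]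
      by (simp add: laurent_eval_add pplus_def pminus_def)
  qed
  moreover have "mterm ?e1 1 + mterm ?e2 (1::int) \<noteq> 0"
  proof
    assume "mterm ?e1 1 + mterm ?e2 (1::int) = 0"
    hence "Poly_Mapping.lookup (mterm ?e1 1 + mterm ?e2 (1::int)) ?e1 = 0" by simp
    thus False by (simp add: lookup_add lookup_single when_def split: if_splits)
  qed
  ultimately show ?thesis by blast
qed

lemma max_mult_pos: "(d::int) > 0 \<Longrightarrow> d * max 0 x = max 0 (d * x)"
  by (auto simp: max_def zero_le_mult_iff mult_le_0_iff)

lemma exchange_factors:
  fixes p :: int
  assumes "p * a = q * a'" "q * b = r * b'"
  shows "p * (a * b) = r * (b' * a')"
proof -
  have "p * (a * b) = (p * a) * b" by (simp only: mult_ac)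
  also have "\<dots> = (q * b) * a'" unfolding assms(1) by (simp only: mult_ac)
  also have "\<dots> = r * (b' * a')" unfolding assms(2) by (simp only: mult_ac)
  finally show ?thesis .
qed

text \<open>The same symmetrizer works.\<close>

lemma skew_symmetrizable_mutate:
  assumes "skew_symmetrizable (mut t) (mat t)" "k \<in> mut t"
  shows "skew_symmetrizable (mut t) (mat (mutate k t))"
proof -
  obtain d :: "'a \<Rightarrow> int" where dpos: "\<And>i. i \<in> mut t \<Longrightarrow> d i > 0" 
    and d: "\<And>i j. i \<in> mut t \<Longrightarrow> j \<in> mut t \<Longrightarrow> d i * mat t i j = - (d j * mat t j i)"
    using assms(1) unfolding skew_symmetrizable_def by blast
  have "d i * mat (mutate k t) i j = - (d j * mat (mutate k t) j i)" if ij: "i \<in> mut t" "j \<in> mut t" for i j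
  proof (cases "i = k \<or> j = k")
    case True
    thus ?thesis using d[OF ij] by (auto simp: mat_mutate)
  next
    case False
    have m: "d a * max 0 (mat t a b) = d b * max 0 (- mat t b a)"
      "d a * max 0 (- mat t a b) = d b * max 0 (mat t b a)" if "a \<in> mut t" "b \<in> mut t" for a b
      using d[OF that] dpos[OF that(1)] dpos[OF that(2)] by (simp_all add: max_mult_pos)
    have 1: "d i * (max 0 (mat t i k) * max 0 (mat t k j)) = d j * (max 0 (- mat t j k) * max 0 (- mat t k i))"
      by (rule exchange_factors[OF m(1)[OF ij(1) assms(2)] m(1)[OF assms(2) ij(2)]])
    have 2: "d i * (max 0 (- mat t i k) * max 0 (- mat t k j)) = d j * (max 0 (mat t j k) * max 0 (mat t k i))"
      by (rule exchange_factors[OF m(2)[OF ij(1) assms(2)] m(2)[OF assms(2) ij(2)]])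
    show ?thesis using False d[OF ij] 1 2 by (simp add: mat_mutate ring_distribs)
  qed
  thus ?thesis unfolding skew_symmetrizable_def using dpos by blast
qed

lemma good_mutate:
  assumes t: "good t" and k: "k \<in> mut t"
  shows "good (mutate k t)"
proof -
  obtain q where q: "q \<in> laurent_in (ind t - {k})" "laurent_eval (padded_var t) q = pplus t k + pminus t k" "q \<noteq> 0"
    using exchange_numerator_laurent[OF t k] by blast
  have kI: "k \<in> ind t" using k goodD(2)[OF t] by auto
  have "laurent_eval (padded_var t) q \<noteq> 0" using q goodD(3)[OF t] laurent_in_mono[of "ind t - {k}" "ind t"]
    unfolding lindep_def by blast
  hence "lindep (ind t) ((padded_var t)(k := laurent_eval (padded_var t) q / padded_var t k))"
    by (intro lindep_mutate goodD(3)[OF t] padded_var_nonzero[OF t] kI q(1))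
  moreover have "padded_var (mutate k t) = (padded_var t)(k := laurent_eval (padded_var t) q / padded_var t k)"
    using kI by (auto simp: padded_var_def fun_eq_iff q(2) var_mutate_same)
  ultimately show ?thesis using t skew_symmetrizable_mutate[OF goodD(4)[OF t] k] by (simp add: good_def)
qed

lemma exchange:
  assumes "good t" "k \<in> mut t"
  shows "var (mutate k t) k * var t k = pplus t k + pminus t k"
  using good_nonzero[OF assms(1)] goodD(2)[OF assms(1)] assms(2) by (auto simp: var_mutate_same)

lemma mutate_involutive:
  assumes t: "good t" and k: "k \<in> mut t"
  shows "mutate k (mutate k t) = t"
proof -
  have kI: "k \<in> ind t" using k goodD(2)[OF t] by auto
  have g': "good (mutate k t)" using good_mutate[OF t k] .
  have "var (mutate k t) i ^ nat (mat (mutate k t) i k) = var t i ^ nat (- mat t i k)"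
    "var (mutate k t) i ^ nat (- mat (mutate k t) i k) = var t i ^ nat (mat t i k)" for i
    using good_mat_diag[OF t k] by (cases "i = k"; simp add: mat_mutate)+
  hence "pplus (mutate k t) k = pminus t k" "pminus (mutate k t) k = pplus t k"
    unfolding pplus_def pminus_def by simp_all
  hence "var (mutate k (mutate k t)) k = var t k"
    using exchange[OF t k] good_nonzero[OF g'] kI 
    by (simp add: var_mutate_same[of k "mutate k t"] add.commute field_simps)
  hence "var (mutate k (mutate k t)) = var t"
    by (metis ext var_mutate_other)
  moreover have "mat (mutate k (mutate k t)) = mat t"
    using good_mat_diag[OF t k] by (intro ext) (auto simp: mat_mutate)
  moreover have "ind (mutate k (mutate k t)) = ind t" "mut (mutate k (mutate k t)) = mut t" by simp_all
  ultimately show ?thesis by (intro seed.equality) (simp_all add: mutate_def)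
qed

text \<open>The columns of the extended exchange matrix are linearly independent.\<close>

definition fullrank :: "('i, 'f::field_char_0) seed \<Rightarrow> bool" where
  "fullrank t \<longleftrightarrow> (\<forall>c :: 'i \<Rightarrow> int. (\<forall>i\<in>ind t. (\<Sum>j\<in>mut t. mat t i j * c j) = 0) \<longrightarrow> (\<forall>j\<in>mut t. c j = 0))"

lemma fullrank_mutate:
  assumes t: "good t" and r: "fullrank t" and k: "k \<in> mut t"
  shows "fullrank (mutate k t)"
  unfolding fullrank_def
proof (intro allI impI)
  fix c assume c: "\<forall>i\<in>ind (mutate k t). (\<Sum>j\<in>mut (mutate k t). mat (mutate k t) i j * c j) = 0"
  have fin: "finite (mut t)" using goodD(1,2)[OF t] by (rule finite_subset[rotated])
  have kk: "mat t k k = 0" by (rule good_mat_diag[OF t k])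
  have kI: "k \<in> ind t" using k goodD(2)[OF t] by auto
  let ?M = "mut t - {k}"
  have split: "(\<Sum>j\<in>mut t. f j) = f k + (\<Sum>j\<in>?M. f j)" for f :: "'a \<Rightarrow> int"
    by (rule sum.remove[OF fin k])
  define S where "S = (\<Sum>j\<in>?M. mat t k j * c j)"
  define T where "T = (\<Sum>j\<in>?M. max 0 (- mat t k j) * c j)"
  \<comment> \<open>Mutation multiplies the matrix by invertible matrices on both sides; \<open>c'\<close> is the image of \<open>c\<close> under the right-hand one.\<close>
  define c' where "c' j = (if j = k then T - c k else c j)" for j
  have "0 = (\<Sum>j\<in>mut t. mat (mutate k t) k j * c j)" using c kI by simp
  also have "\<dots> = - S" unfolding split S_def by (simp add: mat_mutate kk sum_negf)
  finally have S: "S = 0" by simp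
  have id: "max 0 a * max 0 b - max 0 (- a) * max 0 (- b) = max 0 a * b + a * max 0 (- b)" for a b :: int
    by (simp add: max_def)
  have c'_sum: "(\<Sum>j\<in>?M. f j * c' j) = (\<Sum>j\<in>?M. f j * c j)" for f
    by (rule sum.cong) (auto simp: c'_def)
  have "(\<Sum>j\<in>mut t. mat t i j * c' j) = 0" if i: "i \<in> ind t" for i
  proof (cases "i = k")
    case True
    thus ?thesis unfolding split c'_sum using S by (simp add: S_def kk)
  next
    case False
    have "0 = (\<Sum>j\<in>mut t. mat (mutate k t) i j * c j)" using c i by simp
    also have "\<dots> = - mat t i k * c k + (\<Sum>j\<in>?M. mat t i j * c j + max 0 (mat t i k) * (mat t k j * c j) + mat t i k * (max 0 (- mat t k j) * c j))"
      unfolding split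
    proof (intro arg_cong2[where f = "(+)"] sum.cong refl)
      fix j assume "j \<in> ?M"
      hence "mat (mutate k t) i j = mat t i j + (max 0 (mat t i k) * max 0 (mat t k j) - max 0 (- mat t i k) * max 0 (- mat t k j))"
        using False by (simp add: mat_mutate)
      thus "mat (mutate k t) i j * c j = mat t i j * c j + max 0 (mat t i k) * (mat t k j * c j) + mat t i k * (max 0 (- mat t k j) * c j)"
        unfolding id by (simp add: algebra_simps)
    qed (simp add: mat_mutate)
    also have "\<dots> = (\<Sum>j\<in>?M. mat t i j * c j) + max 0 (mat t i k) * S + mat t i k * (T - c k)"
      by (simp add: sum.distrib S_def T_def sum_distrib_left algebra_simps)
    finally show ?thesis unfolding split c'_sum using S by (simp add: c'_def)
  qed
  hence "\<forall>j\<in>mut t. c' j = 0" using r unfolding fullrank_def by blast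
  hence c0: "c j = 0" if "j \<in> ?M" for j using that by (auto simp: c'_def split: if_splits)
  hence "T = 0" unfolding T_def by simp
  moreover have "T - c k = 0" using \<open>\<forall>j\<in>mut t. c' j = 0\<close> k by (auto simp: c'_def)
  ultimately show "\<forall>j\<in>mut (mutate k t). c j = 0" using c0 by (metis Diff_iff diff_0 empty_iff insert_iff mut_mutate neg_0_equal_iff_equal)
qed

section \<open>The Laurent phenomenon for seeds of full rank\<close>

lemma laurents_clear_denominators:
  assumes t: "good t" and L: "sring L" and mem: "\<And>i. i \<in> ind t \<Longrightarrow> var t i \<in> L" and x: "x \<in> laurents t"
  shows "\<exists>a. x * (\<Prod>i\<in>ind t. var t i) ^ a \<in> L"
proof -
  let ?m = "\<Prod>i\<in>ind t. var t i"
  define P where "P x \<longleftrightarrow> (\<exists>a. x * ?m ^ a \<in> L)" for x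
  have mL: "?m \<in> L" using mem by (intro sring_prod[OF L])
  have P_L: "P x" if "x \<in> L" for x unfolding P_def by (rule exI[of _ 0]) (use that in simp)
  have P_mult: "P (x * y)" if xy: "P x" "P y" for x y
  proof -
    obtain a b where ab: "x * ?m ^ a \<in> L" "y * ?m ^ b \<in> L" using xy unfolding P_def by blast
    have "(x * y) * ?m ^ (a + b) = (x * ?m ^ a) * (y * ?m ^ b)" by (simp add: power_add mult_ac)
    thus ?thesis unfolding P_def using sring_mult[OF L ab] by metis
  qed
  have P_add: "P (x + y)" if xy: "P x" "P y" for x y
  proof -
    obtain a b where ab: "x * ?m ^ a \<in> L" "y * ?m ^ b \<in> L" using xy unfolding P_def by blast
    have "(x + y) * ?m ^ (a + b) = (x * ?m ^ a) * ?m ^ b + (y * ?m ^ b) * ?m ^ a" 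
      by (simp add: power_add algebra_simps)
    thus ?thesis unfolding P_def 
      using sring_add[OF L sring_mult[OF L ab(1) sring_power[OF L mL]] sring_mult[OF L ab(2) sring_power[OF L mL]]] by metis
  qed
  have P_prod: "P (\<Prod>i\<in>S. g i)" if "\<And>i. i \<in> S \<Longrightarrow> P (g i)" for S and g :: "'a \<Rightarrow> 'b"
    using that by (induction S rule: infinite_finite_induct) (auto intro: P_mult P_L sring_one[OF L])
  have P_powi: "P (padded_var t i powi n)" for i n
  proof (cases "i \<in> ind t")
    case i: True
    show ?thesis
    proof (cases "n \<ge> 0")
      case True
      thus ?thesis using i by (auto simp: padded_var_def power_int_def intro!: P_L sring_power[OF L] mem)
    next
      case False
      let ?r = "\<Prod>l\<in>ind t - {i}. var t l"
      have m: "?m = var t i * ?r" by (rule prod.remove[OF goodD(1)[OF t] i])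
      have "padded_var t i powi n * ?m ^ nat (- n) = ?r ^ nat (- n)"
        using False good_nonzero[OF t i] i by (simp add: m padded_var_def power_int_def power_mult_distrib field_simps)
      moreover have "?r ^ nat (- n) \<in> L" using mem by (intro sring_power[OF L] sring_prod[OF L]) auto
      ultimately show ?thesis unfolding P_def by metis
    qed
  qed (simp add: padded_var_def P_L sring_one[OF L])
  obtain p where "x = laurent_eval (padded_var t) p" using x unfolding laurents_def by blast
  moreover have "P (laurent_eval (padded_var t) p)"
  proof (induction p rule: poly_mapping_mterm_induct)
    case (single a c)
    have "P (monval (padded_var t) a)" unfolding monval_def by (intro P_prod P_powi)
    thus ?case using P_L[OF sring_of_int[OF L]] by (simp add: P_mult)
  next
    case (sum p q)
    thus ?case by (simp add: laurent_eval_add P_add)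
  qed
  ultimately show ?thesis by (simp add: P_def)
qed

lemma prod_split_two:
  assumes "finite I" "j \<in> I" "k \<in> I" "j \<noteq> k"
  shows "prod f I = f j * (f k * prod f (I - {j, k}))"
proof -
  have "prod f I = f j * prod f (I - {j})" using assms by (simp add: prod.remove)
  also have "prod f (I - {j}) = f k * prod f (I - {j} - {k})" using assms by (simp add: prod.remove)
  also have "I - {j} - {k} = I - {j, k}" by blast
  finally show ?thesis .
qed

text \<open>Up to units both elements are binomials. Their exponent vectors are independent: the first involves \<open>k\<close> and not \<open>j\<close>, the
  second \<open>j\<close> and not \<open>k\<close>.\<close>

lemma regular_mod_rank_two:
  fixes t :: "('i, 'f::field_char_0) seed" and fA fB fC fD :: "'i \<Rightarrow> nat"
  assumes t: "good t" and jk: "j \<in> ind t" "k \<in> ind t" "j \<noteq> k" and c: "c > 0"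
  defines "M \<equiv> (\<lambda>f. \<Prod>i\<in>ind t - {j, k}. var t i ^ f i)"
  assumes z: "z * var t j = M fA * var t k ^ c + M fB"
  shows "regular_mod (laurents t) z (M fD * var t j + of_nat c * M fC * M fB)"
proof -
  let ?R = "ind t - {j, k}"
  note L = sring_laurents[OF t]
  have fin: "finite (ind t)" by (rule goodD(1)[OF t])
  have nz: "var t i \<noteq> 0" if "i \<in> ind t" for i by (rule good_nonzero[OF t that])
  have M_unit: "lunit (laurents t) (M f)" for f
    unfolding M_def using lunit_var[OF t] by (intro lunit_prod[OF L] lunit_power[OF L]) auto
  have M_nz: "M f \<noteq> 0" for f by (rule lunitD(3)[OF L M_unit])
  define g1 where "g1 i = (if i = j then 0 else if i = k then int c else int (fA i) - int (fB i))" for i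
  define g2 where "g2 i = (if i = j then - 1 else if i = k then 0 else int (fC i) + int (fB i) - int (fD i))" for i
  let ?\<beta> = "expo (ind t) g1" and ?\<gamma> = "expo (ind t) g2"
  have monval_split: "monval (padded_var t) (expo (ind t) g) = var t j powi g j * (var t k powi g k * (\<Prod>i\<in>?R. var t i powi g i))" for g
    unfolding monval_expo[OF fin] prod_split_two[OF fin jk]
    using jk by (simp add: padded_var_def)
  have "(\<Prod>i\<in>?R. var t i powi g1 i) = (\<Prod>i\<in>?R. var t i ^ fA i / var t i ^ fB i)"
    by (rule prod.cong) (auto simp: g1_def power_int_diff nz)
  hence b: "monval (padded_var t) ?\<beta> = var t k ^ c * (M fA / M fB)"
    unfolding monval_split M_def using jk by (simp add: g1_def prod_dividef)
  have "(\<Prod>i\<in>?R. var t i powi g2 i) = (\<Prod>i\<in>?R. (var t i ^ fC i * var t i ^ fB i) / var t i ^ fD i)"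
    by (rule prod.cong) (auto simp: g2_def power_int_diff power_int_add nz)
  hence g: "monval (padded_var t) ?\<gamma> = inverse (var t j) * (M fC * M fB / M fD)"
    unfolding monval_split M_def using jk by (simp add: g2_def prod_dividef prod.distrib power_int_minus)
  have cop0: "regular_mod (laurents t) (1 + monval (padded_var t) ?\<beta>) (1 + of_int (int c) * monval (padded_var t) ?\<gamma>)"
  proof (rule regular_mod_basic[OF t keys_expo[OF fin] keys_expo[OF fin]])
    fix a b :: int assume eq: "frag_cmul a ?\<beta> + frag_cmul b ?\<gamma> = 0"
    have l: "a * g1 i + b * g2 i = 0" if "i \<in> ind t" for i
    proof -
      have "Poly_Mapping.lookup (frag_cmul a ?\<beta> + frag_cmul b ?\<gamma>) i = 0" unfolding eq by simp
      thus ?thesis using that by (simp add: lookup_add lookup_expo[OF fin])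
    qed
    have "b = 0" using l[OF jk(1)] by (simp add: g1_def g2_def)
    moreover have "a = 0" using l[OF jk(2)] jk(3) c by (simp add: g1_def g2_def split: if_splits)
    ultimately show "a = 0 \<and> b = 0" by simp
  qed (use c in simp)
  have z': "z = (M fB / var t j) * (1 + monval (padded_var t) ?\<beta>)"
  proof -
    have "z = (M fA * var t k ^ c + M fB) / var t j" using z nz[OF jk(1)] by (simp add: eq_divide_eq)
    also have "\<dots> = (M fB / var t j) * (1 + var t k ^ c * (M fA / M fB))"
      using nz[OF jk(1)] M_nz[of fB] by (simp add: field_simps)
    finally show ?thesis unfolding b .
  qed
  have w': "M fD * var t j + of_nat c * M fC * M fB = (M fD * var t j) * (1 + of_int (int c) * monval (padded_var t) ?\<gamma>)"
    using nz[OF jk(1)] M_nz[of fD] unfolding g by (simp add: field_simps)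
  have u1: "lunit (laurents t) (M fB / var t j)" and u2: "lunit (laurents t) (M fD * var t j)"
    using lunit_var[OF t jk(1)] M_unit by (auto intro: lunit_divide[OF L] lunit_mult[OF L])
  show ?thesis unfolding z' w'
    by (intro regular_mod_scale_left[OF L] regular_mod_mult[OF L] regular_mod_unit[OF L] u1 u2 cop0 lunitD(1)[OF L])
qed

lemma nat_parts:
  assumes "(m'::int) = - m - max 0 x * int c"
  shows "nat (- m') + nat (- m) = nat m + nat m' + nat x * c"
proof -
  have "int (nat x * c) = max 0 x * int c" by (simp add: max_def)
  hence "m' = - m - int (nat x * c)" using assms by linarith
  thus ?thesis by linarith
qed

text \<open>Collecting the variables other than \<open>j\<close> and \<open>k\<close> into unit monomials brings the three exchange relations into the form of
  \<open>rank_two_exchange\<close>; the two signs of \<open>mat t k j\<close> are symmetric. If \<open>j\<close> and \<open>k\<close> are not connected, the third mutation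
  undoes the first one and only the regularity of \<open>w\<close> modulo \<open>z\<close> needs an argument.\<close>

lemma exchange_step:
  fixes t :: "('i, 'f::field_char_0) seed"
  assumes t: "good t" and r: "fullrank t" and j: "j \<in> mut t" and k: "k \<in> mut t" and jk: "j \<noteq> k"
  defines "t1 \<equiv> mutate j t" and "t2 \<equiv> mutate k (mutate j t)" and "t3 \<equiv> mutate j (mutate k (mutate j t))"
  defines "z \<equiv> var t1 j" and "w \<equiv> var t2 k" and "v \<equiv> var t3 j"
  shows "z \<in> laurents t \<and> w \<in> laurents t \<and> v \<in> laurents t \<and> regular_mod (laurents t) z w \<and> regular_mod (laurents t) z v"
proof -
  let ?R = "ind t - {j, k}"
  note L = sring_laurents[OF t]
  have fin: "finite (ind t)" by (rule goodD(1)[OF t])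
  have jI: "j \<in> ind t" and kI: "k \<in> ind t" using j k goodD(2)[OF t] by auto
  have nz: "var t i \<noteq> 0" if "i \<in> ind t" for i by (rule good_nonzero[OF t that])
  have g1: "good t1" unfolding t1_def by (rule good_mutate[OF t j])
  have t2: "t2 = mutate k t1" and t3: "t3 = mutate j t2" by (simp_all add: t1_def t2_def t3_def)
  have sets: "ind t1 = ind t" "mut t1 = mut t" "ind t2 = ind t" "mut t2 = mut t" by (simp_all add: t1_def t2_def)
  have g2: "good t2" unfolding t2 by (rule good_mutate[OF g1]) (simp add: sets k)
  have z_nz: "z \<noteq> 0" unfolding z_def by (rule good_nonzero[OF g1]) (simp add: sets jI)
  have vars: "var t1 k = var t k" "var t2 j = z" "\<And>i. i \<in> ?R \<Longrightarrow> var t1 i = var t i" 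
    "\<And>i. i \<in> ?R \<Longrightarrow> var t2 i = var t i"
    using jk by (auto simp: t1_def t2_def z_def)
  have jj: "mat t j j = 0" by (rule good_mat_diag[OF t j])
  have kk1: "mat t1 k k = 0" by (rule good_mat_diag[OF g1]) (simp add: sets k)
  have jj2: "mat t2 j j = 0" by (rule good_mat_diag[OF g2]) (simp add: sets j)
  have m1jk: "mat t1 j k = - mat t j k" and m1kj: "mat t1 k j = - mat t k j" 
    and m1j: "\<And>i. mat t1 i j = - mat t i j"
    by (simp_all add: t1_def mat_mutate)
  have m1k: "mat t1 i k = mat t i k + max 0 (mat t i j) * max 0 (mat t j k) - max 0 (- mat t i j) * max 0 (- mat t j k)" if "i \<noteq> j" for i
    using that jk by (simp add: t1_def mat_mutate)
  have m2kj: "mat t2 k j = mat t k j" by (simp add: t2 mat_mutate m1kj)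
  have m2j: "mat t2 i j = - mat t i j + max 0 (mat t1 i k) * max 0 (- mat t k j) - max 0 (- mat t1 i k) * max 0 (mat t k j)" if "i \<noteq> k" for i
    using that jk by (simp add: t2 mat_mutate[of k t1] m1kj m1j)
  define M where "M f = (\<Prod>i\<in>?R. var t i ^ nat (f i))" for f :: "'i \<Rightarrow> int"
  have M_unit: "lunit (laurents t) (M f)" for f
    unfolding M_def using lunit_var[OF t] by (intro lunit_prod[OF L] lunit_power[OF L]) auto
  have MR: "(\<Prod>i\<in>?R. var t1 i ^ nat (f i)) = M f" "(\<Prod>i\<in>?R. var t2 i ^ nat (f i)) = M f" for f
    unfolding M_def by (auto intro!: prod.cong simp: vars)
  have ez: "z * var t j = M (\<lambda>i. mat t i j) * var t k ^ nat (mat t k j) + M (\<lambda>i. - mat t i j) * var t k ^ nat (- mat t k j)"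
    using exchange[OF t j] unfolding pplus_def pminus_def prod_split_two[OF fin jI kI jk] z_def t1_def M_def
    by (simp add: jj mult.commute)
  have ew: "w * var t k = M (\<lambda>i. mat t1 i k) * z ^ nat (- mat t j k) + M (\<lambda>i. - mat t1 i k) * z ^ nat (mat t j k)"
    using exchange[OF g1, of k] k unfolding pplus_def pminus_def sets prod_split_two[OF fin jI kI jk] w_def t2 MR
    by (simp add: kk1 mult.commute vars m1jk z_def)
  have ev: "v * z = M (\<lambda>i. mat t2 i j) * w ^ nat (mat t k j) + M (\<lambda>i. - mat t2 i j) * w ^ nat (- mat t k j)"
    using exchange[OF g2, of j] j unfolding pplus_def pminus_def sets prod_split_two[OF fin jI kI jk] v_def t3 MR
    by (simp add: jj2 mult.commute vars m2kj w_def)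
  have uj: "lunit (laurents t) (var t j)" and uk: "lunit (laurents t) (var t k)" by (intro lunit_var[OF t] jI kI)+
  consider (zero) "mat t k j = 0" "mat t j k = 0" | (pos) "mat t k j > 0" "mat t j k < 0" | (neg) "mat t k j < 0" "mat t j k > 0"
    using good_mat_sign[OF t j k] good_mat_sign[OF t k j] by linarith
  thus ?thesis
  proof cases
    case pos
    \<comment> \<open>The exponent of \<open>w\<close> in the third exchange relation equals that of \<open>var t k\<close> in the first one.\<close>
    define b c where "b = nat (- mat t j k)" and "c = nat (mat t k j)"
    have bc: "b > 0" "c > 0" "int c = mat t k j" using pos by (auto simp: b_def c_def)
    have rel: "M (\<lambda>i. - mat t2 i j) * M (\<lambda>i. - mat t i j) = M (\<lambda>i. mat t i j) * M (\<lambda>i. mat t2 i j) * M (\<lambda>i. - mat t1 i k) ^ c"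
      unfolding M_def prod_power_distrib prod.distrib[symmetric] power_mult[symmetric] power_add[symmetric]
    proof (rule prod.cong[OF refl])
      fix i assume "i \<in> ?R"
      hence "mat t2 i j = - mat t i j - max 0 (- mat t1 i k) * int c" using pos bc m2j[of i] by simp
      hence "nat (- mat t2 i j) + nat (- mat t i j) = nat (mat t i j) + nat (mat t2 i j) + nat (- mat t1 i k) * c"
        by (rule nat_parts)
      thus "var t i ^ (nat (- mat t2 i j) + nat (- mat t i j)) = var t i ^ (nat (mat t i j) + nat (mat t2 i j) + nat (- mat t1 i k) * c)"
        by simp
    qed
    show ?thesis
    proof (rule rank_two_exchange[OF L uj uk M_unit M_unit M_unit M_unit M_unit M_unit bc(1,2) z_nz _ _ _ rel])
      show z: "z * var t j = M (\<lambda>i. mat t i j) * var t k ^ c + M (\<lambda>i. - mat t i j)" using ez pos by (simp add: c_def)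
      show "w * var t k = M (\<lambda>i. mat t1 i k) * z ^ b + M (\<lambda>i. - mat t1 i k)" using ew pos by (simp add: b_def)
      show "z * v = M (\<lambda>i. mat t2 i j) * w ^ c + M (\<lambda>i. - mat t2 i j)" using ev pos by (simp add: c_def mult.commute)
      show "regular_mod (laurents t) z (M (\<lambda>i. - mat t1 i k) * var t j + of_nat c * M (\<lambda>i. mat t1 i k) * M (\<lambda>i. - mat t i j))"
        using z unfolding M_def by (rule regular_mod_rank_two[OF t jI kI jk bc(2)])
    qed
  next
    case neg
    define b c where "b = nat (mat t j k)" and "c = nat (- mat t k j)"
    have bc: "b > 0" "c > 0" "int c = - mat t k j" using neg by (auto simp: b_def c_def)
    have rel: "M (\<lambda>i. mat t2 i j) * M (\<lambda>i. mat t i j) = M (\<lambda>i. - mat t i j) * M (\<lambda>i. - mat t2 i j) * M (\<lambda>i. mat t1 i k) ^ c"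
      unfolding M_def prod_power_distrib prod.distrib[symmetric] power_mult[symmetric] power_add[symmetric]
    proof (rule prod.cong[OF refl])
      fix i assume "i \<in> ?R"
      hence "- mat t2 i j = - (- mat t i j) - max 0 (mat t1 i k) * int c" using neg bc m2j[of i] by simp
      from nat_parts[OF this]
      have "nat (mat t2 i j) + nat (mat t i j) = nat (- mat t i j) + nat (- mat t2 i j) + nat (mat t1 i k) * c"
        by simp
      thus "var t i ^ (nat (mat t2 i j) + nat (mat t i j)) = var t i ^ (nat (- mat t i j) + nat (- mat t2 i j) + nat (mat t1 i k) * c)"
        by simp
    qed
    show ?thesis
    proof (rule rank_two_exchange[OF L uj uk M_unit M_unit M_unit M_unit M_unit M_unit bc(1,2) z_nz _ _ _ rel])
      show z: "z * var t j = M (\<lambda>i. - mat t i j) * var t k ^ c + M (\<lambda>i. mat t i j)" using ez neg by (simp add: c_def)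
      show "w * var t k = M (\<lambda>i. - mat t1 i k) * z ^ b + M (\<lambda>i. mat t1 i k)" using ew neg by (simp add: b_def)
      show "z * v = M (\<lambda>i. - mat t2 i j) * w ^ c + M (\<lambda>i. mat t2 i j)" using ev neg by (simp add: c_def mult.commute)
      show "regular_mod (laurents t) z (M (\<lambda>i. mat t1 i k) * var t j + of_nat c * M (\<lambda>i. - mat t1 i k) * M (\<lambda>i. mat t i j))"
        using z unfolding M_def by (rule regular_mod_rank_two[OF t jI kI jk bc(2)])
    qed
  next
    case zero
    have m1k': "mat t1 i k = mat t i k" if "i \<in> ?R" for i using that zero m1k by simp
    have m2j': "mat t2 i j = - mat t i j" if "i \<in> ?R" for i using that zero m2j by simp
    have ez': "z * var t j = M (\<lambda>i. mat t i j) + M (\<lambda>i. - mat t i j)" using ez zero by simp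
    have "M (\<lambda>i. mat t1 i k) = M (\<lambda>i. mat t i k)" "M (\<lambda>i. - mat t1 i k) = M (\<lambda>i. - mat t i k)"
      unfolding M_def by (auto intro!: prod.cong simp: m1k')
    hence ew': "w * var t k = M (\<lambda>i. mat t i k) + M (\<lambda>i. - mat t i k)" using ew zero by simp
    have "M (\<lambda>i. mat t2 i j) = M (\<lambda>i. - mat t i j)" "M (\<lambda>i. - mat t2 i j) = M (\<lambda>i. mat t i j)"
      unfolding M_def by (auto intro!: prod.cong simp: m2j')
    hence "v * z = z * var t j" using ev ez' zero by simp
    hence v: "v = var t j" using z_nz by simp
    have binomial: "x = (M (\<lambda>i. - mat t i l) / y) * (1 + monval (padded_var t) (expo (ind t) (\<lambda>i. mat t i l)))"
      if eq: "x * y = M (\<lambda>i. mat t i l) + M (\<lambda>i. - mat t i l)" and "y \<noteq> 0" and l0: "mat t j l = 0" "mat t k l = 0" for x y l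
    proof -
      have "monval (padded_var t) (expo (ind t) (\<lambda>i. mat t i l)) = (\<Prod>i\<in>?R. var t i powi mat t i l)"
        unfolding monval_expo[OF fin] prod_split_two[OF fin jI kI jk] by (simp add: l0 padded_var_def)
      also have "\<dots> = (\<Prod>i\<in>?R. var t i ^ nat (mat t i l) / var t i ^ nat (- mat t i l))"
        by (rule prod.cong) (auto simp: power_int_def field_simps)
      also have "\<dots> = M (\<lambda>i. mat t i l) / M (\<lambda>i. - mat t i l)" by (simp add: M_def prod_dividef)
      finally have m: "monval (padded_var t) (expo (ind t) (\<lambda>i. mat t i l)) = M (\<lambda>i. mat t i l) / M (\<lambda>i. - mat t i l)" .
      have "x = (M (\<lambda>i. mat t i l) + M (\<lambda>i. - mat t i l)) / y" using eq \<open>y \<noteq> 0\<close> by (simp add: eq_divide_eq)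
      also have "\<dots> = (M (\<lambda>i. - mat t i l) / y) * (1 + M (\<lambda>i. mat t i l) / M (\<lambda>i. - mat t i l))"
        using \<open>y \<noteq> 0\<close> lunitD(3)[OF L M_unit] by (simp add: field_simps)
      finally show ?thesis unfolding m .
    qed
    \<comment> \<open>Up to units \<open>z\<close> and \<open>w\<close> are binomials whose exponent vectors are two columns of the matrix; these are independent by full rank.\<close>
    have kk: "mat t k k = 0" by (rule good_mat_diag[OF t k])
    have z': "z = (M (\<lambda>i. - mat t i j) / var t j) * (1 + monval (padded_var t) (expo (ind t) (\<lambda>i. mat t i j)))"
      by (rule binomial[OF ez' nz[OF jI] jj zero(1)])
    have w': "w = (M (\<lambda>i. - mat t i k) / var t k) * (1 + of_int 1 * monval (padded_var t) (expo (ind t) (\<lambda>i. mat t i k)))"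
      using binomial[OF ew' nz[OF kI] zero(2) kk] by simp
    have "regular_mod (laurents t) (1 + monval (padded_var t) (expo (ind t) (\<lambda>i. mat t i j))) (1 + of_int 1 * monval (padded_var t) (expo (ind t) (\<lambda>i. mat t i k)))"
    proof (rule regular_mod_basic[OF t keys_expo[OF fin] keys_expo[OF fin]])
      fix a b :: int assume eq: "frag_cmul a (expo (ind t) (\<lambda>i. mat t i j)) + frag_cmul b (expo (ind t) (\<lambda>i. mat t i k)) = 0"
      define c where "c i = (if i = j then a else if i = k then b else 0)" for i
      have "(\<Sum>l\<in>mut t. mat t i l * c l) = 0" if "i \<in> ind t" for i
      proof -
        have "Poly_Mapping.lookup (frag_cmul a (expo (ind t) (\<lambda>i. mat t i j)) + frag_cmul b (expo (ind t) (\<lambda>i. mat t i k))) i = 0" 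
          unfolding eq by simp
        hence "a * mat t i j + b * mat t i k = 0" using that by (simp add: lookup_add lookup_expo[OF fin])
        moreover have "(\<Sum>l\<in>mut t. mat t i l * c l) = (\<Sum>l\<in>{j, k}. mat t i l * c l)"
          using j k goodD(1,2)[OF t] by (intro sum.mono_neutral_right) (auto simp: c_def intro: finite_subset)
        ultimately show ?thesis using jk by (simp add: c_def mult.commute)
      qed
      hence "c j = 0" "c k = 0" using r j k unfolding fullrank_def by blast+
      thus "a = 0 \<and> b = 0" using jk by (simp add: c_def)
    qed simp
    moreover have u1: "lunit (laurents t) (M (\<lambda>i. - mat t i j) / var t j)" and u2: "lunit (laurents t) (M (\<lambda>i. - mat t i k) / var t k)"
      using uj uk M_unit by (auto intro: lunit_divide[OF L])
    ultimately have "regular_mod (laurents t) z w" unfolding z' w'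
      by (intro regular_mod_scale_left[OF L regular_mod_mult[OF L regular_mod_unit[OF L u2] _ lunitD(1)[OF L u2]] u1])
    moreover have "z = (M (\<lambda>i. mat t i j) + M (\<lambda>i. - mat t i j)) * inverse (var t j)" using ez' nz[OF jI] by (simp add: field_simps)
    hence "z \<in> laurents t" using sring_mult[OF L sring_add[OF L] lunitD(2)[OF L uj]] lunitD(1)[OF L M_unit] by simp
    moreover have "w = (M (\<lambda>i. mat t i k) + M (\<lambda>i. - mat t i k)) * inverse (var t k)" using ew' nz[OF kI] by (simp add: field_simps)
    hence "w \<in> laurents t" using sring_mult[OF L sring_add[OF L] lunitD(2)[OF L uk]] lunitD(1)[OF L M_unit] by simp
    moreover have "v \<in> laurents t" "regular_mod (laurents t) z v" unfolding v using uj by (auto intro: lunitD(1)[OF L] regular_mod_unit[OF L])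
    ultimately show ?thesis by simp
  qed
qed

lemma lunit_cancel:
  assumes L: "sring L" and u: "lunit L u" and x: "x * u \<in> L"
  shows "x \<in> L"
proof -
  have "x = (x * u) * inverse u" using lunitD(3)[OF L u] by (simp add: mult.assoc)
  thus ?thesis using sring_mult[OF L x lunitD(2)[OF L u]] by metis
qed

lemma mutate_var_in_laurents:
  assumes t: "good t" and k: "k \<in> mut t" and i: "i \<in> ind t"
  shows "var (mutate k t) i \<in> laurents t"
proof (cases "i = k")
  case True
  note L = sring_laurents[OF t]
  have var: "var t i \<in> laurents t" if "i \<in> ind t" for i by (rule lunitD(1)[OF L lunit_var[OF t that]])
  have "pplus t k + pminus t k \<in> laurents t"
    unfolding pplus_def pminus_def by (intro sring_add[OF L] sring_prod[OF L] sring_power[OF L] var)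
  moreover have "inverse (var t k) \<in> laurents t" by (rule lunitD(2)[OF L lunit_var[OF t]]) (use i True in simp)
  ultimately show ?thesis using sring_mult[OF L] True by (simp add: var_mutate_same divide_inverse)
next
  case False
  thus ?thesis using lunitD(1)[OF sring_laurents[OF t] lunit_var[OF t i]] by simp
qed

text \<open>Induction on the length of the mutation sequence. If it starts with \<open>j\<close> and \<open>k\<close>, then the variable \<open>x\<close> that is reached is
  Laurent in the clusters after one mutation, at \<open>j\<close>, and after three mutations, at \<open>j\<close>, \<open>k\<close> and \<open>j\<close>. So a power of \<open>z\<close>
  and a power of \<open>v * w\<close> are denominators of \<open>x\<close>, and \<open>exchange_step\<close> shows that these have no common factor.\<close>

theorem laurent_full_rank:
  assumes "good t" "fullrank t" "set ks \<subseteq> mut t" "i \<in> ind t"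
  shows "var (fold mutate ks t) i \<in> laurents t"
  using assms
proof (induction "length ks" arbitrary: ks t rule: less_induct)
  case less
  note t = less.prems(1) and r = less.prems(2)
  note L = sring_laurents[OF t]
  show ?case
  proof (cases ks)
    case Nil
    thus ?thesis using lunitD(1)[OF L lunit_var[OF t less.prems(4)]] by simp
  next
    case ks: (Cons j ks1)
    have j: "j \<in> mut t" using less.prems(3) ks by simp
    show ?thesis
    proof (cases ks1)
      case Nil
      thus ?thesis using mutate_var_in_laurents[OF t j less.prems(4)] ks by simp
    next
      case ks1: (Cons k ks2)
      have k: "k \<in> mut t" using less.prems(3) ks ks1 by simp
      have ks2: "set ks2 \<subseteq> mut t" using less.prems(3) ks ks1 by simp
      show ?thesis
      proof (cases "j = k")
        case True
        have "fold mutate ks t = fold mutate ks2 t"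
          using ks ks1 True mutate_involutive[OF t k] by simp
        thus ?thesis using less.hyps[of ks2 t] t r ks2 less.prems(4) ks ks1 by simp
      next
        case jk: False
        define t1 t2 t3 where "t1 = mutate j t" and "t2 = mutate k t1" and "t3 = mutate j t2"
        define x where "x = var (fold mutate ks t) i"
        have g1: "good t1" and r1: "fullrank t1" unfolding t1_def by (intro good_mutate fullrank_mutate t r j)+
        have m1: "mut t1 = mut t" "ind t1 = ind t" by (simp_all add: t1_def)
        have g2: "good t2" and r2: "fullrank t2" unfolding t2_def by (intro good_mutate fullrank_mutate g1 r1; simp add: m1 k)+
        have m2: "mut t2 = mut t" "ind t2 = ind t" by (simp_all add: t2_def m1)
        have g3: "good t3" and r3: "fullrank t3" unfolding t3_def by (intro good_mutate fullrank_mutate g2 r2; simp add: m2 j)+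
        have m3: "mut t3 = mut t" "ind t3 = ind t" by (simp_all add: t3_def m2)
        have "x = var (fold mutate (k # ks2) t1) i" by (simp add: x_def ks ks1 t1_def)
        hence x1: "x \<in> laurents t1" using less.hyps[of "k # ks2" t1] g1 r1 m1 k ks2 less.prems(4) ks ks1 by simp
        \<comment> \<open>Inserting the second mutation at \<open>j\<close> twice changes nothing, so \<open>x\<close> is also reached from \<open>t3\<close> by a shorter sequence.\<close>
        have "x = var (fold mutate (j # ks2) t3) i"
          using mutate_involutive[OF g2, of j] j by (simp add: x_def ks ks1 t3_def t2_def t1_def)
        hence x3: "x \<in> laurents t3" using less.hyps[of "j # ks2" t3] g3 r3 m3 j ks2 less.prems(4) ks ks1 by simp
        define z w v where "z = var t1 j" and "w = var t2 k" and "v = var t3 j"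
        have step: "z \<in> laurents t" "w \<in> laurents t" "v \<in> laurents t" "regular_mod (laurents t) z w" "regular_mod (laurents t) z v"
          using exchange_step[OF t r j k jk] by (simp_all add: z_def w_def v_def t3_def t2_def t1_def)
        have fin: "finite (ind t)" by (rule goodD(1)[OF t])
        have jI: "j \<in> ind t" and kI: "k \<in> ind t" using j k goodD(2)[OF t] by auto
        have var: "var t l \<in> laurents t" if "l \<in> ind t" for l by (rule lunitD(1)[OF L lunit_var[OF t that]])
        have unit: "lunit (laurents t) ((\<Prod>l\<in>ind t - S. var t l) ^ a)" for S a
          by (intro lunit_power[OF L] lunit_prod[OF L] lunit_var[OF t]) auto
        have "var t1 l \<in> laurents t" if "l \<in> ind t1" for l
          using that var step(1) by (cases "l = j") (auto simp: z_def t1_def)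
        then obtain a where a: "x * (\<Prod>l\<in>ind t1. var t1 l) ^ a \<in> laurents t"
          using laurents_clear_denominators[OF g1 L _ x1] by blast
        have "(\<Prod>l\<in>ind t1. var t1 l) = z * (\<Prod>l\<in>ind t - {j}. var t l)"
          unfolding m1 prod.remove[OF fin jI] z_def by (simp add: t1_def)
        hence "(x * z ^ a) * (\<Prod>l\<in>ind t - {j}. var t l) ^ a \<in> laurents t"
          using a by (simp add: power_mult_distrib mult_ac)
        hence xz: "x * z ^ a \<in> laurents t" by (rule lunit_cancel[OF L unit])
        have "var t3 l \<in> laurents t" if "l \<in> ind t3" for l
        proof -
          consider "l = j" | "l = k" "l \<noteq> j" | "l \<noteq> j" "l \<noteq> k" by blast
          thus ?thesis using that var step
            by cases (auto simp: v_def w_def t3_def t2_def t1_def)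
        qed
        then obtain b where b: "x * (\<Prod>l\<in>ind t3. var t3 l) ^ b \<in> laurents t"
          using laurents_clear_denominators[OF g3 L _ x3] by blast
        have "(\<Prod>l\<in>ind t - {j, k}. var t3 l) = (\<Prod>l\<in>ind t - {j, k}. var t l)"
          by (rule prod.cong) (auto simp: t3_def t2_def t1_def)
        hence "(\<Prod>l\<in>ind t3. var t3 l) = v * (w * (\<Prod>l\<in>ind t - {j, k}. var t l))"
          unfolding m3 prod_split_two[OF fin jI kI jk] v_def w_def using jk by (simp add: t3_def)
        hence "(x * (v * w) ^ b) * (\<Prod>l\<in>ind t - {j, k}. var t l) ^ b \<in> laurents t"
          using b by (simp add: power_mult_distrib mult_ac)
        hence xw: "x * (v * w) ^ b \<in> laurents t" by (rule lunit_cancel[OF L unit])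
        have "regular_mod (laurents t) z ((v * w) ^ b)"
          using step by (intro regular_mod_power[OF L] regular_mod_mult[OF L] sring_mult[OF L])
        moreover have "z \<noteq> 0" unfolding z_def by (rule good_nonzero[OF g1]) (simp add: m1 jI)
        ultimately show ?thesis using regular_mod_conclude[OF L _ _ step(1) xw xz] by (simp add: x_def)
      qed
    qed
  qed
qed

section \<open>The Laurent phenomenon in general\<close>

instance fract :: ("{idom, ring_char_0}") field_char_0
proof
  show "inj (of_nat :: nat \<Rightarrow> 'a fract)"
    by (rule injI) (simp add: Fract_of_nat_eq[symmetric] eq_fract)
qed

text \<open>A field of rational functions in countably many variables, as the home of the seed with principal coefficients.\<close>

type_synonym ratfun = "nat laurent fract"

definition gen :: "nat \<Rightarrow> ratfun" where
  "gen a = Fract (mterm (frag_of a) 1) 1"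

lemma mterm_nonzero: "mterm e (1::int) \<noteq> 0"
  by (metis lookup_single_eq lookup_zero zero_neq_one)

lemma gen_nonzero: "gen a \<noteq> 0"
  by (simp add: gen_def Zero_fract_def eq_fract mterm_nonzero)

lemma monval_gen: "monval gen e = Fract (mterm e 1) 1"
proof -
  have "Poly_Mapping.keys e \<subseteq> UNIV" by simp
  thus ?thesis
  proof (induction e rule: frag_induction)
    case zero
    thus ?case by (simp add: One_fract_def single_one)
  next
    case (one x)
    thus ?case by (simp add: gen_def)
  next
    case (diff a b)
    have "monval gen (a - b) = monval gen a * inverse (monval gen b)"
      using mon_add[of gen a "- b", OF gen_nonzero] mon_uminus[of gen b, OF gen_nonzero] by simp
    also have "\<dots> = Fract (mterm a 1) (mterm b 1)" using diff by simp
    also have "\<dots> = Fract (mterm (a - b) 1) 1"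
      by (simp add: eq_fract mterm_nonzero mult_single)
    finally show ?case .
  qed
qed

lemma laurent_eval_gen: "laurent_eval gen p = Fract p 1"
proof (induction p rule: poly_mapping_mterm_induct)
  case (single a c)
  have "(of_int c :: ratfun) = Fract (of_int c) 1"
    by (cases c rule: int_cases2) (simp_all add: Fract_of_nat_eq flip: minus_fract)
  moreover have "(of_int c :: nat laurent) = mterm 0 c" by (simp add: single_of_int[symmetric])
  ultimately show ?case by (simp add: monval_gen mult_single)
next
  case (sum p q)
  thus ?case by (simp add: laurent_eval_add)
qed

lemma laurent_eval_cong:
  assumes "\<And>i. i \<in> I \<Longrightarrow> v i = v' i" "p \<in> laurent_in I"
  shows "laurent_eval v p = laurent_eval v' p"
  unfolding laurent_eval_def
proof (rule sum.cong[OF refl])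
  fix e assume "e \<in> Poly_Mapping.keys p"
  hence "Poly_Mapping.keys e \<subseteq> I" using assms(2) unfolding laurent_in_def by blast
  hence "monval v e = monval v' e" unfolding monval_def using assms(1) by (intro prod.cong) auto
  thus "of_int (Poly_Mapping.lookup p e) * monval v e = of_int (Poly_Mapping.lookup p e) * monval v' e" by simp
qed

lemma laurent_eval_in_sring:
  assumes L: "sring L" and v: "\<And>i. lunit L (v i)"
  shows "laurent_eval v p \<in> L"
proof -
  have "v i powi n \<in> L" for i n
    using lunitD(1,2)[OF L v[of i]] by (auto simp: power_int_def intro: sring_power[OF L])
  thus ?thesis unfolding laurent_eval_def monval_def
    by (intro sring_sum[OF L] sring_mult[OF L] sring_of_int[OF L] sring_prod[OF L])
qed

lemma good_fold: "good t \<Longrightarrow> set ks \<subseteq> mut t \<Longrightarrow> good (fold mutate ks t)"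
  by (induction ks arbitrary: t) (simp_all add: good_mutate)

lemma ind_fold [simp]: "ind (fold mutate ks t) = ind t" and mut_fold [simp]: "mut (fold mutate ks t) = mut t"
  by (induction ks arbitrary: t) auto

text \<open>The seed with principal coefficients: every index gets a frozen companion, which makes the columns independent. The indices are
  moved to natural numbers by \<open>e\<close> to have room for the companions: the index \<open>e i < n\<close> has the companion \<open>n + e i\<close>. Rows
  \<open>n + e i\<close> of frozen \<open>i\<close> are zero in the relevant columns.\<close>

definition principal :: "nat \<Rightarrow> ('i \<Rightarrow> nat) \<Rightarrow> ('i, 'f::field_char_0) seed \<Rightarrow> (nat, ratfun) seed" where
  "principal n e s = \<lparr> ind = {..<2 * n}, mut = e ` mut s, var = gen,
     mat = (\<lambda>a b. if a < n then mat s (inv_into (ind s) e a) (inv_into (ind s) e b) else if a = n + b then 1 else 0) \<rparr>"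

lemma principal_sel [simp]: "ind (principal n e s) = {..<2 * n}" "mut (principal n e s) = e ` mut s"
  "var (principal n e s) = gen"
  by (simp_all add: principal_def)

lemma principal_good:
  assumes s: "good s" and e: "bij_betw e (ind s) {..<n}"
  shows "good (principal n e s)" "fullrank (principal n e s)"
proof -
  have e_less: "e i < n" if "i \<in> ind s" for i using e that unfolding bij_betw_def by auto
  have ms: "mut s \<subseteq> ind s" by (rule goodD(2)[OF s])
  have inv: "inv_into (ind s) e (e i) = i" if "i \<in> ind s" for i
    using e that unfolding bij_betw_def by (simp add: inv_into_f_f)
  have "lindep {..<2 * n} (padded_var (principal n e s))"
    unfolding lindep_def
  proof (intro ballI impI)
    fix p assume p: "p \<in> laurent_in {..<2 * n}" "laurent_eval (padded_var (principal n e s)) p = 0"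
    have "laurent_eval (padded_var (principal n e s)) p = laurent_eval gen p" by (rule laurent_eval_cong[OF _ p(1)]) (simp add: padded_var_def)
    thus "p = 0" using p(2) by (simp add: laurent_eval_gen Zero_fract_def eq_fract)
  qed
  moreover have "skew_symmetrizable (e ` mut s) (mat (principal n e s))"
  proof -
    obtain d :: "'a \<Rightarrow> int" where d: "\<forall>i\<in>mut s. d i > 0" "\<forall>i\<in>mut s. \<forall>j\<in>mut s. d i * mat s i j = - (d j * mat s j i)"
      using goodD(4)[OF s] unfolding skew_symmetrizable_def by blast
    have m: "mat (principal n e s) (e i) (e j) = mat s i j" if "i \<in> mut s" "j \<in> mut s" for i j
      using that ms e_less inv by (auto simp: principal_def subset_iff)
    have i: "inv_into (ind s) e (e i) = i" if "i \<in> mut s" for i using that ms inv by blast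
    show ?thesis unfolding skew_symmetrizable_def
    proof (intro exI[of _ "\<lambda>a. d (inv_into (ind s) e a)"] conjI ballI)
      fix a assume "a \<in> e ` mut s"
      thus "0 < d (inv_into (ind s) e a)" using d(1) i by auto
    next
      fix a b assume "a \<in> e ` mut s" "b \<in> e ` mut s"
      then obtain k l where kl: "k \<in> mut s" "l \<in> mut s" and ab: "a = e k" "b = e l" by blast
      have "d k * mat s k l = - (d l * mat s l k)" using d(2) kl by blast
      thus "d (inv_into (ind s) e a) * mat (principal n e s) a b = - (d (inv_into (ind s) e b) * mat (principal n e s) b a)"
        unfolding ab i[OF kl(1)] i[OF kl(2)] m[OF kl] m[OF kl(2,1)] .
    qed
  qed
  moreover have "e ` mut s \<subseteq> {..<2 * n}" using ms e_less by fastforce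
  ultimately show "good (principal n e s)" by (simp add: good_def)
  have fin: "finite (mut s)" using ms goodD(1)[OF s] by (rule finite_subset)
  show "fullrank (principal n e s)"
    unfolding fullrank_def
  proof (intro allI impI ballI)
    fix c :: "nat \<Rightarrow> int" and b
    assume c: "\<forall>a\<in>ind (principal n e s). (\<Sum>b\<in>mut (principal n e s). mat (principal n e s) a b * c b) = 0"
      and b: "b \<in> mut (principal n e s)"
    have bn: "b < n" using b e_less ms by auto
    have "(\<Sum>b'\<in>e ` mut s. mat (principal n e s) (n + b) b' * c b') = (\<Sum>b'\<in>e ` mut s. if b' = b then c b else 0)"
      by (rule sum.cong) (auto simp: principal_def)
    also have "\<dots> = c b" using b fin by simp
    finally show "c b = 0" using c bn by auto
  qed
qed

text \<open>Setting the companions to 1 turns the cluster variables with principal coefficients, which are Laurent polynomials by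
  \<open>laurent_full_rank\<close>, into those of the original seed: the specialisation is a ring homomorphism on Laurent polynomials and the
  exchange relation of the former becomes the one of the latter.\<close>

lemma principal_specialises:
  assumes s: "good s" and e: "bij_betw e (ind s) {..<n}" and ks: "set ks \<subseteq> mut s"
  defines "\<sigma> \<equiv> (\<lambda>a. if a < n then padded_var s (inv_into (ind s) e a) else 1)"
  defines "t \<equiv> fold mutate ks s" and "t' \<equiv> fold mutate (map e ks) (principal n e s)"
  shows "(\<forall>i\<in>ind s. \<forall>j\<in>ind s. mat t' (e i) (e j) = mat t i j) \<and>
    (\<forall>a\<ge>n. var t' a = gen a) \<and>
    (\<forall>i\<in>ind s. \<exists>p. var t' (e i) = Fract p 1 \<and> var t i = laurent_eval \<sigma> p)"
  using ks unfolding t_def t'_def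
proof (induction ks rule: rev_induct)
  case Nil
  have e_less: "e i < n" if "i \<in> ind s" for i using e that unfolding bij_betw_def by auto
  have inv: "inv_into (ind s) e (e i) = i" if "i \<in> ind s" for i
    using e that unfolding bij_betw_def by (simp add: inv_into_f_f)
  have "\<exists>p. gen (e i) = Fract p 1 \<and> var s i = laurent_eval \<sigma> p" if i: "i \<in> ind s" for i
    by (rule exI[of _ "mterm (frag_of (e i)) 1"]) (use e_less[OF i] inv[OF i] i in \<open>simp add: gen_def \<sigma>_def padded_var_def\<close>)
  thus ?case using e_less inv by (simp add: principal_def)
next
  case (snoc k ks)
  have e_less: "e i < n" if "i \<in> ind s" for i using e that unfolding bij_betw_def by auto
  have inv: "inv_into (ind s) e (e i) = i" if "i \<in> ind s" for i
    using e that unfolding bij_betw_def by (simp add: inv_into_f_f)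
  have inj: "e i = e j \<longleftrightarrow> i = j" if "i \<in> ind s" "j \<in> ind s" for i j
    using inv that by metis
  define t where "t = fold mutate ks s"
  define t' where "t' = fold mutate (map e ks) (principal n e s)"
  have ms: "mut s \<subseteq> ind s" by (rule goodD(2)[OF s])
  have k: "k \<in> mut s" "k \<in> ind s" and ks: "set ks \<subseteq> mut s" using snoc.prems ms by auto
  have IH: "\<And>i j. i \<in> ind s \<Longrightarrow> j \<in> ind s \<Longrightarrow> mat t' (e i) (e j) = mat t i j"
    "\<And>a. a \<ge> n \<Longrightarrow> var t' a = gen a" "\<And>i. i \<in> ind s \<Longrightarrow> \<exists>p. var t' (e i) = Fract p 1 \<and> var t i = laurent_eval \<sigma> p"
    using snoc.IH[OF ks] unfolding t_def t'_def by blast+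
  have \<sigma>_nz: "\<sigma> a \<noteq> 0" for a using padded_var_nonzero[OF s] by (simp add: \<sigma>_def)
  have t: "good t" unfolding t_def by (rule good_fold[OF s ks])
  note ps = principal_good[OF s e]
  have t': "good t'" unfolding t'_def by (rule good_fold[OF ps(1)]) (use ks in auto)
  have sets: "ind t = ind s" "mut t = mut s" "ind t' = {..<2 * n}" "mut t' = e ` mut s" by (simp_all add: t_def t'_def)
  obtain P0 where P0: "\<And>i. i \<in> ind s \<Longrightarrow> var t' (e i) = Fract (P0 i) 1 \<and> var t i = laurent_eval \<sigma> (P0 i)" using IH(3) by metis
  define P where "P a = (if a < n then P0 (inv_into (ind s) e a) else mterm (frag_of a) 1)" for a
  have "var t' a = Fract (P a) 1" for a
  proof (cases "a < n")
    case True
    then obtain i where "i \<in> ind s" "a = e i" using e unfolding bij_betw_def by auto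
    thus ?thesis using P0 inv True by (simp add: P_def)
  qed (simp add: P_def IH(2) gen_def)
  hence varP: "var t' a = laurent_eval gen (P a)" for a by (simp add: laurent_eval_gen)
  have laurent_eval_P: "laurent_eval \<sigma> (P a) = (if a < n then var t (inv_into (ind s) e a) else 1)" for a
  proof (cases "a < n")
    case True
    then obtain i where "i \<in> ind s" "a = e i" using e unfolding bij_betw_def by auto
    thus ?thesis using P0 inv True by (simp add: P_def)
  qed (simp add: P_def \<sigma>_def)
  have spec: "laurent_eval \<sigma> (\<Prod>a<2*n. P a ^ nat (f a)) = (\<Prod>i\<in>ind s. var t i ^ nat (f (e i)))" for f
  proof -
    have "laurent_eval \<sigma> (\<Prod>a<2*n. P a ^ nat (f a)) = (\<Prod>a<2*n. if a < n then var t (inv_into (ind s) e a) ^ nat (f a) else 1)"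
      by (simp add: laurent_eval_prod[OF \<sigma>_nz] laurent_eval_power[OF \<sigma>_nz] laurent_eval_P if_distrib[of "\<lambda>x. x ^ _"] cong: if_cong)
    also have "\<dots> = (\<Prod>a<n. var t (inv_into (ind s) e a) ^ nat (f a))"
      by (rule prod.mono_neutral_cong_right) auto
    also have "\<dots> = (\<Prod>i\<in>ind s. var t i ^ nat (f (e i)))"
      by (rule prod.reindex_bij_betw[OF e, symmetric, THEN trans]) (rule prod.cong, use inv in auto)
    finally show ?thesis .
  qed
  have ek: "e k \<in> mut t'" by (simp add: sets k)
  have "var (fold mutate (map e (ks @ [k])) (principal n e s)) (e k) \<in> laurents (principal n e s)"
    by (rule laurent_full_rank[OF ps]) (use ks k e_less[OF k(2)] in auto)
  hence "var (mutate (e k) t') (e k) \<in> laurents (principal n e s)" by (simp add: t'_def)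
  then obtain q where q: "q \<in> laurent_in {..<2*n}" "var (mutate (e k) t') (e k) = laurent_eval (padded_var (principal n e s)) q"
    unfolding laurents_def by auto
  have "laurent_eval (padded_var (principal n e s)) q = laurent_eval gen q" by (rule laurent_eval_cong[OF _ q(1)]) (simp add: padded_var_def)
  hence q': "var (mutate (e k) t') (e k) = laurent_eval gen q" using q by simp
  have "laurent_eval gen (q * P (e k)) = laurent_eval gen ((\<Prod>a<2*n. P a ^ nat (mat t' a (e k))) + (\<Prod>a<2*n. P a ^ nat (- mat t' a (e k))))"
    using exchange[OF t' ek] unfolding q' varP pplus_def pminus_def sets
    by (simp add: laurent_eval_mult laurent_eval_add laurent_eval_prod laurent_eval_power gen_nonzero)
  hence "q * P (e k) = (\<Prod>a<2*n. P a ^ nat (mat t' a (e k))) + (\<Prod>a<2*n. P a ^ nat (- mat t' a (e k)))"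
    by (simp add: laurent_eval_gen eq_fract)
  hence "laurent_eval \<sigma> (q * P (e k)) = laurent_eval \<sigma> ((\<Prod>a<2*n. P a ^ nat (mat t' a (e k))) + (\<Prod>a<2*n. P a ^ nat (- mat t' a (e k))))"
    by (rule arg_cong)
  hence "laurent_eval \<sigma> q * laurent_eval \<sigma> (P (e k)) = (\<Prod>i\<in>ind s. var t i ^ nat (mat t' (e i) (e k))) + (\<Prod>i\<in>ind s. var t i ^ nat (- mat t' (e i) (e k)))"
    unfolding laurent_eval_add laurent_eval_mult[OF \<sigma>_nz] spec .
  also have "\<dots> = pplus t k + pminus t k"
    unfolding pplus_def pminus_def sets using IH(1) k(2) by simp
  finally have "laurent_eval \<sigma> q * var t k = var (mutate k t) k * var t k"
    using exchange[OF t, of k] k e_less[OF k(2)] inv[OF k(2)] by (simp add: sets laurent_eval_P)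
  hence "laurent_eval \<sigma> q = var (mutate k t) k" using good_nonzero[OF t] k by (simp add: sets)
  hence "\<exists>p. var (mutate (e k) t') (e i) = Fract p 1 \<and> var (mutate k t) i = laurent_eval \<sigma> p" if "i \<in> ind s" for i
    using q' IH(3)[OF that] inj[OF that k(2)] by (cases "i = k") (auto simp: laurent_eval_gen)
  moreover have "mat (mutate (e k) t') (e i) (e j) = mat (mutate k t) i j" if "i \<in> ind s" "j \<in> ind s" for i j
    using IH(1) that k(2) inj by (simp add: mat_mutate)
  moreover have "var (mutate (e k) t') a = gen a" if "a \<ge> n" for a
    using IH(2)[OF that] e_less[OF k(2)] that by simp
  ultimately show ?case by (simp add: t_def t'_def)
qed

lemma seeds_of_fold:
  assumes "t \<in> seeds_of s"
  shows "\<exists>ks. set ks \<subseteq> mut s \<and> t = fold mutate ks s"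
  using assms
proof induction
  case initial
  show ?case by (rule exI[of _ "[]"]) simp
next
  case (mutation t k)
  then obtain ks where "set ks \<subseteq> mut s" "t = fold mutate ks s" by blast
  thus ?case using mutation by (intro exI[of _ "ks @ [k]"]) auto
qed

lemma seeds_of_sel:
  assumes "t \<in> seeds_of s"
  shows "ind t = ind s" "mut t = mut s"
  using seeds_of_fold[OF assms] by auto

lemma seeds_of_good: "good s \<Longrightarrow> t \<in> seeds_of s \<Longrightarrow> good t"
  using seeds_of_fold good_fold by metis

lemma seeds_of_trans: "t \<in> seeds_of s \<Longrightarrow> u \<in> seeds_of t \<Longrightarrow> u \<in> seeds_of s"
  by (rotate_tac, induction rule: seeds_of.induct) (auto intro: seeds_of.intros)

lemma seeds_of_sym:
  assumes s: "good s" and "t \<in> seeds_of s"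
  shows "s \<in> seeds_of t"
  using assms(2)
proof induction
  case (mutation t k)
  have "mutate k (mutate k t) \<in> seeds_of (mutate k t)"
    by (intro seeds_of.intros) (use mutation in simp)
  hence "t \<in> seeds_of (mutate k t)" using mutate_involutive[OF seeds_of_good[OF s]] mutation by metis
  thus ?case using mutation.IH seeds_of_trans by metis
qed (rule seeds_of.initial)

text \<open>The specialisation evaluates a Laurent polynomial at the variables of \<open>s\<close> and at 1, all of which are units of the Laurent ring of \<open>s\<close>.\<close>

theorem laurent_phenomenon:
  assumes s: "good s" and t: "t \<in> seeds_of s" and i: "i \<in> ind s"
  shows "var t i \<in> laurents s"
proof -
  obtain ks where ks: "set ks \<subseteq> mut s" "t = fold mutate ks s" using seeds_of_fold[OF t] by blast
  obtain e where e: "bij_betw e (ind s) {..<card (ind s)}"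
    using ex_bij_betw_finite_nat[OF goodD(1)[OF s]] by (auto simp: atLeast0LessThan)
  obtain p where p: "var t i = laurent_eval (\<lambda>a. if a < card (ind s) then padded_var s (inv_into (ind s) e a) else 1) p"
    using principal_specialises[OF s e ks(1)] i unfolding ks(2) by blast
  show ?thesis unfolding p
    by (rule laurent_eval_in_sring[OF sring_laurents[OF s]]) (use lunit_var[OF s] lunit_one[OF sring_laurents[OF s]] in \<open>simp add: padded_var_def\<close>)
qed

section \<open>Ideals and subrings\<close>

lemma (in cring) idealI_absorb:
  assumes "I \<subseteq> carrier R" "\<zero> \<in> I" "\<And>x y. x \<in> I \<Longrightarrow> y \<in> I \<Longrightarrow> x \<oplus> y \<in> I"
    and abs: "\<And>a x. a \<in> carrier R \<Longrightarrow> x \<in> I \<Longrightarrow> a \<otimes> x \<in> I"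
  shows "ideal I R"
proof (rule idealI[OF ring_axioms])
  have inv: "\<ominus> x \<in> I" if "x \<in> I" for x
  proof -
    have "\<ominus> x = (\<ominus> \<one>) \<otimes> x" using that assms(1) by (simp add: l_minus subset_iff)
    thus ?thesis using abs[of "\<ominus> \<one>" x] that by simp
  qed
  show "subgroup I (add_monoid R)"
    by (rule add.subgroupI) (use assms inv in \<open>auto simp: a_inv_def[symmetric]\<close>)
  show "x \<otimes> a \<in> I" "a \<otimes> x \<in> I" if "a \<in> I" "x \<in> carrier R" for a x
    using abs[of x a] that assms(1) by (auto simp: m_comm[of a x] subset_iff)
qed

lemma (in cring) exists_maximalideal:
  assumes I: "ideal I R" and one: "\<one> \<notin> I"
  shows "\<exists>M. maximalideal M R \<and> I \<subseteq> M"
proof -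
  define Js where "Js = {J. ideal J R \<and> I \<subseteq> J \<and> \<one> \<notin> J}"
  have "\<exists>M\<in>Js. \<forall>Z\<in>Js. M \<subseteq> Z \<longrightarrow> Z = M"
  proof (rule subset_Zorn)
    fix C assume C: "subset.chain Js C"
    have CS: "C \<subseteq> Js" and tot: "\<And>Z Y. Z \<in> C \<Longrightarrow> Y \<in> C \<Longrightarrow> Z \<subseteq> Y \<or> Y \<subseteq> Z"
      using C unfolding subset.chain_def by auto
    show "\<exists>U\<in>Js. \<forall>Z\<in>C. Z \<subseteq> U"
    proof (cases "C = {}")
      case True
      thus ?thesis using I one unfolding Js_def by blast
    next
      case False
      have "subset.chain {I. ideal I R} C" using CS tot unfolding subset.chain_def Js_def by blast
      hence "ideal (\<Union>C) R" using chain_Union_is_ideal[of C] False by simp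
      hence "\<Union>C \<in> Js" using CS False unfolding Js_def by blast
      thus ?thesis by blast
    qed
  qed
  then obtain M where M: "ideal M R" "I \<subseteq> M" "\<one> \<notin> M" "\<And>Z. ideal Z R \<Longrightarrow> I \<subseteq> Z \<Longrightarrow> \<one> \<notin> Z \<Longrightarrow> M \<subseteq> Z \<Longrightarrow> Z = M"
    unfolding Js_def by auto
  have "maximalideal M R"
  proof (rule maximalidealI[OF M(1)])
    show "carrier R \<noteq> M" using M(3) by auto
    fix J assume J: "ideal J R" "M \<subseteq> J" "J \<subseteq> carrier R"
    show "J = M \<or> J = carrier R"
      using M(2) M(4)[OF J(1)] J ideal.one_imp_carrier[OF J(1)] by blast
  qed
  thus ?thesis using M(2) by blast
qed

lemma type_ring_simps [simp]:
  "carrier ring_of_type_algebra = UNIV" 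
  "x \<otimes>\<^bsub>ring_of_type_algebra\<^esub> y = x * y" "x \<oplus>\<^bsub>ring_of_type_algebra\<^esub> y = x + y"
  "\<one>\<^bsub>ring_of_type_algebra\<^esub> = 1" "\<zero>\<^bsub>ring_of_type_algebra\<^esub> = 0"
  by (simp_all add: ring_of_type_algebra_def)

lemma type_ring_a_inv [simp]: "\<ominus>\<^bsub>ring_of_type_algebra\<^esub> (x :: 'a::comm_ring_1) = - x"
proof -
  interpret ring "ring_of_type_algebra :: 'a ring" by (rule ring_from_type_algebra)
  have "(\<ominus>\<^bsub>ring_of_type_algebra\<^esub> x) + x = 0" using l_neg[of x] by simp
  thus ?thesis by (simp add: eq_neg_iff_add_eq_0)
qed

lemma sring_subring_gen: "sring (subring_gen G)"
  unfolding sring_def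
  using generate_ring.one[of ring_of_type_algebra G] generate_ring.eng_add[of _ ring_of_type_algebra G]
    generate_ring.eng_mult[of _ ring_of_type_algebra G] generate_ring.a_inv[of _ ring_of_type_algebra G] by simp

lemma subring_gen_incl: "G \<subseteq> subring_gen G"
  by (auto intro: generate_ring.incl)

lemma subring_gen_minimal:
  assumes L: "sring L" and "G \<subseteq> L"
  shows "subring_gen G \<subseteq> L"
proof
  fix x assume "x \<in> subring_gen G"
  thus "x \<in> L"
    by induction (use assms(2) in \<open>auto intro: sring_one[OF L] sring_add[OF L] sring_mult[OF L] sring_uminus[OF L]\<close>)
qed

lemma cring_sring:
  fixes L :: "'f::field_char_0 set"
  assumes L: "sring L"
  shows "cring (ring_of_type_algebra \<lparr> carrier := L \<rparr>)"
proof -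
  interpret cring "ring_of_type_algebra :: 'f ring" by (rule cring_from_type_algebra)
  have "subring L (ring_of_type_algebra :: 'f ring)"
    by (rule subringI) (auto intro: sring_one[OF L] sring_add[OF L] sring_mult[OF L] sring_uminus[OF L])
  thus ?thesis using subcring_iff[of L] subcringI' by simp
qed

lemma countable_subring_gen:
  assumes "countable G"
  shows "countable (subring_gen (G :: 'f::field_char_0 set))"
proof -
  define H where "H = rec_nat (insert 1 G)
    (\<lambda>_ Z. Z \<union> uminus ` Z \<union> (\<lambda>(x, y). x + y) ` (Z \<times> Z) \<union> (\<lambda>(x, y). x * y) ` (Z \<times> Z))"
  have S0: "H 0 = insert 1 G" by (simp add: H_def)
  have SS: "H (Suc n) = H n \<union> uminus ` H n \<union> (\<lambda>(x, y). x + y) ` (H n \<times> H n) \<union> (\<lambda>(x, y). x * y) ` (H n \<times> H n)" for n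
    by (simp add: H_def)
  have cS: "countable (H n)" for n
    by (induction n) (use assms in \<open>auto simp: S0 SS\<close>)
  have mono: "H n \<subseteq> H m" if "n \<le> m" for n m
    using that by (induction rule: dec_induct) (auto simp: SS)
  have up: "\<exists>n. x \<in> H n \<and> y \<in> H n" if "x \<in> (\<Union>n. H n)" "y \<in> (\<Union>n. H n)" for x y
  proof -
    from that obtain n m where "x \<in> H n" "y \<in> H m" by blast
    hence "x \<in> H (max n m)" "y \<in> H (max n m)" using mono[of n "max n m"] mono[of m "max n m"] by auto
    thus ?thesis by blast
  qed
  have "sring (\<Union>n. H n)"
    unfolding sring_def
  proof (intro conjI ballI)
    show "1 \<in> (\<Union>n. H n)" using S0 by blast
    fix x assume x: "x \<in> (\<Union>n. H n)"
    show "- x \<in> (\<Union>n. H n)"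
    proof -
      obtain n where "x \<in> H n" using x by blast
      hence "- x \<in> H (Suc n)" by (simp add: SS)
      thus ?thesis by blast
    qed
    fix y assume y: "y \<in> (\<Union>n. H n)"
    obtain n where n: "x \<in> H n" "y \<in> H n" using up[OF x y] by blast
    have "(x, y) \<in> H n \<times> H n" using n by simp
    hence "x + y \<in> H (Suc n)" "x * y \<in> H (Suc n)" unfolding SS by (force, force)
    thus "x + y \<in> (\<Union>n. H n)" "x * y \<in> (\<Union>n. H n)" by blast+
  qed
  moreover have "G \<subseteq> (\<Union>n. H n)" using S0 by blast
  ultimately have "subring_gen G \<subseteq> (\<Union>n. H n)" by (rule subring_gen_minimal)
  moreover have "countable (\<Union>n. H n)" using cS by simp
  ultimately show ?thesis by (rule countable_subset)
qed

section \<open>Cluster algebras inside Laurent polynomial rings\<close>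

lemma is_seed_good:
  assumes "is_seed s"
  shows "good s"
proof -
  have "padded_var s = (\<lambda>i. if i \<in> ind s then var s i else 1)" by (rule ext) (simp add: padded_var_def)
  thus ?thesis using assms lindep_free_generators[of "ind s" "var s"] by (simp add: is_seed_def good_def)
qed

lemma laurent_ring_eq_laurents:
  assumes t: "good t"
  shows "laurent_ring t = laurents t"
proof
  note L = sring_laurents[OF t]
  show "laurent_ring t \<subseteq> laurents t"
    unfolding laurent_ring_def cluster_def
    by (rule subring_gen_minimal[OF L]) (auto intro: lunitD(1,2)[OF L lunit_var[OF t]])
  have G: "sring (laurent_ring t)" unfolding laurent_ring_def by (rule sring_subring_gen)
  have "cluster t \<union> inverse ` cluster t \<subseteq> laurent_ring t" unfolding laurent_ring_def by (rule subring_gen_incl)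
  hence "lunit (laurent_ring t) (padded_var t i)" for i
    using good_nonzero[OF t] by (auto simp: padded_var_def lunit_def[OF G] cluster_def intro: sring_one[OF G])
  thus "laurents t \<subseteq> laurent_ring t" unfolding laurents_def using laurent_eval_in_sring[OF G] by blast
qed

lemma frozen_var: "t \<in> seeds_of s \<Longrightarrow> i \<notin> mut s \<Longrightarrow> var t i = var s i"
proof (induction rule: seeds_of.induct)
  case (mutation t k)
  hence "i \<noteq> k" using seeds_of_sel(2) by blast
  thus ?case using mutation by simp
qed simp

lemma sring_cluster_algebra: "sring (cluster_algebra s)"
  unfolding cluster_algebra_def by (rule sring_subring_gen)

lemma var_in_cluster_algebra:
  assumes "t \<in> seeds_of s" "i \<in> ind s"
  shows "var t i \<in> cluster_algebra s"
  unfolding cluster_algebra_def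
  by (rule generate_ring.incl) (use assms seeds_of_sel[OF assms(1)] in \<open>auto simp: cluster_def\<close>)

lemma inverse_frozen_in_cluster_algebra:
  assumes "i \<in> ind s" "i \<notin> mut s"
  shows "inverse (var s i) \<in> cluster_algebra s"
  unfolding cluster_algebra_def by (rule generate_ring.incl) (use assms in auto)

text \<open>Mutations are reversible, so every cluster may serve as the initial one in the Laurent phenomenon.\<close>

lemma cluster_algebra_subset_laurents:
  assumes s: "good s" and t: "t \<in> seeds_of s"
  shows "cluster_algebra s \<subseteq> laurents t"
  unfolding cluster_algebra_def
proof (rule subring_gen_minimal)
  have gt: "good t" by (rule seeds_of_good[OF s t])
  show L: "sring (laurents t)" by (rule sring_laurents[OF gt])
  have "var u i \<in> laurents t" if u: "u \<in> seeds_of s" and i: "i \<in> ind s" for u i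
    by (rule laurent_phenomenon[OF gt seeds_of_trans[OF seeds_of_sym[OF s t] u]]) (simp add: i seeds_of_sel[OF t])
  moreover have "inverse (var s i) \<in> laurents t" if "i \<in> ind s" "i \<notin> mut s" for i
    using lunitD(2)[OF L lunit_var[OF gt, of i]] frozen_var[OF t] that seeds_of_sel[OF t] by simp
  ultimately show "(\<Union>t \<in> seeds_of s. cluster t) \<union> (\<lambda>i. inverse (var s i)) ` (ind s - mut s) \<subseteq> laurents t"
    unfolding cluster_def using seeds_of_sel(1) by force
qed

definition cluster_monomial :: "('i, 'f::field_char_0) seed \<Rightarrow> 'f" where
  "cluster_monomial t = (\<Prod>i\<in>ind t. var t i)"

lemma good_inj_var:
  assumes t: "good t"
  shows "inj_on (var t) (ind t)"
proof (rule inj_onI)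
  fix i j assume ij: "i \<in> ind t" "j \<in> ind t" "var t i = var t j"
  have "frag_of (frag_of i) = frag_of (frag_of j)"
    by (rule lindepD[OF goodD(3)[OF t]]) (use ij in \<open>auto intro!: laurent_in_single simp: padded_var_def\<close>)
  thus "i = j" by (simp add: frag_of_eq)
qed

lemma prod_cluster: "good t \<Longrightarrow> (\<Prod>x\<in>cluster t. x) = cluster_monomial t"
  unfolding cluster_def cluster_monomial_def by (subst prod.reindex[OF good_inj_var]) simp_all

lemma cluster_monomial_in:
  assumes "t \<in> seeds_of s"
  shows "cluster_monomial t \<in> cluster_algebra s"
  unfolding cluster_monomial_def
  by (intro sring_prod[OF sring_cluster_algebra] var_in_cluster_algebra) (use assms seeds_of_sel[OF assms] in auto)

lemma cluster_ring_simps [simp]: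
  "carrier (cluster_ring s) = cluster_algebra s" 
  "x \<otimes>\<^bsub>cluster_ring s\<^esub> y = x * y" "x \<oplus>\<^bsub>cluster_ring s\<^esub> y = x + y"
  "\<one>\<^bsub>cluster_ring s\<^esub> = 1" "\<zero>\<^bsub>cluster_ring s\<^esub> = 0"
  by (simp_all add: cluster_ring_def)

lemma cring_cluster_ring: "cring (cluster_ring s)"
  unfolding cluster_ring_def by (rule cring_sring[OF sring_cluster_algebra])

section \<open>Deep points and the deep ideal\<close>

lemma deep_ideal_eq:
  assumes "good s"
  shows "deep_ideal s = Idl\<^bsub>cluster_ring s\<^esub> (cluster_monomial ` seeds_of s)"
proof -
  have "{\<Prod>x\<in>cluster t. x | t. t \<in> seeds_of s} = cluster_monomial ` seeds_of s"
    using prod_cluster[OF seeds_of_good[OF assms]] by force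
  thus ?thesis unfolding deep_ideal_def by simp
qed

text \<open>A partition of unity by cluster monomials, the form in which the hypothesis on the deep ideal is used.\<close>

lemma one_in_deep_ideal_expand:
  assumes s: "good s" and one: "1 \<in> deep_ideal s"
  shows "\<exists>F a. finite F \<and> F \<subseteq> seeds_of s \<and> (\<forall>t\<in>F. a t \<in> cluster_algebra s) \<and> (\<Sum>t\<in>F. a t * cluster_monomial t) = 1"
proof -
  let ?A = "cluster_algebra s"
  note A = sring_cluster_algebra[of s]
  interpret cring "cluster_ring s" by (rule cring_cluster_ring)
  define J where "J = {x. \<exists>F a. finite F \<and> F \<subseteq> seeds_of s \<and> (\<forall>t\<in>F. a t \<in> ?A) \<and> (\<Sum>t\<in>F. a t * cluster_monomial t) = x}"
  have "ideal J (cluster_ring s)"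
  proof (rule idealI_absorb)
    show "J \<subseteq> carrier (cluster_ring s)"
      unfolding J_def using cluster_monomial_in 
      by (auto intro!: sring_sum[OF A] sring_mult[OF A])
    show "\<zero>\<^bsub>cluster_ring s\<^esub> \<in> J" unfolding J_def by (auto intro!: exI[of _ "{}"])
  next
    fix x y assume "x \<in> J" "y \<in> J"
    then obtain F a G b where F: "finite F" "F \<subseteq> seeds_of s" "\<forall>t\<in>F. a t \<in> ?A" "(\<Sum>t\<in>F. a t * cluster_monomial t) = x"
      and G: "finite G" "G \<subseteq> seeds_of s" "\<forall>t\<in>G. b t \<in> ?A" "(\<Sum>t\<in>G. b t * cluster_monomial t) = y"
      unfolding J_def by blast
    define c where "c t = (if t \<in> F then a t else 0) + (if t \<in> G then b t else 0)" for t
    have "(\<Sum>t\<in>F \<union> G. c t * cluster_monomial t) = 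
      (\<Sum>t\<in>F \<union> G. if t \<in> F then a t * cluster_monomial t else 0) + (\<Sum>t\<in>F \<union> G. if t \<in> G then b t * cluster_monomial t else 0)"
      unfolding sum.distrib[symmetric] by (rule sum.cong) (auto simp: c_def ring_distribs)
    also have "\<dots> = x + y"
      using F G by (simp add: sum.If_cases Int_absorb1 Int_commute[of _ F] Int_commute[of _ G])
    finally have "(\<Sum>t\<in>F \<union> G. c t * cluster_monomial t) = x + y" .
    moreover have "\<forall>t\<in>F \<union> G. c t \<in> ?A"
      using F(3) G(3) sring_zero[OF A] by (auto simp: c_def intro!: sring_add[OF A])
    ultimately show "x \<oplus>\<^bsub>cluster_ring s\<^esub> y \<in> J"
      unfolding J_def using F(1,2) G(1,2) by (auto intro!: exI[of _ "F \<union> G"] exI[of _ c])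
  next
    fix r x assume r: "r \<in> carrier (cluster_ring s)" and "x \<in> J"
    then obtain F a where F: "finite F" "F \<subseteq> seeds_of s" "\<forall>t\<in>F. a t \<in> ?A" "(\<Sum>t\<in>F. a t * cluster_monomial t) = x"
      unfolding J_def by blast
    have "(\<Sum>t\<in>F. (r * a t) * cluster_monomial t) = r * x"
      using F(4) by (simp add: sum_distrib_left[symmetric] mult.assoc)
    moreover have "\<forall>t\<in>F. r * a t \<in> ?A" using F(3) r by (auto intro: sring_mult[OF A])
    ultimately show "r \<otimes>\<^bsub>cluster_ring s\<^esub> x \<in> J"
      unfolding J_def using F(1,2) by (auto intro!: exI[of _ F] exI[of _ "\<lambda>t. r * a t"])
  qed
  moreover have "cluster_monomial ` seeds_of s \<subseteq> J"
  proof
    fix x assume "x \<in> cluster_monomial ` seeds_of s"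
    then obtain t where t: "t \<in> seeds_of s" "x = cluster_monomial t" by blast
    thus "x \<in> J" unfolding J_def
      by (intro CollectI exI[of _ "{t}"] exI[of _ "\<lambda>_. 1"]) (auto simp: sring_one[OF A])
  qed
  ultimately have "deep_ideal s \<subseteq> J" unfolding deep_ideal_eq[OF s] by (rule genideal_minimal)
  thus ?thesis using one unfolding J_def by blast
qed

text \<open>A point that kills a variable of every cluster kills the whole partition of unity.\<close>

lemma point_off_deep_locus:
  assumes s: "good s" and one: "1 \<in> deep_ideal s" and K: "field K" and p: "p \<in> cluster_variety s K"
  shows "\<exists>t\<in>seeds_of s. \<forall>i\<in>ind s. p (var t i) \<noteq> \<zero>\<^bsub>K\<^esub>"
proof (rule ccontr)
  interpret K: field K by fact
  interpret A: cring "cluster_ring s" by (rule cring_cluster_ring)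
  have p': "p \<in> ring_hom (cluster_ring s) K" using p by (simp add: cluster_variety_def)
  interpret h: ring_hom_cring "cluster_ring s" K p
    by (rule ring_hom_cringI[OF _ _ p'])  unfold_locales
  note A = sring_cluster_algebra[of s]
  assume neg: "\<not> ?thesis"
  have hA: "p (x * y) = p x \<otimes>\<^bsub>K\<^esub> p y" "p (x + y) = p x \<oplus>\<^bsub>K\<^esub> p y" "p x \<in> carrier K" "p y \<in> carrier K"
    if "x \<in> cluster_algebra s" "y \<in> cluster_algebra s" for x y
    using h.hom_mult[of x y] h.hom_add[of x y] h.hom_closed that by auto
  have h01: "p 0 = \<zero>\<^bsub>K\<^esub>" "p 1 = \<one>\<^bsub>K\<^esub>" using h.hom_zero h.hom_one by simp_all
  have "ideal {x \<in> cluster_algebra s. p x = \<zero>\<^bsub>K\<^esub>} (cluster_ring s)"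
    by (rule A.idealI_absorb) (auto simp: hA h01 intro: sring_zero[OF A] sring_add[OF A] sring_mult[OF A])
  moreover have "cluster_monomial ` seeds_of s \<subseteq> {x \<in> cluster_algebra s. p x = \<zero>\<^bsub>K\<^esub>}"
  proof
    fix x assume "x \<in> cluster_monomial ` seeds_of s"
    then obtain t where t: "t \<in> seeds_of s" "x = cluster_monomial t" by blast
    then obtain i where i: "i \<in> ind s" "p (var t i) = \<zero>\<^bsub>K\<^esub>" using neg by blast
    have "x = var t i * (\<Prod>j\<in>ind t - {i}. var t j)"
      unfolding t(2) cluster_monomial_def
      by (rule prod.remove) (use i goodD(1)[OF s] seeds_of_sel[OF t(1)] in auto)
    moreover have "(\<Prod>j\<in>ind t - {i}. var t j) \<in> cluster_algebra s"
      by (intro sring_prod[OF A] var_in_cluster_algebra t) (use seeds_of_sel[OF t(1)] in auto)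
    ultimately have "p x = \<zero>\<^bsub>K\<^esub>" using hA var_in_cluster_algebra[OF t(1) i(1)] i(2) by simp
    thus "x \<in> {x \<in> cluster_algebra s. p x = \<zero>\<^bsub>K\<^esub>}" using t cluster_monomial_in by blast
  qed
  ultimately have "deep_ideal s \<subseteq> {x \<in> cluster_algebra s. p x = \<zero>\<^bsub>K\<^esub>}"
    unfolding deep_ideal_eq[OF s] by (rule A.genideal_minimal)
  thus False using one h01 K.zero_not_one by auto
qed

text \<open>A proper deep ideal lies in a maximal ideal \<open>M\<close>, and the residue map of \<open>M\<close> is a deep point because \<open>M\<close> is prime.\<close>

lemma no_deep_points_iff:
  assumes s: "good s"
  shows "no_deep_points TYPE('k::infinite) s \<longleftrightarrow> 1 \<in> deep_ideal s"
proof
  assume one: "1 \<in> deep_ideal s"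
  show "no_deep_points TYPE('k) s"
    unfolding no_deep_points_def deep_point_def
  proof (intro allI impI notI, elim exE conjE)
    fix K :: "'k ring" and p assume K: "field K" and p: "p \<in> cluster_variety s K"
      and deep: "\<forall>t\<in>seeds_of s. \<exists>x\<in>cluster t. p x = \<zero>\<^bsub>K\<^esub>"
    obtain t where t: "t \<in> seeds_of s" "\<forall>i\<in>ind s. p (var t i) \<noteq> \<zero>\<^bsub>K\<^esub>" 
      using point_off_deep_locus[OF s one K p] by blast
    thus False using deep seeds_of_sel[OF t(1)] unfolding cluster_def by blast
  qed
next
  assume nd: "no_deep_points TYPE('k) s"
  interpret A: cring "cluster_ring s" by (rule cring_cluster_ring)
  note As = sring_cluster_algebra[of s]
  show "1 \<in> deep_ideal s"
  proof (rule ccontr)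
    assume no: "1 \<notin> deep_ideal s"
    have G: "cluster_monomial ` seeds_of s \<subseteq> carrier (cluster_ring s)" using cluster_monomial_in by auto
    have "ideal (deep_ideal s) (cluster_ring s)" unfolding deep_ideal_eq[OF s] by (rule A.genideal_ideal[OF G])
    then obtain M where M: "maximalideal M (cluster_ring s)" "deep_ideal s \<subseteq> M"
      using A.exists_maximalideal[of "deep_ideal s"] no by auto
    interpret M: maximalideal M "cluster_ring s" by (rule M(1))
    interpret P: primeideal M "cluster_ring s" by (rule A.maximalideal_prime[OF M(1)])
    define F where "F = cluster_ring s Quot M"
    interpret F: field F unfolding F_def by (rule M.quotient_is_field[OF cring_cluster_ring])
    have carF: "carrier F = (\<lambda>a. M +>\<^bsub>cluster_ring s\<^esub> a) ` cluster_algebra s"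
      by (auto simp: F_def FactRing_def A_RCOSETS_def RCOSETS_def a_r_coset_def)
    have "finite (cluster s)" using goodD(1)[OF s] by (simp add: cluster_def)
    hence "countable (laurent_ring s)" unfolding laurent_ring_def by (intro countable_subring_gen) (simp add: countable_finite)
    hence "countable (cluster_algebra s)"
      using cluster_algebra_subset_laurents[OF s seeds_of.initial] laurent_ring_eq_laurents[OF s] countable_subset by metis
    hence cF: "countable (carrier F)" unfolding carF by simp
    \<comment> \<open>The residue field is countable, so a copy of it fits into any infinite type.\<close>
    obtain g :: "nat \<Rightarrow> 'k" where g: "inj g" using infinite_countable_subset[OF infinite_UNIV] by blast
    define f where "f = g \<circ> to_nat_on (carrier F)"
    have f: "inj_on f (carrier F)"
      unfolding f_def using g inj_on_to_nat_on[OF cF] by (meson comp_inj_on inj_on_subset subset_UNIV)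
    define K where "K = image_ring f F"
    have K: "field K" unfolding K_def by (rule F.inj_imp_image_ring_is_field[OF f])
    define p where "p = f \<circ> (\<lambda>a. M +>\<^bsub>cluster_ring s\<^esub> a)"
    have h1: "(\<lambda>a. M +>\<^bsub>cluster_ring s\<^esub> a) \<in> ring_hom (cluster_ring s) F" unfolding F_def by (rule M.rcos_ring_hom)
    have h2: "f \<in> ring_hom F K" using inj_imp_image_ring_iso[OF f] unfolding K_def ring_iso_def by blast
    have "p \<in> ring_hom (cluster_ring s) K" unfolding p_def by (rule ring_hom_trans[OF h1 h2])
    moreover have "\<exists>x\<in>cluster t. p x = \<zero>\<^bsub>K\<^esub>" if t: "t \<in> seeds_of s" for t
    proof -
      have "\<exists>i\<in>S. var t i \<in> M" if "finite S" "S \<subseteq> ind s" "(\<Prod>i\<in>S. var t i) \<in> M" for S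
        using that
      proof induction
        case empty
        thus ?case using P.I_notcarr M.one_imp_carrier by simp
      next
        case (insert i S)
        have "(\<Prod>j\<in>S. var t j) \<in> cluster_algebra s"
          by (intro sring_prod[OF As] var_in_cluster_algebra t) (use insert in auto)
        hence "var t i \<in> M \<or> (\<Prod>j\<in>S. var t j) \<in> M"
          using P.I_prime[of "var t i" "\<Prod>j\<in>S. var t j"] insert var_in_cluster_algebra[OF t, of i] by simp
        thus ?case using insert by blast
      qed
      moreover have "cluster_monomial t \<in> M"
        using M(2) A.genideal_self[OF G] t unfolding deep_ideal_eq[OF s] by blast
      ultimately obtain i where i: "i \<in> ind s" "var t i \<in> M"
        using goodD(1)[OF s] seeds_of_sel[OF t] unfolding cluster_monomial_def by (metis subset_refl)
      have "M +>\<^bsub>cluster_ring s\<^esub> var t i = M"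
        using i(2) A.a_coset_join2 M.a_subgroup M.additive_subgroup_axioms var_in_cluster_algebra[OF t i(1)]
        by (simp add: M.a_rcos_const)
      hence "p (var t i) = f \<zero>\<^bsub>F\<^esub>" by (simp add: p_def F_def FactRing_def)
      also have "\<dots> = \<zero>\<^bsub>K\<^esub>" by (simp add: K_def image_ring_zero)
      finally show ?thesis using i(1) seeds_of_sel[OF t] unfolding cluster_def by blast
    qed
    ultimately have "deep_point s K p" unfolding deep_point_def cluster_variety_def by blast
    thus False using nd K unfolding no_deep_points_def by blast
  qed
qed

section \<open>Finite generation, upper bounds, and local acyclicity\<close>

text \<open>The radical of an ideal is closed under sums.\<close>

lemma sum_nilpotent_mod:
  fixes B P :: "'f::field set"
  assumes B: "sring B" and P0: "0 \<in> P" and Padd: "\<And>x y. x \<in> P \<Longrightarrow> y \<in> P \<Longrightarrow> x + y \<in> P"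
    and Pmult: "\<And>b x. b \<in> B \<Longrightarrow> x \<in> P \<Longrightarrow> b * x \<in> P" and "finite F"
    and g: "\<And>t. t \<in> F \<Longrightarrow> g t \<in> B \<and> (\<exists>n. g t ^ n \<in> P)"
  shows "(\<Sum>t\<in>F. g t) \<in> B \<and> (\<exists>n. (\<Sum>t\<in>F. g t) ^ n \<in> P)"
  using \<open>finite F\<close> g
proof (induction F)
  case empty
  show ?case using sring_zero[OF B] P0 by (auto intro!: exI[of _ 1])
next
  case (insert t F)
  let ?x = "g t" and ?y = "\<Sum>t\<in>F. g t"
  obtain m n where mn: "?x ^ m \<in> P" "?y ^ n \<in> P" "?x \<in> B" "?y \<in> B" using insert by blast
  have "(?x + ?y) ^ (m + n) = (\<Sum>k\<le>m + n. of_nat (m + n choose k) * ?x ^ k * ?y ^ (m + n - k))"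
    by (rule binomial_ring)
  also have "\<dots> \<in> P"
  proof -
    have termP: "of_nat (m + n choose k) * ?x ^ k * ?y ^ (m + n - k) \<in> P" if "k \<le> m + n" for k
    proof (cases "m \<le> k")
      case True
      have "of_nat (m + n choose k) * ?x ^ k * ?y ^ (m + n - k) = (of_nat (m + n choose k) * ?x ^ (k - m) * ?y ^ (m + n - k)) * ?x ^ m"
        using True by (simp add: power_add[symmetric] mult_ac)
      also have "\<dots> \<in> P" using mn 
        by (intro Pmult sring_mult[OF B] sring_of_nat[OF B] sring_power[OF B])
      finally show ?thesis .
    next
      case False
      have "of_nat (m + n choose k) * ?x ^ k * ?y ^ (m + n - k) = (of_nat (m + n choose k) * ?x ^ k * ?y ^ (m - k)) * ?y ^ n"
      proof -
        have "m + n - k = (m - k) + n" using False by simp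
        thus ?thesis by (simp only: power_add mult_ac)
      qed
      also have "\<dots> \<in> P" using mn 
        by (intro Pmult sring_mult[OF B] sring_of_nat[OF B] sring_power[OF B])
      finally show ?thesis .
    qed
    have sumP: "(\<Sum>k\<in>S. h k) \<in> P" if "\<And>k. k \<in> S \<Longrightarrow> h k \<in> P" for S and h :: "nat \<Rightarrow> 'f"
      using that by (induction S rule: infinite_finite_induct) (auto intro: P0 Padd)
    show ?thesis by (rule sumP) (rule termP, simp)
  qed
  finally have "(?x + ?y) ^ (m + n) \<in> P" .
  thus ?case using insert(1,2) mn sring_add[OF B] by auto
qed

text \<open>An element \<open>u\<close> of the upper cluster algebra is a Laurent polynomial in each cluster of the partition of unity, so some power of
  each cluster monomial is a denominator of \<open>u\<close>. Hence so is a power of \<open>1\<close>. The subring \<open>B\<close> is kept general: it may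
  be the cluster algebra or a subring generated by finitely many elements.\<close>

lemma upper_subset_of_covering:
  assumes s: "good s" and F: "finite F" "F \<subseteq> seeds_of s" and one: "(\<Sum>t\<in>F. a t * cluster_monomial t) = 1"
    and B: "sring B" and aB: "\<And>t. t \<in> F \<Longrightarrow> a t \<in> B" and varB: "\<And>t i. t \<in> F \<Longrightarrow> i \<in> ind s \<Longrightarrow> var t i \<in> B"
  shows "upper_cluster_algebra s \<subseteq> B"
proof
  fix u assume u: "u \<in> upper_cluster_algebra s"
  \<comment> \<open>The ideal of denominators of \<open>u\<close>; it contains a power of each summand of the partition of 1.\<close>
  define P where "P = {y \<in> B. u * y \<in> B}"
  have mB: "cluster_monomial t \<in> B" if "t \<in> F" for t
    unfolding cluster_monomial_def by (intro sring_prod[OF B] varB that) (use seeds_of_sel F that in blast)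
  have "\<exists>n. (\<Sum>t\<in>F. a t * cluster_monomial t) ^ n \<in> P"
  proof (rule sum_nilpotent_mod[OF B _ _ _ F(1), THEN conjunct2])
    show "0 \<in> P" using sring_zero[OF B] by (simp add: P_def)
    show "x + y \<in> P" if "x \<in> P" "y \<in> P" for x y using that sring_add[OF B] by (auto simp: P_def ring_distribs)
    show "b * x \<in> P" if "b \<in> B" "x \<in> P" for b x 
      using that sring_mult[OF B] by (auto simp: P_def mult.left_commute[of u])
    fix t assume t: "t \<in> F"
    have ts: "t \<in> seeds_of s" using F t by blast
    have gt: "good t" by (rule seeds_of_good[OF s ts])
    have "u \<in> laurents t" using u ts laurent_ring_eq_laurents[OF gt] unfolding upper_cluster_algebra_def by blast
    then obtain n where n: "u * cluster_monomial t ^ n \<in> B"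
      using laurents_clear_denominators[OF gt B] varB[OF t] unfolding cluster_monomial_def seeds_of_sel(1)[OF ts] by blast
    have "u * (a t * cluster_monomial t) ^ n = a t ^ n * (u * cluster_monomial t ^ n)"
      by (simp add: power_mult_distrib mult_ac)
    also have "\<dots> \<in> B" by (intro sring_mult[OF B] sring_power[OF B] aB t n)
    finally have "u * (a t * cluster_monomial t) ^ n \<in> B" .
    moreover have "a t * cluster_monomial t \<in> B" by (intro sring_mult[OF B] aB mB t)
    ultimately show "a t * cluster_monomial t \<in> B \<and> (\<exists>n. (a t * cluster_monomial t) ^ n \<in> P)"
      unfolding P_def using sring_power[OF B] by blast
  qed
  thus "u \<in> B" using one by (simp add: P_def)
qed

lemma cluster_algebra_subset_upper:
  assumes "good s"
  shows "cluster_algebra s \<subseteq> upper_cluster_algebra s"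
  unfolding upper_cluster_algebra_def
  using cluster_algebra_subset_laurents[OF assms] laurent_ring_eq_laurents[OF seeds_of_good[OF assms]] by blast

lemma equals_upper:
  assumes s: "good s" and one: "1 \<in> deep_ideal s"
  shows "cluster_algebra s = upper_cluster_algebra s"
proof
  obtain F a where F: "finite F" "F \<subseteq> seeds_of s" "\<forall>t\<in>F. a t \<in> cluster_algebra s" "(\<Sum>t\<in>F. a t * cluster_monomial t) = 1"
    using one_in_deep_ideal_expand[OF s one] by blast
  show "upper_cluster_algebra s \<subseteq> cluster_algebra s"
  proof (rule upper_subset_of_covering[OF s F(1,2,4) sring_cluster_algebra])
    show "a t \<in> cluster_algebra s" if "t \<in> F" for t using F(3) that by blast
    show "var t i \<in> cluster_algebra s" if "t \<in> F" "i \<in> ind s" for t i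
      by (rule var_in_cluster_algebra) (use F(2) that in auto)
  qed
qed (rule cluster_algebra_subset_upper[OF s])

text \<open>The coefficients and the variables of a partition of unity suffice as generators.\<close>

lemma finitely_generated:
  assumes s: "good s" and one: "1 \<in> deep_ideal s"
  shows "finitely_generated_ring (cluster_algebra s)"
proof -
  obtain F a where F: "finite F" "F \<subseteq> seeds_of s" "\<forall>t\<in>F. a t \<in> cluster_algebra s" "(\<Sum>t\<in>F. a t * cluster_monomial t) = 1"
    using one_in_deep_ideal_expand[OF s one] by blast
  define G where "G = a ` F \<union> (\<Union>t\<in>F. var t ` ind s)"
  have "finite G" using F(1) goodD(1)[OF s] by (simp add: G_def)
  moreover have GA: "G \<subseteq> cluster_algebra s"
    unfolding G_def using F(2,3) var_in_cluster_algebra[of _ s] by force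
  moreover have "cluster_algebra s = subring_gen G"
  proof
    have "upper_cluster_algebra s \<subseteq> subring_gen G"
      by (rule upper_subset_of_covering[OF s F(1,2,4) sring_subring_gen])
         (use subring_gen_incl[of G] in \<open>auto simp: G_def\<close>)
    thus "cluster_algebra s \<subseteq> subring_gen G" using cluster_algebra_subset_upper[OF s] by blast
  qed (rule subring_gen_minimal[OF sring_cluster_algebra GA])
  ultimately show ?thesis unfolding finitely_generated_ring_def by blast
qed

text \<open>Freezing all variables of a cluster gives its Laurent ring, which is acyclic because nothing is left to mutate.\<close>

lemma freeze_all:
  assumes s: "good s" and t: "t \<in> seeds_of s"
  defines "t' \<equiv> freeze (mut t) t"
  shows "cluster_algebra t' = laurents t" "t' \<in> cluster_localizations s" "acyclic_cluster_algebra t'"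
proof -
  have gt: "good t" by (rule seeds_of_good[OF s t])
  have sel: "ind t' = ind t" "mut t' = {}" "var t' = var t" by (simp_all add: t'_def freeze_def)
  have seeds: "seeds_of t' = {t'}"
  proof -
    have "u = t'" if "u \<in> seeds_of t'" for u
      using that by induction (auto simp: sel)
    thus ?thesis using seeds_of.initial by blast
  qed
  have "cluster_algebra t' = laurent_ring t"
    unfolding cluster_algebra_def laurent_ring_def seeds by (simp add: sel cluster_def image_image)
  thus eq: "cluster_algebra t' = laurents t" by (simp add: laurent_ring_eq_laurents[OF gt])
  show "acyclic_cluster_algebra t'"
    unfolding acyclic_cluster_algebra_def seeds by (simp add: sel acyclic_def)
  have "laurent_ring t = subring_gen (cluster_algebra s \<union> (\<lambda>i. inverse (var t i)) ` mut t)"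
  proof
    let ?S = "subring_gen (cluster_algebra s \<union> (\<lambda>i. inverse (var t i)) ` mut t)"
    note S = subring_gen_incl[of "cluster_algebra s \<union> (\<lambda>i. inverse (var t i)) ` mut t"]
    show "?S \<subseteq> laurent_ring t"
      using cluster_algebra_subset_laurents[OF s t] lunitD(2)[OF sring_laurents[OF gt] lunit_var[OF gt]] goodD(2)[OF gt]
      unfolding laurent_ring_eq_laurents[OF gt] by (intro subring_gen_minimal sring_laurents[OF gt]) auto
    have "inverse (var t i) \<in> ?S" if i: "i \<in> ind t" for i
    proof (cases "i \<in> mut t")
      case False
      hence "inverse (var t i) \<in> cluster_algebra s"
        using inverse_frozen_in_cluster_algebra[of i s] i seeds_of_sel[OF t] frozen_var[OF t] by simp
      thus ?thesis using S by blast
    qed (use S in blast)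
    moreover have "var t i \<in> ?S" if i: "i \<in> ind t" for i
      using var_in_cluster_algebra[OF t, of i] i seeds_of_sel[OF t] S by auto
    ultimately show "laurent_ring t \<subseteq> ?S"
      unfolding laurent_ring_def cluster_def by (intro subring_gen_minimal[OF sring_subring_gen]) auto
  qed
  thus "t' \<in> cluster_localizations s"
    unfolding cluster_localizations_def using t eq laurent_ring_eq_laurents[OF gt] t'_def by blast
qed

text \<open>The Laurent rings of all clusters cover: a prime \<open>P\<close> misses the cluster monomial of some cluster, and then it stays proper in the
  Laurent ring of this cluster.\<close>

lemma locally_acyclic_if_no_deep:
  assumes s: "good s" and one: "1 \<in> deep_ideal s"
  shows "locally_acyclic s"
  unfolding locally_acyclic_def
proof (intro exI conjI allI impI ballI)
  let ?L = "(\<lambda>t. freeze (mut t) t) ` seeds_of s"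
  show "?L \<subseteq> cluster_localizations s" using freeze_all(2)[OF s] by blast
  show "acyclic_cluster_algebra t" if "t \<in> ?L" for t using freeze_all(3)[OF s] that by blast
  fix P assume P: "primeideal P (cluster_ring s)"
  interpret P: primeideal P "cluster_ring s" by (rule P)
  note A = sring_cluster_algebra[of s]
  have oneP: "1 \<notin> P" using P.I_notcarr P.one_imp_carrier by auto
  have "\<not> cluster_monomial ` seeds_of s \<subseteq> P"
    using P.genideal_minimal[OF P.ideal_axioms] one oneP unfolding deep_ideal_eq[OF s] by blast
  then obtain t where t: "t \<in> seeds_of s" "cluster_monomial t \<notin> P" by blast
  have gt: "good t" by (rule seeds_of_good[OF s t(1)])
  let ?t = "freeze (mut t) t" and ?m = "cluster_monomial t"
  have mA: "?m \<in> cluster_algebra s" by (rule cluster_monomial_in[OF t(1)])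
  have Psub: "P \<subseteq> cluster_algebra s" using P.a_subset by simp
  have mpow: "?m ^ n \<notin> P" for n
  proof (induction n)
    case (Suc n)
    thus ?case using P.I_prime[of ?m "?m ^ n"] t(2) mA sring_power[OF A mA] by auto
  qed (use oneP in simp)
  \<comment> \<open>The extension of \<open>P\<close> to the Laurent ring, written as the set of fractions with numerator in \<open>P\<close>.\<close>
  define J where "J = {y \<in> laurents t. \<exists>n. y * ?m ^ n \<in> P}"
  interpret T: cring "cluster_ring ?t" by (rule cring_cluster_ring)
  note L = sring_laurents[OF gt]
  have absP: "x * y \<in> P" if "x \<in> cluster_algebra s" "y \<in> P" for x y using P.I_l_closed[of y x] that by simp
  have addP: "x + y \<in> P" if "x \<in> P" "y \<in> P" for x y
    using additive_subgroup.a_closed[OF P.is_additive_subgroup that] by simp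
  have "ideal J (cluster_ring ?t)"
  proof (rule T.idealI_absorb)
    show "J \<subseteq> carrier (cluster_ring ?t)" by (auto simp: J_def freeze_all(1)[OF s t(1)])
    show "\<zero>\<^bsub>cluster_ring ?t\<^esub> \<in> J" using additive_subgroup.zero_closed[OF P.is_additive_subgroup] sring_zero[OF L] by (auto simp: J_def)
  next
    fix x y assume "x \<in> J" "y \<in> J"
    then obtain n k where n: "x \<in> laurents t" "x * ?m ^ n \<in> P" "y \<in> laurents t" "y * ?m ^ k \<in> P" unfolding J_def by blast
    have "(x + y) * ?m ^ (n + k) = ?m ^ k * (x * ?m ^ n) + ?m ^ n * (y * ?m ^ k)" by (simp add: power_add algebra_simps)
    also have "\<dots> \<in> P" by (intro addP absP sring_power[OF A mA] n)
    finally show "x \<oplus>\<^bsub>cluster_ring ?t\<^esub> y \<in> J" using n sring_add[OF L] by (auto simp: J_def)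
  next
    fix a x assume a: "a \<in> carrier (cluster_ring ?t)" and "x \<in> J"
    then obtain n where n: "x \<in> laurents t" "x * ?m ^ n \<in> P" unfolding J_def by blast
    have aL: "a \<in> laurents t" using a freeze_all(1)[OF s t(1)] by simp
    obtain k where k: "a * ?m ^ k \<in> cluster_algebra s"
      using laurents_clear_denominators[OF gt A _ aL] var_in_cluster_algebra[OF t(1)]
      unfolding cluster_monomial_def seeds_of_sel(1)[OF t(1)] by blast
    have "(a * x) * ?m ^ (k + n) = (a * ?m ^ k) * (x * ?m ^ n)" by (simp add: power_add mult_ac)
    also have "\<dots> \<in> P" by (rule absP[OF k n(2)])
    finally show "a \<otimes>\<^bsub>cluster_ring ?t\<^esub> x \<in> J" using n aL sring_mult[OF L] by (auto simp: J_def)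
  qed
  moreover have "P \<subseteq> J"
    using Psub cluster_algebra_subset_laurents[OF s t(1)] by (auto simp: J_def intro!: exI[of _ 0])
  ultimately have "Idl\<^bsub>cluster_ring ?t\<^esub> P \<subseteq> J" by (rule T.genideal_minimal)
  moreover have "1 \<notin> J" using mpow by (simp add: J_def)
  moreover have "1 \<in> carrier (cluster_ring ?t)" using sring_one[OF L] by (simp add: freeze_all(1)[OF s t(1)])
  ultimately have "Idl\<^bsub>cluster_ring ?t\<^esub> P \<noteq> carrier (cluster_ring ?t)" by blast
  thus "\<exists>t\<in>?L. Idl\<^bsub>cluster_ring t\<^esub> P \<noteq> carrier (cluster_ring t)" using t(1) by blast
qed

section \<open>Noetherian subrings\<close>

text \<open>Ideals of a subset \<open>S\<close> of the ring, and the ascending chain condition for them in the form that every ideal is finitely generated.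
  Working inside one ambient ring allows adjoining elements one at a time without constructing polynomial rings.\<close>

definition (in ring) subset_ideal :: "'a set \<Rightarrow> 'a set \<Rightarrow> bool" where
  "subset_ideal S J \<longleftrightarrow> J \<subseteq> S \<and> \<zero> \<in> J \<and> (\<forall>x\<in>J. \<forall>y\<in>J. x \<oplus> y \<in> J) \<and> (\<forall>a\<in>S. \<forall>x\<in>J. a \<otimes> x \<in> J)"

definition (in ring) noeth :: "'a set \<Rightarrow> bool" where
  "noeth S \<longleftrightarrow> (\<forall>J. subset_ideal S J \<longrightarrow> (\<exists>H. finite H \<and> H \<subseteq> J \<and> (\<forall>J'. subset_ideal S J' \<and> H \<subseteq> J' \<longrightarrow> J \<subseteq> J')))"

text \<open>The polynomials in \<open>x\<close> over \<open>S\<close> of degree less than \<open>d\<close>; the element \<open>x\<close> may be algebraic over \<open>S\<close>.\<close>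

primrec (in ring) polys_below :: "'a set \<Rightarrow> 'a \<Rightarrow> nat \<Rightarrow> 'a set" where
  "polys_below S x 0 = {\<zero>}"
| "polys_below S x (Suc d) = {a \<otimes> x [^] d \<oplus> r | a r. a \<in> S \<and> r \<in> polys_below S x d}"

declare (in ring) polys_below.simps(2) [simp del]

lemma (in ring) sidealD:
  assumes "subset_ideal S J"
  shows "J \<subseteq> S" "\<zero> \<in> J" "x \<in> J \<Longrightarrow> y \<in> J \<Longrightarrow> x \<oplus> y \<in> J" "a \<in> S \<Longrightarrow> x \<in> J \<Longrightarrow> a \<otimes> x \<in> J"
  using assms unfolding subset_ideal_def by blast+

lemma (in ring) sidealI:
  assumes "J \<subseteq> S" "\<zero> \<in> J" "\<And>x y. x \<in> J \<Longrightarrow> y \<in> J \<Longrightarrow> x \<oplus> y \<in> J" "\<And>a x. a \<in> S \<Longrightarrow> x \<in> J \<Longrightarrow> a \<otimes> x \<in> J"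
  shows "subset_ideal S J"
  using assms unfolding subset_ideal_def by blast

lemma (in ring) noeth_chain:
  assumes n: "noeth S" and L: "\<And>d. subset_ideal S (L d)" and mono: "\<And>d. L d \<subseteq> L (Suc d)"
  shows "\<exists>N. \<forall>d. L d \<subseteq> L N"
proof -
  have le: "L d \<subseteq> L e" if "d \<le> e" for d e using that by (induction rule: dec_induct) (use mono in auto)
  have "subset_ideal S (\<Union>d. L d)"
  proof (rule sidealI)
    show "(\<Union>d. L d) \<subseteq> S" using sidealD(1)[OF L] by blast
    show "\<zero> \<in> (\<Union>d. L d)" using sidealD(2)[OF L] by blast
    show "a \<otimes> x \<in> (\<Union>d. L d)" if "a \<in> S" "x \<in> (\<Union>d. L d)" for a x
      using that sidealD(4)[OF L] by blast
    show "x \<oplus> y \<in> (\<Union>d. L d)" if xy: "x \<in> (\<Union>d. L d)" "y \<in> (\<Union>d. L d)" for x y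
    proof -
      obtain d e where "x \<in> L d" "y \<in> L e" using xy by blast
      hence "x \<in> L (max d e)" "y \<in> L (max d e)" using le[of d "max d e"] le[of e "max d e"] by auto
      hence "x \<oplus> y \<in> L (max d e)" by (rule sidealD(3)[OF L])
      thus ?thesis by blast
    qed
  qed
  then obtain H where H: "finite H" "H \<subseteq> (\<Union>d. L d)" "\<And>J'. subset_ideal S J' \<Longrightarrow> H \<subseteq> J' \<Longrightarrow> (\<Union>d. L d) \<subseteq> J'"
    using n unfolding noeth_def by meson
  have "\<exists>N. H \<subseteq> L N"
    using H(1,2)
  proof induction
    case (insert h H)
    then obtain N d where "H \<subseteq> L N" "h \<in> L d" by blast
    thus ?case using le[of N "max N d"] le[of d "max N d"] by (intro exI[of _ "max N d"]) auto
  qed simp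
  thus ?thesis using H(3)[OF L] by blast
qed

context cring
begin

context
  fixes S x
  assumes S: "subring S R" and x: "x \<in> carrier R"
begin

lemma S_carrier: "S \<subseteq> carrier R" 
  and S_zero: "\<zero> \<in> S" and S_one: "\<one> \<in> S"
  and S_neg: "a \<in> S \<Longrightarrow> \<ominus> a \<in> S"
  and S_add: "a \<in> S \<Longrightarrow> b \<in> S \<Longrightarrow> a \<oplus> b \<in> S"
  and S_mult: "a \<in> S \<Longrightarrow> b \<in> S \<Longrightarrow> a \<otimes> b \<in> S"
  using subringE[OF S] by auto

lemma S_in [simp]: "a \<in> S \<Longrightarrow> a \<in> carrier R" using S_carrier by blast

lemma x_pow [simp]: "x [^] (n::nat) \<in> carrier R" using x by simp

lemma polys_below_carrier: "polys_below S x d \<subseteq> carrier R"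
  by (induction d) (auto simp: subset_iff polys_below.simps(2))

lemma polys_below_in [simp]: "f \<in> polys_below S x d \<Longrightarrow> f \<in> carrier R"
  using polys_below_carrier by blast

lemma polys_below_SucI: "a \<in> S \<Longrightarrow> r \<in> polys_below S x d \<Longrightarrow> a \<otimes> x [^] d \<oplus> r \<in> polys_below S x (Suc d)"
  by (auto simp: polys_below.simps(2))

lemma polys_below_zero: "\<zero> \<in> polys_below S x d"
proof (induction d)
  case (Suc d)
  have "\<zero> \<otimes> x [^] d \<oplus> \<zero> \<in> polys_below S x (Suc d)" by (rule polys_below_SucI[OF S_zero Suc])
  thus ?case by simp
qed simp

lemma polys_below_add: "f \<in> polys_below S x d \<Longrightarrow> g \<in> polys_below S x d \<Longrightarrow> f \<oplus> g \<in> polys_below S x d"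
proof (induction d arbitrary: f g)
  case (Suc d)
  then obtain a r b s where f: "a \<in> S" "r \<in> polys_below S x d" "f = a \<otimes> x [^] d \<oplus> r"
    and g: "b \<in> S" "s \<in> polys_below S x d" "g = b \<otimes> x [^] d \<oplus> s" by (auto simp: polys_below.simps(2))
  have "f \<oplus> g = (a \<oplus> b) \<otimes> x [^] d \<oplus> (r \<oplus> s)"
    using f g by (simp add: l_distr a_ac)
  also have "\<dots> \<in> polys_below S x (Suc d)" using f g Suc.IH by (intro polys_below_SucI S_add)
  finally show ?case .
qed simp

lemma polys_below_smult: "a \<in> S \<Longrightarrow> f \<in> polys_below S x d \<Longrightarrow> a \<otimes> f \<in> polys_below S x d"
proof (induction d arbitrary: f)
  case (Suc d)
  then obtain b r where f: "b \<in> S" "r \<in> polys_below S x d" "f = b \<otimes> x [^] d \<oplus> r" by (auto simp: polys_below.simps(2))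
  have "a \<otimes> f = (a \<otimes> b) \<otimes> x [^] d \<oplus> a \<otimes> r" using f Suc.prems(1) by (simp add: r_distr m_ac)
  also have "\<dots> \<in> polys_below S x (Suc d)" using f Suc by (intro polys_below_SucI S_mult)
  finally show ?case .
qed simp

lemma polys_below_neg: "f \<in> polys_below S x d \<Longrightarrow> \<ominus> f \<in> polys_below S x d"
  using polys_below_smult[OF S_neg[OF S_one]] by (simp add: l_minus)

lemma polys_below_Suc: "f \<in> polys_below S x d \<Longrightarrow> f \<in> polys_below S x (Suc d)"
  using polys_below_SucI[OF S_zero, of f d] by simp

lemma polys_below_mono: "d \<le> e \<Longrightarrow> polys_below S x d \<subseteq> polys_below S x e"
  by (induction rule: dec_induct) (use polys_below_Suc in blast)+

lemma polys_below_shift: "f \<in> polys_below S x d \<Longrightarrow> x \<otimes> f \<in> polys_below S x (Suc d)"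
proof (induction d arbitrary: f)
  case 0
  thus ?case using x polys_below_zero[of "Suc 0"] by simp
next
  case (Suc d)
  then obtain b r where f: "b \<in> S" "r \<in> polys_below S x d" "f = b \<otimes> x [^] d \<oplus> r" by (auto simp: polys_below.simps(2))
  have "x \<otimes> f = b \<otimes> x [^] Suc d \<oplus> x \<otimes> r" using f x by (simp add: r_distr m_ac)
  also have "\<dots> \<in> polys_below S x (Suc (Suc d))" using f Suc.IH by (intro polys_below_SucI)
  finally show ?case .
qed

lemma polys_below_shift_pow: "f \<in> polys_below S x d \<Longrightarrow> x [^] n \<otimes> f \<in> polys_below S x (n + d)"
proof (induction n)
  case (Suc n)
  have "x [^] Suc n \<otimes> f = x \<otimes> (x [^] n \<otimes> f)" using Suc.prems x by (simp add: m_ac)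
  thus ?case using polys_below_shift[OF Suc.IH[OF Suc.prems]] by simp
qed simp

lemma polys_below_mult: "f \<in> polys_below S x d \<Longrightarrow> g \<in> polys_below S x e \<Longrightarrow> f \<otimes> g \<in> polys_below S x (d + e)"
proof (induction d arbitrary: f)
  case 0
  thus ?case using polys_below_zero by simp
next
  case (Suc d)
  then obtain b r where f: "b \<in> S" "r \<in> polys_below S x d" "f = b \<otimes> x [^] d \<oplus> r" by (auto simp: polys_below.simps(2))
  have "f \<otimes> g = b \<otimes> (x [^] d \<otimes> g) \<oplus> r \<otimes> g" using f Suc.prems(2) by (simp add: l_distr m_assoc)
  moreover have "b \<otimes> (x [^] d \<otimes> g) \<in> polys_below S x (Suc d + e)"
    using polys_below_Suc[OF polys_below_smult[OF f(1) polys_below_shift_pow[OF Suc.prems(2)]]] by simp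
  moreover have "r \<otimes> g \<in> polys_below S x (Suc d + e)"
    using polys_below_Suc[OF Suc.IH[OF f(2) Suc.prems(2)]] by simp
  ultimately show ?case using polys_below_add by simp
qed

lemma polys_below_S: "a \<in> S \<Longrightarrow> a \<in> polys_below S x (Suc 0)"
  using polys_below_SucI[of a \<zero> 0] by simp

lemma polys_below_x: "x \<in> polys_below S x (Suc (Suc 0))"
  using polys_below_shift[OF polys_below_S[OF S_one]] x by simp

lemma subring_polys_below: "subring (\<Union>d. polys_below S x d) R"
proof (rule subringI)
  show "\<one> \<in> (\<Union>d. polys_below S x d)" using polys_below_S[OF S_one] by blast
  show "h1 \<otimes> h2 \<in> (\<Union>d. polys_below S x d)" if "h1 \<in> (\<Union>d. polys_below S x d)" "h2 \<in> (\<Union>d. polys_below S x d)" for h1 h2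
    using that polys_below_mult by blast
  show "h1 \<oplus> h2 \<in> (\<Union>d. polys_below S x d)" if h: "h1 \<in> (\<Union>d. polys_below S x d)" "h2 \<in> (\<Union>d. polys_below S x d)" for h1 h2
  proof -
    obtain d e where "h1 \<in> polys_below S x d" "h2 \<in> polys_below S x e" using h by blast
    hence "h1 \<oplus> h2 \<in> polys_below S x (max d e)"
      using polys_below_mono[of d "max d e"] polys_below_mono[of e "max d e"] by (intro polys_below_add) auto
    thus ?thesis by blast
  qed
qed (use polys_below_neg polys_below_carrier in blast)+

lemma cancel_leading:
  assumes "u \<in> carrier R" "s \<in> carrier R" "q \<in> carrier R"
  shows "s \<ominus> q = (u \<oplus> s) \<oplus> (\<ominus> \<one>) \<otimes> (u \<oplus> q)" "(u \<oplus> q) \<oplus> (s \<ominus> q) = u \<oplus> s"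
  using assms by algebra+

lemma leading_ideal:
  assumes J: "subset_ideal (\<Union>d. polys_below S x d) J"
  shows "subset_ideal S {a \<in> S. \<exists>r\<in>polys_below S x d. a \<otimes> x [^] d \<oplus> r \<in> J}" (is "subset_ideal S ?L")
proof (rule sidealI)
  have "\<zero> \<otimes> x [^] d \<oplus> \<zero> \<in> J" using sidealD(2)[OF J] by simp
  thus "\<zero> \<in> ?L" using S_zero polys_below_zero by blast
next
  fix a b assume "a \<in> ?L" "b \<in> ?L"
  then obtain r s where a: "a \<in> S" "r \<in> polys_below S x d" "a \<otimes> x [^] d \<oplus> r \<in> J"
    and b: "b \<in> S" "s \<in> polys_below S x d" "b \<otimes> x [^] d \<oplus> s \<in> J" by blast
  have "(a \<oplus> b) \<otimes> x [^] d \<oplus> (r \<oplus> s) = (a \<otimes> x [^] d \<oplus> r) \<oplus> (b \<otimes> x [^] d \<oplus> s)"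
    using a b by (simp add: l_distr a_ac)
  hence "(a \<oplus> b) \<otimes> x [^] d \<oplus> (r \<oplus> s) \<in> J" using sidealD(3)[OF J a(3) b(3)] by simp
  thus "a \<oplus> b \<in> ?L" using S_add[OF a(1) b(1)] polys_below_add[OF a(2) b(2)] by blast
next
  fix c a assume c: "c \<in> S" and "a \<in> ?L"
  then obtain r where a: "a \<in> S" "r \<in> polys_below S x d" "a \<otimes> x [^] d \<oplus> r \<in> J" by blast
  have cT: "c \<in> (\<Union>d. polys_below S x d)" using polys_below_S[OF c] by blast
  have "(c \<otimes> a) \<otimes> x [^] d \<oplus> c \<otimes> r = c \<otimes> (a \<otimes> x [^] d \<oplus> r)" using a c by (simp add: r_distr m_ac)
  hence "(c \<otimes> a) \<otimes> x [^] d \<oplus> c \<otimes> r \<in> J" using sidealD(4)[OF J cT a(3)] by simp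
  thus "c \<otimes> a \<in> ?L" using S_mult[OF c a(1)] polys_below_smult[OF c a(2)] by blast
qed blast

text \<open>The ideals of leading coefficients of degree \<open>d\<close> increase with \<open>d\<close>, so they are stationary from some \<open>N\<close> on. Elements of \<open>J\<close>
  whose leading coefficients generate these ideals for \<open>d \<le> N\<close> generate \<open>J\<close>, by induction on the degree. Instead of writing down
  combinations of them, the proof takes an arbitrary ideal \<open>J'\<close> that contains them.\<close>

theorem hilbert_basis_step:
  assumes n: "noeth S"
  shows "noeth (\<Union>d. polys_below S x d)"
  unfolding noeth_def
proof (intro allI impI)
  let ?T = "\<Union>d. polys_below S x d"
  fix J assume J: "subset_ideal ?T J"
  define lead where "lead J d = {a \<in> S. \<exists>r\<in>polys_below S x d. a \<otimes> x [^] d \<oplus> r \<in> J}" for J d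
  have xT: "x [^] n \<in> ?T" for n :: nat
    using polys_below_shift_pow[OF polys_below_S[OF S_one], of n] by auto
  have shift: "a \<otimes> x [^] (n + d) \<oplus> x [^] n \<otimes> r \<in> J'"
    if "subset_ideal ?T J'" "a \<in> S" "r \<in> polys_below S x d" "a \<otimes> x [^] d \<oplus> r \<in> J'" for J' a r d n
  proof -
    have "x [^] n \<otimes> (a \<otimes> x [^] d \<oplus> r) = a \<otimes> x [^] (n + d) \<oplus> x [^] n \<otimes> r"
      using that(2,3) x by (simp add: r_distr nat_pow_mult[symmetric] m_ac)
    thus ?thesis using sidealD(4)[OF that(1) xT that(4), of n] by simp
  qed
  have lead: "subset_ideal S (lead J' d)" if "subset_ideal ?T J'" for J' d
    unfolding lead_def by (rule leading_ideal[OF that])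
  have lead_mono: "lead J d \<subseteq> lead J (Suc d)" for d
  proof
    fix a assume "a \<in> lead J d"
    then obtain r where a: "a \<in> S" "r \<in> polys_below S x d" "a \<otimes> x [^] d \<oplus> r \<in> J" unfolding lead_def by blast
    show "a \<in> lead J (Suc d)"
      using shift[OF J a, of 1] a(1) polys_below_shift[OF a(2)] x unfolding lead_def by auto
  qed
  obtain N where N: "\<And>d. lead J d \<subseteq> lead J N" 
    using noeth_chain[where L = "lead J", OF n lead[OF J] lead_mono] by blast
  obtain H where H: "\<And>d. finite (H d)" "\<And>d. H d \<subseteq> lead J d" "\<And>d J'. subset_ideal S J' \<Longrightarrow> H d \<subseteq> J' \<Longrightarrow> lead J d \<subseteq> J'"
  proof -
    have "\<forall>d. \<exists>H. finite H \<and> H \<subseteq> lead J d \<and> (\<forall>J'. subset_ideal S J' \<and> H \<subseteq> J' \<longrightarrow> lead J d \<subseteq> J')"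
      using n lead[OF J] unfolding noeth_def by blast
    then obtain H where "\<And>d. finite (H d) \<and> H d \<subseteq> lead J d \<and> (\<forall>J'. subset_ideal S J' \<and> H d \<subseteq> J' \<longrightarrow> lead J d \<subseteq> J')" by metis
    thus ?thesis using that by metis
  qed
  have "\<forall>d a. \<exists>r. a \<in> H d \<longrightarrow> r \<in> polys_below S x d \<and> a \<otimes> x [^] d \<oplus> r \<in> J"
    using H(2) unfolding lead_def by blast
  then obtain r where r: "\<And>d a. a \<in> H d \<Longrightarrow> r d a \<in> polys_below S x d \<and> a \<otimes> x [^] d \<oplus> r d a \<in> J" by metis
  define G where "G = (\<Union>d\<le>N. (\<lambda>a. a \<otimes> x [^] d \<oplus> r d a) ` H d)"
  have "finite G" using H(1) by (simp add: G_def)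
  moreover have GJ: "G \<subseteq> J" using r by (auto simp: G_def)
  moreover have "J \<subseteq> J'" if J': "subset_ideal ?T J'" "G \<subseteq> J'" for J'
  proof -
    have J2: "subset_ideal ?T (J' \<inter> J)" using J J'(1) unfolding subset_ideal_def by blast
    have lead_sub: "lead J d \<subseteq> lead (J' \<inter> J) d" if "d \<le> N" for d
    proof (rule H(3)[OF lead[OF J2]])
      show "H d \<subseteq> lead (J' \<inter> J) d"
      proof
        fix a assume a: "a \<in> H d"
        hence "a \<otimes> x [^] d \<oplus> r d a \<in> J' \<inter> J" using J'(2) GJ that by (auto simp: G_def)
        thus "a \<in> lead (J' \<inter> J) d" using r[OF a] H(2) a unfolding lead_def by blast
      qed
    qed
    have "f \<in> J' \<inter> J" if "f \<in> J" "f \<in> polys_below S x d" for f d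
      using that
    proof (induction d arbitrary: f)
      case 0
      thus ?case using sidealD(2)[OF J2] by simp
    next
      case (Suc d)
      then obtain a s where f: "a \<in> S" "s \<in> polys_below S x d" "f = a \<otimes> x [^] d \<oplus> s" by (auto simp: polys_below.simps(2))
      have a: "a \<in> lead J d" using f Suc.prems(1) unfolding lead_def by blast
      have "\<exists>q\<in>polys_below S x d. a \<otimes> x [^] d \<oplus> q \<in> J' \<inter> J"
      proof (cases "d \<le> N")
        case True
        thus ?thesis using lead_sub[OF True] a unfolding lead_def by blast
      next
        case False
        have "a \<in> lead (J' \<inter> J) N" using a N lead_sub[of N] by blast
        then obtain q where q: "q \<in> polys_below S x N" "a \<otimes> x [^] N \<oplus> q \<in> J' \<inter> J" unfolding lead_def by blast
        have "a \<otimes> x [^] (d - N + N) \<oplus> x [^] (d - N) \<otimes> q \<in> J' \<inter> J" by (rule shift[OF J2 f(1) q])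
        moreover have "x [^] (d - N) \<otimes> q \<in> polys_below S x (d - N + N)" by (rule polys_below_shift_pow[OF q(1)])
        ultimately show ?thesis using False by auto
      qed
      then obtain q where q: "q \<in> polys_below S x d" "a \<otimes> x [^] d \<oplus> q \<in> J' \<inter> J" by blast
      let ?g = "a \<otimes> x [^] d \<oplus> q"
      have car: "a \<otimes> x [^] d \<in> carrier R" "s \<in> carrier R" "q \<in> carrier R" using f(1,2) q(1) by simp_all
      have one': "\<ominus> \<one> \<in> ?T" using polys_below_S[OF S_neg[OF S_one]] by blast
      have mg: "(\<ominus> \<one>) \<otimes> ?g \<in> J" using sidealD(4)[OF J one'] q(2) by blast
      have "s \<ominus> q = f \<oplus> (\<ominus> \<one>) \<otimes> ?g" 
        unfolding f(3) by (rule cancel_leading(1)[OF car])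
      hence "s \<ominus> q \<in> J" using sidealD(3)[OF J Suc.prems(1) mg] by simp
      moreover have "s \<ominus> q \<in> polys_below S x d" unfolding minus_eq by (intro polys_below_add polys_below_neg f(2) q(1))
      ultimately have "s \<ominus> q \<in> J' \<inter> J" by (rule Suc.IH)
      hence "?g \<oplus> (s \<ominus> q) \<in> J' \<inter> J" by (rule sidealD(3)[OF J2 q(2)])
      moreover have "?g \<oplus> (s \<ominus> q) = f" unfolding f(3) by (rule cancel_leading(2)[OF car])
      ultimately show ?case by simp
    qed
    thus ?thesis using sidealD(1)[OF J] by blast
  qed
  ultimately show "\<exists>H. finite H \<and> H \<subseteq> J \<and> (\<forall>J'. subset_ideal ?T J' \<and> H \<subseteq> J' \<longrightarrow> J \<subseteq> J')" by blast
qed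

declare S_in [simp del] x_pow [simp del] polys_below_in [simp del]

end

lemma noeth_subfield:
  assumes F: "subfield F R"
  shows "noeth F"
  unfolding noeth_def
proof (intro allI impI)
  fix J assume J: "subset_ideal F J"
  show "\<exists>H. finite H \<and> H \<subseteq> J \<and> (\<forall>J'. subset_ideal F J' \<and> H \<subseteq> J' \<longrightarrow> J \<subseteq> J')"
  proof (cases "J \<subseteq> {\<zero>}")
    case True
    thus ?thesis using sidealD(2) by (intro exI[of _ "{}"]) blast
  next
    case False
    then obtain a where a: "a \<in> J" "a \<noteq> \<zero>" by blast
    have aF: "a \<in> F" using sidealD(1)[OF J] a by blast
    have inv: "inv a \<in> F" "inv a \<otimes> a = \<one>" using subfield_m_inv[OF F, of a] aF a(2) by auto
    have "J \<subseteq> J'" if J': "subset_ideal F J'" "{a} \<subseteq> J'" for J'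
    proof
      fix b assume "b \<in> J"
      hence b: "b \<in> F" using sidealD(1)[OF J] by blast
      have "\<one> \<in> J'" using sidealD(4)[OF J'(1) inv(1), of a] J'(2) inv(2) by simp
      hence "b \<otimes> \<one> \<in> J'" using sidealD(4)[OF J'(1) b] by blast
      thus "b \<in> J'" using b subfieldE(3)[OF F] by auto
    qed
    thus ?thesis using a(1) by (intro exI[of _ "{a}"]) blast
  qed
qed

lemma noeth_adjoin_finitely_many:
  fixes x :: "nat \<Rightarrow> 'a"
  assumes F: "subfield F R" and x: "\<And>i. i < n \<Longrightarrow> x i \<in> carrier R"
  shows "\<exists>S. subring S R \<and> noeth S \<and> F \<subseteq> S \<and> x ` {..<n} \<subseteq> S"
  using x
proof (induction n)
  case 0
  show ?case using noeth_subfield[OF F] subfieldE(1)[OF F] subcring.axioms(1) subdomainE by (intro exI[of _ F]) (auto simp: subfield_def subdomain_def subcring_def)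
next
  case (Suc n)
  then obtain S where S: "subring S R" "noeth S" "F \<subseteq> S" "x ` {..<n} \<subseteq> S" by (meson less_SucI)
  have xn: "x n \<in> carrier R" using Suc.prems by simp
  let ?T = "\<Union>d. polys_below S (x n) d"
  have ST: "S \<subseteq> ?T" using polys_below_S[OF S(1) xn] by blast
  have xT: "x n \<in> ?T" using polys_below_x[OF S(1) xn] by blast
  have "x ` {..<Suc n} = insert (x n) (x ` {..<n})" by (auto simp: less_Suc_eq)
  hence "x ` {..<Suc n} \<subseteq> ?T" using subset_trans[OF S(4) ST] xT by simp
  moreover have "F \<subseteq> ?T" by (rule subset_trans[OF S(3) ST])
  ultimately show ?case using subring_polys_below[OF S(1) xn] hilbert_basis_step[OF S(1) xn S(2)] by (intro exI[of _ ?T]) simp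
qed

end

section \<open>Chains of primes in a localized polynomial ring\<close>

text \<open>The exponent vectors with \<open>m\<close> entries, each at most \<open>D\<close>; a list, because linear dependence is a notion for lists.\<close>

primrec exponents :: "nat \<Rightarrow> nat \<Rightarrow> nat list list" where
  "exponents D 0 = [[]]"
| "exponents D (Suc m) = concat (map (\<lambda>d. map ((#) d) (exponents D m)) [0..<Suc D])"

lemma length_exponents: "length (exponents D m) = Suc D ^ m"
  by (induction m) (simp_all add: length_concat o_def sum_list_triv del: upt_Suc)

lemma set_exponents_Suc: "set (exponents D (Suc m)) = {d # es | d es. d \<le> D \<and> es \<in> set (exponents D m)}"
  by (auto simp: less_Suc_eq_le simp del: upt_Suc)

lemma set_exponents: "set (exponents D m) = {es. length es = m \<and> set es \<subseteq> {..D}}"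
proof (induction m)
  case (Suc m)
  show ?case unfolding set_exponents_Suc Suc by (auto simp: length_Suc_conv)
qed auto

lemma distinct_exponents: "distinct (exponents D m)"
proof (induction m)
  case (Suc m)
  have d: "distinct (concat (map (\<lambda>d. map ((#) d) (exponents D m)) ds))" if "distinct ds" for ds
    using that
  proof (induction ds)
    case (Cons d ds)
    have "distinct (map ((#) d) (exponents D m))" using Suc by (simp add: distinct_map)
    thus ?case using Cons by auto
  qed simp
  show ?case using d[of "[0..<Suc D]"] by (simp del: upt_Suc)
qed simp

context cring
begin

fun monom_at :: "'a list \<Rightarrow> nat list \<Rightarrow> 'a" where
  "monom_at (f # fs) (e # es) = f [^] e \<otimes> monom_at fs es"
| "monom_at _ _ = \<one>"

text \<open>The sum of \<open>f [^] d \<otimes> g d\<close> over \<open>d < D\<close>, and with it the value at \<open>fs\<close> of the polynomial with coefficients \<open>k\<close>. The nesting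
  singles out the first variable, along which the induction in \<open>prime_chain_independent\<close> runs.\<close>

primrec horner :: "'a \<Rightarrow> nat \<Rightarrow> (nat \<Rightarrow> 'a) \<Rightarrow> 'a" where
  "horner f 0 g = \<zero>"
| "horner f (Suc D) g = horner f D g \<oplus> f [^] D \<otimes> g D"

primrec poly_at :: "nat \<Rightarrow> 'a list \<Rightarrow> (nat list \<Rightarrow> 'a) \<Rightarrow> 'a" where
  "poly_at D [] k = k []"
| "poly_at D (f # fs) k = horner f (Suc D) (\<lambda>d. poly_at D fs (\<lambda>es. k (d # es)))"

lemma monom_at_closed [simp]: "set fs \<subseteq> carrier R \<Longrightarrow> monom_at fs es \<in> carrier R"
  by (induction fs es rule: monom_at.induct) auto

lemma horner_closed: "f \<in> carrier R \<Longrightarrow> (\<And>d. d < D \<Longrightarrow> g d \<in> carrier R) \<Longrightarrow> horner f D g \<in> carrier R"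
  by (induction D) auto

lemma poly_at_closed: "set fs \<subseteq> carrier R \<Longrightarrow> (\<And>es. k es \<in> carrier R) \<Longrightarrow> poly_at D fs k \<in> carrier R"
  by (induction fs arbitrary: k) (auto intro!: horner_closed simp del: horner.simps)

lemma horner_leading:
  assumes f: "f \<in> carrier R" and g: "\<And>d. g d \<in> carrier R" and z: "\<And>d. d < d0 \<Longrightarrow> g d = \<zero>"
  shows "d0 \<le> D \<Longrightarrow> \<exists>r\<in>carrier R. horner f (Suc D) g = f [^] d0 \<otimes> (g d0 \<oplus> f \<otimes> r)"
proof (induction D rule: dec_induct)
  case base
  have "horner f d g = \<zero>" if "d \<le> d0" for d
    using that by (induction d) (auto simp: z f)
  thus ?case using f g by (intro bexI[of _ \<zero>]) auto
next
  case (step D)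
  then obtain r where r: "r \<in> carrier R" "horner f (Suc D) g = f [^] d0 \<otimes> (g d0 \<oplus> f \<otimes> r)" by blast
  obtain n where n: "Suc D = d0 + Suc n" using step(1) by (metis add_Suc_right le_add_diff_inverse)
  have pow: "f [^] Suc D = f [^] d0 \<otimes> (f \<otimes> f [^] n)"
    using f unfolding n by (simp add: nat_pow_mult[symmetric] m_ac)
  have "horner f (Suc (Suc D)) g = horner f (Suc D) g \<oplus> f [^] Suc D \<otimes> g (Suc D)" by simp
  also have "\<dots> = f [^] d0 \<otimes> (g d0 \<oplus> f \<otimes> (r \<oplus> f [^] n \<otimes> g (Suc D)))"
    unfolding pow r(2) using r(1) f g by (simp add: r_distr a_ac m_ac)
  finally show ?case using r(1) f g by (intro bexI[of _ "r \<oplus> f [^] n \<otimes> g (Suc D)"]) auto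
qed

lemma horner_zero: "f \<in> carrier R \<Longrightarrow> (\<And>d. d < D \<Longrightarrow> g d = \<zero>) \<Longrightarrow> horner f D g = \<zero>"
  by (induction D) auto

lemma poly_at_zero: "set fs \<subseteq> carrier R \<Longrightarrow> (\<And>es. es \<in> set (exponents D (length fs)) \<Longrightarrow> k es = \<zero>) \<Longrightarrow> poly_at D fs k = \<zero>"
proof (induction fs arbitrary: k)
  case (Cons f fs)
  have "poly_at D fs (\<lambda>es. k (d # es)) = \<zero>" if "d < Suc D" for d
    using that Cons.prems(1)
    by (intro Cons.IH Cons.prems(2)) (auto simp: set_exponents_Suc simp del: exponents.simps)
  thus ?case using Cons.prems(1) by (auto intro!: horner_zero simp del: horner.simps)
qed simp

text \<open>Elements \<open>fs ! i \<in> P (j + i + 1) - P (j + i)\<close> of a chain of primes satisfy no polynomial relation over the field. Order the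
  relation by powers of the first element \<open>f\<close>. Since \<open>f\<close> is not in the prime ideal \<open>P j\<close>, the lowest power of \<open>f\<close> can be cancelled; since \<open>f\<close> is
  in \<open>P (j + 1)\<close>, the lowest coefficient then lies in \<open>P (j + 1)\<close>, and the induction hypothesis for the remaining elements makes it zero.
  This proceeds from the lowest coefficient upwards.\<close>

lemma prime_chain_independent:
  assumes F: "subfield F R" and P: "\<And>i. i \<le> j + length fs \<Longrightarrow> primeideal (P i) R"
    and chain: "\<And>i. i < j + length fs \<Longrightarrow> P i \<subseteq> P (Suc i)"
    and fs: "\<And>i. i < length fs \<Longrightarrow> fs ! i \<in> P (Suc (j + i)) - P (j + i)"
    and k: "\<And>es. k es \<in> F" and poly_at: "poly_at D fs k \<in> P j" and es: "es \<in> set (exponents D (length fs))"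
  shows "k es = \<zero>"
  using P chain fs k poly_at es
proof (induction fs arbitrary: j k es)
  case Nil
  interpret P: primeideal "P j" R using Nil.prems(1) by simp
  have "k [] \<in> P j" "es = []" using Nil.prems by simp_all
  show ?case
  proof (rule ccontr)
    assume "k es \<noteq> \<zero>"
    hence "inv (k es) \<otimes> k es = \<one>" "inv (k es) \<in> carrier R"
      using subfield_m_inv[OF F, of "k es"] Nil.prems(4) subfieldE(3)[OF F] by auto
    hence "\<one> \<in> P j" using P.I_l_closed[of "k es" "inv (k es)"] \<open>k [] \<in> P j\<close> \<open>es = []\<close> by simp
    thus False using P.I_notcarr P.one_imp_carrier by simp
  qed
next
  case (Cons f fs)
  interpret P: primeideal "P j" R using Cons.prems(1) by simp
  interpret P': primeideal "P (Suc j)" R using Cons.prems(1)[of "Suc j"] by simp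
  have F: "F \<subseteq> carrier R" by (rule subfieldE(3)[OF F])
  have f: "f \<in> P (Suc j)" "f \<notin> P j" using Cons.prems(3)[of 0] by auto
  have fR: "f \<in> carrier R" using f(1) P'.a_subset by blast
  have fsR: "set fs \<subseteq> carrier R"
  proof
    fix x assume "x \<in> set fs"
    then obtain i where i: "i < length fs" "x = fs ! i" by (auto simp: in_set_conv_nth)
    hence "x \<in> P (Suc (j + Suc i))" using Cons.prems(3)[of "Suc i"] by auto
    moreover have "primeideal (P (Suc (j + Suc i))) R" using Cons.prems(1) i by simp
    ultimately show "x \<in> carrier R" using primeideal.axioms(1) ideal.axioms(1) additive_subgroup.a_subset by blast
  qed
  define g where "g d = poly_at D fs (\<lambda>es. k (d # es))" for d
  have gR: "g d \<in> carrier R" for d unfolding g_def using fsR Cons.prems(4) F by (intro poly_at_closed) auto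
  have IH: "\<forall>es\<in>set (exponents D (length fs)). k (d # es) = \<zero>" if "g d \<in> P (Suc j)" for d
  proof
    fix es assume es: "es \<in> set (exponents D (length fs))"
    show "k (d # es) = \<zero>"
    proof (rule Cons.IH[of "Suc j" "\<lambda>es. k (d # es)"])
      show "poly_at D fs (\<lambda>es. k (d # es)) \<in> P (Suc j)" using that by (simp add: g_def)
      show "fs ! i \<in> P (Suc (Suc j + i)) - P (Suc j + i)" if "i < length fs" for i
        using Cons.prems(3)[of "Suc i"] that by simp
    qed (use Cons.prems(1,2,4) es in auto)
  qed
  have all: "\<forall>es\<in>set (exponents D (length fs)). k (d # es) = \<zero>" if "d \<le> D" for d
    using that
  proof (induction d rule: less_induct)
    case (less d)
    have "g d' = \<zero>" if "d' < d" for d'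
      unfolding g_def using less that by (intro poly_at_zero fsR) auto
    then obtain r where r: "r \<in> carrier R" "horner f (Suc D) g = f [^] d \<otimes> (g d \<oplus> f \<otimes> r)"
      using horner_leading[of f g d D] fR gR less.prems by blast
    have "f [^] d \<otimes> (g d \<oplus> f \<otimes> r) \<in> P j"
      using Cons.prems(5) r(2) unfolding g_def by simp
    moreover have "f [^] n \<notin> P j" for n :: nat
    proof (induction n)
      case 0
      show ?case using P.I_notcarr P.one_imp_carrier by auto
    next
      case (Suc n)
      thus ?case using P.I_prime[of "f [^] n" f] f(2) fR by auto
    qed
    ultimately have "g d \<oplus> f \<otimes> r \<in> P j"
      using P.I_prime[of "f [^] d" "g d \<oplus> f \<otimes> r"] fR gR r(1) by auto
    hence 1: "g d \<oplus> f \<otimes> r \<in> P (Suc j)" using Cons.prems(2)[of j] by auto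
    have 2: "f \<otimes> r \<in> P (Suc j)" using P'.I_r_closed[OF f(1) r(1)] .
    have "g d = (g d \<oplus> f \<otimes> r) \<ominus> f \<otimes> r" using fR gR r(1) by (simp add: minus_eq a_assoc r_neg)
    also have "\<dots> \<in> P (Suc j)" unfolding minus_eq by (rule P'.a_closed[OF 1 P'.a_inv_closed[OF 2]])
    finally show ?case by (rule IH)
  qed
  obtain d es' where "es = d # es'" "d \<le> D" "es' \<in> set (exponents D (length fs))"
    using Cons.prems(6) by (auto simp del: upt_Suc)
  thus ?case using all by blast
qed

subsection \<open>Algebraic dependence by counting monomials\<close>

inductive_set lincomb :: "'a set \<Rightarrow> 'a set \<Rightarrow> 'a set" for F B where
  zero: "\<zero> \<in> lincomb F B"
| step: "c \<in> F \<Longrightarrow> b \<in> B \<Longrightarrow> v \<in> lincomb F B \<Longrightarrow> c \<otimes> b \<oplus> v \<in> lincomb F B"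

context
  fixes F
  assumes F: "subfield F R"
begin

lemma F_carrier: "c \<in> F \<Longrightarrow> c \<in> carrier R" using subfieldE(3)[OF F] by blast

lemma F_closed: "\<one> \<in> F" "c \<in> F \<Longrightarrow> d \<in> F \<Longrightarrow> c \<otimes> d \<in> F" "c \<in> F \<Longrightarrow> \<ominus> c \<in> F"
  using subringE[OF subfieldE(1)[OF F]] by auto

lemma lincomb_carrier: "B \<subseteq> carrier R \<Longrightarrow> v \<in> lincomb F B \<Longrightarrow> v \<in> carrier R"
  by (rotate_tac, induction rule: lincomb.induct) (auto simp: F_carrier subset_iff)

lemma lincomb_add: "B \<subseteq> carrier R \<Longrightarrow> u \<in> lincomb F B \<Longrightarrow> v \<in> lincomb F B \<Longrightarrow> u \<oplus> v \<in> lincomb F B"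
proof (rotate_tac, induction rule: lincomb.induct)
  case zero
  thus ?case using lincomb_carrier by simp
next
  case (step c b w)
  have "(c \<otimes> b \<oplus> w) \<oplus> v = c \<otimes> b \<oplus> (w \<oplus> v)"
    using step lincomb_carrier F_carrier by (intro a_assoc) auto
  thus ?case using step by (auto intro: lincomb.step)
qed

lemma lincomb_base: "B \<subseteq> carrier R \<Longrightarrow> b \<in> B \<Longrightarrow> b \<in> lincomb F B"
  using lincomb.step[OF F_closed(1) _ lincomb.zero, of b B] by auto

lemma lincomb_smult: "B \<subseteq> carrier R \<Longrightarrow> c \<in> F \<Longrightarrow> v \<in> lincomb F B \<Longrightarrow> c \<otimes> v \<in> lincomb F B"
proof (rotate_tac 2, induction rule: lincomb.induct)
  case zero
  thus ?case using F_carrier by (simp add: lincomb.zero)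
next
  case (step a b w)
  have "c \<otimes> (a \<otimes> b \<oplus> w) = (c \<otimes> a) \<otimes> b \<oplus> c \<otimes> w"
    using step lincomb_carrier F_carrier by (subst r_distr) (auto simp: m_assoc)
  thus ?case using step F_closed by (auto intro: lincomb.step)
qed

lemma lincomb_mono: "B \<subseteq> B' \<Longrightarrow> lincomb F B \<subseteq> lincomb F B'"
proof
  fix v assume B: "B \<subseteq> B'" and "v \<in> lincomb F B"
  from this(2) show "v \<in> lincomb F B'" by induction (use B in \<open>auto intro: lincomb.intros\<close>)
qed

lemma lincomb_mult:
  assumes B: "B \<subseteq> carrier R" "B' \<subseteq> carrier R" "B'' \<subseteq> carrier R"
    and mult: "\<And>b b'. b \<in> B \<Longrightarrow> b' \<in> B' \<Longrightarrow> b \<otimes> b' \<in> B''"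
    and u: "u \<in> lincomb F B" and v: "v \<in> lincomb F B'"
  shows "u \<otimes> v \<in> lincomb F B''"
  using u
proof induction
  case zero
  show ?case using lincomb_carrier[OF B(2) v] by (simp add: lincomb.zero)
next
  case (step c b w)
  have bv: "b \<otimes> v \<in> lincomb F B''"
    using v
  proof induction
    case zero
    show ?case using step(2) B(1) by (auto simp: lincomb.zero subset_iff)
  next
    case (step c' b' w')
    have "b \<otimes> (c' \<otimes> b' \<oplus> w') = c' \<otimes> (b \<otimes> b') \<oplus> b \<otimes> w'"
      using step lincomb_carrier[OF B(2)] F_carrier \<open>b \<in> B\<close> B by (subst r_distr) (auto simp: m_lcomm subset_iff)
    thus ?case using step mult[OF \<open>b \<in> B\<close>] by (auto intro: lincomb.step)
  qed
  have "(c \<otimes> b \<oplus> w) \<otimes> v = c \<otimes> (b \<otimes> v) \<oplus> w \<otimes> v"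
    using step lincomb_carrier[OF B(2) v] lincomb_carrier[OF B(1)] F_carrier B(1) by (subst l_distr) (auto simp: m_assoc subset_iff)
  thus ?case using lincomb_add[OF B(3) lincomb_smult[OF B(3) step(1) bv] step.IH] by simp
qed

lemma lincomb_Span:
  assumes "set Bs \<subseteq> carrier R" "v \<in> lincomb F (set Bs)"
  shows "v \<in> Span F Bs"
  using assms(2)
proof induction
  case zero
  show ?case using Span_subgroup_props(2)[OF F assms(1)] .
next
  case (step c b v)
  have "b \<in> Span F Bs" using Span_base_incl[OF F assms(1)] step(2) by blast
  thus ?case using step Span_subgroup_props(3)[OF F assms(1)] Span_smult_closed[OF F assms(1)] by blast
qed

lemma length_le_if_independent_in_Span:
  assumes "set Vs \<subseteq> carrier R" "independent F Us" "set Us \<subseteq> Span F Vs"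
  shows "length Us \<le> length Vs"
  using assms
proof -
  have "\<exists>Ws. independent F Ws \<and> Span F Ws = Span F Vs \<and> length Ws \<le> length Vs"
    using assms(1)
  proof (induction Vs)
    case (Cons v Vs)
    then obtain Ws where Ws: "independent F Ws" "Span F Ws = Span F Vs" "length Ws \<le> length Vs" by auto
    show ?case
    proof (cases "v \<in> Span F Vs")
      case True
      have "Span F (v # Vs) \<subseteq> Span F Vs"
        using True Cons.prems by (intro mono_Span_subset[OF F]) (use Span_base_incl[OF F] in auto)
      moreover have "Span F Vs \<subseteq> Span F (v # Vs)" using Cons.prems by (intro mono_Span[OF F]) auto
      ultimately show ?thesis using Ws by auto
    next
      case False
      have "Span F (v # Ws) = Span F (v # Vs)" using Ws(2) by simp
      moreover have "independent F (v # Ws)" using Cons.prems False Ws by (intro li_Cons) auto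
      ultimately show ?thesis using Ws(3) by (intro exI[of _ "v # Ws"]) auto
    qed
  qed auto
  then obtain Ws where Ws: "independent F Ws" "Span F Ws = Span F Vs" "length Ws \<le> length Vs" by blast
  have "length Us \<le> length Ws" by (rule independent_length_le[OF F assms(2) Ws(1)]) (use assms(3) Ws(2) in simp)
  thus ?thesis using Ws(3) by simp
qed

definition monoms :: "'a list \<Rightarrow> nat \<Rightarrow> 'a set" where
  "monoms xs d = monom_at xs ` set (exponents d (length xs))"

lemma monoms_carrier: "set xs \<subseteq> carrier R \<Longrightarrow> monoms xs d \<subseteq> carrier R"
  by (auto simp: monoms_def)

lemma monom_at_mult: "set xs \<subseteq> carrier R \<Longrightarrow> length es = length xs \<Longrightarrow> length es' = length xs \<Longrightarrow>
  monom_at xs es \<otimes> monom_at xs es' = monom_at xs (map2 (+) es es')"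
proof (induction xs arbitrary: es es')
  case (Cons x xs)
  then obtain e fs e' fs' where es: "es = e # fs" "es' = e' # fs'" by (metis length_Suc_conv list.size(4) add.right_neutral add_Suc_right)
  have "monom_at xs fs \<otimes> monom_at xs fs' = monom_at xs (map2 (+) fs fs')" using Cons es by simp
  thus ?case using Cons.prems(1) unfolding es by (simp add: nat_pow_mult[symmetric] m_ac)
qed simp

lemma monoms_mult:
  assumes xs: "set xs \<subseteq> carrier R" and b: "b \<in> monoms xs d" "b' \<in> monoms xs d'"
  shows "b \<otimes> b' \<in> monoms xs (d + d')"
proof -
  obtain es es' where es: "length es = length xs" "set es \<subseteq> {..d}" "b = monom_at xs es"
    "length es' = length xs" "set es' \<subseteq> {..d'}" "b' = monom_at xs es'"
    using b by (auto simp: monoms_def set_exponents)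
  have "set (map2 (+) es es') \<subseteq> {..d + d'}"
  proof
    fix y assume "y \<in> set (map2 (+) es es')"
    then obtain a b where "a \<in> set es" "b \<in> set es'" "y = a + b" using set_zip_leftD set_zip_rightD by fastforce
    hence "a \<le> d" "b \<le> d'" using es by auto
    thus "y \<in> {..d + d'}" using \<open>y = a + b\<close> by simp
  qed
  thus ?thesis using es monom_at_mult[OF xs es(1,4)] by (auto simp: monoms_def set_exponents)
qed

lemma monoms_mono: "d \<le> d' \<Longrightarrow> monoms xs d \<subseteq> monoms xs d'"
  unfolding monoms_def set_exponents by (intro image_mono) auto

lemma monom_at_zeros: "set xs \<subseteq> carrier R \<Longrightarrow> monom_at xs (replicate (length xs) 0) = \<one>"
  by (induction xs) auto

lemma one_monoms: "set xs \<subseteq> carrier R \<Longrightarrow> \<one> \<in> monoms xs d"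
  unfolding monoms_def using monom_at_zeros[of xs] by (intro image_eqI[of _ _ "replicate (length xs) 0"]) (auto simp: set_exponents)

lemma var_monoms: "set xs \<subseteq> carrier R \<Longrightarrow> x \<in> set xs \<Longrightarrow> x \<in> monoms xs 1"
proof (induction xs)
  case (Cons y xs)
  show ?case
  proof (cases "x = y")
    case True
    have "monom_at (y # xs) (1 # replicate (length xs) 0) = x" using monom_at_zeros[of xs] Cons.prems True by simp
    thus ?thesis unfolding monoms_def by (intro image_eqI[of _ _ "1 # replicate (length xs) 0"]) (auto simp: set_exponents)
  next
    case False
    then obtain es where "length es = length xs" "set es \<subseteq> {..1}" "x = monom_at xs es"
      using Cons by (auto simp: monoms_def set_exponents)
    thus ?thesis using Cons.prems unfolding monoms_def by (intro image_eqI[of _ _ "0 # es"]) (auto simp: set_exponents)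
  qed
qed simp

lemma generated_lincomb:
  assumes xs: "set xs \<subseteq> carrier R" and f: "f \<in> generate_ring R (F \<union> set xs)"
  shows "\<exists>d. f \<in> lincomb F (monoms xs d)"
proof -
  note mc = monoms_carrier[OF xs]
  have mono: "f \<in> lincomb F (monoms xs d')" if "f \<in> lincomb F (monoms xs d)" "d \<le> d'" for f d d'
    using lincomb_mono[OF monoms_mono[OF that(2)]] that(1) by blast
  have F_lincomb: "c \<in> lincomb F (monoms xs 0)" if "c \<in> F" for c
    using lincomb_smult[OF mc that lincomb_base[OF mc one_monoms[OF xs]]] F_carrier[OF that] by simp
  show ?thesis using f
  proof induction
    case one
    show ?case using F_lincomb[OF F_closed(1)] by blast
  next
    case (incl h)
    thus ?case using F_lincomb lincomb_base[OF mc var_monoms[OF xs]] by blast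
  next
    case (a_inv h)
    then obtain d where d: "h \<in> lincomb F (monoms xs d)" by blast
    hence "\<ominus> h = \<ominus> \<one> \<otimes> h" using lincomb_carrier[OF mc] by (simp add: l_minus)
    thus ?case using lincomb_smult[OF mc F_closed(3)[OF F_closed(1)] d] by auto
  next
    case (eng_add h1 h2)
    then obtain d1 d2 where "h1 \<in> lincomb F (monoms xs d1)" "h2 \<in> lincomb F (monoms xs d2)" by blast
    hence "h1 \<in> lincomb F (monoms xs (d1 + d2))" "h2 \<in> lincomb F (monoms xs (d1 + d2))" using mono by auto
    thus ?case using lincomb_add[OF mc] by blast
  next
    case (eng_mult h1 h2)
    then obtain d1 d2 where d: "h1 \<in> lincomb F (monoms xs d1)" "h2 \<in> lincomb F (monoms xs d2)" by blast
    show ?case using lincomb_mult[OF mc mc mc monoms_mult[OF xs] d] by blast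
  qed
qed

lemma pow_lincomb:
  assumes xs: "set xs \<subseteq> carrier R" and f: "f \<in> lincomb F (monoms xs d)"
  shows "f [^] (n::nat) \<in> lincomb F (monoms xs (n * d))"
proof (induction n)
  case 0
  show ?case using lincomb_base[OF monoms_carrier[OF xs] one_monoms[OF xs]] by simp
next
  case (Suc n)
  have "f [^] n \<otimes> f \<in> lincomb F (monoms xs (n * d + d))"
    by (rule lincomb_mult[OF monoms_carrier[OF xs] monoms_carrier[OF xs] monoms_carrier[OF xs] monoms_mult[OF xs] Suc f])
  thus ?case by (simp add: add.commute)
qed

lemma monom_at_lincomb:
  assumes xs: "set xs \<subseteq> carrier R"
  shows "(\<And>f. f \<in> set fs \<Longrightarrow> f \<in> lincomb F (monoms xs d)) \<Longrightarrow> es \<in> set (exponents D (length fs)) \<Longrightarrow>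
    monom_at fs es \<in> lincomb F (monoms xs (length fs * (D * d)))"
proof (induction fs arbitrary: es)
  case Nil
  thus ?case using lincomb_base[OF monoms_carrier[OF xs] one_monoms[OF xs]] by simp
next
  case (Cons f fs)
  then obtain e es' where es: "es = e # es'" "e \<le> D" "es' \<in> set (exponents D (length fs))"
    by (auto simp: set_exponents length_Suc_conv)
  have "f [^] e \<in> lincomb F (monoms xs (e * d))" using Cons.prems(1) by (intro pow_lincomb[OF xs]) simp
  hence 1: "f [^] e \<in> lincomb F (monoms xs (D * d))" using lincomb_mono[OF monoms_mono[of "e * d" "D * d"]] es(2) by auto
  have 2: "monom_at fs es' \<in> lincomb F (monoms xs (length fs * (D * d)))" using Cons es(3) by simp
  have "f [^] e \<otimes> monom_at fs es' \<in> lincomb F (monoms xs (D * d + length fs * (D * d)))"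
    by (rule lincomb_mult[OF monoms_carrier[OF xs] monoms_carrier[OF xs] monoms_carrier[OF xs] monoms_mult[OF xs] 1 2])
  thus ?case by (simp add: es(1))
qed

lemma combine_concat:
  assumes len: "\<And>d. length (Ks d) = length (Us d)" and car: "\<And>d. set (Ks d) \<subseteq> carrier R" "\<And>d. set (Us d) \<subseteq> carrier R"
  shows "combine (concat (map Ks (ds @ [d']))) (concat (map Us (ds @ [d']))) = 
    combine (concat (map Ks ds)) (concat (map Us ds)) \<oplus> combine (Ks d') (Us d')"
proof -
  have "length (concat (map Ks ds)) = length (concat (map Us ds))"
    using len by (induction ds) auto
  moreover have "set (concat (map Ks ds)) \<subseteq> carrier R" "set (concat (map Us ds)) \<subseteq> carrier R"
    using car by auto
  ultimately show ?thesis using combine_append[OF _ _ _ car(1)[of d'] car(2)[of d']] by simp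
qed

lemma combine_poly_at:
  assumes "set fs \<subseteq> carrier R" "\<And>es. k es \<in> carrier R"
  shows "combine (map k (exponents D (length fs))) (map (monom_at fs) (exponents D (length fs))) = poly_at D fs k"
  using assms
proof (induction fs arbitrary: k)
  case (Cons f fs)
  have f: "f \<in> carrier R" and fs: "set fs \<subseteq> carrier R" using Cons.prems by auto
  let ?L = "exponents D (length fs)"
  have scale: "combine (map h L) (map (\<lambda>es. c \<otimes> monom_at fs es) L) = c \<otimes> combine (map h L) (map (monom_at fs) L)"
    if "c \<in> carrier R" "\<And>es. h es \<in> carrier R" for h c L
  proof (induction L)
    case (Cons e L)
    have "combine (map h L) (map (monom_at fs) L) \<in> carrier R"
      using that fs by (intro combine_in_carrier) auto
    thus ?case using Cons that fs by (simp add: r_distr m_lcomm)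
  qed (use that in simp)
  have "combine (concat (map (\<lambda>d. map (\<lambda>es. k (d # es)) ?L) [0..<n])) (concat (map (\<lambda>d. map (\<lambda>es. monom_at (f # fs) (d # es)) ?L) [0..<n]))
     = horner f n (\<lambda>d. poly_at D fs (\<lambda>es. k (d # es)))" for n
  proof (induction n)
    case (Suc n)
    have "combine (map (\<lambda>es. k (n # es)) ?L) (map (\<lambda>es. monom_at (f # fs) (n # es)) ?L) = f [^] n \<otimes> poly_at D fs (\<lambda>es. k (n # es))"
      using scale[of "f [^] n" "\<lambda>es. k (n # es)" ?L] f Cons.prems(2) Cons.IH[OF fs, of "\<lambda>es. k (n # es)"] by simp
    moreover have "set (map (\<lambda>es. k (d # es)) ?L) \<subseteq> carrier R" "set (map (\<lambda>es. monom_at (f # fs) (d # es)) ?L) \<subseteq> carrier R" for d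
      using Cons.prems(2) f fs by auto
    ultimately show ?case
      using combine_concat[of "\<lambda>d. map (\<lambda>es. k (d # es)) ?L" "\<lambda>d. map (\<lambda>es. monom_at (f # fs) (d # es)) ?L" "[0..<n]" n] Suc
      by simp
  qed simp
  from this[of "Suc D"] show ?case by (simp add: map_concat o_def del: upt_Suc horner.simps)
qed (use assms in simp)

text \<open>More than \<open>length xs\<close> polynomials in the \<open>xs\<close> are algebraically dependent, by counting: products of the \<open>fs\<close> with exponents up to
  \<open>D\<close> are more numerous than the monomials in the \<open>xs\<close> needed to express them.\<close>

lemma algebraic_dependence:
  assumes xs: "set xs \<subseteq> carrier R" and len: "length fs = Suc (length xs)"
    and fs: "\<And>f. f \<in> set fs \<Longrightarrow> f \<in> generate_ring R (F \<union> set xs)"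
  shows "\<exists>D k. (\<forall>es. k es \<in> F) \<and> poly_at D fs k = \<zero> \<and> (\<exists>es\<in>set (exponents D (length fs)). k es \<noteq> \<zero>)"
proof -
  have "\<exists>d. \<forall>f\<in>set fs. f \<in> lincomb F (monoms xs d)"
    using fs
  proof (induction fs)
    case (Cons f fs)
    then obtain d where d: "\<forall>f\<in>set fs. f \<in> lincomb F (monoms xs d)" by auto
    obtain d' where "f \<in> lincomb F (monoms xs d')" using generated_lincomb[OF xs] Cons.prems by auto
    hence "\<forall>f\<in>set (f # fs). f \<in> lincomb F (monoms xs (d + d'))"
      using d lincomb_mono[OF monoms_mono[of d "d + d'" xs]] lincomb_mono[OF monoms_mono[of d' "d + d'" xs]] by auto
    thus ?case by blast
  qed simp
  then obtain d where d: "\<And>f. f \<in> set fs \<Longrightarrow> f \<in> lincomb F (monoms xs d)" by blast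
  let ?n = "length xs"
  \<comment> \<open>The \<open>(D + 1) ^ (n + 1)\<close> products of the \<open>fs\<close> are combinations of at most \<open>(e + 1) ^ n\<close> monomials
    in the \<open>xs\<close>; with this \<open>D\<close> the latter number is at most \<open>D * (D + 1) ^ n\<close>, hence smaller.\<close>
  define D where "D = (Suc ?n * d + 1) ^ ?n"
  define e where "e = Suc ?n * (D * d)"
  have fsR: "set fs \<subseteq> carrier R" using lincomb_carrier[OF monoms_carrier[OF xs]] d by blast
  define Us where "Us = map (monom_at fs) (exponents D (length fs))"
  define Vs where "Vs = map (monom_at xs) (exponents e ?n)"
  have Vs: "set Vs = monoms xs e" "set Vs \<subseteq> carrier R" using monoms_carrier[OF xs] by (auto simp: Vs_def monoms_def)
  have "set Us \<subseteq> Span F Vs"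
  proof
    fix u assume "u \<in> set Us"
    then obtain es where "es \<in> set (exponents D (length fs))" "u = monom_at fs es" by (auto simp: Us_def)
    hence "u \<in> lincomb F (set Vs)" using monom_at_lincomb[OF xs, of fs d es D] d unfolding Vs(1) e_def len by simp
    thus "u \<in> Span F Vs" by (rule lincomb_Span[OF Vs(2)])
  qed
  moreover have "length Vs < length Us"
  proof -
    have "e + 1 \<le> (Suc ?n * d + 1) * Suc D" by (simp add: e_def algebra_simps)
    hence "(e + 1) ^ ?n \<le> ((Suc ?n * d + 1) * Suc D) ^ ?n" by (rule power_mono) simp
    also have "\<dots> = D * Suc D ^ ?n" by (simp only: power_mult_distrib D_def)
    also have "\<dots> < Suc D * Suc D ^ ?n" by simp
    finally show ?thesis by (simp add: Us_def Vs_def length_exponents len del: exponents.simps)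
  qed
  ultimately have dep: "dependent F Us"
    using length_le_if_independent_in_Span[OF Vs(2), of Us] by fastforce
  have UsR: "set Us \<subseteq> carrier R" using fsR by (auto simp: Us_def)
  obtain Ks where Ks: "length Ks = length Us" "combine Ks Us = \<zero>" "set Ks \<subseteq> F" "set Ks \<noteq> {\<zero>}"
    using dependent_imp_non_trivial_combine[OF F UsR dep] by blast
  let ?L = "exponents D (length fs)"
  define k where "k es = (case map_of (zip ?L Ks) es of Some c \<Rightarrow> c | None \<Rightarrow> \<zero>)" for es
  have lenK: "length ?L = length Ks" using Ks(1) by (simp add: Us_def)
  have kL: "map k ?L = Ks"
  proof (rule nth_equalityI)
    fix i assume "i < length (map k ?L)"
    hence i: "i < length ?L" by simp
    have "map_of (zip ?L Ks) (?L ! i) = Some (Ks ! i)"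
      using map_of_zip_nth[OF lenK distinct_exponents] i lenK by simp
    thus "map k ?L ! i = Ks ! i" using i by (simp add: k_def)
  qed (simp add: lenK)
  have kF: "k es \<in> F" for es
  proof (cases "map_of (zip ?L Ks) es")
    case None
    thus ?thesis using subringE(2)[OF subfieldE(1)[OF F]] by (simp add: k_def)
  next
    case (Some c)
    hence "c \<in> set Ks" using map_of_SomeD set_zip_rightD by metis
    thus ?thesis using Ks(3) Some by (auto simp: k_def)
  qed
  have "poly_at D fs k = \<zero>"
    using combine_poly_at[OF fsR, of k D] kF F_carrier Ks(2) unfolding kL Us_def by simp
  moreover have "Ks \<noteq> []" using lenK by (auto simp: length_exponents dest!: arg_cong[of _ _ length])
  hence "\<exists>es\<in>set ?L. k es \<noteq> \<zero>"
    using Ks(4) unfolding kL[symmetric] by (cases ?L) auto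
  ultimately show ?thesis using kF by blast
qed

text \<open>Elements that witness the strict inclusions may be multiplied by units and so be taken among the polynomials in the \<open>xs\<close>. They are
  independent by \<open>prime_chain_independent\<close>, and there are at most \<open>length xs\<close> independent ones.\<close>

lemma prime_chain_length:
  assumes xs: "set xs \<subseteq> carrier R" 
    and frac: "\<And>r. r \<in> carrier R \<Longrightarrow> \<exists>g\<in>Units R. g \<otimes> r \<in> generate_ring R (F \<union> set xs)"
    and P: "\<And>i. i \<le> N \<Longrightarrow> primeideal (P i) R" and chain: "\<And>i. i < N \<Longrightarrow> P i \<subset> P (Suc i)"
  shows "N \<le> length xs"
proof (rule ccontr)
  assume "\<not> N \<le> length xs"
  hence N: "Suc (length xs) \<le> N" by simp
  have "\<exists>f. f \<in> P (Suc i) - P i \<and> f \<in> generate_ring R (F \<union> set xs)" if i: "i < N" for i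
  proof -
    interpret P: primeideal "P i" R using P i by simp
    interpret P': primeideal "P (Suc i)" R using P i by simp
    obtain a where a: "a \<in> P (Suc i)" "a \<notin> P i" using chain[OF i] by blast
    have aR: "a \<in> carrier R" using a(1) P'.a_subset by blast
    obtain g where g: "g \<in> Units R" "g \<otimes> a \<in> generate_ring R (F \<union> set xs)" using frac[OF aR] by blast
    have gR: "g \<in> carrier R" by (rule Units_closed[OF g(1)])
    have "g \<otimes> a \<notin> P i"
    proof
      assume "g \<otimes> a \<in> P i"
      hence "inv g \<otimes> (g \<otimes> a) \<in> P i" using P.I_l_closed[of "g \<otimes> a" "inv g"] g(1) by simp
      moreover have "inv g \<otimes> (g \<otimes> a) = a" using g(1) gR aR by (simp add: m_assoc[symmetric])
      ultimately show False using a(2) by simp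
    qed
    thus ?thesis using P'.I_l_closed[OF a(1) gR] g(2) by blast
  qed
  then obtain f where f: "\<And>i. i < N \<Longrightarrow> f i \<in> P (Suc i) - P i \<and> f i \<in> generate_ring R (F \<union> set xs)" by metis
  define fs where "fs = map f [0..<Suc (length xs)]"
  have len: "length fs = Suc (length xs)" by (simp add: fs_def)
  have gen: "g \<in> generate_ring R (F \<union> set xs)" if "g \<in> set fs" for g
    using that f N by (auto simp: fs_def simp del: upt_Suc)
  obtain D k es where k: "\<forall>es. k es \<in> F" "poly_at D fs k = \<zero>" "es \<in> set (exponents D (length fs))" "k es \<noteq> \<zero>"
    using algebraic_dependence[OF xs len gen] by blast
  interpret P: primeideal "P 0" R using P by simp
  have "k es = \<zero>"
  proof (rule prime_chain_independent[OF F, where j = 0 and fs = fs and P = P and D = D])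
    show "primeideal (P i) R" if "i \<le> 0 + length fs" for i using P that N len by simp
    show "P i \<subseteq> P (Suc i)" if "i < 0 + length fs" for i using chain[of i] that N len by (simp add: psubset_eq)
    show "fs ! i \<in> P (Suc (0 + i)) - P (0 + i)" if "i < length fs" for i
      using f[of i] that N by (simp add: fs_def del: upt_Suc)
  qed (use k in auto)
  thus False using k(4) by simp
qed

end

end

section \<open>A criterion for regularity\<close>

context cring
begin

text \<open>Up to units, every ideal is generated by its intersection with \<open>S\<close>.\<close>

lemma noetherian_if_fractions:
  assumes S: "noeth S" "subring S R" and frac: "\<And>r. r \<in> carrier R \<Longrightarrow> \<exists>g\<in>Units R. g \<otimes> r \<in> S"
  shows "noetherian_ring R"
proof (rule noetherian_ringI)
  fix J assume J: "ideal J R"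
  interpret J: ideal J R by (rule J)
  have SR: "S \<subseteq> carrier R" using subringE(1)[OF S(2)] .
  have Sid: "subset_ideal S (I \<inter> S)" if I: "ideal I R" for I
  proof -
    interpret I: ideal I R by (rule I)
    show ?thesis
    proof (rule sidealI)
      show "\<zero> \<in> I \<inter> S" using I.zero_closed subringE(2)[OF S(2)] by blast
      show "x \<oplus> y \<in> I \<inter> S" if "x \<in> I \<inter> S" "y \<in> I \<inter> S" for x y
        using that I.a_closed[of x y] subringE(7)[OF S(2), of x y] by blast
      show "a \<otimes> x \<in> I \<inter> S" if "a \<in> S" "x \<in> I \<inter> S" for a x
        using that I.I_l_closed[of x a] SR subringE(6)[OF S(2), of a x] by blast
    qed blast
  qed
  obtain H where H: "finite H" "H \<subseteq> J \<inter> S" "\<And>J'. subset_ideal S J' \<Longrightarrow> H \<subseteq> J' \<Longrightarrow> J \<inter> S \<subseteq> J'"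
    using S(1) Sid[OF J] unfolding noeth_def by meson
  have HR: "H \<subseteq> carrier R" using H(2) SR by blast
  interpret G: ideal "Idl H" R by (rule genideal_ideal[OF HR])
  have "J \<inter> S \<subseteq> Idl H \<inter> S"
    by (rule H(3)[OF Sid[OF G.ideal_axioms]]) (use genideal_self[OF HR] H(2) in blast)
  hence JS: "J \<inter> S \<subseteq> Idl H" by blast
  have "J = Idl H"
  proof
    show "Idl H \<subseteq> J" by (rule genideal_minimal[OF J]) (use H(2) in blast)
    show "J \<subseteq> Idl H"
    proof
      fix r assume r: "r \<in> J"
      have rR: "r \<in> carrier R" using r J.a_subset by blast
      obtain g where g: "g \<in> Units R" "g \<otimes> r \<in> S" using frac[OF rR] by blast
      have "g \<otimes> r \<in> Idl H" using JS J.I_l_closed[OF r Units_closed[OF g(1)]] g(2) by blast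
      hence "inv g \<otimes> (g \<otimes> r) \<in> Idl H" using G.I_l_closed[OF _ Units_inv_closed[OF g(1)]] by blast
      thus "r \<in> Idl H" using g(1) rR by (simp add: m_assoc[symmetric] Units_closed)
    qed
  qed
  thus "\<exists>A\<subseteq>carrier R. finite A \<and> J = Idl A" using HR H(1) by blast
qed

text \<open>The ring behaves like the localization of an algebra \<open>F[xs]\<close> at the point where the \<open>xs\<close> have the values \<open>c\<close>. The elements \<open>y i\<close> generate the
  maximal ideal, so the embedding dimension is at most \<open>n\<close>; the chain \<open>P\<close> shows that the Krull dimension is at least \<open>n\<close>, and it is at
  most \<open>n\<close> by \<open>prime_chain_length\<close>.\<close>

theorem regular_local_ringI:
  assumes F: "subfield F R" and xs: "set xs \<subseteq> carrier R" and n: "n = length xs"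
    and frac: "\<And>r. r \<in> carrier R \<Longrightarrow> \<exists>g\<in>Units R. g \<otimes> r \<in> generate_ring R (F \<union> set xs)"
    and M: "ideal M R" "M \<noteq> carrier R" and units: "\<And>r. r \<in> carrier R \<Longrightarrow> r \<notin> M \<Longrightarrow> r \<in> Units R"
    and y: "\<And>i. i < n \<Longrightarrow> y i \<in> M \<and> (\<exists>c\<in>F. y i = xs ! i \<ominus> c)"
    and P: "\<And>j. j \<le> n \<Longrightarrow> primeideal (P j) R" and chain: "\<And>j. j < n \<Longrightarrow> P j \<subseteq> P (Suc j)"
    and yP: "\<And>i j. i < n \<Longrightarrow> j \<le> n \<Longrightarrow> y i \<in> P j \<longleftrightarrow> i < j"
  shows "regular_local_ring R"
proof -
  interpret M: ideal M R by (rule M)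
  have FR: "c \<in> carrier R" if "c \<in> F" for c using subfieldE(3)[OF F] that by blast
  have unit_M: "r \<notin> M" if "r \<in> Units R" for r
  proof
    assume "r \<in> M"
    hence "inv r \<otimes> r \<in> M" using M.I_l_closed that by blast
    thus False using M.one_imp_carrier M(2) that by simp
  qed
  have unit_F: "c \<in> Units R" if "c \<in> F" "c \<noteq> \<zero>" for c
    using subfield_m_inv[OF F, of c] that FR by (auto simp: Units_def intro!: bexI[of _ "inv c"])
  have yR: "y i \<in> carrier R" if "i < n" for i using y[OF that] M.a_subset by blast
  have noeth: "noetherian_ring R"
  proof -
    have "xs ! i \<in> carrier R" if "i < length xs" for i using xs that by auto
    then obtain S where S: "subring S R" "noeth S" "F \<subseteq> S" "((!) xs) ` {..<length xs} \<subseteq> S"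
      using noeth_adjoin_finitely_many[OF F, of "length xs" "(!) xs"] by blast
    have "set xs \<subseteq> S"
    proof
      fix x assume "x \<in> set xs"
      then obtain i where "i < length xs" "x = xs ! i" by (auto simp: in_set_conv_nth)
      thus "x \<in> S" using S(4) by blast
    qed
    hence "generate_ring R (F \<union> set xs) \<subseteq> S"
      using S(3) FR xs by (intro generate_ring_min_subring1 S(1)) auto
    thus ?thesis using frac by (intro noetherian_if_fractions[OF S(2,1)]) blast
  qed
  have maximal: "maximalideal M R"
  proof (rule maximalidealI[OF M(1)])
    fix J assume J: "ideal J R" "M \<subseteq> J" "J \<subseteq> carrier R"
    interpret J: ideal J R by (rule J)
    show "J = M \<or> J = carrier R"
    proof (cases "J \<subseteq> M")
      case False
      then obtain r where r: "r \<in> J" "r \<notin> M" by blast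
      hence u: "r \<in> Units R" using units J(3) by blast
      hence "inv r \<otimes> r \<in> J" using J.I_l_closed[OF r(1)] by blast
      thus ?thesis using J.one_imp_carrier u by simp
    qed (use J(2) in blast)
  qed (use M(2) in blast)
  have unique: "M' = M" if "maximalideal M' R" for M'
  proof -
    interpret M': maximalideal M' R by (rule that)
    have "M' \<subseteq> M"
    proof
      fix r assume r: "r \<in> M'"
      show "r \<in> M"
      proof (rule ccontr)
        assume "r \<notin> M"
        hence u: "r \<in> Units R" using units r M'.a_subset by blast
        hence "inv r \<otimes> r \<in> M'" using M'.I_l_closed[OF r] by blast
        thus False using M'.one_imp_carrier M'.I_notcarr u by simp
      qed
    qed
    thus ?thesis using M'.I_maximal[OF M(1)] M(2) M.a_subset by blast
  qed
  define Y where "Y = y ` {..<n}"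
  have YR: "Y \<subseteq> carrier R" using yR by (auto simp: Y_def)
  interpret J: ideal "Idl Y" R by (rule genideal_ideal[OF YR])
  have YM: "Idl Y \<subseteq> M" by (rule genideal_minimal[OF M(1)]) (use y in \<open>auto simp: Y_def\<close>)
  \<comment> \<open>Modulo the \<open>y i\<close> every polynomial in the \<open>xs\<close> becomes constant, and a constant in \<open>M\<close> is a non-unit of \<open>F\<close>, hence zero.\<close>
  have const: "\<exists>c\<in>F. f \<ominus> c \<in> Idl Y" if "f \<in> generate_ring R (F \<union> set xs)" for f
  proof -
    have gR: "h \<in> carrier R" if "h \<in> generate_ring R (F \<union> set xs)" for h
      using generate_ring_in_carrier[OF _ that] FR xs by blast
    note Fr = subringE[OF subfieldE(1)[OF F]]
    show ?thesis using that
    proof induction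
      case one
      show ?case using Fr(3) J.zero_closed by (intro bexI[of _ \<one>]) (simp_all add: minus_eq r_neg)
    next
      case (incl h)
      thus ?case
      proof
        assume "h \<in> F"
        thus ?thesis using FR J.zero_closed by (intro bexI[of _ h]) (simp_all add: minus_eq r_neg)
      next
        assume "h \<in> set xs"
        then obtain i where i: "i < n" "h = xs ! i" using n by (auto simp: in_set_conv_nth)
        then obtain c where "c \<in> F" "y i = h \<ominus> c" using y by blast
        moreover have "y i \<in> Idl Y" using genideal_self[OF YR] i(1) by (auto simp: Y_def)
        ultimately show ?thesis by auto
      qed
    next
      case (a_inv h)
      then obtain c where c: "c \<in> F" "h \<ominus> c \<in> Idl Y" by blast
      have "\<ominus> h \<ominus> \<ominus> c = \<ominus> (h \<ominus> c)" using gR[OF a_inv(1)] FR[OF c(1)] by algebra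
      thus ?case using J.a_inv_closed[OF c(2)] Fr(5)[OF c(1)] by metis
    next
      case (eng_add h1 h2)
      then obtain c1 c2 where c: "c1 \<in> F" "h1 \<ominus> c1 \<in> Idl Y" "c2 \<in> F" "h2 \<ominus> c2 \<in> Idl Y" by blast
      have "(h1 \<oplus> h2) \<ominus> (c1 \<oplus> c2) = (h1 \<ominus> c1) \<oplus> (h2 \<ominus> c2)"
        using gR[OF eng_add(1)] gR[OF eng_add(2)] FR[OF c(1)] FR[OF c(3)] by algebra
      thus ?case using J.a_closed[OF c(2,4)] Fr(7)[OF c(1,3)] by metis
    next
      case (eng_mult h1 h2)
      then obtain c1 c2 where c: "c1 \<in> F" "h1 \<ominus> c1 \<in> Idl Y" "c2 \<in> F" "h2 \<ominus> c2 \<in> Idl Y" by blast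
      have "(h1 \<otimes> h2) \<ominus> (c1 \<otimes> c2) = h1 \<otimes> (h2 \<ominus> c2) \<oplus> c2 \<otimes> (h1 \<ominus> c1)"
        using gR[OF eng_mult(1)] gR[OF eng_mult(2)] FR[OF c(1)] FR[OF c(3)] by algebra
      thus ?case using J.a_closed[OF J.I_l_closed[OF c(4) gR[OF eng_mult(1)]] J.I_l_closed[OF c(2) FR[OF c(3)]]]
          Fr(6)[OF c(1,3)] by metis
    qed
  qed
  have M_eq: "M = Idl Y"
  proof
    show "M \<subseteq> Idl Y"
    proof
      fix r assume r: "r \<in> M"
      hence rR: "r \<in> carrier R" using M.a_subset by blast
      obtain g where g: "g \<in> Units R" "g \<otimes> r \<in> generate_ring R (F \<union> set xs)" using frac[OF rR] by blast
      note gR = Units_closed[OF g(1)]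
      obtain c where c: "c \<in> F" "g \<otimes> r \<ominus> c \<in> Idl Y" using const[OF g(2)] by blast
      have grM: "g \<otimes> r \<in> M" by (rule M.I_l_closed[OF r gR])
      have "c = g \<otimes> r \<ominus> (g \<otimes> r \<ominus> c)" using gR rR FR[OF c(1)] by algebra
      also have "\<dots> \<in> M" unfolding minus_eq[of _ "g \<otimes> r \<ominus> c"] 
        by (rule M.a_closed[OF grM M.a_inv_closed]) (use c(2) YM in blast)
      finally have "c = \<zero>" using unit_F[OF c(1)] unit_M by blast
      moreover have "g \<otimes> r \<ominus> \<zero> = g \<otimes> r" using gR rR by algebra
      ultimately have "g \<otimes> r \<in> Idl Y" using c(2) by simp
      hence "inv g \<otimes> (g \<otimes> r) \<in> Idl Y" using J.I_l_closed[OF _ Units_inv_closed[OF g(1)]] by blast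
      thus "r \<in> Idl Y" using g(1) rR gR by (simp add: m_assoc[symmetric])
    qed
  qed (rule YM)
  have "inj_on y {..<n}"
  proof (rule linorder_inj_onI')
    fix i j assume ij: "i \<in> {..<n}" "j \<in> {..<n}" "i < j"
    show "y i \<noteq> y j" using yP[of i j] yP[of j j] ij by auto
  qed
  hence card: "card Y = n" by (simp add: Y_def card_image)
  have dim: "krull_dim R = enat n"
  proof (rule antisym)
    show "krull_dim R \<le> enat n"
      unfolding krull_dim_def
    proof (rule Sup_least)
      fix N' assume "N' \<in> {enat n | n. \<exists>P. (\<forall>i\<le>n. primeideal (P i) R) \<and> (\<forall>i<n. P i \<subset> P (Suc i))}"
      then obtain N P where N: "N' = enat N" "\<And>i. i \<le> N \<Longrightarrow> primeideal (P i) R" "\<And>i. i < N \<Longrightarrow> P i \<subset> P (Suc i)" by blast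
      have "N \<le> length xs" by (rule prime_chain_length[where P = P and N = N, OF F xs frac N(2,3)])
      thus "N' \<le> enat n" using N(1) n by simp
    qed
    \<comment> \<open>The inclusion is strict because of \<open>y j\<close>.\<close>
    have "P j \<subset> P (Suc j)" if "j < n" for j
    proof -
      have "y j \<in> P (Suc j)" "y j \<notin> P j" using yP[of j "Suc j"] yP[of j j] that by auto
      thus ?thesis using chain[OF that] by blast
    qed
    thus "enat n \<le> krull_dim R" unfolding krull_dim_def using P by (intro Sup_upper) blast
  qed
  show ?thesis
  proof -
    have "finite Y \<and> Y \<subseteq> carrier R \<and> M = Idl Y \<and> enat (card Y) = krull_dim R"
      by (intro conjI YR M_eq) (simp_all only: card dim, simp add: Y_def)
    moreover have "\<forall>M'. maximalideal M' R \<longrightarrow> M' = M" using unique by blast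
    ultimately show ?thesis unfolding regular_local_ring_def using is_cring noeth maximal by blast
  qed
qed

end

section \<open>The localization at a prime ideal\<close>

text \<open>Operations on equivalence classes are unions over representatives; this evaluates such a union.\<close>

lemma UN_pairs_const:
  assumes "(a0, b0) \<in> A" "(a1, b1) \<in> B" 
    and eq: "\<And>a b a' b'. (a, b) \<in> A \<Longrightarrow> (a', b') \<in> B \<Longrightarrow> g a b a' b' = C"
  shows "(\<Union>(a, b)\<in>A. \<Union>(a', b')\<in>B. g a b a' b') = C"
proof (intro equalityI subsetI)
  fix x assume "x \<in> (\<Union>(a, b)\<in>A. \<Union>(a', b')\<in>B. g a b a' b')"
  then obtain a b a' b' where "(a, b) \<in> A" "(a', b') \<in> B" "x \<in> g a b a' b'" by auto
  thus "x \<in> C" using eq by simp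
next
  fix x assume "x \<in> C"
  hence "x \<in> g a0 b0 a1 b1" using eq assms(1,2) by simp
  thus "x \<in> (\<Union>(a, b)\<in>A. \<Union>(a', b')\<in>B. g a b a' b')" using assms(1,2) by force
qed

locale prime_localization = primeideal P T for P and T (structure)
begin

abbreviation "den \<equiv> carrier T - P"

definition frac :: "'a \<Rightarrow> 'a \<Rightarrow> ('a \<times> 'a) set" where
  "frac r s = fraction_rel T P `` {(r, s)}"

lemma den_one: "\<one> \<in> den" using I_notcarr one_imp_carrier by auto

lemma den_mult: "s \<in> den \<Longrightarrow> t \<in> den \<Longrightarrow> s \<otimes> t \<in> den"
  using I_prime by auto

lemma den_carrier: "s \<in> den \<Longrightarrow> s \<in> carrier T" by simp

lemma fraction_rel_iff: "((r, s), (r', s')) \<in> fraction_rel T P \<longleftrightarrow>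
  r \<in> carrier T \<and> r' \<in> carrier T \<and> s \<in> den \<and> s' \<in> den \<and> (\<exists>t\<in>den. t \<otimes> (r \<otimes> s' \<ominus> r' \<otimes> s) = \<zero>)"
  unfolding fraction_rel_def by blast

lemma equiv_fraction_rel: "equiv (carrier T \<times> den) (fraction_rel T P)"
proof (rule equivI)
  show "fraction_rel T P \<subseteq> (carrier T \<times> den) \<times> (carrier T \<times> den)"
    unfolding fraction_rel_def by blast
  show "refl_on (carrier T \<times> den) (fraction_rel T P)"
  proof (rule refl_onI)
    fix x assume "x \<in> carrier T \<times> den"
    then obtain r s where x: "x = (r, s)" "r \<in> carrier T" "s \<in> den" by blast
    have "\<one> \<otimes> (r \<otimes> s \<ominus> r \<otimes> s) = \<zero>" using x by (simp add: minus_eq r_neg)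
    thus "(x, x) \<in> fraction_rel T P" unfolding x(1) fraction_rel_iff using x(2,3) den_one by blast
  qed
  show "sym (fraction_rel T P)"
  proof (rule symI, clarify)
    fix r s r' s' assume "((r, s), (r', s')) \<in> fraction_rel T P"
    then obtain t where *: "r \<in> carrier T" "r' \<in> carrier T" "s \<in> den" "s' \<in> den" "t \<in> den" "t \<otimes> (r \<otimes> s' \<ominus> r' \<otimes> s) = \<zero>"
      by (auto simp: fraction_rel_iff)
    have "t \<otimes> (r' \<otimes> s \<ominus> r \<otimes> s') = \<ominus> (t \<otimes> (r \<otimes> s' \<ominus> r' \<otimes> s))"
      using *(1,2) den_carrier[OF *(3)] den_carrier[OF *(4)] den_carrier[OF *(5)] by algebra
    thus "((r', s'), (r, s)) \<in> fraction_rel T P" using * by (auto simp: fraction_rel_iff)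
  qed
  show "trans (fraction_rel T P)"
  proof (rule transI, clarify)
    fix r s r' s' r'' s'' assume "((r, s), (r', s')) \<in> fraction_rel T P" "((r', s'), (r'', s'')) \<in> fraction_rel T P"
    then obtain t u where *: "r \<in> carrier T" "r' \<in> carrier T" "r'' \<in> carrier T" "s \<in> den" "s' \<in> den" "s'' \<in> den" "t \<in> den" "u \<in> den"
      and t: "t \<otimes> (r \<otimes> s' \<ominus> r' \<otimes> s) = \<zero>" and u: "u \<otimes> (r' \<otimes> s'' \<ominus> r'' \<otimes> s') = \<zero>"
      by (auto simp: fraction_rel_iff)
    note c = *(1-3) *(4-8)[THEN den_carrier]
    have "(t \<otimes> u \<otimes> s') \<otimes> (r \<otimes> s'' \<ominus> r'' \<otimes> s) =
      (u \<otimes> s'') \<otimes> (t \<otimes> (r \<otimes> s' \<ominus> r' \<otimes> s)) \<oplus> (t \<otimes> s) \<otimes> (u \<otimes> (r' \<otimes> s'' \<ominus> r'' \<otimes> s'))"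
      using c by algebra
    also have "\<dots> = \<zero>" unfolding t u using c by simp
    finally have "(t \<otimes> u \<otimes> s') \<otimes> (r \<otimes> s'' \<ominus> r'' \<otimes> s) = \<zero>" .
    moreover have "t \<otimes> u \<otimes> s' \<in> den" by (intro den_mult *)
    ultimately show "((r, s), (r'', s'')) \<in> fraction_rel T P" using * by (auto simp: fraction_rel_iff)
  qed
qed

lemma frac_eq_iff:
  assumes "r \<in> carrier T" "s \<in> den" "r' \<in> carrier T" "s' \<in> den"
  shows "frac r s = frac r' s' \<longleftrightarrow> (\<exists>t\<in>den. t \<otimes> (r \<otimes> s' \<ominus> r' \<otimes> s) = \<zero>)"
  unfolding frac_def using assms
  by (subst eq_equiv_class_iff[OF equiv_fraction_rel]) (auto simp: fraction_rel_iff)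

lemma frac_eqI:
  assumes "r \<in> carrier T" "s \<in> den" "r' \<in> carrier T" "s' \<in> den" "r \<otimes> s' = r' \<otimes> s"
  shows "frac r s = frac r' s'"
  unfolding frac_eq_iff[OF assms(1-4)]
  by (rule bexI[OF _ den_one]) (use assms in \<open>simp add: minus_eq r_neg\<close>)

abbreviation "L \<equiv> localization_at T P"

lemma carrier_L: "carrier L = {frac r s | r s. r \<in> carrier T \<and> s \<in> den}"
  unfolding localization_at_def quotient_def frac_def by auto

lemma carrier_LE:
  assumes "x \<in> carrier L"
  obtains r s where "r \<in> carrier T" "s \<in> den" "x = frac r s"
  using assms unfolding carrier_L by blast

lemma frac_in_L [simp]: "r \<in> carrier T \<Longrightarrow> s \<in> den \<Longrightarrow> frac r s \<in> carrier L"
  unfolding carrier_L by blast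

lemma rel_mult_cong:
  assumes "((r, s), (a, b)) \<in> fraction_rel T P" "((r', s'), (a', b')) \<in> fraction_rel T P"
  shows "frac (a \<otimes> a') (b \<otimes> b') = frac (r \<otimes> r') (s \<otimes> s')"
    "frac (a \<otimes> b' \<oplus> a' \<otimes> b) (b \<otimes> b') = frac (r \<otimes> s' \<oplus> r' \<otimes> s) (s \<otimes> s')"
proof -
  from assms obtain t u where *: "r \<in> carrier T" "r' \<in> carrier T" "a \<in> carrier T" "a' \<in> carrier T"
      "s \<in> den" "s' \<in> den" "b \<in> den" "b' \<in> den" "t \<in> den" "u \<in> den"
      and t: "t \<otimes> (r \<otimes> b \<ominus> a \<otimes> s) = \<zero>" and u: "u \<otimes> (r' \<otimes> b' \<ominus> a' \<otimes> s') = \<zero>"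
    by (auto simp: fraction_rel_iff)
  note c = *(1-4) *(5-10)[THEN den_carrier]
  have d: "b \<otimes> b' \<in> den" "s \<otimes> s' \<in> den" "t \<otimes> u \<in> den" by (intro den_mult *)+
  have "(t \<otimes> u) \<otimes> ((a \<otimes> a') \<otimes> (s \<otimes> s') \<ominus> (r \<otimes> r') \<otimes> (b \<otimes> b')) =
    \<ominus> ((u \<otimes> r' \<otimes> b') \<otimes> (t \<otimes> (r \<otimes> b \<ominus> a \<otimes> s)) \<oplus> (t \<otimes> a \<otimes> s) \<otimes> (u \<otimes> (r' \<otimes> b' \<ominus> a' \<otimes> s')))"
    using c by algebra
  also have "\<dots> = \<zero>" unfolding t u using c by simp
  finally show "frac (a \<otimes> a') (b \<otimes> b') = frac (r \<otimes> r') (s \<otimes> s')"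
    using c d by (subst frac_eq_iff) (auto simp del: Diff_iff)
  have "(t \<otimes> u) \<otimes> ((a \<otimes> b' \<oplus> a' \<otimes> b) \<otimes> (s \<otimes> s') \<ominus> (r \<otimes> s' \<oplus> r' \<otimes> s) \<otimes> (b \<otimes> b')) =
    \<ominus> ((u \<otimes> s' \<otimes> b') \<otimes> (t \<otimes> (r \<otimes> b \<ominus> a \<otimes> s)) \<oplus> (t \<otimes> s \<otimes> b) \<otimes> (u \<otimes> (r' \<otimes> b' \<ominus> a' \<otimes> s')))"
    using c by algebra
  also have "\<dots> = \<zero>" unfolding t u using c by simp
  finally show "frac (a \<otimes> b' \<oplus> a' \<otimes> b) (b \<otimes> b') = frac (r \<otimes> s' \<oplus> r' \<otimes> s) (s \<otimes> s')"
    using c d by (subst frac_eq_iff) (auto simp del: Diff_iff)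
qed

lemma frac_mult:
  assumes "r \<in> carrier T" "s \<in> den" "r' \<in> carrier T" "s' \<in> den"
  shows "frac r s \<otimes>\<^bsub>L\<^esub> frac r' s' = frac (r \<otimes> r') (s \<otimes> s')"
proof -
  have in1: "(r, s) \<in> frac r s" and in2: "(r', s') \<in> frac r' s'"
    unfolding frac_def using equiv_class_self[OF equiv_fraction_rel] assms by auto
  have "frac r s \<otimes>\<^bsub>L\<^esub> frac r' s' = (\<Union>(a, b)\<in>frac r s. \<Union>(a', b')\<in>frac r' s'. frac (a \<otimes> a') (b \<otimes> b'))"
    by (simp add: localization_at_def frac_def)
  also have "\<dots> = frac (r \<otimes> r') (s \<otimes> s')"
    by (rule UN_pairs_const[OF in1 in2], rule rel_mult_cong(1)) (simp_all add: frac_def)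
  finally show ?thesis .
qed

lemma frac_add:
  assumes "r \<in> carrier T" "s \<in> den" "r' \<in> carrier T" "s' \<in> den"
  shows "frac r s \<oplus>\<^bsub>L\<^esub> frac r' s' = frac (r \<otimes> s' \<oplus> r' \<otimes> s) (s \<otimes> s')"
proof -
  have in1: "(r, s) \<in> frac r s" and in2: "(r', s') \<in> frac r' s'"
    unfolding frac_def using equiv_class_self[OF equiv_fraction_rel] assms by auto
  have "frac r s \<oplus>\<^bsub>L\<^esub> frac r' s' = (\<Union>(a, b)\<in>frac r s. \<Union>(a', b')\<in>frac r' s'. frac (a \<otimes> b' \<oplus> a' \<otimes> b) (b \<otimes> b'))"
    by (simp add: localization_at_def frac_def)
  also have "\<dots> = frac (r \<otimes> s' \<oplus> r' \<otimes> s) (s \<otimes> s')"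
    by (rule UN_pairs_const[OF in1 in2], rule rel_mult_cong(2)) (simp_all add: frac_def)
  finally show ?thesis .
qed

lemma one_L: "\<one>\<^bsub>L\<^esub> = frac \<one> \<one>" and zero_L: "\<zero>\<^bsub>L\<^esub> = frac \<zero> \<one>"
  by (simp_all add: localization_at_def frac_def)

lemma cring_L: "cring L"
proof (rule cringI)
  note d1 = den_one den_mult den_carrier
  show "abelian_group L"
  proof (rule abelian_groupI)
    show "x \<oplus>\<^bsub>L\<^esub> y \<in> carrier L" if "x \<in> carrier L" "y \<in> carrier L" for x y
      using that by (elim carrier_LE) (auto simp: frac_add intro!: frac_in_L den_mult)
    show "\<zero>\<^bsub>L\<^esub> \<in> carrier L" unfolding zero_L using den_one by simp
    show "x \<oplus>\<^bsub>L\<^esub> y \<oplus>\<^bsub>L\<^esub> z = x \<oplus>\<^bsub>L\<^esub> (y \<oplus>\<^bsub>L\<^esub> z)" if xyz: "x \<in> carrier L" "y \<in> carrier L" "z \<in> carrier L" for x y z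
    proof -
      obtain a s where a: "a \<in> carrier T" "s \<in> den" "x = frac a s" using xyz(1) by (elim carrier_LE)
      obtain b t where b: "b \<in> carrier T" "t \<in> den" "y = frac b t" using xyz(2) by (elim carrier_LE)
      obtain c u where c: "c \<in> carrier T" "u \<in> den" "z = frac c u" using xyz(3) by (elim carrier_LE)
      note * = a(1) b(1) c(1) a(2) b(2) c(2)
      note c' = *(1-3) *(4-6)[THEN den_carrier]
      have e: "(a \<otimes> t \<oplus> b \<otimes> s) \<otimes> u \<oplus> c \<otimes> (s \<otimes> t) = a \<otimes> (t \<otimes> u) \<oplus> (b \<otimes> u \<oplus> c \<otimes> t) \<otimes> s" "s \<otimes> t \<otimes> u = s \<otimes> (t \<otimes> u)"
        using c' by algebra+
      show ?thesis unfolding a(3) b(3) c(3) using * c' by (simp add: frac_add den_mult e del: Diff_iff)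
    qed
    show "x \<oplus>\<^bsub>L\<^esub> y = y \<oplus>\<^bsub>L\<^esub> x" if "x \<in> carrier L" "y \<in> carrier L" for x y
      using that by (elim carrier_LE) (simp add: frac_add a_comm m_comm)
    show "\<zero>\<^bsub>L\<^esub> \<oplus>\<^bsub>L\<^esub> x = x" if "x \<in> carrier L" for x
      using that den_one unfolding zero_L by (elim carrier_LE) (simp add: frac_add del: Diff_iff, simp)
    show "\<exists>y\<in>carrier L. y \<oplus>\<^bsub>L\<^esub> x = \<zero>\<^bsub>L\<^esub>" if x: "x \<in> carrier L" for x
    proof -
      obtain a s where *: "a \<in> carrier T" "s \<in> den" "x = frac a s" using x by (elim carrier_LE)
      have "frac (\<ominus> a) s \<oplus>\<^bsub>L\<^esub> x = frac (\<ominus> a \<otimes> s \<oplus> a \<otimes> s) (s \<otimes> s)" unfolding *(3) using * by (intro frac_add) auto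
      also have "\<dots> = \<zero>\<^bsub>L\<^esub>" unfolding zero_L using * by (intro frac_eqI den_mult den_one) (auto simp: l_minus l_neg)
      finally show ?thesis using * by (intro bexI[of _ "frac (\<ominus> a) s"]) auto
    qed
  qed
  show "comm_monoid L"
  proof (rule comm_monoidI)
    show "x \<otimes>\<^bsub>L\<^esub> y \<in> carrier L" if "x \<in> carrier L" "y \<in> carrier L" for x y
      using that by (elim carrier_LE) (auto simp: frac_mult intro!: frac_in_L den_mult)
    show "\<one>\<^bsub>L\<^esub> \<in> carrier L" unfolding one_L using den_one by simp
    show "x \<otimes>\<^bsub>L\<^esub> y \<otimes>\<^bsub>L\<^esub> z = x \<otimes>\<^bsub>L\<^esub> (y \<otimes>\<^bsub>L\<^esub> z)" if "x \<in> carrier L" "y \<in> carrier L" "z \<in> carrier L" for x y z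
      using that by (elim carrier_LE) (simp add: frac_mult den_mult den_carrier m_assoc del: Diff_iff)
    show "x \<otimes>\<^bsub>L\<^esub> y = y \<otimes>\<^bsub>L\<^esub> x" if "x \<in> carrier L" "y \<in> carrier L" for x y
      using that by (elim carrier_LE) (simp add: frac_mult m_comm)
    show "\<one>\<^bsub>L\<^esub> \<otimes>\<^bsub>L\<^esub> x = x" if "x \<in> carrier L" for x
      using that den_one unfolding one_L by (elim carrier_LE) (simp add: frac_mult del: Diff_iff, simp)
  qed
  show "(x \<oplus>\<^bsub>L\<^esub> y) \<otimes>\<^bsub>L\<^esub> z = x \<otimes>\<^bsub>L\<^esub> z \<oplus>\<^bsub>L\<^esub> y \<otimes>\<^bsub>L\<^esub> z" if xyz: "x \<in> carrier L" "y \<in> carrier L" "z \<in> carrier L" for x y z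
  proof -
    obtain a s where a: "a \<in> carrier T" "s \<in> den" "x = frac a s" using xyz(1) by (elim carrier_LE)
    obtain b t where b: "b \<in> carrier T" "t \<in> den" "y = frac b t" using xyz(2) by (elim carrier_LE)
    obtain c u where c: "c \<in> carrier T" "u \<in> den" "z = frac c u" using xyz(3) by (elim carrier_LE)
    note * = a(1) b(1) c(1) a(2) b(2) c(2)
    note c' = *(1-3) *(4-6)[THEN den_carrier]
    have "(x \<oplus>\<^bsub>L\<^esub> y) \<otimes>\<^bsub>L\<^esub> z = frac ((a \<otimes> t \<oplus> b \<otimes> s) \<otimes> c) (s \<otimes> t \<otimes> u)"
      unfolding a(3) b(3) c(3) using * c' by (simp add: frac_add frac_mult den_mult del: Diff_iff)
    also have "\<dots> = frac (a \<otimes> c \<otimes> (t \<otimes> u) \<oplus> b \<otimes> c \<otimes> (s \<otimes> u)) (s \<otimes> u \<otimes> (t \<otimes> u))"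
      by (intro frac_eqI den_mult *) (use c' in \<open>simp, simp, algebra\<close>)
    also have "\<dots> = x \<otimes>\<^bsub>L\<^esub> z \<oplus>\<^bsub>L\<^esub> y \<otimes>\<^bsub>L\<^esub> z"
      unfolding a(3) b(3) c(3) using * c' by (simp add: frac_add frac_mult den_mult del: Diff_iff)
    finally show ?thesis .
  qed
qed

definition loc :: "'a \<Rightarrow> ('a \<times> 'a) set" where "loc r = frac r \<one>"

lemma loc_hom: "loc \<in> ring_hom T L"
proof (rule ring_hom_memI)
  show "loc (x \<otimes> y) = loc x \<otimes>\<^bsub>L\<^esub> loc y" "loc (x \<oplus> y) = loc x \<oplus>\<^bsub>L\<^esub> loc y" if "x \<in> carrier T" "y \<in> carrier T" for x y
    using that den_one unfolding loc_def by (simp_all add: frac_mult frac_add del: Diff_iff)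
qed (use den_one in \<open>simp_all add: loc_def one_L\<close>)

lemma loc_eq_zero: "t \<in> carrier T \<Longrightarrow> loc t = \<zero>\<^bsub>L\<^esub> \<longleftrightarrow> (\<exists>s\<in>den. s \<otimes> t = \<zero>)"
  unfolding loc_def zero_L using den_one by (subst frac_eq_iff) (auto simp: minus_eq)

lemma loc_unit:
  assumes "s \<in> den"
  shows "loc s \<in> Units L"
proof -
  interpret L: cring L by (rule cring_L)
  have "frac \<one> s \<otimes>\<^bsub>L\<^esub> loc s = frac (\<one> \<otimes> s) (s \<otimes> \<one>)"
    unfolding loc_def using assms den_one by (intro frac_mult) auto
  also have "\<dots> = \<one>\<^bsub>L\<^esub>"
    unfolding one_L using assms den_one by (intro frac_eqI den_mult) (auto simp: m_comm)
  finally have "frac \<one> s \<otimes>\<^bsub>L\<^esub> loc s = \<one>\<^bsub>L\<^esub>" .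
  moreover have "frac \<one> s \<in> carrier L" "loc s \<in> carrier L" using assms den_one by (auto simp: loc_def)
  ultimately show ?thesis using L.m_comm unfolding Units_def by blast
qed

lemma loc_fraction:
  assumes "x \<in> carrier L"
  obtains r s where "r \<in> carrier T" "s \<in> den" "loc s \<otimes>\<^bsub>L\<^esub> x = loc r"
proof -
  obtain r s where *: "r \<in> carrier T" "s \<in> den" "x = frac r s" using assms by (elim carrier_LE)
  have "loc s \<otimes>\<^bsub>L\<^esub> x = frac (s \<otimes> r) (\<one> \<otimes> s)" unfolding *(3) loc_def using * den_one by (subst frac_mult) auto
  also have "\<dots> = loc r" unfolding loc_def using * den_one by (intro frac_eqI den_mult) (auto simp: m_comm)
  finally show ?thesis using that * by blast
qed

text \<open>The extension of an ideal of \<open>T\<close> to the localization: the fractions that have a representation with numerator in the ideal. For prime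
  ideals inside \<open>P\<close> the choice of the representation does not matter.\<close>

definition ext :: "'a set \<Rightarrow> ('a \<times> 'a) set set" where
  "ext I = {x \<in> carrier L. \<exists>r\<in>I. \<exists>s\<in>den. loc s \<otimes>\<^bsub>L\<^esub> x = loc r}"

lemma ext_iff:
  assumes I: "primeideal I T" "I \<subseteq> P" and x: "x \<in> carrier L" and r: "r \<in> carrier T" and s: "s \<in> den" "loc s \<otimes>\<^bsub>L\<^esub> x = loc r"
  shows "x \<in> ext I \<longleftrightarrow> r \<in> I"
proof
  interpret I: primeideal I T by (rule I)
  interpret L: cring L by (rule cring_L)
  interpret h: ring_hom_cring T L loc by (rule ring_hom_cringI[OF is_cring cring_L loc_hom])
  assume "x \<in> ext I"
  then obtain r' s' where r': "r' \<in> I" "s' \<in> den" "loc s' \<otimes>\<^bsub>L\<^esub> x = loc r'" unfolding ext_def by blast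
  have r'T: "r' \<in> carrier T" using r'(1) I.a_subset by blast
  have sT: "s \<in> carrier T" "s' \<in> carrier T" using s r' by auto
  have "loc (s' \<otimes> r) = loc s' \<otimes>\<^bsub>L\<^esub> (loc s \<otimes>\<^bsub>L\<^esub> x)" using sT r s by simp
  also have "\<dots> = loc s \<otimes>\<^bsub>L\<^esub> (loc s' \<otimes>\<^bsub>L\<^esub> x)" using sT x by (simp add: L.m_lcomm)
  also have "\<dots> = loc (s \<otimes> r')" using r'(3) sT r'T by simp
  finally have "loc (s' \<otimes> r \<ominus> s \<otimes> r') = \<zero>\<^bsub>L\<^esub>" using sT r r'T by (simp add: minus_eq L.r_neg)
  then obtain u where u: "u \<in> den" "u \<otimes> (s' \<otimes> r \<ominus> s \<otimes> r') = \<zero>" using loc_eq_zero[of "s' \<otimes> r \<ominus> s \<otimes> r'"] sT r r'T by auto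
  have "s' \<otimes> r \<ominus> s \<otimes> r' \<in> I"
    using I.I_prime[of u "s' \<otimes> r \<ominus> s \<otimes> r'"] u I(2) I.zero_closed sT r r'T by auto
  moreover have "s \<otimes> r' \<in> I" using I.I_l_closed[OF r'(1) sT(1)] .
  ultimately have "(s' \<otimes> r \<ominus> s \<otimes> r') \<oplus> s \<otimes> r' \<in> I" by (rule I.a_closed)
  moreover have "(s' \<otimes> r \<ominus> s \<otimes> r') \<oplus> s \<otimes> r' = s' \<otimes> r" using sT r r'T by algebra
  ultimately show "r \<in> I" using I.I_prime[of s' r] sT r r'(2) I(2) by auto
next
  assume "r \<in> I"
  thus "x \<in> ext I" using x s unfolding ext_def by blast
qed

lemma ext_loc_iff:
  assumes I: "primeideal I T" "I \<subseteq> P" and r: "r \<in> carrier T"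
  shows "loc r \<in> ext I \<longleftrightarrow> r \<in> I"
proof -
  interpret L: cring L by (rule cring_L)
  interpret h: ring_hom_cring T L loc by (rule ring_hom_cringI[OF is_cring cring_L loc_hom])
  show ?thesis by (rule ext_iff[OF I _ r den_one]) (use r in simp_all)
qed

lemma ext_prime:
  assumes I: "primeideal I T" "I \<subseteq> P"
  shows "primeideal (ext I) L"
proof -
  interpret I: primeideal I T by (rule I)
  interpret L: cring L by (rule cring_L)
  interpret h: ring_hom_cring T L loc by (rule ring_hom_cringI[OF is_cring cring_L loc_hom])
  note iff = ext_iff[OF I]
  have mult: "loc (s \<otimes> t) \<otimes>\<^bsub>L\<^esub> (x \<otimes>\<^bsub>L\<^esub> y) = loc (a \<otimes> b)" "loc (s \<otimes> t) \<otimes>\<^bsub>L\<^esub> (x \<oplus>\<^bsub>L\<^esub> y) = loc (a \<otimes> t \<oplus> b \<otimes> s)"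
    if *: "x \<in> carrier L" "y \<in> carrier L" "a \<in> carrier T" "b \<in> carrier T" "s \<in> den" "t \<in> den"
      "loc s \<otimes>\<^bsub>L\<^esub> x = loc a" "loc t \<otimes>\<^bsub>L\<^esub> y = loc b" for x y a b s t
  proof -
    have c: "loc s \<in> carrier L" "loc t \<in> carrier L" "s \<in> carrier T" "t \<in> carrier T" using * by auto
    have st: "loc (s \<otimes> t) = loc s \<otimes>\<^bsub>L\<^esub> loc t" using c by simp
    have "loc (s \<otimes> t) \<otimes>\<^bsub>L\<^esub> (x \<otimes>\<^bsub>L\<^esub> y) = (loc s \<otimes>\<^bsub>L\<^esub> x) \<otimes>\<^bsub>L\<^esub> (loc t \<otimes>\<^bsub>L\<^esub> y)"
      unfolding st using *(1,2) c(1,2) by (simp add: L.m_ac)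
    thus "loc (s \<otimes> t) \<otimes>\<^bsub>L\<^esub> (x \<otimes>\<^bsub>L\<^esub> y) = loc (a \<otimes> b)" unfolding *(7,8) using *(3,4) by simp
    have "loc (s \<otimes> t) \<otimes>\<^bsub>L\<^esub> (x \<oplus>\<^bsub>L\<^esub> y) = (loc s \<otimes>\<^bsub>L\<^esub> x) \<otimes>\<^bsub>L\<^esub> loc t \<oplus>\<^bsub>L\<^esub> (loc t \<otimes>\<^bsub>L\<^esub> y) \<otimes>\<^bsub>L\<^esub> loc s"
      unfolding st using *(1,2) c(1,2) by (simp add: L.r_distr L.m_ac)
    thus "loc (s \<otimes> t) \<otimes>\<^bsub>L\<^esub> (x \<oplus>\<^bsub>L\<^esub> y) = loc (a \<otimes> t \<oplus> b \<otimes> s)" unfolding *(7,8) using *(3,4) c(3,4) by simp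
  qed
  show ?thesis
  proof (rule primeidealI)
    show "cring L" by (rule cring_L)
    show "ideal (ext I) L"
    proof (rule L.idealI_absorb)
      show "ext I \<subseteq> carrier L" by (auto simp: ext_def)
      show "\<zero>\<^bsub>L\<^esub> \<in> ext I" using ext_loc_iff[OF I, of \<zero>] I.zero_closed by simp
    next
      fix x y assume xy: "x \<in> ext I" "y \<in> ext I"
      hence c: "x \<in> carrier L" "y \<in> carrier L" by (auto simp: ext_def)
      obtain a s where a: "a \<in> carrier T" "s \<in> den" "loc s \<otimes>\<^bsub>L\<^esub> x = loc a" using loc_fraction[OF c(1)] by blast
      obtain b t where b: "b \<in> carrier T" "t \<in> den" "loc t \<otimes>\<^bsub>L\<^esub> y = loc b" using loc_fraction[OF c(2)] by blast
      have "a \<in> I" "b \<in> I" using xy iff[OF c(1) a] iff[OF c(2) b] by auto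
      hence "a \<otimes> t \<oplus> b \<otimes> s \<in> I" using a(2) b(2) by (intro I.a_closed I.I_r_closed) auto
      thus "x \<oplus>\<^bsub>L\<^esub> y \<in> ext I"
        using iff[OF _ _ den_mult[OF a(2) b(2)] mult(2)[OF c a(1) b(1) a(2) b(2) a(3) b(3)]] c a b by auto
    next
      fix x y assume xy: "x \<in> carrier L" "y \<in> ext I"
      hence c: "x \<in> carrier L" "y \<in> carrier L" by (auto simp: ext_def)
      obtain a s where a: "a \<in> carrier T" "s \<in> den" "loc s \<otimes>\<^bsub>L\<^esub> x = loc a" using loc_fraction[OF c(1)] by blast
      obtain b t where b: "b \<in> carrier T" "t \<in> den" "loc t \<otimes>\<^bsub>L\<^esub> y = loc b" using loc_fraction[OF c(2)] by blast
      have "b \<in> I" using xy iff[OF c(2) b] by auto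
      hence "a \<otimes> b \<in> I" using a(1) by (intro I.I_l_closed)
      thus "x \<otimes>\<^bsub>L\<^esub> y \<in> ext I"
        using iff[OF _ _ den_mult[OF a(2) b(2)] mult(1)[OF c a(1) b(1) a(2) b(2) a(3) b(3)]] c a b by auto
    qed
    have "\<one> \<notin> I" using I.I_notcarr I.one_imp_carrier by blast
    hence "\<one>\<^bsub>L\<^esub> \<notin> ext I" using ext_loc_iff[OF I, of \<one>] by simp
    thus "carrier L \<noteq> ext I" using L.one_closed by blast
  next
    fix x y assume c: "x \<in> carrier L" "y \<in> carrier L" and xy: "x \<otimes>\<^bsub>L\<^esub> y \<in> ext I"
    obtain a s where a: "a \<in> carrier T" "s \<in> den" "loc s \<otimes>\<^bsub>L\<^esub> x = loc a" using loc_fraction[OF c(1)] by blast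
    obtain b t where b: "b \<in> carrier T" "t \<in> den" "loc t \<otimes>\<^bsub>L\<^esub> y = loc b" using loc_fraction[OF c(2)] by blast
    have "a \<otimes> b \<in> I"
      using iff[OF _ _ den_mult[OF a(2) b(2)] mult(1)[OF c a(1) b(1) a(2) b(2) a(3) b(3)]] c a b xy by auto
    hence "a \<in> I \<or> b \<in> I" using I.I_prime a(1) b(1) by blast
    thus "x \<in> ext I \<or> y \<in> ext I" using iff[OF c(1) a] iff[OF c(2) b] by blast
  qed
qed

lemma unit_if_not_in_ext:
  assumes x: "x \<in> carrier L" "x \<notin> ext P"
  shows "x \<in> Units L"
proof -
  interpret L: cring L by (rule cring_L)
  obtain a s where a: "a \<in> carrier T" "s \<in> den" "loc s \<otimes>\<^bsub>L\<^esub> x = loc a" using loc_fraction[OF x(1)] by blast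
  have "a \<in> den" using x a unfolding ext_def by blast
  hence "loc s \<otimes>\<^bsub>L\<^esub> x \<in> Units L" using loc_unit a(3) by simp
  thus ?thesis using L.unit_factor[of x "loc s"] x(1) L.Units_closed[OF loc_unit[OF a(2)]] by (simp add: L.m_comm)
qed

end

section \<open>Additive extension from a free abelian group to a ring\<close>

text \<open>The additive extension of \<open>\<phi>\<close> to the free abelian group.\<close>

definition additive_ext :: "('d, 'n) ring_scheme \<Rightarrow> ('x \<Rightarrow> 'd) \<Rightarrow> ('x \<Rightarrow>\<^sub>0 int) \<Rightarrow> 'd" where
  "additive_ext D \<phi> u = finsum D (\<lambda>x. add_pow D (Poly_Mapping.lookup u x) (\<phi> x)) (Poly_Mapping.keys u)"

lemma frag_extend_diff_fun: "frag_extend (\<lambda>x. f x - g x) u = frag_extend f u - frag_extend g u"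
proof -
  have "Poly_Mapping.keys u \<subseteq> UNIV" by simp
  thus ?thesis by (induction u rule: frag_induction) (simp_all add: frag_extend_diff)
qed

lemma frag_add_induct [consumes 1, case_names of diff]:
  assumes "Poly_Mapping.keys u \<subseteq> S" "\<And>x. x \<in> S \<Longrightarrow> P (frag_of x)" 
    "\<And>a b. Poly_Mapping.keys a \<subseteq> S \<Longrightarrow> Poly_Mapping.keys b \<subseteq> S \<Longrightarrow> P a \<Longrightarrow> P b \<Longrightarrow> P (a - b)" "P 0"
  shows "P u"
proof -
  have "Poly_Mapping.keys u \<subseteq> S \<and> P u"
    using assms(1)
  proof (induction u rule: frag_induction)
    case (diff a b)
    thus ?case using assms(3) keys_diff[of a b] by blast
  qed (use assms(2,4) in \<open>auto simp: keys_frag_of\<close>)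
  thus ?thesis by simp
qed

context cring
begin

lemma additive_ext_superset:
  assumes "finite S" "Poly_Mapping.keys u \<subseteq> S" "\<phi> \<in> S \<rightarrow> carrier R"
  shows "additive_ext R \<phi> u = (\<Oplus>x\<in>S. [Poly_Mapping.lookup u x] \<cdot> \<phi> x)"
proof -
  have z: "add_pow R (0::int) a = \<zero>" for a by (simp add: add_pow_def)
  show ?thesis unfolding additive_ext_def
    by (rule add.finprod_mono_neutral_cong_left)
       (use assms in \<open>auto simp: in_keys_iff Pi_iff z\<close>)
qed

lemma additive_ext_closed:
  assumes "Poly_Mapping.keys u \<subseteq> S" "\<phi> \<in> S \<rightarrow> carrier R"
  shows "additive_ext R \<phi> u \<in> carrier R"
  unfolding additive_ext_def by (rule finsum_closed) (use assms in auto)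

lemma additive_ext_zero [simp]: "additive_ext R \<phi> 0 = \<zero>"
  by (simp add: additive_ext_def)

lemma additive_ext_of: "\<phi> x \<in> carrier R \<Longrightarrow> additive_ext R \<phi> (frag_of x) = \<phi> x"
  by (simp add: additive_ext_def keys_frag_of)

lemma additive_ext_add:
  assumes u: "Poly_Mapping.keys u \<subseteq> S" and v: "Poly_Mapping.keys v \<subseteq> S" and \<phi>: "\<phi> \<in> S \<rightarrow> carrier R"
  shows "additive_ext R \<phi> (u + v) = additive_ext R \<phi> u \<oplus> additive_ext R \<phi> v"
proof -
  let ?T = "Poly_Mapping.keys u \<union> Poly_Mapping.keys v"
  have T: "finite ?T" "\<phi> \<in> ?T \<rightarrow> carrier R" using u v \<phi> by auto
  have "additive_ext R \<phi> (u + v) = (\<Oplus>x\<in>?T. [Poly_Mapping.lookup (u + v) x] \<cdot> \<phi> x)"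
    by (rule additive_ext_superset[OF T(1) _ T(2)]) (use Poly_Mapping.keys_add[of u v] in auto)
  also have "\<dots> = (\<Oplus>x\<in>?T. [Poly_Mapping.lookup u x] \<cdot> \<phi> x \<oplus> [Poly_Mapping.lookup v x] \<cdot> \<phi> x)"
    by (rule finsum_cong') (use T(2) in \<open>auto simp: lookup_add add.int_pow_mult Pi_iff\<close>)
  also have "\<dots> = (\<Oplus>x\<in>?T. [Poly_Mapping.lookup u x] \<cdot> \<phi> x) \<oplus> (\<Oplus>x\<in>?T. [Poly_Mapping.lookup v x] \<cdot> \<phi> x)"
    by (rule finsum_addf) (use T(2) in auto)
  also have "\<dots> = additive_ext R \<phi> u \<oplus> additive_ext R \<phi> v"
    using additive_ext_superset[OF T(1) _ T(2), of u] additive_ext_superset[OF T(1) _ T(2), of v] by simp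
  finally show ?thesis .
qed

lemma additive_ext_diff:
  assumes u: "Poly_Mapping.keys u \<subseteq> S" and v: "Poly_Mapping.keys v \<subseteq> S" and \<phi>: "\<phi> \<in> S \<rightarrow> carrier R"
  shows "additive_ext R \<phi> (u - v) = additive_ext R \<phi> u \<ominus> additive_ext R \<phi> v"
proof -
  have uv: "Poly_Mapping.keys (u - v) \<subseteq> S" using keys_diff[of u v] u v by blast
  have "additive_ext R \<phi> u = additive_ext R \<phi> (u - v) \<oplus> additive_ext R \<phi> v"
    using additive_ext_add[OF uv v \<phi>] by simp
  thus ?thesis using additive_ext_closed[OF uv \<phi>] additive_ext_closed[OF v \<phi>] by (simp add: minus_eq a_assoc r_neg)
qed

end

section \<open>Monoid rings over the integers and the tensor product\<close>

definition mult_ext :: "('x \<Rightarrow> 'x \<Rightarrow> 'x) \<Rightarrow> ('x \<Rightarrow>\<^sub>0 int) \<Rightarrow> ('x \<Rightarrow>\<^sub>0 int) \<Rightarrow> ('x \<Rightarrow>\<^sub>0 int)" where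
  "mult_ext op u v = frag_extend (\<lambda>x. frag_extend (\<lambda>y. frag_of (op x y)) v) u"

lemma mult_ext_of [simp]: "mult_ext op (frag_of x) (frag_of y) = frag_of (op x y)"
  by (simp add: mult_ext_def)

lemma mult_ext_diff_left: "mult_ext op (a - b) v = mult_ext op a v - mult_ext op b v"
  by (simp add: mult_ext_def frag_extend_diff)

lemma mult_ext_diff_right: "mult_ext op u (a - b) = mult_ext op u a - mult_ext op u b"
  by (simp add: mult_ext_def frag_extend_diff frag_extend_diff_fun)

lemma mult_ext_zero [simp]: "mult_ext op 0 v = 0" "mult_ext op u 0 = 0"
  using mult_ext_diff_right[of op u 0 0] by (simp_all add: mult_ext_def)

lemma mult_ext_add_left: "mult_ext op (a + b) v = mult_ext op a v + mult_ext op b v"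
  by (simp add: mult_ext_def frag_extend_add)

text \<open>The monoid ring over the integers of a commutative monoid on the set \<open>S\<close>. The ring of pairs that covers the tensor product is the
  instance for the product of the two multiplicative monoids.\<close>

locale frag_monoid =
  fixes S :: "'x set" and op :: "'x \<Rightarrow> 'x \<Rightarrow> 'x" and e :: 'x
  assumes closed: "\<And>x y. x \<in> S \<Longrightarrow> y \<in> S \<Longrightarrow> op x y \<in> S" and e: "e \<in> S"
    and assoc: "\<And>x y z. x \<in> S \<Longrightarrow> y \<in> S \<Longrightarrow> z \<in> S \<Longrightarrow> op (op x y) z = op x (op y z)"
    and comm: "\<And>x y. x \<in> S \<Longrightarrow> y \<in> S \<Longrightarrow> op x y = op y x"
    and unit: "\<And>x. x \<in> S \<Longrightarrow> op e x = x"
begin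

definition mring :: "('x \<Rightarrow>\<^sub>0 int) ring" where
  "mring = \<lparr> carrier = {u. Poly_Mapping.keys u \<subseteq> S}, monoid.mult = mult_ext op, one = frag_of e, ring.zero = 0, add = (+) \<rparr>"

lemma mult_ext_closed:
  assumes "Poly_Mapping.keys u \<subseteq> S" "Poly_Mapping.keys v \<subseteq> S"
  shows "Poly_Mapping.keys (mult_ext op u v) \<subseteq> S"
  using assms(1)
proof (induction u rule: frag_add_induct)
  case (of x)
  show ?case using assms(2)
  proof (induction v rule: frag_add_induct)
    case (diff a b)
    thus ?case using keys_diff[of "mult_ext op (frag_of x) a" "mult_ext op (frag_of x) b"] by (auto simp: mult_ext_diff_right)
  qed (use of closed in \<open>auto simp: keys_frag_of\<close>)
next
  case (diff a b)
  thus ?case using keys_diff[of "mult_ext op a v" "mult_ext op b v"] by (auto simp: mult_ext_diff_left)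
qed auto

lemma mult_ext_comm:
  assumes "Poly_Mapping.keys u \<subseteq> S" "Poly_Mapping.keys v \<subseteq> S"
  shows "mult_ext op u v = mult_ext op v u"
  using assms(1)
proof (induction u rule: frag_add_induct)
  case (of x)
  show ?case using assms(2)
    by (induction v rule: frag_add_induct) (use of comm in \<open>auto simp: mult_ext_diff_left mult_ext_diff_right\<close>)
qed (auto simp: mult_ext_diff_left mult_ext_diff_right)

lemma mult_ext_assoc:
  assumes "Poly_Mapping.keys u \<subseteq> S" "Poly_Mapping.keys v \<subseteq> S" "Poly_Mapping.keys w \<subseteq> S"
  shows "mult_ext op (mult_ext op u v) w = mult_ext op u (mult_ext op v w)"
  using assms(1)
proof (induction u rule: frag_add_induct)
  case (of x)
  show ?case using assms(2)
  proof (induction v rule: frag_add_induct)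
    case y: (of y)
    show ?case using assms(3)
      by (induction w rule: frag_add_induct) (use of y assoc in \<open>auto simp: mult_ext_diff_right\<close>)
  qed (auto simp: mult_ext_diff_left mult_ext_diff_right)
qed (auto simp: mult_ext_diff_left mult_ext_diff_right)

lemma mult_ext_unit: "Poly_Mapping.keys u \<subseteq> S \<Longrightarrow> mult_ext op (frag_of e) u = u"
  by (induction u rule: frag_add_induct) (auto simp: mult_ext_diff_right unit)

lemma cring_mring: "cring mring"
proof (rule cringI)
  show "abelian_group mring"
  proof (rule abelian_groupI)
    show "x \<oplus>\<^bsub>mring\<^esub> y \<in> carrier mring" if "x \<in> carrier mring" "y \<in> carrier mring" for x y
      using that Poly_Mapping.keys_add[of x y] by (auto simp: mring_def)
    show "\<exists>y\<in>carrier mring. y \<oplus>\<^bsub>mring\<^esub> x = \<zero>\<^bsub>mring\<^esub>" if "x \<in> carrier mring" for x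
      using that by (intro bexI[of _ "- x"]) (auto simp: mring_def)
  qed (auto simp: mring_def add_ac)
  show "comm_monoid mring"
    by (rule comm_monoidI) (use mult_ext_closed mult_ext_assoc mult_ext_comm mult_ext_unit e in \<open>auto simp: mring_def keys_frag_of\<close>)
qed (auto simp: mring_def mult_ext_add_left)

lemma additive_ext_mult:
  assumes D: "cring D" and \<phi>: "\<phi> \<in> S \<rightarrow> carrier D" 
    and mult: "\<And>x y. x \<in> S \<Longrightarrow> y \<in> S \<Longrightarrow> \<phi> (op x y) = \<phi> x \<otimes>\<^bsub>D\<^esub> \<phi> y"
    and u: "Poly_Mapping.keys u \<subseteq> S" and v: "Poly_Mapping.keys v \<subseteq> S"
  shows "additive_ext D \<phi> (mult_ext op u v) = additive_ext D \<phi> u \<otimes>\<^bsub>D\<^esub> additive_ext D \<phi> v"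
proof -
  interpret D: cring D by fact
  have \<phi>': "\<phi> x \<in> carrier D" if "x \<in> S" for x using \<phi> that by auto
  note cl = D.additive_ext_closed[OF _ \<phi>]
  have min: "(a \<ominus>\<^bsub>D\<^esub> b) \<otimes>\<^bsub>D\<^esub> c = a \<otimes>\<^bsub>D\<^esub> c \<ominus>\<^bsub>D\<^esub> b \<otimes>\<^bsub>D\<^esub> c" "c \<otimes>\<^bsub>D\<^esub> (a \<ominus>\<^bsub>D\<^esub> b) = c \<otimes>\<^bsub>D\<^esub> a \<ominus>\<^bsub>D\<^esub> c \<otimes>\<^bsub>D\<^esub> b" 
    if "a \<in> carrier D" "b \<in> carrier D" "c \<in> carrier D" for a b c using that by algebra+
  show ?thesis using u
  proof (induction u rule: frag_add_induct)
    case (of x)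
    show ?case using v
    proof (induction v rule: frag_add_induct)
      case y: (of y)
      show ?case using of y \<phi>' closed mult by (simp add: D.additive_ext_of)
    next
      case (diff a b)
      have x: "Poly_Mapping.keys (frag_of x) \<subseteq> S" using of by (simp add: keys_frag_of)
      show ?case unfolding mult_ext_diff_right
        using diff cl[OF diff(1)] cl[OF diff(2)] cl[OF x]
        by (simp add: D.additive_ext_diff[OF _ _ \<phi>] mult_ext_closed[OF x] min)
    qed (use cl[of "frag_of x"] of in \<open>simp add: keys_frag_of\<close>)
  next
    case (diff a b)
    show ?case unfolding mult_ext_diff_left
      using diff cl[OF diff(1)] cl[OF diff(2)] cl[OF v]
      by (simp add: D.additive_ext_diff[OF _ _ \<phi>] mult_ext_closed[OF _ v] min)
  qed (use cl[OF v] in simp)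
qed

lemma additive_ext_hom:
  assumes D: "cring D" and \<phi>: "\<phi> \<in> S \<rightarrow> carrier D" 
    and mult: "\<And>x y. x \<in> S \<Longrightarrow> y \<in> S \<Longrightarrow> \<phi> (op x y) = \<phi> x \<otimes>\<^bsub>D\<^esub> \<phi> y" and one: "\<phi> e = \<one>\<^bsub>D\<^esub>"
  shows "additive_ext D \<phi> \<in> ring_hom mring D"
proof -
  interpret D: cring D by fact
  show ?thesis
    by (rule ring_hom_memI)
       (use additive_ext_mult[OF D \<phi> mult] D.additive_ext_add[OF _ _ \<phi>] D.additive_ext_closed[OF _ \<phi>] D.additive_ext_of[of \<phi> e] \<phi> e one 
         in \<open>auto simp: mring_def\<close>)
qed

end

lemma kernel_prime:
  assumes T: "cring T" and D: "domain D" and h: "h \<in> ring_hom T D"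
  shows "primeideal {x \<in> carrier T. h x = \<zero>\<^bsub>D\<^esub>} T"
proof -
  interpret T: cring T by fact
  interpret D: domain D by fact
  interpret h: ring_hom_cring T D h by (rule ring_hom_cringI[OF T D.is_cring h])
  show ?thesis
  proof (rule primeidealI)
    show "ideal {x \<in> carrier T. h x = \<zero>\<^bsub>D\<^esub>} T"
      by (rule T.idealI_absorb) auto
    show "carrier T \<noteq> {x \<in> carrier T. h x = \<zero>\<^bsub>D\<^esub>}" using h.hom_one T.one_closed D.zero_not_one by force
    show "a \<in> {x \<in> carrier T. h x = \<zero>\<^bsub>D\<^esub>} \<or> b \<in> {x \<in> carrier T. h x = \<zero>\<^bsub>D\<^esub>}"
      if "a \<in> carrier T" "b \<in> carrier T" "a \<otimes>\<^bsub>T\<^esub> b \<in> {x \<in> carrier T. h x = \<zero>\<^bsub>D\<^esub>}" for a b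
      using that D.integral[of "h a" "h b"] by auto
  qed (rule T)
qed

locale tensor_product = A: cring A + B: cring B for A :: "('a, 'm) ring_scheme" and B :: "('b, 'n) ring_scheme"
begin

abbreviation "pairs \<equiv> carrier A \<times> carrier B"
abbreviation "pop \<equiv> \<lambda>x y. (fst x \<otimes>\<^bsub>A\<^esub> fst y, snd x \<otimes>\<^bsub>B\<^esub> snd y)"

sublocale M: frag_monoid pairs pop "(\<one>\<^bsub>A\<^esub>, \<one>\<^bsub>B\<^esub>)"
  by unfold_locales (auto simp: A.m_assoc B.m_assoc intro: A.m_comm B.m_comm)

lemma pair_ring_eq: "pair_ring A B = M.mring"
  unfolding pair_ring_def M.mring_def mult_ext_def by (simp add: split_def)

lemma cring_pair_ring: "cring (pair_ring A B)"
  unfolding pair_ring_eq by (rule M.cring_mring)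

sublocale PR: cring "pair_ring A B" by (rule cring_pair_ring)

lemma carrier_pair_ring: "carrier (pair_ring A B) = {u. Poly_Mapping.keys u \<subseteq> pairs}"
  by (simp add: pair_ring_def)

lemma pair_ring_add [simp]: "u \<oplus>\<^bsub>pair_ring A B\<^esub> v = u + v" and pair_ring_zero [simp]: "\<zero>\<^bsub>pair_ring A B\<^esub> = 0"
  by (simp_all add: pair_ring_def)

lemma of_in_pair_ring [simp]: "a \<in> carrier A \<Longrightarrow> b \<in> carrier B \<Longrightarrow> frag_of (a, b) \<in> carrier (pair_ring A B)"
  by (simp add: carrier_pair_ring keys_frag_of)

lemma pair_ring_diff:
  assumes "u \<in> carrier (pair_ring A B)" "v \<in> carrier (pair_ring A B)"
  shows "u - v \<in> carrier (pair_ring A B)" "u \<ominus>\<^bsub>pair_ring A B\<^esub> v = u - v"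
proof -
  show uv: "u - v \<in> carrier (pair_ring A B)" using assms keys_diff[of u v] by (auto simp: carrier_pair_ring)
  have "u = (u - v) \<oplus>\<^bsub>pair_ring A B\<^esub> v" by simp
  hence "u \<ominus>\<^bsub>pair_ring A B\<^esub> v = (u - v) \<oplus>\<^bsub>pair_ring A B\<^esub> v \<ominus>\<^bsub>pair_ring A B\<^esub> v" by simp
  also have "\<dots> = u - v" using uv assms(2) by algebra
  finally show "u \<ominus>\<^bsub>pair_ring A B\<^esub> v = u - v" .
qed

abbreviation "rels \<equiv> {frag_of (a \<oplus>\<^bsub>A\<^esub> a', b) - frag_of (a, b) - frag_of (a', b) | a a' b.
         a \<in> carrier A \<and> a' \<in> carrier A \<and> b \<in> carrier B} \<union>
      {frag_of (a, b \<oplus>\<^bsub>B\<^esub> b') - frag_of (a, b) - frag_of (a, b') | a b b'.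
         a \<in> carrier A \<and> b \<in> carrier B \<and> b' \<in> carrier B}"

abbreviation "I \<equiv> tensor_ideal A B"

lemma rels_carrier: "rels \<subseteq> carrier (pair_ring A B)"
  by (auto intro!: pair_ring_diff)

sublocale I: ideal I "pair_ring A B"
  unfolding tensor_ideal_def by (rule PR.genideal_ideal[OF rels_carrier])

abbreviation "T \<equiv> tensor_ring A B"
abbreviation "cls u \<equiv> I +>\<^bsub>pair_ring A B\<^esub> u"

lemma cring_T: "cring T"
  unfolding tensor_ring_def by (rule I.quotient_is_cring[OF cring_pair_ring])

sublocale T: cring T by (rule cring_T)

lemma cls_hom: "cls \<in> ring_hom (pair_ring A B) T"
  unfolding tensor_ring_def by (rule I.rcos_ring_hom)

sublocale cls: ring_hom_cring "pair_ring A B" T cls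
  by (rule ring_hom_cringI[OF cring_pair_ring cring_T cls_hom])

lemma carrier_T: "carrier T = cls ` carrier (pair_ring A B)"
  by (auto simp: tensor_ring_def FactRing_def A_RCOSETS_def RCOSETS_def a_r_coset_def)

lemma cls_eq_iff:
  assumes "u \<in> carrier (pair_ring A B)" "v \<in> carrier (pair_ring A B)"
  shows "cls u = cls v \<longleftrightarrow> u - v \<in> I"
  using PR.quotient_eq_iff_same_a_r_cos[OF I.ideal_axioms assms] pair_ring_diff(2)[OF assms] by simp

text \<open>The additive extension of \<open>f a \<otimes> g b\<close> is multiplicative and kills the relations of the tensor product.\<close>

lemma tensor_hom:
  assumes D: "cring D" and f: "f \<in> ring_hom A D" and g: "g \<in> ring_hom B D"
  shows "\<exists>h\<in>ring_hom T D. \<forall>u\<in>carrier (pair_ring A B). h (cls u) = additive_ext D (\<lambda>(a, b). f a \<otimes>\<^bsub>D\<^esub> g b) u"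
proof -
  interpret D: cring D by fact
  interpret f: ring_hom_cring A D f by (rule ring_hom_cringI[OF A.is_cring D f])
  interpret g: ring_hom_cring B D g by (rule ring_hom_cringI[OF B.is_cring D g])
  let ?\<phi> = "\<lambda>(a, b). f a \<otimes>\<^bsub>D\<^esub> g b"
  let ?\<Phi> = "additive_ext D ?\<phi>"
  have \<phi>: "?\<phi> \<in> pairs \<rightarrow> carrier D" by auto
  have \<Phi>: "?\<Phi> \<in> ring_hom (pair_ring A B) D"
    unfolding pair_ring_eq
    by (rule M.additive_ext_hom[OF D \<phi>]) (auto simp: D.m_ac)
  interpret \<Phi>: ring_hom_cring "pair_ring A B" D ?\<Phi> by (rule ring_hom_cringI[OF cring_pair_ring D \<Phi>])
  have of: "?\<Phi> (frag_of (a, b)) = f a \<otimes>\<^bsub>D\<^esub> g b" if "a \<in> carrier A" "b \<in> carrier B" for a b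
    using that by (subst D.additive_ext_of) auto
  have diff: "?\<Phi> (u - v) = ?\<Phi> u \<ominus>\<^bsub>D\<^esub> ?\<Phi> v" if "u \<in> carrier (pair_ring A B)" "v \<in> carrier (pair_ring A B)" for u v
    by (rule D.additive_ext_diff[OF _ _ \<phi>]) (use that in \<open>auto simp: carrier_pair_ring\<close>)
  have "I \<subseteq> {x \<in> carrier (pair_ring A B). ?\<Phi> x = \<zero>\<^bsub>D\<^esub>}"
    unfolding tensor_ideal_def
  proof (rule PR.genideal_minimal)
    show "ideal {x \<in> carrier (pair_ring A B). ?\<Phi> x = \<zero>\<^bsub>D\<^esub>} (pair_ring A B)"
      by (rule PR.idealI_absorb) (use \<Phi>.hom_add \<Phi>.hom_mult \<Phi>.hom_zero PR.a_closed in \<open>auto simp del: pair_ring_add pair_ring_zero\<close>)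
    have 1: "(x \<oplus>\<^bsub>D\<^esub> y) \<otimes>\<^bsub>D\<^esub> z \<ominus>\<^bsub>D\<^esub> x \<otimes>\<^bsub>D\<^esub> z \<ominus>\<^bsub>D\<^esub> y \<otimes>\<^bsub>D\<^esub> z = \<zero>\<^bsub>D\<^esub>" "z \<otimes>\<^bsub>D\<^esub> (x \<oplus>\<^bsub>D\<^esub> y) \<ominus>\<^bsub>D\<^esub> z \<otimes>\<^bsub>D\<^esub> x \<ominus>\<^bsub>D\<^esub> z \<otimes>\<^bsub>D\<^esub> y = \<zero>\<^bsub>D\<^esub>"
      if "x \<in> carrier D" "y \<in> carrier D" "z \<in> carrier D" for x y z
      using that by algebra+
    show "rels \<subseteq> {x \<in> carrier (pair_ring A B). ?\<Phi> x = \<zero>\<^bsub>D\<^esub>}"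
    proof
      fix x assume x: "x \<in> rels"
      hence "?\<Phi> x = \<zero>\<^bsub>D\<^esub>"
        by (auto simp: diff of pair_ring_diff 1)
      thus "x \<in> {x \<in> carrier (pair_ring A B). ?\<Phi> x = \<zero>\<^bsub>D\<^esub>}" using x rels_carrier by blast
    qed
  qed
  hence I0: "?\<Phi> i = \<zero>\<^bsub>D\<^esub>" if "i \<in> I" for i using that by blast
  define h where "h Z = ?\<Phi> (SOME u. u \<in> carrier (pair_ring A B) \<and> Z = cls u)" for Z
  have h: "h (cls u) = ?\<Phi> u" if u: "u \<in> carrier (pair_ring A B)" for u
  proof -
    define w where "w = (SOME w. w \<in> carrier (pair_ring A B) \<and> cls u = cls w)"
    have w: "w \<in> carrier (pair_ring A B) \<and> cls u = cls w" unfolding w_def by (rule someI[of _ u]) (use u in simp)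
    have "?\<Phi> (u - w) = \<zero>\<^bsub>D\<^esub>" using I0 cls_eq_iff[OF u, of w] w by simp
    hence "?\<Phi> u \<ominus>\<^bsub>D\<^esub> ?\<Phi> w = \<zero>\<^bsub>D\<^esub>" using diff[OF u, of w] w by simp
    hence "?\<Phi> u = ?\<Phi> w" using D.r_right_minus_eq \<Phi>.hom_closed u w by simp
    thus ?thesis unfolding h_def w_def by simp
  qed
  have "h \<in> ring_hom T D"
  proof (rule ring_hom_memI)
    fix Z assume "Z \<in> carrier T"
    then obtain u where u: "u \<in> carrier (pair_ring A B)" "Z = cls u" unfolding carrier_T by blast
    thus "h Z \<in> carrier D" using h \<Phi>.hom_closed by simp
    fix Y assume "Y \<in> carrier T"
    then obtain v where v: "v \<in> carrier (pair_ring A B)" "Y = cls v" unfolding carrier_T by blast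
    have "Z \<otimes>\<^bsub>T\<^esub> Y = cls (u \<otimes>\<^bsub>pair_ring A B\<^esub> v)" "Z \<oplus>\<^bsub>T\<^esub> Y = cls (u \<oplus>\<^bsub>pair_ring A B\<^esub> v)"
      using u v cls.hom_mult cls.hom_add by (simp_all del: pair_ring_add)
    note ZY = this
    have "h (Z \<otimes>\<^bsub>T\<^esub> Y) = ?\<Phi> (u \<otimes>\<^bsub>pair_ring A B\<^esub> v)" unfolding ZY(1) by (rule h[OF PR.m_closed[OF u(1) v(1)]])
    also have "\<dots> = ?\<Phi> u \<otimes>\<^bsub>D\<^esub> ?\<Phi> v" by (rule \<Phi>.hom_mult[OF u(1) v(1)])
    also have "\<dots> = h Z \<otimes>\<^bsub>D\<^esub> h Y" unfolding u(2) v(2) h[OF u(1)] h[OF v(1)] by (rule refl)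
    finally show "h (Z \<otimes>\<^bsub>T\<^esub> Y) = h Z \<otimes>\<^bsub>D\<^esub> h Y" .
    have "h (Z \<oplus>\<^bsub>T\<^esub> Y) = ?\<Phi> (u \<oplus>\<^bsub>pair_ring A B\<^esub> v)" unfolding ZY(2) by (rule h[OF PR.a_closed[OF u(1) v(1)]])
    also have "\<dots> = ?\<Phi> u \<oplus>\<^bsub>D\<^esub> ?\<Phi> v" by (rule \<Phi>.hom_add[OF u(1) v(1)])
    also have "\<dots> = h Z \<oplus>\<^bsub>D\<^esub> h Y" unfolding u(2) v(2) h[OF u(1)] h[OF v(1)] by (rule refl)
    finally show "h (Z \<oplus>\<^bsub>T\<^esub> Y) = h Z \<oplus>\<^bsub>D\<^esub> h Y" .
  next
    have "h (cls \<one>\<^bsub>pair_ring A B\<^esub>) = \<one>\<^bsub>D\<^esub>" using h[OF PR.one_closed] \<Phi>.hom_one by simp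
    thus "h \<one>\<^bsub>T\<^esub> = \<one>\<^bsub>D\<^esub>" using cls.hom_one by simp
  qed
  thus ?thesis using h by blast
qed

definition tens :: "'a \<Rightarrow> 'b \<Rightarrow> (('a \<times> 'b) \<Rightarrow>\<^sub>0 int) set" where
  "tens a b = cls (frag_of (a, b))"

lemma tens_closed [simp]: "a \<in> carrier A \<Longrightarrow> b \<in> carrier B \<Longrightarrow> tens a b \<in> carrier T"
  unfolding tens_def by simp

lemma tens_mult:
  assumes "a \<in> carrier A" "b \<in> carrier B" "a' \<in> carrier A" "b' \<in> carrier B"
  shows "tens a b \<otimes>\<^bsub>T\<^esub> tens a' b' = tens (a \<otimes>\<^bsub>A\<^esub> a') (b \<otimes>\<^bsub>B\<^esub> b')"
proof -
  have "frag_of (a, b) \<otimes>\<^bsub>pair_ring A B\<^esub> frag_of (a', b') = frag_of (a \<otimes>\<^bsub>A\<^esub> a', b \<otimes>\<^bsub>B\<^esub> b')"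
    by (simp add: pair_ring_eq M.mring_def)
  thus ?thesis using cls.hom_mult[of "frag_of (a, b)" "frag_of (a', b')"] assms by (simp add: tens_def)
qed

lemma tens_one: "tens \<one>\<^bsub>A\<^esub> \<one>\<^bsub>B\<^esub> = \<one>\<^bsub>T\<^esub>"
  using cls.hom_one by (simp add: tens_def pair_ring_def)

lemma tens_add_left:
  assumes "a \<in> carrier A" "a' \<in> carrier A" "b \<in> carrier B"
  shows "tens (a \<oplus>\<^bsub>A\<^esub> a') b = tens a b \<oplus>\<^bsub>T\<^esub> tens a' b"
proof -
  let ?r = "frag_of (a \<oplus>\<^bsub>A\<^esub> a', b) - frag_of (a, b) - frag_of (a', b)"
  have "?r \<in> I" unfolding tensor_ideal_def using PR.genideal_self[OF rels_carrier] assms by blast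
  hence "frag_of (a \<oplus>\<^bsub>A\<^esub> a', b) - (frag_of (a, b) + frag_of (a', b)) \<in> I" by (simp add: algebra_simps)
  hence "cls (frag_of (a \<oplus>\<^bsub>A\<^esub> a', b)) = cls (frag_of (a, b) \<oplus>\<^bsub>pair_ring A B\<^esub> frag_of (a', b))"
    using assms by (subst cls_eq_iff) (auto simp del: pair_ring_add simp flip: pair_ring_add)
  thus ?thesis using assms by (simp add: tens_def cls.hom_add del: pair_ring_add)
qed

lemma tens_add_right:
  assumes "a \<in> carrier A" "b \<in> carrier B" "b' \<in> carrier B"
  shows "tens a (b \<oplus>\<^bsub>B\<^esub> b') = tens a b \<oplus>\<^bsub>T\<^esub> tens a b'"
proof -
  let ?r = "frag_of (a, b \<oplus>\<^bsub>B\<^esub> b') - frag_of (a, b) - frag_of (a, b')"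
  have "?r \<in> I" unfolding tensor_ideal_def using PR.genideal_self[OF rels_carrier] assms by blast
  hence "frag_of (a, b \<oplus>\<^bsub>B\<^esub> b') - (frag_of (a, b) + frag_of (a, b')) \<in> I" by (simp add: algebra_simps)
  hence "cls (frag_of (a, b \<oplus>\<^bsub>B\<^esub> b')) = cls (frag_of (a, b) \<oplus>\<^bsub>pair_ring A B\<^esub> frag_of (a, b'))"
    using assms by (subst cls_eq_iff) (auto simp del: pair_ring_add simp flip: pair_ring_add)
  thus ?thesis using assms by (simp add: tens_def cls.hom_add del: pair_ring_add)
qed

lemma left_hom: "(\<lambda>a. tens a \<one>\<^bsub>B\<^esub>) \<in> ring_hom A T"
  by (rule ring_hom_memI) (auto simp: tens_mult tens_add_left tens_one)

lemma right_hom: "(\<lambda>b. tens \<one>\<^bsub>A\<^esub> b) \<in> ring_hom B T"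
  by (rule ring_hom_memI) (auto simp: tens_mult tens_add_right tens_one)

lemma tens_eq: "a \<in> carrier A \<Longrightarrow> b \<in> carrier B \<Longrightarrow> tens a b = tens a \<one>\<^bsub>B\<^esub> \<otimes>\<^bsub>T\<^esub> tens \<one>\<^bsub>A\<^esub> b"
  by (simp add: tens_mult)

lemma T_induct [consumes 1, case_names tens diff]:
  assumes Z: "Z \<in> carrier T" and tens: "\<And>a b. a \<in> carrier A \<Longrightarrow> b \<in> carrier B \<Longrightarrow> P (tens a b)"
    and diff: "\<And>Z Y. Z \<in> carrier T \<Longrightarrow> Y \<in> carrier T \<Longrightarrow> P Z \<Longrightarrow> P Y \<Longrightarrow> P (Z \<ominus>\<^bsub>T\<^esub> Y)"
  shows "P Z"
proof -
  obtain u where u: "Poly_Mapping.keys u \<subseteq> pairs" "Z = cls u" using Z unfolding carrier_T by (auto simp: carrier_pair_ring)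
  have d: "P (cls (a - b))" if "Poly_Mapping.keys a \<subseteq> pairs" "Poly_Mapping.keys b \<subseteq> pairs" "P (cls a)" "P (cls b)" for a b
  proof -
    have ab: "a \<in> carrier (pair_ring A B)" "b \<in> carrier (pair_ring A B)" using that by (simp_all add: carrier_pair_ring)
    have "cls (a \<ominus>\<^bsub>pair_ring A B\<^esub> b) = cls a \<ominus>\<^bsub>T\<^esub> cls b"
      using ab cls.hom_add cls.hom_a_inv by (simp add: PR.minus_eq T.minus_eq del: pair_ring_add)
    thus ?thesis using diff[of "cls a" "cls b"] that ab pair_ring_diff(2)[OF ab] by simp
  qed
  have of: "P (cls (frag_of x))" if "x \<in> pairs" for x using that tens unfolding tens_def by auto
  have P0: "P (cls 0)"
    using d[of "frag_of (\<zero>\<^bsub>A\<^esub>, \<zero>\<^bsub>B\<^esub>)" "frag_of (\<zero>\<^bsub>A\<^esub>, \<zero>\<^bsub>B\<^esub>)"] of[of "(\<zero>\<^bsub>A\<^esub>, \<zero>\<^bsub>B\<^esub>)"] by (simp add: keys_frag_of)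
  have "P (cls w)" if "Poly_Mapping.keys w \<subseteq> pairs" for w
    using that by (induction w rule: frag_add_induct) (use d of P0 in auto)
  thus ?thesis unfolding u(2) using u(1) by blast
qed

end

section \<open>The group algebra of a linearly ordered group\<close>

text \<open>The group algebra as finitely supported functions on the exponents. The order on the exponents serves only to show that it is a domain.\<close>

definition (in cring) group_algebra :: "('e::linordered_ab_group_add \<Rightarrow> 'a) ring" where
  "group_algebra = \<lparr> carrier = {f. finite {m. f m \<noteq> \<zero>} \<and> (\<forall>m. f m \<in> carrier R)},
     monoid.mult = (\<lambda>f g m. \<Oplus>a\<in>{a. f a \<noteq> \<zero>}. f a \<otimes> g (m - a)),
     one = (\<lambda>m. if m = 0 then \<one> else \<zero>), ring.zero = (\<lambda>m. \<zero>), add = (\<lambda>f g m. f m \<oplus> g m) \<rparr>"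

text \<open>The monomial with exponent \<open>a\<close> and coefficient \<open>k\<close>.\<close>

definition (in cring) delta :: "'e::linordered_ab_group_add \<Rightarrow> 'a \<Rightarrow> 'e \<Rightarrow> 'a" where
  "delta a k = (\<lambda>m. if m = a then k else \<zero>)"

context cring
begin

lemma galD: "f \<in> carrier group_algebra \<Longrightarrow> finite {m. f m \<noteq> \<zero>}" "f \<in> carrier group_algebra \<Longrightarrow> f m \<in> carrier R"
  by (auto simp: group_algebra_def)

lemma group_algebra_simps: "f \<oplus>\<^bsub>group_algebra\<^esub> g = (\<lambda>m. f m \<oplus> g m)" "\<zero>\<^bsub>group_algebra\<^esub> = (\<lambda>m. \<zero>)" "\<one>\<^bsub>group_algebra\<^esub> = delta 0 \<one>"
  by (auto simp: group_algebra_def delta_def)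

lemma delta_in_group_algebra [simp]: "k \<in> carrier R \<Longrightarrow> delta a k \<in> carrier group_algebra"
proof -
  assume "k \<in> carrier R"
  moreover have "finite {m. delta a k m \<noteq> \<zero>}" by (rule finite_subset[of _ "{a}"]) (auto simp: delta_def)
  ultimately show ?thesis by (auto simp: group_algebra_def delta_def)
qed

lemma group_algebra_add_closed:
  assumes "f \<in> carrier group_algebra" "g \<in> carrier group_algebra"
  shows "f \<oplus>\<^bsub>group_algebra\<^esub> g \<in> carrier group_algebra"
proof -
  have "finite {m. f m \<oplus> g m \<noteq> \<zero>}"
    by (rule finite_subset[of _ "{m. f m \<noteq> \<zero>} \<union> {m. g m \<noteq> \<zero>}"]) (use galD[OF assms(1)] galD[OF assms(2)] in auto)
  thus ?thesis using galD[OF assms(1)] galD[OF assms(2)] by (auto simp: group_algebra_def)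
qed

lemma group_algebra_induct [consumes 1, case_names zero step]:
  assumes f: "f \<in> carrier group_algebra" and zero: "P \<zero>\<^bsub>group_algebra\<^esub>"
    and step: "\<And>a k g. k \<in> carrier R \<Longrightarrow> g \<in> carrier group_algebra \<Longrightarrow> P g \<Longrightarrow> P (delta a k \<oplus>\<^bsub>group_algebra\<^esub> g)"
  shows "P f"
proof -
  have "finite S \<Longrightarrow> {m. f m \<noteq> \<zero>} \<subseteq> S \<Longrightarrow> f \<in> carrier group_algebra \<Longrightarrow> P f" for S f
  proof (induction S arbitrary: f rule: finite_induct)
    case empty
    hence "f = \<zero>\<^bsub>group_algebra\<^esub>" by (auto simp: group_algebra_simps)
    thus ?case using zero by simp
  next
    case (insert a S)
    define g where "g = f(a := \<zero>)"
    have "finite {m. g m \<noteq> \<zero>}" by (rule finite_subset[OF _ insert(1)]) (use insert(4) in \<open>auto simp: g_def\<close>)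
    hence g: "g \<in> carrier group_algebra" using galD(2)[OF insert(5)] by (auto simp: group_algebra_def g_def)
    have "f = delta a (f a) \<oplus>\<^bsub>group_algebra\<^esub> g" using galD(2)[OF insert(5)] by (auto simp: group_algebra_simps delta_def g_def)
    moreover have "P g" by (rule insert(3)[OF _ g]) (use insert(4) in \<open>auto simp: g_def\<close>)
    ultimately show ?case using step[OF galD(2)[OF insert(5)] g, of a a] by simp
  qed
  thus ?thesis using galD(1)[OF f] f by blast
qed

lemma group_algebra_mult_superset:
  assumes f: "f \<in> carrier group_algebra" and g: "g \<in> carrier group_algebra" and S: "finite S" "{a. f a \<noteq> \<zero>} \<subseteq> S"
  shows "(f \<otimes>\<^bsub>group_algebra\<^esub> g) m = (\<Oplus>a\<in>S. f a \<otimes> g (m - a))"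
proof -
  have "(f \<otimes>\<^bsub>group_algebra\<^esub> g) m = (\<Oplus>a\<in>{a. f a \<noteq> \<zero>}. f a \<otimes> g (m - a))" by (simp add: group_algebra_def)
  also have "\<dots> = (\<Oplus>a\<in>S. f a \<otimes> g (m - a))"
    by (rule add.finprod_mono_neutral_cong_left) (use S galD(2)[OF f] galD(2)[OF g] in auto)
  finally show ?thesis .
qed

lemma group_algebra_delta_mult:
  assumes k: "k \<in> carrier R" and g: "g \<in> carrier group_algebra"
  shows "delta a k \<otimes>\<^bsub>group_algebra\<^esub> g = (\<lambda>m. k \<otimes> g (m - a))"
proof
  fix m
  have "(delta a k \<otimes>\<^bsub>group_algebra\<^esub> g) m = (\<Oplus>b\<in>{a}. delta a k b \<otimes> g (m - b))"
    by (rule group_algebra_mult_superset[OF delta_in_group_algebra[OF k] g]) (auto simp: delta_def)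
  also have "\<dots> = k \<otimes> g (m - a)" using k galD(2)[OF g] by (simp add: delta_def)
  finally show "(delta a k \<otimes>\<^bsub>group_algebra\<^esub> g) m = k \<otimes> g (m - a)" .
qed

lemma group_algebra_l_distr:
  assumes f: "f \<in> carrier group_algebra" and f': "f' \<in> carrier group_algebra" and g: "g \<in> carrier group_algebra"
  shows "(f \<oplus>\<^bsub>group_algebra\<^esub> f') \<otimes>\<^bsub>group_algebra\<^esub> g = (f \<otimes>\<^bsub>group_algebra\<^esub> g) \<oplus>\<^bsub>group_algebra\<^esub> (f' \<otimes>\<^bsub>group_algebra\<^esub> g)"
proof
  fix m
  let ?S = "{a. f a \<noteq> \<zero>} \<union> {a. f' a \<noteq> \<zero>}"
  have S: "finite ?S" using galD(1)[OF f] galD(1)[OF f'] by simp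
  have c: "f a \<in> carrier R" "f' a \<in> carrier R" "g a \<in> carrier R" for a using galD(2) f f' g by auto
  have "((f \<oplus>\<^bsub>group_algebra\<^esub> f') \<otimes>\<^bsub>group_algebra\<^esub> g) m = (\<Oplus>a\<in>?S. (f \<oplus>\<^bsub>group_algebra\<^esub> f') a \<otimes> g (m - a))"
    by (rule group_algebra_mult_superset[OF group_algebra_add_closed[OF f f'] g S]) (auto simp: group_algebra_simps)
  also have "\<dots> = (\<Oplus>a\<in>?S. f a \<otimes> g (m - a) \<oplus> f' a \<otimes> g (m - a))"
    by (rule finsum_cong') (auto simp: group_algebra_simps l_distr c)
  also have "\<dots> = (\<Oplus>a\<in>?S. f a \<otimes> g (m - a)) \<oplus> (\<Oplus>a\<in>?S. f' a \<otimes> g (m - a))"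
    by (rule finsum_addf) (auto simp: c)
  also have "\<dots> = (f \<otimes>\<^bsub>group_algebra\<^esub> g) m \<oplus> (f' \<otimes>\<^bsub>group_algebra\<^esub> g) m"
    using group_algebra_mult_superset[OF f g S, of m] group_algebra_mult_superset[OF f' g S, of m] by simp
  finally show "((f \<oplus>\<^bsub>group_algebra\<^esub> f') \<otimes>\<^bsub>group_algebra\<^esub> g) m = ((f \<otimes>\<^bsub>group_algebra\<^esub> g) \<oplus>\<^bsub>group_algebra\<^esub> (f' \<otimes>\<^bsub>group_algebra\<^esub> g)) m"
    by (simp add: group_algebra_simps)
qed

lemma group_algebra_r_distr:
  assumes f: "f \<in> carrier group_algebra" and g: "g \<in> carrier group_algebra" and g': "g' \<in> carrier group_algebra"
  shows "f \<otimes>\<^bsub>group_algebra\<^esub> (g \<oplus>\<^bsub>group_algebra\<^esub> g') = (f \<otimes>\<^bsub>group_algebra\<^esub> g) \<oplus>\<^bsub>group_algebra\<^esub> (f \<otimes>\<^bsub>group_algebra\<^esub> g')"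
proof
  fix m
  let ?S = "{a. f a \<noteq> \<zero>}"
  have S: "finite ?S" using galD(1)[OF f] .
  have c: "f a \<in> carrier R" "g' a \<in> carrier R" "g a \<in> carrier R" for a using galD(2) f g g' by auto
  have "(f \<otimes>\<^bsub>group_algebra\<^esub> (g \<oplus>\<^bsub>group_algebra\<^esub> g')) m = (\<Oplus>a\<in>?S. f a \<otimes> (g \<oplus>\<^bsub>group_algebra\<^esub> g') (m - a))"
    by (rule group_algebra_mult_superset[OF f group_algebra_add_closed[OF g g'] S]) simp
  also have "\<dots> = (\<Oplus>a\<in>?S. f a \<otimes> g (m - a) \<oplus> f a \<otimes> g' (m - a))"
    by (rule finsum_cong') (auto simp: group_algebra_simps r_distr c)
  also have "\<dots> = (\<Oplus>a\<in>?S. f a \<otimes> g (m - a)) \<oplus> (\<Oplus>a\<in>?S. f a \<otimes> g' (m - a))"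
    by (rule finsum_addf) (auto simp: c)
  also have "\<dots> = (f \<otimes>\<^bsub>group_algebra\<^esub> g) m \<oplus> (f \<otimes>\<^bsub>group_algebra\<^esub> g') m"
    using group_algebra_mult_superset[OF f g S, of m] group_algebra_mult_superset[OF f g' S, of m] by simp
  finally show "(f \<otimes>\<^bsub>group_algebra\<^esub> (g \<oplus>\<^bsub>group_algebra\<^esub> g')) m = ((f \<otimes>\<^bsub>group_algebra\<^esub> g) \<oplus>\<^bsub>group_algebra\<^esub> (f \<otimes>\<^bsub>group_algebra\<^esub> g')) m"
    by (simp add: group_algebra_simps)
qed

lemma group_algebra_zero_closed: "\<zero>\<^bsub>group_algebra\<^esub> \<in> carrier group_algebra"
  by (simp add: group_algebra_def)

lemma group_algebra_zero_mult: "f \<in> carrier group_algebra \<Longrightarrow> \<zero>\<^bsub>group_algebra\<^esub> \<otimes>\<^bsub>group_algebra\<^esub> f = \<zero>\<^bsub>group_algebra\<^esub>" "f \<in> carrier group_algebra \<Longrightarrow> f \<otimes>\<^bsub>group_algebra\<^esub> \<zero>\<^bsub>group_algebra\<^esub> = \<zero>\<^bsub>group_algebra\<^esub>"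
proof -
  assume f: "f \<in> carrier group_algebra"
  show "\<zero>\<^bsub>group_algebra\<^esub> \<otimes>\<^bsub>group_algebra\<^esub> f = \<zero>\<^bsub>group_algebra\<^esub>" by (simp add: group_algebra_def)
  have "(\<Oplus>a\<in>{a. f a \<noteq> \<zero>}. f a \<otimes> \<zero>) = \<zero>" by (rule add.finprod_one_eqI) (use galD(2)[OF f] in simp)
  thus "f \<otimes>\<^bsub>group_algebra\<^esub> \<zero>\<^bsub>group_algebra\<^esub> = \<zero>\<^bsub>group_algebra\<^esub>" by (simp add: group_algebra_def)
qed

lemma group_algebra_delta_delta: "k \<in> carrier R \<Longrightarrow> l \<in> carrier R \<Longrightarrow> delta a k \<otimes>\<^bsub>group_algebra\<^esub> delta b l = delta (a + b) (k \<otimes> l)"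
  unfolding group_algebra_delta_mult[OF _ delta_in_group_algebra] by (auto simp: delta_def fun_eq_iff algebra_simps)

lemma group_algebra_mult_closed:
  assumes f: "f \<in> carrier group_algebra" and g: "g \<in> carrier group_algebra"
  shows "f \<otimes>\<^bsub>group_algebra\<^esub> g \<in> carrier group_algebra"
  using f
proof (induction f rule: group_algebra_induct)
  case zero
  show ?case by (simp add: group_algebra_zero_mult[OF g] group_algebra_zero_closed)
next
  case (step a k f)
  have "delta a k \<otimes>\<^bsub>group_algebra\<^esub> g \<in> carrier group_algebra"
  proof -
    have "finite {m. k \<otimes> g (m - a) \<noteq> \<zero>}"
    proof (rule finite_subset)
      show "{m. k \<otimes> g (m - a) \<noteq> \<zero>} \<subseteq> (\<lambda>b. b + a) ` {b. g b \<noteq> \<zero>}"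
      proof
        fix m assume "m \<in> {m. k \<otimes> g (m - a) \<noteq> \<zero>}"
        hence "g (m - a) \<noteq> \<zero>" using step(1) by auto
        thus "m \<in> (\<lambda>b. b + a) ` {b. g b \<noteq> \<zero>}" by (intro image_eqI[of _ _ "m - a"]) auto
      qed
      show "finite ((\<lambda>b. b + a) ` {b. g b \<noteq> \<zero>})" using galD(1)[OF g] by simp
    qed
    thus ?thesis unfolding group_algebra_delta_mult[OF step(1) g] using step(1) galD(2)[OF g] by (auto simp: group_algebra_def)
  qed
  thus ?case using step group_algebra_l_distr[OF delta_in_group_algebra[OF step(1)] step(2) g] group_algebra_add_closed by simp
qed

lemma group_algebra_comm:
  assumes f: "f \<in> carrier group_algebra" and g: "g \<in> carrier group_algebra"
  shows "f \<otimes>\<^bsub>group_algebra\<^esub> g = g \<otimes>\<^bsub>group_algebra\<^esub> f"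
  using f
proof (induction f rule: group_algebra_induct)
  case (step a k f)
  have "delta a k \<otimes>\<^bsub>group_algebra\<^esub> g = g \<otimes>\<^bsub>group_algebra\<^esub> delta a k"
    using g
  proof (induction g rule: group_algebra_induct)
    case (step b l g)
    thus ?case using \<open>k \<in> carrier R\<close> by (simp add: group_algebra_l_distr group_algebra_r_distr group_algebra_delta_delta m_comm add.commute)
  qed (use step(1) in \<open>simp add: group_algebra_zero_mult\<close>)
  thus ?case using step g by (simp add: group_algebra_l_distr group_algebra_r_distr)
qed (use g in \<open>simp add: group_algebra_zero_mult\<close>)

lemma group_algebra_assoc:
  assumes f: "f \<in> carrier group_algebra" and g: "g \<in> carrier group_algebra" and h: "h \<in> carrier group_algebra"
  shows "(f \<otimes>\<^bsub>group_algebra\<^esub> g) \<otimes>\<^bsub>group_algebra\<^esub> h = f \<otimes>\<^bsub>group_algebra\<^esub> (g \<otimes>\<^bsub>group_algebra\<^esub> h)"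
  using f
proof (induction f rule: group_algebra_induct)
  case (step a k f)
  have "(delta a k \<otimes>\<^bsub>group_algebra\<^esub> g) \<otimes>\<^bsub>group_algebra\<^esub> h = delta a k \<otimes>\<^bsub>group_algebra\<^esub> (g \<otimes>\<^bsub>group_algebra\<^esub> h)"
    using g
  proof (induction g rule: group_algebra_induct)
    case (step b l g)
    have k: "k \<in> carrier R" by fact
    have "delta (a + b) (k \<otimes> l) \<otimes>\<^bsub>group_algebra\<^esub> h = delta a k \<otimes>\<^bsub>group_algebra\<^esub> (delta b l \<otimes>\<^bsub>group_algebra\<^esub> h)"
      using k step(1) h group_algebra_mult_closed[OF delta_in_group_algebra[OF step(1)] h, of b] galD(2)[OF h]
      by (simp add: group_algebra_delta_mult fun_eq_iff m_assoc diff_diff_eq)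
    thus ?case using step k h by (simp add: group_algebra_l_distr group_algebra_r_distr group_algebra_delta_delta group_algebra_mult_closed)
  qed (use step(1) h in \<open>simp add: group_algebra_zero_mult\<close>)
  thus ?case using step g h by (simp add: group_algebra_l_distr group_algebra_mult_closed)
qed (use g h in \<open>simp add: group_algebra_zero_mult group_algebra_mult_closed\<close>)

lemma cring_group_algebra: "cring group_algebra"
proof (rule cringI)
  show "abelian_group group_algebra"
  proof (rule abelian_groupI)
    show "\<exists>g\<in>carrier group_algebra. g \<oplus>\<^bsub>group_algebra\<^esub> f = \<zero>\<^bsub>group_algebra\<^esub>" if f: "f \<in> carrier group_algebra" for f :: "'e::linordered_ab_group_add \<Rightarrow> 'a"
    proof (rule bexI)
      show "(\<lambda>m. \<ominus> f m) \<oplus>\<^bsub>group_algebra\<^esub> f = \<zero>\<^bsub>group_algebra\<^esub>" using galD(2)[OF f] by (simp add: group_algebra_simps l_neg)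
      have "{m. \<ominus> f m \<noteq> \<zero>} \<subseteq> {m. f m \<noteq> \<zero>}" by auto
      hence "finite {m. \<ominus> f m \<noteq> \<zero>}" using galD(1)[OF f] finite_subset by blast
      thus "(\<lambda>m. \<ominus> f m) \<in> carrier group_algebra" using galD(2)[OF f] by (simp add: group_algebra_def)
    qed
  qed (auto simp: group_algebra_add_closed group_algebra_zero_closed, auto simp: group_algebra_simps fun_eq_iff a_ac galD(2))
  show "comm_monoid group_algebra"
  proof (rule comm_monoidI)
    show "\<one>\<^bsub>group_algebra\<^esub> \<otimes>\<^bsub>group_algebra\<^esub> f = f" if f: "f \<in> carrier group_algebra" for f :: "'e::linordered_ab_group_add \<Rightarrow> 'a"
      unfolding group_algebra_simps group_algebra_delta_mult[OF one_closed f] using galD(2)[OF f] by simp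
    show "\<one>\<^bsub>group_algebra\<^esub> \<in> carrier group_algebra" by (simp add: group_algebra_simps)
  qed (auto simp: group_algebra_mult_closed group_algebra_assoc intro: group_algebra_comm)
qed (rule group_algebra_l_distr)

lemma delta_hom: "delta 0 \<in> ring_hom R group_algebra"
  by (rule ring_hom_memI) (simp_all add: group_algebra_delta_delta group_algebra_simps, simp add: delta_def fun_eq_iff)

lemma delta_unit:
  assumes "k \<in> Units R"
  shows "delta a k \<in> Units group_algebra"
proof -
  have k: "k \<in> carrier R" "inv k \<in> carrier R" using Units_closed[OF assms] Units_inv_closed[OF assms] by auto
  have "delta (- a) (inv k) \<otimes>\<^bsub>group_algebra\<^esub> delta a k = \<one>\<^bsub>group_algebra\<^esub>" "delta a k \<otimes>\<^bsub>group_algebra\<^esub> delta (- a) (inv k) = \<one>\<^bsub>group_algebra\<^esub>"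
    using k assms by (simp_all add: group_algebra_delta_delta group_algebra_simps)
  thus ?thesis unfolding Units_def using delta_in_group_algebra[OF k(1)] delta_in_group_algebra[OF k(2)] by blast
qed

end

lemma (in domain) domain_group_algebra: "domain (group_algebra :: ('e::linordered_ab_group_add \<Rightarrow> 'a) ring)"
proof (rule domainI)
  show "cring (group_algebra :: ('e \<Rightarrow> 'a) ring)" by (rule cring_group_algebra)
  have "delta (0::'e) \<one> 0 \<noteq> \<zero>" by (simp add: delta_def)
  thus "\<one>\<^bsub>group_algebra\<^esub> \<noteq> (\<zero>\<^bsub>group_algebra\<^esub> :: 'e \<Rightarrow> 'a)" by (auto simp: group_algebra_simps)
  fix f g :: "'e \<Rightarrow> 'a" assume fg: "f \<otimes>\<^bsub>group_algebra\<^esub> g = \<zero>\<^bsub>group_algebra\<^esub>" and f: "f \<in> carrier group_algebra" and g: "g \<in> carrier group_algebra"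
  show "f = \<zero>\<^bsub>group_algebra\<^esub> \<or> g = \<zero>\<^bsub>group_algebra\<^esub>"
  proof (rule ccontr)
    assume "\<not> ?thesis"
    hence ne: "{a. f a \<noteq> \<zero>} \<noteq> {}" "{a. g a \<noteq> \<zero>} \<noteq> {}" by (auto simp: group_algebra_simps)
    \<comment> \<open>The product of the leading terms cannot cancel.\<close>
    define a where "a = Max {a. f a \<noteq> \<zero>}"
    define b where "b = Max {a. g a \<noteq> \<zero>}"
    have a: "f a \<noteq> \<zero>" and b: "g b \<noteq> \<zero>" using Max_in[OF galD(1)[OF f] ne(1)] Max_in[OF galD(1)[OF g] ne(2)] by (auto simp: a_def b_def)
    have z: "f a' \<otimes> g (a + b - a') = \<zero>" if "a' \<noteq> a" for a'
    proof (cases "f a' = \<zero>")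
      case False
      hence "a' < a" using Max_ge[OF galD(1)[OF f], of a'] that by (simp add: a_def)
      hence "\<not> a + b - a' \<le> b" by simp
      hence "g (a + b - a') = \<zero>" using Max_ge[OF galD(1)[OF g], of "a + b - a'"] by (auto simp: b_def)
      thus ?thesis using galD(2)[OF f] by simp
    qed (use galD(2)[OF g] in simp)
    have "(f \<otimes>\<^bsub>group_algebra\<^esub> g) (a + b) = (\<Oplus>a'\<in>{a. f a \<noteq> \<zero>}. f a' \<otimes> g (a + b - a'))" by (simp add: group_algebra_def)
    also have "\<dots> = (\<Oplus>a'\<in>{a}. f a' \<otimes> g (a + b - a'))"
      by (rule add.finprod_mono_neutral_cong_right) (use galD[OF f] galD(2)[OF g] a z in auto)
    also have "\<dots> = f a \<otimes> g b" using galD(2)[OF f] galD(2)[OF g] by simp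
    finally have "f a \<otimes> g b = \<zero>" using fg by (simp add: group_algebra_simps)
    thus False using integral[of "f a" "g b"] galD(2)[OF f] galD(2)[OF g] a b by blast
  qed
qed

lemma group_algebra_universal:
  fixes \<psi> :: "'e::linordered_ab_group_add \<Rightarrow> 'd"
  assumes K: "cring K" and D: "cring D" and g: "g \<in> ring_hom K D"
    and \<psi>: "\<And>a. \<psi> a \<in> carrier D" "\<And>a b. \<psi> (a + b) = \<psi> a \<otimes>\<^bsub>D\<^esub> \<psi> b" "\<psi> 0 = \<one>\<^bsub>D\<^esub>"
  obtains h where "h \<in> ring_hom (cring.group_algebra K) D"
    "\<And>a k. k \<in> carrier K \<Longrightarrow> h (cring.delta K a k) = g k \<otimes>\<^bsub>D\<^esub> \<psi> a"
proof -
  interpret K: cring K by fact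
  interpret D: cring D by fact
  interpret g: ring_hom_cring K D g by (rule ring_hom_cringI[OF K D g])
  let ?G = "K.group_algebra :: ('e \<Rightarrow> _) ring"
  interpret G: cring ?G by (rule K.cring_group_algebra)
  define h where "h f = (\<Oplus>\<^bsub>D\<^esub>m\<in>{m. f m \<noteq> \<zero>\<^bsub>K\<^esub>}. g (f m) \<otimes>\<^bsub>D\<^esub> \<psi> m)" for f
  have sup: "h f = (\<Oplus>\<^bsub>D\<^esub>m\<in>S. g (f m) \<otimes>\<^bsub>D\<^esub> \<psi> m)" if "f \<in> carrier ?G" "finite S" "{m. f m \<noteq> \<zero>\<^bsub>K\<^esub>} \<subseteq> S" for f S
    unfolding h_def
    by (rule D.add.finprod_mono_neutral_cong_left) (use that K.galD(2)[OF that(1)] \<psi>(1) in auto)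
  have cl: "h f \<in> carrier D" if "f \<in> carrier ?G" for f
    unfolding h_def by (rule D.finsum_closed) (use K.galD(2)[OF that] \<psi>(1) in auto)
  have add: "h (f \<oplus>\<^bsub>?G\<^esub> f') = h f \<oplus>\<^bsub>D\<^esub> h f'" if f: "f \<in> carrier ?G" "f' \<in> carrier ?G" for f f'
  proof -
    let ?S = "{a. f a \<noteq> \<zero>\<^bsub>K\<^esub>} \<union> {a. f' a \<noteq> \<zero>\<^bsub>K\<^esub>}"
    have S: "finite ?S" using K.galD(1)[OF f(1)] K.galD(1)[OF f(2)] by simp
    have c: "f a \<in> carrier K" "f' a \<in> carrier K" for a using K.galD(2) f by auto
    have "h (f \<oplus>\<^bsub>?G\<^esub> f') = (\<Oplus>\<^bsub>D\<^esub>m\<in>?S. g ((f \<oplus>\<^bsub>?G\<^esub> f') m) \<otimes>\<^bsub>D\<^esub> \<psi> m)"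
      by (rule sup[OF G.a_closed[OF f] S]) (auto simp: K.group_algebra_simps)
    also have "\<dots> = (\<Oplus>\<^bsub>D\<^esub>m\<in>?S. g (f m) \<otimes>\<^bsub>D\<^esub> \<psi> m \<oplus>\<^bsub>D\<^esub> g (f' m) \<otimes>\<^bsub>D\<^esub> \<psi> m)"
      by (rule D.finsum_cong') (auto simp: K.group_algebra_simps D.l_distr c \<psi>(1))
    also have "\<dots> = (\<Oplus>\<^bsub>D\<^esub>m\<in>?S. g (f m) \<otimes>\<^bsub>D\<^esub> \<psi> m) \<oplus>\<^bsub>D\<^esub> (\<Oplus>\<^bsub>D\<^esub>m\<in>?S. g (f' m) \<otimes>\<^bsub>D\<^esub> \<psi> m)"
      by (rule D.finsum_addf) (auto simp: c \<psi>(1))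
    also have "\<dots> = h f \<oplus>\<^bsub>D\<^esub> h f'" using sup[OF f(1) S] sup[OF f(2) S] by simp
    finally show ?thesis .
  qed
  have delta: "h (K.delta a k) = g k \<otimes>\<^bsub>D\<^esub> \<psi> a" if k: "k \<in> carrier K" for a k
  proof -
    have "h (K.delta a k) = (\<Oplus>\<^bsub>D\<^esub>m\<in>{a}. g (K.delta a k m) \<otimes>\<^bsub>D\<^esub> \<psi> m)"
      by (rule sup[OF K.delta_in_group_algebra[OF k]]) (auto simp: K.delta_def)
    thus ?thesis using k \<psi>(1) by (simp add: K.delta_def)
  qed
  have h0: "h \<zero>\<^bsub>?G\<^esub> = \<zero>\<^bsub>D\<^esub>" by (simp add: h_def K.group_algebra_simps)
  have mult: "h (f \<otimes>\<^bsub>?G\<^esub> f') = h f \<otimes>\<^bsub>D\<^esub> h f'" if f: "f \<in> carrier ?G" and f': "f' \<in> carrier ?G" for f f'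
    using f
  proof (induction f rule: K.group_algebra_induct)
    case zero
    show ?case using f' cl by (simp add: h0)
  next
    case (step a k f)
    have k: "k \<in> carrier K" by fact
    have 1: "h (K.delta a k \<otimes>\<^bsub>?G\<^esub> f') = h (K.delta a k) \<otimes>\<^bsub>D\<^esub> h f'"
      using f'
    proof (induction f' rule: K.group_algebra_induct)
      case zero
      show ?case using k cl[OF K.delta_in_group_algebra[OF k]] by (simp add: h0)
    next
      case (step b l f')
      have "h (K.delta a k \<otimes>\<^bsub>?G\<^esub> K.delta b l) = h (K.delta a k) \<otimes>\<^bsub>D\<^esub> h (K.delta b l)"
        using k step(1) \<psi>(1) by (simp add: K.group_algebra_delta_delta delta \<psi>(2) D.m_ac)
      thus ?case using step k cl by (simp add: G.r_distr D.r_distr add)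
    qed
    show ?case using step k 1 f' cl by (simp add: G.l_distr D.l_distr add)
  qed
  have "h \<in> ring_hom ?G D"
    by (rule ring_hom_memI) (use cl mult add delta[of "\<one>\<^bsub>K\<^esub>" 0] \<psi>(3) in \<open>auto simp: K.group_algebra_simps(3)\<close>)
  thus thesis using delta by (rule that)
qed

section \<open>Homomorphisms out of Laurent polynomial rings\<close>

lemma units_character:
  fixes u :: "'x \<Rightarrow> 'd"
  assumes D: "cring D" and u: "\<And>i. u i \<in> Units D"
  obtains \<psi> where "\<And>e. \<psi> e \<in> Units D" "\<And>e e'. \<psi> (e + e') = \<psi> e \<otimes>\<^bsub>D\<^esub> \<psi> e'" "\<psi> 0 = \<one>\<^bsub>D\<^esub>" "\<And>i. \<psi> (frag_of i) = u i"
proof -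
  interpret D: cring D by fact
  interpret U: comm_group "units_of D" by (rule D.units_comm_group)
  have "u ` UNIV \<subseteq> carrier (units_of D)" using u by (auto simp: units_of_def)
  then obtain \<psi> where \<psi>: "\<psi> \<in> hom (free_Abelian_group UNIV) (units_of D)" "\<And>x. \<psi> (frag_of x) = u x"
    using U.free_Abelian_group_universal[of u UNIV] by (metis UNIV_I)
  have m: "\<psi> (e + e') = \<psi> e \<otimes>\<^bsub>D\<^esub> \<psi> e'" and c: "\<psi> e \<in> Units D" for e e'
    using \<psi>(1) by (auto simp: hom_def free_Abelian_group_def units_of_def)
  have "\<psi> 0 \<otimes>\<^bsub>D\<^esub> \<psi> 0 = \<psi> 0" using m[of 0 0] by simp
  hence "\<psi> 0 = \<one>\<^bsub>D\<^esub>"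
    using c[of 0] D.Units_closed D.Units_l_cancel[of "\<psi> 0" "\<psi> 0" "\<one>\<^bsub>D\<^esub>"] by simp
  show thesis by (rule that[OF c m \<open>\<psi> 0 = \<one>\<^bsub>D\<^esub>\<close> \<psi>(2)])
qed

text \<open>Laurent polynomials in a cluster have unique representations, so a choice of units for the cluster variables extends to a homomorphism.\<close>

lemma laurent_universal:
  fixes t :: "('i, 'f::field_char_0) seed" and D :: "('d, 'n) ring_scheme"
  assumes t: "good t" and D: "cring D" and u: "\<And>i. i \<in> ind t \<Longrightarrow> u i \<in> Units D"
  obtains f where "\<And>x. x \<in> laurents t \<Longrightarrow> f x \<in> carrier D"
    "\<And>x y. x \<in> laurents t \<Longrightarrow> y \<in> laurents t \<Longrightarrow> f (x + y) = f x \<oplus>\<^bsub>D\<^esub> f y"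
    "\<And>x y. x \<in> laurents t \<Longrightarrow> y \<in> laurents t \<Longrightarrow> f (x * y) = f x \<otimes>\<^bsub>D\<^esub> f y"
    "f 1 = \<one>\<^bsub>D\<^esub>" "\<And>i. i \<in> ind t \<Longrightarrow> f (var t i) = u i"
proof -
  interpret D: cring D by fact
  obtain \<psi> where \<psi>: "\<And>e. \<psi> e \<in> Units D" "\<And>e e'. \<psi> (e + e') = \<psi> e \<otimes>\<^bsub>D\<^esub> \<psi> e'" "\<psi> 0 = \<one>\<^bsub>D\<^esub>"
    "\<And>i. \<psi> (frag_of i) = (if i \<in> ind t then u i else \<one>\<^bsub>D\<^esub>)"
  proof -
    have "(if i \<in> ind t then u i else \<one>\<^bsub>D\<^esub>) \<in> Units D" for i using u by simp
    from units_character[OF D this] that show thesis .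
  qed
  have \<psi>c: "\<psi> \<in> UNIV \<rightarrow> carrier D" using \<psi>(1) D.Units_closed by auto
  define F where "F p = additive_ext D \<psi> p" for p :: "'i laurent"
  have Fadd: "F (p + q) = F p \<oplus>\<^bsub>D\<^esub> F q" for p q unfolding F_def by (rule D.additive_ext_add[OF _ _ \<psi>c]) auto
  have Fdiff: "F (p - q) = F p \<ominus>\<^bsub>D\<^esub> F q" for p q unfolding F_def by (rule D.additive_ext_diff[OF _ _ \<psi>c]) auto
  have Fcl: "F p \<in> carrier D" for p unfolding F_def by (rule D.additive_ext_closed[OF _ \<psi>c]) auto
  have Fof: "F (frag_of e) = \<psi> e" for e unfolding F_def using \<psi>c by (intro D.additive_ext_of) auto
  have F0: "F 0 = \<zero>\<^bsub>D\<^esub>" by (simp add: F_def)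
  have min: "(a \<ominus>\<^bsub>D\<^esub> b) \<otimes>\<^bsub>D\<^esub> c = a \<otimes>\<^bsub>D\<^esub> c \<ominus>\<^bsub>D\<^esub> b \<otimes>\<^bsub>D\<^esub> c" "c \<otimes>\<^bsub>D\<^esub> (a \<ominus>\<^bsub>D\<^esub> b) = c \<otimes>\<^bsub>D\<^esub> a \<ominus>\<^bsub>D\<^esub> c \<otimes>\<^bsub>D\<^esub> b" 
    if "a \<in> carrier D" "b \<in> carrier D" "c \<in> carrier D" for a b c using that by algebra+
  have Fmult: "F (p * q) = F p \<otimes>\<^bsub>D\<^esub> F q" for p q
  proof -
    have "Poly_Mapping.keys p \<subseteq> UNIV" by simp
    thus ?thesis
    proof (induction p rule: frag_add_induct)
      case (of a)
      have "Poly_Mapping.keys q \<subseteq> UNIV" by simp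
      thus ?case
      proof (induction q rule: frag_add_induct)
        case (of b)
        show ?case by (simp add: mult_single Fof \<psi>(2))
      next
        case (diff q r)
        thus ?case by (simp add: right_diff_distrib Fdiff min Fcl)
      qed (simp add: F0 Fcl)
    next
      case (diff q r)
      thus ?case by (simp add: left_diff_distrib Fdiff min Fcl)
    qed (simp add: F0 Fcl)
  qed
  define r where "r x = (SOME p. p \<in> laurent_in (ind t) \<and> laurent_eval (padded_var t) p = x)" for x
  have r: "r x \<in> laurent_in (ind t)" "laurent_eval (padded_var t) (r x) = x" if "x \<in> laurents t" for x
    using someI_ex[of "\<lambda>p. p \<in> laurent_in (ind t) \<and> laurent_eval (padded_var t) p = x"] that unfolding r_def laurents_def by blast+
  have r_eq: "r x = p" if "p \<in> laurent_in (ind t)" "laurent_eval (padded_var t) p = x" for x p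
  proof -
    have "x \<in> laurents t" using that unfolding laurents_def by blast
    thus ?thesis using lindepD[OF goodD(3)[OF t] r(1) that(1)] r(2) that(2) by metis
  qed
  note nz = padded_var_nonzero[OF t]
  have r_ops: "r (x + y) = r x + r y" "r (x * y) = r x * r y" if "x \<in> laurents t" "y \<in> laurents t" for x y
    by (rule r_eq; use r[OF that(1)] r[OF that(2)] in \<open>simp add: laurent_in_add laurent_in_mult laurent_eval_add laurent_eval_mult nz\<close>)+
  have r1: "r 1 = 1" by (rule r_eq) simp_all
  have rv: "r (var t i) = frag_of (frag_of i)" if "i \<in> ind t" for i
    by (rule r_eq) (use that in \<open>auto intro!: laurent_in_single simp: padded_var_def\<close>)
  have F1: "F 1 = \<one>\<^bsub>D\<^esub>" using Fof[of 0] \<psi>(3) by (simp add: single_one)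
  show thesis
    by (rule that[of "\<lambda>x. F (r x)"]) (simp_all add: Fcl r_ops Fadd Fmult r1 F1 rv Fof \<psi>(4))
qed

section \<open>The local ring at a point of a torus\<close>

context tensor_product
begin

text \<open>The homomorphism out of the tensor product is chosen here as a function of \<open>f\<close> and \<open>g\<close>, so that different ones can be compared.\<close>

definition lift :: "('d, 'n1) ring_scheme \<Rightarrow> ('a \<Rightarrow> 'd) \<Rightarrow> ('b \<Rightarrow> 'd) \<Rightarrow> (('a \<times> 'b) \<Rightarrow>\<^sub>0 int) set \<Rightarrow> 'd" where
  "lift D f g = (SOME h. h \<in> ring_hom T D \<and>
     (\<forall>u\<in>carrier (pair_ring A B). h (cls u) = additive_ext D (\<lambda>(a, b). f a \<otimes>\<^bsub>D\<^esub> g b) u))"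

lemma lift:
  assumes D: "cring D" and f: "f \<in> ring_hom A D" and g: "g \<in> ring_hom B D"
  shows lift_hom: "lift D f g \<in> ring_hom T D"
    and lift_cls: "u \<in> carrier (pair_ring A B) \<Longrightarrow> lift D f g (cls u) = additive_ext D (\<lambda>(a, b). f a \<otimes>\<^bsub>D\<^esub> g b) u"
    and lift_tens: "a \<in> carrier A \<Longrightarrow> b \<in> carrier B \<Longrightarrow> lift D f g (tens a b) = f a \<otimes>\<^bsub>D\<^esub> g b"
proof -
  interpret D: cring D by fact
  have *: "lift D f g \<in> ring_hom T D \<and>
     (\<forall>u\<in>carrier (pair_ring A B). lift D f g (cls u) = additive_ext D (\<lambda>(a, b). f a \<otimes>\<^bsub>D\<^esub> g b) u)"
    using someI_ex[OF tensor_hom[OF D f g, unfolded Bex_def], folded lift_def] .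
  thus "lift D f g \<in> ring_hom T D" by blast
  show 1: "lift D f g (cls u) = additive_ext D (\<lambda>(a, b). f a \<otimes>\<^bsub>D\<^esub> g b) u" if "u \<in> carrier (pair_ring A B)" for u
    using * that by blast
  show "lift D f g (tens a b) = f a \<otimes>\<^bsub>D\<^esub> g b" if "a \<in> carrier A" "b \<in> carrier B"
    using that ring_hom_closed[OF f] ring_hom_closed[OF g] unfolding tens_def by (simp add: 1 D.additive_ext_of)
qed

end

lemma cluster_ring_a_inv: "x \<in> cluster_algebra s \<Longrightarrow> \<ominus>\<^bsub>cluster_ring s\<^esub> x = - x"
proof -
  assume x: "x \<in> cluster_algebra s"
  interpret A: cring "cluster_ring s" by (rule cring_cluster_ring)
  show ?thesis using A.minus_equality[of "- x" x] x sring_uminus[OF sring_cluster_algebra x] by simp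
qed

text \<open>Every element of the cluster algebra is, up to a power of the cluster monomial, a polynomial in the cluster. So homomorphisms that make
  this monomial invertible are determined by their values on one cluster.\<close>

lemma cluster_hom_eq:
  fixes s :: "('i, 'f::field_char_0) seed" and D :: "('d, 'n) ring_scheme"
  assumes s: "good s" and t: "t \<in> seeds_of s" and D: "cring D"
    and f: "f \<in> ring_hom (cluster_ring s) D" and g: "g \<in> ring_hom (cluster_ring s) D"
    and u: "\<And>i. i \<in> ind s \<Longrightarrow> f (var t i) \<in> Units D" and eq: "\<And>i. i \<in> ind s \<Longrightarrow> f (var t i) = g (var t i)"
    and x: "x \<in> cluster_algebra s"
  shows "f x = g x"
proof -
  note A = sring_cluster_algebra[of s]
  note ind = seeds_of_sel(1)[OF t]
  interpret D: cring D by fact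
  interpret f: ring_hom_cring "cluster_ring s" D f by (rule ring_hom_cringI[OF cring_cluster_ring D f])
  interpret g: ring_hom_cring "cluster_ring s" D g by (rule ring_hom_cringI[OF cring_cluster_ring D g])
  have fm: "f (a * b) = f a \<otimes>\<^bsub>D\<^esub> f b" "g (a * b) = g a \<otimes>\<^bsub>D\<^esub> g b" "f (a + b) = f a \<oplus>\<^bsub>D\<^esub> f b" "g (a + b) = g a \<oplus>\<^bsub>D\<^esub> g b"
    if "a \<in> cluster_algebra s" "b \<in> cluster_algebra s" for a b
    using f.hom_mult[of a b] g.hom_mult[of a b] f.hom_add[of a b] g.hom_add[of a b] that by simp_all
  have fc: "f a \<in> carrier D" "g a \<in> carrier D" if "a \<in> cluster_algebra s" for a
    using f.hom_closed[of a] g.hom_closed[of a] that by simp_all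
  \<comment> \<open>The equalizer is a subring containing the cluster, hence a multiple of \<open>x\<close> by a monomial that is mapped to a unit.\<close>
  define E where "E = {a \<in> cluster_algebra s. f a = g a}"
  have E: "sring E" unfolding sring_def
  proof (intro conjI ballI)
    show "1 \<in> E" using f.hom_one g.hom_one sring_one[OF A] by (simp add: E_def)
    show "- a \<in> E" if "a \<in> E" for a
      using that f.hom_a_inv[of a] g.hom_a_inv[of a] sring_uminus[OF A] by (simp add: E_def cluster_ring_a_inv)
  qed (auto simp: E_def fm sring_add[OF A] sring_mult[OF A])
  have v: "var t i \<in> cluster_algebra s" if "i \<in> ind s" for i by (rule var_in_cluster_algebra[OF t that])
  let ?m = "\<Prod>i\<in>ind t. var t i"
  obtain N where N: "x * ?m ^ N \<in> E"
    using laurents_clear_denominators[OF seeds_of_good[OF s t] E, of x] v eq x cluster_algebra_subset_laurents[OF s t]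
    by (auto simp: E_def ind)
  have "?m \<in> E" by (rule sring_prod[OF E]) (use v eq in \<open>simp add: E_def ind\<close>)
  hence mE: "?m ^ N \<in> E" by (rule sring_power[OF E])
  have "f (\<Prod>i\<in>S. var t i) \<in> Units D" if "finite S" "S \<subseteq> ind s" for S
    using that
  proof (induction S rule: finite_induct)
    case empty
    show ?case using f.hom_one by simp
  next
    case (insert i S)
    have "(\<Prod>i\<in>S. var t i) \<in> cluster_algebra s" by (rule sring_prod[OF A]) (use insert(4) v in auto)
    thus ?case using insert u[of i] v[of i] by (simp add: fm)
  qed
  hence um: "f ?m \<in> Units D" using goodD(1)[OF s] by (simp add: ind)
  have mA: "?m \<in> cluster_algebra s" by (rule sring_prod[OF A]) (use v in \<open>simp add: ind\<close>)
  have "f (?m ^ N) \<in> Units D" for N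
  proof (induction N)
    case 0
    show ?case using f.hom_one by simp
  next
    case (Suc N)
    thus ?case using um mA sring_power[OF A mA, of N] by (simp add: fm)
  qed
  moreover have "f x \<otimes>\<^bsub>D\<^esub> f (?m ^ N) = g x \<otimes>\<^bsub>D\<^esub> f (?m ^ N)"
    using N mE x by (simp add: E_def fm)
  ultimately show ?thesis
    using D.Units_l_cancel[of "f (?m ^ N)" "f x" "g x"] fc[OF x] D.Units_closed[of "f (?m ^ N)"]
    by (simp add: D.m_comm)
qed

lemma hom_generate_ring:
  assumes R: "ring R" and S: "ring S" and h: "h \<in> ring_hom R S" and H: "H \<subseteq> carrier R" and x: "x \<in> generate_ring R H"
  shows "h x \<in> generate_ring S (h ` H)"
proof -
  interpret h: ring_hom_ring R S h by (rule ring_hom_ringI2[OF R S h])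
  note c = h.R.generate_ring_in_carrier[OF H]
  show ?thesis using x
    by induction (auto simp: c intro: generate_ring.intros)
qed

lemma ring_hom_eq_tensor:
  fixes s :: "('i, 'f::field_char_0) seed" and D :: "('d, 'n) ring_scheme" and K :: "('l, 'm) ring_scheme"
  assumes s: "good s" and t: "t \<in> seeds_of s" and K: "cring K" and D: "cring D"
    and f: "f \<in> ring_hom (tensor_ring (cluster_ring s) K) D" and g: "g \<in> ring_hom (tensor_ring (cluster_ring s) K) D"
    and u: "\<And>i. i \<in> ind s \<Longrightarrow> f (tensor_product.tens (cluster_ring s) K (var t i) \<one>\<^bsub>K\<^esub>) \<in> Units D"
    and eq: "\<And>i. i \<in> ind s \<Longrightarrow> f (tensor_product.tens (cluster_ring s) K (var t i) \<one>\<^bsub>K\<^esub>) =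
       g (tensor_product.tens (cluster_ring s) K (var t i) \<one>\<^bsub>K\<^esub>)"
    and eqK: "\<And>c. c \<in> carrier K \<Longrightarrow> f (tensor_product.tens (cluster_ring s) K 1 c) = g (tensor_product.tens (cluster_ring s) K 1 c)"
    and x: "x \<in> carrier (tensor_ring (cluster_ring s) K)"
  shows "f x = g x"
proof -
  interpret D: cring D by fact
  interpret K: cring K by fact
  interpret TP: tensor_product "cluster_ring s" K
    by (rule tensor_product.intro[OF cring_cluster_ring K])
  interpret f: ring_hom_cring TP.T D f by (rule ring_hom_cringI[OF TP.cring_T D f])
  interpret g: ring_hom_cring TP.T D g by (rule ring_hom_cringI[OF TP.cring_T D g])
  have fA: "(\<lambda>a. f (TP.tens a \<one>\<^bsub>K\<^esub>)) \<in> ring_hom (cluster_ring s) D"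
    using ring_hom_trans[OF TP.left_hom f] by (simp add: o_def)
  have gA: "(\<lambda>a. g (TP.tens a \<one>\<^bsub>K\<^esub>)) \<in> ring_hom (cluster_ring s) D"
    using ring_hom_trans[OF TP.left_hom g] by (simp add: o_def)
  have A: "f (TP.tens a \<one>\<^bsub>K\<^esub>) = g (TP.tens a \<one>\<^bsub>K\<^esub>)" if "a \<in> cluster_algebra s" for a
    using cluster_hom_eq[OF s t D fA gA u eq that] .
  show ?thesis using x
  proof (induction x rule: TP.T_induct)
    case (tens a c)
    have "f (TP.tens a c) = f (TP.tens a \<one>\<^bsub>K\<^esub> \<otimes>\<^bsub>TP.T\<^esub> TP.tens 1 c)" using TP.tens_eq[OF tens] by simp
    also have "\<dots> = g (TP.tens a \<one>\<^bsub>K\<^esub> \<otimes>\<^bsub>TP.T\<^esub> TP.tens 1 c)"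
      using tens A[of a] eqK[of c] sring_one[OF sring_cluster_algebra, of s] by simp
    finally show ?case using TP.tens_eq[OF tens] by simp
  next
    case (diff Z Y)
    thus ?case by (simp add: a_minus_def)
  qed
qed

text \<open>A point \<open>p\<close> at which no variable of the cluster of \<open>t\<close> vanishes. Near \<open>p\<close> the cluster algebra over \<open>K\<close> looks like the torus with
  coordinates \<open>var t (b i)\<close>, \<open>i < n\<close>.\<close>

locale torus_point =
  fixes s t :: "('i, 'f::field_char_0) seed" and K :: "'l ring" and p :: "'f \<Rightarrow> 'l" and b :: "nat \<Rightarrow> 'i" and n :: nat
  assumes s: "good s" and t: "t \<in> seeds_of s" and K: "field K" and p: "p \<in> ring_hom (cluster_ring s) K"
    and nz: "\<And>i. i \<in> ind s \<Longrightarrow> p (var t i) \<noteq> \<zero>\<^bsub>K\<^esub>" and b: "bij_betw b {..<n} (ind s)"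
begin

sublocale K: field K by (rule K)

sublocale TP: tensor_product "cluster_ring s" K
  by (rule tensor_product.intro[OF cring_cluster_ring K.is_cring])

sublocale p: ring_hom_cring "cluster_ring s" K p
  by (rule ring_hom_cringI[OF cring_cluster_ring K.is_cring p])

abbreviation "T \<equiv> TP.T"
abbreviation "G \<equiv> K.group_algebra :: ((nat \<Rightarrow>\<^sub>0 int) \<Rightarrow> 'l) ring"
abbreviation "v i \<equiv> var t (b i)"

sublocale G: domain G by (rule K.domain_group_algebra)

lemma b_in: "i < n \<Longrightarrow> b i \<in> ind s" using b by (auto simp: bij_betw_def)

lemma b_cases: "i \<in> ind s \<Longrightarrow> (\<And>j. j < n \<Longrightarrow> i = b j \<Longrightarrow> thesis) \<Longrightarrow> thesis"
  using b by (auto simp: bij_betw_def)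

lemma v_in [simp]: "i < n \<Longrightarrow> v i \<in> cluster_algebra s" by (rule var_in_cluster_algebra[OF t b_in])

lemma one_in [simp]: "1 \<in> cluster_algebra s" by (rule sring_one[OF sring_cluster_algebra])

lemma p_in [simp]: "x \<in> cluster_algebra s \<Longrightarrow> p x \<in> carrier K"
  using p.hom_closed[of x] by simp

lemma p_unit: "i < n \<Longrightarrow> p (v i) \<in> Units K"
  using nz[OF b_in[of i]] by (simp add: K.field_Units)

definition ev where "ev = TP.lift K p id"

lemma id_hom: "id \<in> ring_hom K K" by (rule ring_hom_memI) auto

lemmas ev_hom = TP.lift_hom[OF K.is_cring p id_hom, folded ev_def]
  and ev_cls = TP.lift_cls[OF K.is_cring p id_hom, folded ev_def]
  and ev_tens = TP.lift_tens[OF K.is_cring p id_hom, folded ev_def]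

abbreviation "Q \<equiv> point_ideal (cluster_ring s) K p"

lemma Q_eq: "Q = {x \<in> carrier T. ev x = \<zero>\<^bsub>K\<^esub>}"
proof -
  have "ev (TP.cls u) = pair_eval K p u" if "u \<in> carrier (pair_ring (cluster_ring s) K)" for u
    using ev_cls[OF that] by (simp add: pair_eval_def additive_ext_def split_def)
  thus ?thesis unfolding point_ideal_def TP.carrier_T by auto
qed

lemma Q_prime: "primeideal Q T"
  unfolding Q_eq by (rule kernel_prime[OF TP.cring_T K.domain_axioms ev_hom])

text \<open>The coordinates of the generic point of the subtorus on which the first \<open>j\<close> coordinates agree with those of \<open>p\<close>: the remaining ones
  are indeterminates.\<close>

definition coord :: "nat \<Rightarrow> nat \<Rightarrow> (nat \<Rightarrow>\<^sub>0 int) \<Rightarrow> 'l" where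
  "coord j i = (if i < j then K.delta 0 (p (v i)) else K.delta (frag_of i) \<one>\<^bsub>K\<^esub>)"

lemma coord_unit: "i < n \<Longrightarrow> coord j i \<in> Units G"
  using p_unit by (auto simp: coord_def intro!: K.delta_unit)

lemma ex_restriction: "\<exists>f\<in>ring_hom (cluster_ring s) G. \<forall>i<n. f (v i) = coord j i"
proof -
  have inv: "the_inv_into {..<n} b i < n" if "i \<in> ind t" for i
    using the_inv_into_into[of b "{..<n}" i "{..<n}"] b that by (auto simp: bij_betw_def seeds_of_sel(1)[OF t])
  obtain f where f: "\<And>x. x \<in> laurents t \<Longrightarrow> f x \<in> carrier G"
      "\<And>x y. x \<in> laurents t \<Longrightarrow> y \<in> laurents t \<Longrightarrow> f (x + y) = f x \<oplus>\<^bsub>G\<^esub> f y"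
      "\<And>x y. x \<in> laurents t \<Longrightarrow> y \<in> laurents t \<Longrightarrow> f (x * y) = f x \<otimes>\<^bsub>G\<^esub> f y" "f 1 = \<one>\<^bsub>G\<^esub>"
      "\<And>i. i \<in> ind t \<Longrightarrow> f (var t i) = coord j (the_inv_into {..<n} b i)"
    by (rule laurent_universal[OF seeds_of_good[OF s t] G.is_cring,
          where u = "\<lambda>i. coord j (the_inv_into {..<n} b i)"]) (use coord_unit[OF inv] in blast)+
  note sub = subsetD[OF cluster_algebra_subset_laurents[OF s t]]
  have "f \<in> ring_hom (cluster_ring s) G" by (rule ring_hom_memI) (simp_all add: f sub)
  moreover have "f (v i) = coord j i" if "i < n" for i
    using f(5)[of "b i"] b_in[OF that] that b by (simp add: bij_betw_def seeds_of_sel(1)[OF t] the_inv_into_f_f)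
  ultimately show ?thesis by (intro bexI[of _ f] allI impI)
qed

text \<open>The restriction of functions on the variety to that generic point.\<close>

definition restr where "restr j = (SOME f. f \<in> ring_hom (cluster_ring s) G \<and> (\<forall>i<n. f (v i) = coord j i))"

lemma restr: "restr j \<in> ring_hom (cluster_ring s) G" "i < n \<Longrightarrow> restr j (v i) = coord j i"
proof -
  have "restr j \<in> ring_hom (cluster_ring s) G \<and> (\<forall>i<n. restr j (v i) = coord j i)"
    using someI_ex[OF ex_restriction[of j, unfolded Bex_def], folded restr_def] .
  thus "restr j \<in> ring_hom (cluster_ring s) G" "i < n \<Longrightarrow> restr j (v i) = coord j i" by auto
qed

definition \<Psi> where "\<Psi> j = TP.lift G (restr j) (K.delta 0)"

lemma \<Psi>_hom: "\<Psi> j \<in> ring_hom T G"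
  unfolding \<Psi>_def by (rule TP.lift_hom[OF G.is_cring restr(1) K.delta_hom])

lemma \<Psi>_v: "i < n \<Longrightarrow> \<Psi> j (TP.tens (v i) \<one>\<^bsub>K\<^esub>) = coord j i"
proof -
  assume i: "i < n"
  have "\<Psi> j (TP.tens (v i) \<one>\<^bsub>K\<^esub>) = restr j (v i) \<otimes>\<^bsub>G\<^esub> K.delta 0 \<one>\<^bsub>K\<^esub>"
    unfolding \<Psi>_def by (rule TP.lift_tens[OF G.is_cring restr(1) K.delta_hom]) (use i in simp_all)
  thus ?thesis using G.Units_closed[OF coord_unit[OF i]] G.r_one restr(2)[OF i] by (simp add: K.group_algebra_simps(3))
qed

lemma \<Psi>_const: "c \<in> carrier K \<Longrightarrow> \<Psi> j (TP.tens 1 c) = K.delta 0 c"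
proof -
  assume c: "c \<in> carrier K"
  have "\<Psi> j (TP.tens 1 c) = restr j \<one>\<^bsub>cluster_ring s\<^esub> \<otimes>\<^bsub>G\<^esub> K.delta 0 c"
    unfolding \<Psi>_def using TP.lift_tens[OF G.is_cring restr(1) K.delta_hom, of 1 c j] c by simp
  thus ?thesis using ring_hom_one[OF restr(1)] G.l_one[OF K.delta_in_group_algebra[OF c]] by simp
qed

lemma eq_on_T:
  assumes f: "f \<in> ring_hom T G" and j: "\<And>i. i < n \<Longrightarrow> f (TP.tens (v i) \<one>\<^bsub>K\<^esub>) = coord j i"
    and c: "\<And>c. c \<in> carrier K \<Longrightarrow> f (TP.tens 1 c) = K.delta 0 c" and x: "x \<in> carrier T"
  shows "f x = \<Psi> j x"
proof (rule ring_hom_eq_tensor[OF s t K.is_cring G.is_cring f \<Psi>_hom _ _ _ x])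
  fix i assume "i \<in> ind s"
  then obtain k where k: "k < n" "i = b k" by (rule b_cases)
  show "f (TP.tens (var t i) \<one>\<^bsub>K\<^esub>) \<in> Units G" using j coord_unit k by simp
  show "f (TP.tens (var t i) \<one>\<^bsub>K\<^esub>) = \<Psi> j (TP.tens (var t i) \<one>\<^bsub>K\<^esub>)" using j \<Psi>_v k by simp
qed (simp add: c \<Psi>_const)

text \<open>The functions that vanish on the subtorus. These primes form the chain required by the criterion for regularity, from the generic point of the
  torus to \<open>p\<close> itself.\<close>

definition stratum where "stratum j = {x \<in> carrier T. \<Psi> j x = \<zero>\<^bsub>G\<^esub>}"

lemma stratum_prime: "primeideal (stratum j) T"
  unfolding stratum_def by (rule kernel_prime[OF TP.cring_T G.domain_axioms \<Psi>_hom])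

lemma stratum_Suc:
  assumes j: "j < n"
  shows "stratum j \<subseteq> stratum (Suc j)"
proof -
  \<comment> \<open>The specialisation of the \<open>j\<close>-th indeterminate to its value at \<open>p\<close> carries one homomorphism into the next.\<close>
  define u where "u i = (if i = j then K.delta 0 (p (v j)) else K.delta (frag_of i) \<one>\<^bsub>K\<^esub>)" for i
  have uU: "u i \<in> Units G" for i using p_unit[OF j] by (auto simp: u_def intro!: K.delta_unit)
  obtain \<psi> where \<psi>: "\<And>e. \<psi> e \<in> Units G" "\<And>e e'. \<psi> (e + e') = \<psi> e \<otimes>\<^bsub>G\<^esub> \<psi> e'" "\<psi> 0 = \<one>\<^bsub>G\<^esub>" "\<And>i. \<psi> (frag_of i) = u i"
  proof -
    from units_character[where u = u, OF G.is_cring uU] that show thesis .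
  qed
  have \<psi>c: "\<psi> e \<in> carrier G" for e using \<psi>(1) G.Units_closed by blast
  obtain \<sigma> where \<sigma>: "\<sigma> \<in> ring_hom G G" "\<And>a k. k \<in> carrier K \<Longrightarrow> \<sigma> (K.delta a k) = K.delta 0 k \<otimes>\<^bsub>G\<^esub> \<psi> a"
  proof -
    from group_algebra_universal[OF K.is_cring G.is_cring K.delta_hom \<psi>c \<psi>(2,3)] that show thesis .
  qed
  interpret \<sigma>: ring_hom_cring G G \<sigma> by (rule ring_hom_cringI[OF G.is_cring G.is_cring \<sigma>(1)])
  have \<sigma>0: "\<sigma> (K.delta 0 k) = K.delta 0 k" if "k \<in> carrier K" for k
    using \<sigma>(2)[OF that, of 0] G.r_one[OF K.delta_in_group_algebra[OF that]] by (simp add: \<psi>(3))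
  have \<sigma>1: "\<sigma> (K.delta (frag_of i) \<one>\<^bsub>K\<^esub>) = u i" for i
    using \<sigma>(2)[of "\<one>\<^bsub>K\<^esub>" "frag_of i"] G.l_one[OF \<psi>c[of "frag_of i"]] by (simp add: \<psi>(4) K.group_algebra_simps(3))
  have "\<Psi> (Suc j) x = \<sigma> (\<Psi> j x)" if x: "x \<in> carrier T" for x
  proof -
    have "(\<sigma> \<circ> \<Psi> j) x = \<Psi> (Suc j) x"
    proof (rule eq_on_T[OF ring_hom_trans[OF \<Psi>_hom \<sigma>(1)] _ _ x])
      show "(\<sigma> \<circ> \<Psi> j) (TP.tens (v i) \<one>\<^bsub>K\<^esub>) = coord (Suc j) i" if i: "i < n" for i
        using \<sigma>0[of "p (v i)"] \<sigma>1[of i] i by (auto simp: \<Psi>_v coord_def u_def less_Suc_eq)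
      show "(\<sigma> \<circ> \<Psi> j) (TP.tens 1 c) = K.delta 0 c" if "c \<in> carrier K" for c
        using that by (simp add: \<Psi>_const \<sigma>0)
    qed
    thus ?thesis by simp
  qed
  thus ?thesis unfolding stratum_def using \<sigma>.hom_zero by auto
qed

text \<open>On the last subtorus, which is the point \<open>p\<close>, all coordinates are constants, and the homomorphism is evaluation at \<open>p\<close>.\<close>

lemma stratum_n: "stratum n = Q"
proof -
  have "\<Psi> n x = (K.delta 0 \<circ> ev) x" if x: "x \<in> carrier T" for x
  proof (rule sym, rule eq_on_T[OF ring_hom_trans[OF ev_hom K.delta_hom] _ _ x])
    show "(K.delta 0 \<circ> ev) (TP.tens (v i) \<one>\<^bsub>K\<^esub>) = coord n i" if "i < n" for i
      using that ev_tens[of "v i" "\<one>\<^bsub>K\<^esub>"] by (simp add: coord_def)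
    show "(K.delta 0 \<circ> ev) (TP.tens 1 c) = K.delta 0 c" if "c \<in> carrier K" for c
      using that ev_tens[of 1 c] p.hom_one by simp
  qed
  moreover have "K.delta (0 :: nat \<Rightarrow>\<^sub>0 int) c = \<zero>\<^bsub>G\<^esub> \<longleftrightarrow> c = \<zero>\<^bsub>K\<^esub>" for c
    by (auto simp: K.delta_def K.group_algebra_simps fun_eq_iff)
  ultimately show ?thesis unfolding stratum_def Q_eq by auto
qed

lemma stratum_le:
  assumes "j \<le> n"
  shows "stratum j \<subseteq> Q"
  using assms
proof (induction j rule: inc_induct)
  case base
  show ?case by (simp add: stratum_n)
next
  case (step j)
  thus ?case using stratum_Suc by blast
qed

abbreviation "y i \<equiv> TP.tens (v i) \<one>\<^bsub>K\<^esub> \<ominus>\<^bsub>T\<^esub> TP.tens 1 (p (v i))"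

lemma y_stratum:
  assumes i: "i < n"
  shows "y i \<in> stratum j \<longleftrightarrow> i < j"
proof -
  interpret \<Psi>: ring_hom_cring T G "\<Psi> j" by (rule ring_hom_cringI[OF TP.cring_T G.is_cring \<Psi>_hom])
  have c: "TP.tens (v i) \<one>\<^bsub>K\<^esub> \<in> carrier T" "TP.tens 1 (p (v i)) \<in> carrier T" using i by simp_all
  have "\<Psi> j (y i) = coord j i \<ominus>\<^bsub>G\<^esub> K.delta 0 (p (v i))"
    using c i by (simp add: a_minus_def \<Psi>_v \<Psi>_const)
  hence "y i \<in> stratum j \<longleftrightarrow> coord j i = K.delta 0 (p (v i))"
    using c i G.r_right_minus_eq[of "coord j i" "K.delta 0 (p (v i))"] G.Units_closed[OF coord_unit[OF i]]
    by (simp add: stratum_def)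
  also have "\<dots> \<longleftrightarrow> i < j"
  proof -
    have "K.delta (frag_of i) \<one>\<^bsub>K\<^esub> (frag_of i) \<noteq> K.delta 0 (p (v i)) (frag_of i)" by (simp add: K.delta_def)
    thus ?thesis unfolding coord_def by (metis (full_types))
  qed
  finally show ?thesis .
qed

abbreviation "tgen \<equiv> (TP.tens 1) ` carrier K \<union> (\<lambda>i. TP.tens (v i) \<one>\<^bsub>K\<^esub>) ` {..<n}"

text \<open>The tensor product becomes a Laurent polynomial ring over \<open>K\<close> when the cluster monomial is inverted.\<close>

lemma tensor_clear_denominators:
  assumes "x \<in> carrier T"
  shows "\<exists>N. TP.tens (cluster_monomial t ^ N) \<one>\<^bsub>K\<^esub> \<otimes>\<^bsub>T\<^esub> x \<in> generate_ring T tgen"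
  using assms
proof (induction x rule: TP.T_induct)
  note A = sring_cluster_algebra[of s]
  let ?H = "generate_ring T tgen"
  have m: "cluster_monomial t ^ N \<in> cluster_algebra s" for N
    unfolding cluster_monomial_def
    by (intro sring_power[OF A] sring_prod[OF A]) (simp add: var_in_cluster_algebra[OF t] seeds_of_sel(1)[OF t])
  define E where "E = {a \<in> cluster_algebra s. TP.tens a \<one>\<^bsub>K\<^esub> \<in> ?H}"
  interpret l: ring_hom_cring "cluster_ring s" T "\<lambda>a. TP.tens a \<one>\<^bsub>K\<^esub>"
    by (rule ring_hom_cringI[OF cring_cluster_ring TP.cring_T TP.left_hom])
  have E: "sring E" unfolding sring_def
  proof (intro conjI ballI)
    show "1 \<in> E" using l.hom_one generate_ring.one[of T] by (simp add: E_def)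
    show "- a \<in> E" if "a \<in> E" for a
      using that l.hom_a_inv[of a] sring_uminus[OF A] generate_ring.a_inv[of _ T]
      by (simp add: E_def cluster_ring_a_inv)
    show "x + y \<in> E" "x * y \<in> E" if "x \<in> E" "y \<in> E" for x y
      using that l.hom_add[of x y] l.hom_mult[of x y] sring_add[OF A] sring_mult[OF A]
        generate_ring.eng_add[of _ T] generate_ring.eng_mult[of _ T] by (simp_all add: E_def)
  qed
  have vE: "var t i \<in> E" if "i \<in> ind t" for i
  proof -
    obtain k where "k < n" "i = b k" using b_cases \<open>i \<in> ind t\<close> seeds_of_sel(1)[OF t] by metis
    thus ?thesis unfolding E_def by (auto intro!: generate_ring.incl)
  qed
  have mE: "cluster_monomial t ^ N \<in> E" for N
    unfolding cluster_monomial_def by (intro sring_power[OF E] sring_prod[OF E] vE)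
  {
    case (tens a c)
    obtain N where N: "a * cluster_monomial t ^ N \<in> E"
      using laurents_clear_denominators[OF seeds_of_good[OF s t] E vE, of a] tens cluster_algebra_subset_laurents[OF s t]
      by (auto simp: cluster_monomial_def)
    have "TP.tens (cluster_monomial t ^ N) \<one>\<^bsub>K\<^esub> \<otimes>\<^bsub>T\<^esub> TP.tens a c
        = TP.tens (a * cluster_monomial t ^ N) \<one>\<^bsub>K\<^esub> \<otimes>\<^bsub>T\<^esub> TP.tens 1 c"
      using tens m[of N] sring_mult[OF A, of a "cluster_monomial t ^ N"] by (simp add: TP.tens_mult mult.commute)
    moreover have "TP.tens 1 c \<in> ?H" using tens by (auto intro: generate_ring.incl)
    ultimately have "TP.tens (cluster_monomial t ^ N) \<one>\<^bsub>K\<^esub> \<otimes>\<^bsub>T\<^esub> TP.tens a c \<in> ?H"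
      using N generate_ring.eng_mult[of _ T] by (simp add: E_def)
    thus ?case by blast
  next
    case (diff Z Y)
    then obtain N M where NM: "TP.tens (cluster_monomial t ^ N) \<one>\<^bsub>K\<^esub> \<otimes>\<^bsub>T\<^esub> Z \<in> ?H"
        "TP.tens (cluster_monomial t ^ M) \<one>\<^bsub>K\<^esub> \<otimes>\<^bsub>T\<^esub> Y \<in> ?H" by blast
    define a where "a = TP.tens (cluster_monomial t ^ N) \<one>\<^bsub>K\<^esub>"
    define c where "c = TP.tens (cluster_monomial t ^ M) \<one>\<^bsub>K\<^esub>"
    have ac: "a \<in> carrier T" "c \<in> carrier T" "a \<in> ?H" "c \<in> ?H"
      using mE[of N] mE[of M] m by (simp_all add: a_def c_def E_def)
    have "TP.tens (cluster_monomial t ^ (N + M)) \<one>\<^bsub>K\<^esub> = a \<otimes>\<^bsub>T\<^esub> c"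
      unfolding a_def c_def using m by (simp add: TP.tens_mult power_add)
    moreover have "a \<otimes>\<^bsub>T\<^esub> c \<otimes>\<^bsub>T\<^esub> (Z \<ominus>\<^bsub>T\<^esub> Y) = c \<otimes>\<^bsub>T\<^esub> (a \<otimes>\<^bsub>T\<^esub> Z) \<oplus>\<^bsub>T\<^esub> (\<ominus>\<^bsub>T\<^esub> (a \<otimes>\<^bsub>T\<^esub> (c \<otimes>\<^bsub>T\<^esub> Y)))"
      using ac(1,2) diff(1,2) by algebra
    moreover have "\<dots> \<in> ?H"
      using generate_ring.eng_add[OF generate_ring.eng_mult[OF ac(4) NM(1)]
          generate_ring.a_inv[OF generate_ring.eng_mult[OF ac(3) NM(2)]]] unfolding a_def c_def .
    ultimately show ?case by metis
  }
qed

lemma cluster_monomial_notin_Q: "TP.tens (cluster_monomial t ^ N) \<one>\<^bsub>K\<^esub> \<in> carrier T - Q"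
proof -
  note A = sring_cluster_algebra[of s]
  have v: "var t i \<in> cluster_algebra s" if "i \<in> ind s" for i by (rule var_in_cluster_algebra[OF t that])
  have pm: "p (x * y) = p x \<otimes>\<^bsub>K\<^esub> p y" if "x \<in> cluster_algebra s" "y \<in> cluster_algebra s" for x y
    using p.hom_mult[of x y] that by simp
  have p1: "p 1 = \<one>\<^bsub>K\<^esub>" using p.hom_one by simp
  have "(\<Prod>i\<in>S. var t i) \<in> cluster_algebra s \<and> p (\<Prod>i\<in>S. var t i) \<noteq> \<zero>\<^bsub>K\<^esub>" if "finite S" "S \<subseteq> ind s" for S
    using that
  proof (induction S rule: finite_induct)
    case (insert i S)
    thus ?case using v nz[of i] K.integral_iff sring_mult[OF A] by (auto simp: pm)
  qed (simp add: p1)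
  hence m: "cluster_monomial t \<in> cluster_algebra s" "p (cluster_monomial t) \<noteq> \<zero>\<^bsub>K\<^esub>"
    using goodD(1)[OF s] by (auto simp: cluster_monomial_def seeds_of_sel(1)[OF t])
  have "cluster_monomial t ^ N \<in> cluster_algebra s \<and> p (cluster_monomial t ^ N) \<noteq> \<zero>\<^bsub>K\<^esub>"
    by (induction N) (use m K.integral_iff sring_mult[OF A] in \<open>auto simp: pm p1\<close>)
  thus ?thesis using ev_tens[of "cluster_monomial t ^ N" "\<one>\<^bsub>K\<^esub>"] by (simp add: Q_eq)
qed

text \<open>The localization at \<open>p\<close> inverts the cluster variables, so it is a localization of a polynomial ring over \<open>K\<close> up to units, and the
  shifted coordinates \<open>y i\<close> together with the strata satisfy the criterion.\<close>

theorem regular_at_torus_point: "regular_local_ring (localization_at T Q)"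
proof -
  interpret PL: prime_localization Q T by (rule prime_localization.intro[OF Q_prime])
  interpret L: cring PL.L by (rule PL.cring_L)
  interpret loc: ring_hom_cring T PL.L PL.loc by (rule ring_hom_cringI[OF TP.cring_T PL.cring_L PL.loc_hom])
  define \<kappa> where "\<kappa> c = PL.loc (TP.tens 1 c)" for c
  define F where "F = \<kappa> ` carrier K"
  define xs where "xs = map (\<lambda>i. PL.loc (TP.tens (v i) \<one>\<^bsub>K\<^esub>)) [0..<n]"
  have ext: "primeideal (PL.ext (stratum j)) PL.L" if "j \<le> n" for j
    by (rule PL.ext_prime[OF stratum_prime stratum_le[OF that]])
  interpret M: primeideal "PL.ext Q" PL.L using ext[of n] by (simp add: stratum_n)
  have tgen: "F \<union> set xs = PL.loc ` tgen"
    unfolding F_def \<kappa>_def xs_def by (auto simp: image_Un image_image atLeast0LessThan)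
  have yloc: "PL.loc (y i) \<in> PL.ext (stratum j) \<longleftrightarrow> i < j" if "i < n" "j \<le> n" for i j
    using PL.ext_loc_iff[OF stratum_prime stratum_le[OF that(2)], of "y i"] y_stratum[OF that(1)] that(1) by simp
  show ?thesis
  proof (rule L.regular_local_ringI)
    have "\<kappa> = PL.loc \<circ> (\<lambda>c. TP.tens \<one>\<^bsub>cluster_ring s\<^esub> c)" by (simp add: \<kappa>_def fun_eq_iff)
    hence \<kappa>: "\<kappa> \<in> ring_hom K PL.L" using ring_hom_trans[OF TP.right_hom PL.loc_hom] by metis
    have "\<one>\<^bsub>PL.L\<^esub> \<noteq> \<zero>\<^bsub>PL.L\<^esub>"
      using M.one_imp_carrier M.I_notcarr M.zero_closed by metis
    thus "subfield F PL.L"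
      unfolding F_def
      by (rule ring_hom_ring.img_is_subfield(2)[OF ring_hom_ringI2[OF K.ring_axioms L.ring_axioms \<kappa>] K.carrier_is_subfield])
    show "set xs \<subseteq> carrier PL.L" by (auto simp: xs_def)
    show "n = length xs" by (simp add: xs_def)
    show "ideal (PL.ext Q) PL.L" by (rule M.ideal_axioms)
    show "PL.ext Q \<noteq> carrier PL.L" using M.I_notcarr by simp
    show "r \<in> Units PL.L" if "r \<in> carrier PL.L" "r \<notin> PL.ext Q" for r by (rule PL.unit_if_not_in_ext[OF that])
    show "primeideal (PL.ext (stratum j)) PL.L" if "j \<le> n" for j by (rule ext[OF that])
    show "PL.ext (stratum j) \<subseteq> PL.ext (stratum (Suc j))" if "j < n" for j
      using stratum_Suc[OF that] unfolding PL.ext_def by blast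
    show "PL.loc (y i) \<in> PL.ext (stratum j) \<longleftrightarrow> i < j" if "i < n" "j \<le> n" for i j by (rule yloc[OF that])
    show "PL.loc (y i) \<in> PL.ext Q \<and> (\<exists>c\<in>F. PL.loc (y i) = xs ! i \<ominus>\<^bsub>PL.L\<^esub> c)" if i: "i < n" for i
    proof
      show "PL.loc (y i) \<in> PL.ext Q" using yloc[of i n] i by (simp add: stratum_n)
      have "\<kappa> (p (v i)) \<in> F" using i by (simp add: F_def)
      moreover have "PL.loc (y i) = xs ! i \<ominus>\<^bsub>PL.L\<^esub> \<kappa> (p (v i))"
        using i by (simp add: xs_def \<kappa>_def a_minus_def)
      ultimately show "\<exists>c\<in>F. PL.loc (y i) = xs ! i \<ominus>\<^bsub>PL.L\<^esub> c" by blast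
    qed
    show "\<exists>g\<in>Units PL.L. g \<otimes>\<^bsub>PL.L\<^esub> x \<in> generate_ring PL.L (F \<union> set xs)" if x: "x \<in> carrier PL.L" for x
    proof -
      obtain r d where rd: "r \<in> carrier T" "d \<in> PL.den" "PL.loc d \<otimes>\<^bsub>PL.L\<^esub> x = PL.loc r"
        using PL.loc_fraction[OF x] by blast
      obtain N where N: "TP.tens (cluster_monomial t ^ N) \<one>\<^bsub>K\<^esub> \<otimes>\<^bsub>T\<^esub> r \<in> generate_ring T tgen"
        using tensor_clear_denominators[OF rd(1)] by blast
      let ?m = "TP.tens (cluster_monomial t ^ N) \<one>\<^bsub>K\<^esub>"
      have m: "?m \<in> PL.den" by (rule cluster_monomial_notin_Q)
      have "PL.loc (?m \<otimes>\<^bsub>T\<^esub> d) \<otimes>\<^bsub>PL.L\<^esub> x = PL.loc (?m \<otimes>\<^bsub>T\<^esub> r)"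
        using m rd x by (simp add: L.m_assoc)
      moreover have "PL.loc (?m \<otimes>\<^bsub>T\<^esub> r) \<in> generate_ring PL.L (PL.loc ` tgen)"
        by (rule hom_generate_ring[OF TP.T.ring_axioms L.ring_axioms PL.loc_hom _ N]) auto
      moreover have "PL.loc (?m \<otimes>\<^bsub>T\<^esub> d) \<in> Units PL.L" by (rule PL.loc_unit[OF PL.den_mult[OF m rd(2)]])
      ultimately show ?thesis unfolding tgen by metis
    qed
  qed
qed

end

lemma nonsingular:
  fixes s :: "('i, 'f::field_char_0) seed" and K :: "'l ring"
  assumes s: "good s" and one: "1 \<in> deep_ideal s" and K: "field K"
  shows "nonsingular_variety s K"
  unfolding nonsingular_variety_def nonsingular_point_def
proof
  fix p assume p: "p \<in> cluster_variety s K"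
  obtain t where t: "t \<in> seeds_of s" "\<forall>i\<in>ind s. p (var t i) \<noteq> \<zero>\<^bsub>K\<^esub>"
    using point_off_deep_locus[OF s one K p] by blast
  obtain b where b: "bij_betw b {..<card (ind s)} (ind s)"
    using ex_bij_betw_nat_finite[OF goodD(1)[OF s]] by (auto simp: atLeast0LessThan)
  interpret torus_point s t K p b "card (ind s)"
    by (rule torus_point.intro[OF s t(1) K _ _ b]) (use t(2) p in \<open>auto simp: cluster_variety_def\<close>)
  show "regular_local_ring (localization_at (tensor_ring (cluster_ring s) K) (point_ideal (cluster_ring s) K p))"
    by (rule regular_at_torus_point)
qed

theorem theorem2p7:
  fixes s :: "('i, 'f::field_char_0) seed"
  assumes "is_seed s"
  shows "(no_deep_points TYPE('k::infinite) s \<longleftrightarrow> 1 \<in> deep_ideal s) \<and>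
    (no_deep_points TYPE('k) s \<longrightarrow>
       (\<forall>K :: 'l ring. field K \<longrightarrow> nonsingular_variety s K) \<and>
       finitely_generated_ring (cluster_algebra s) \<and>
       cluster_algebra s = upper_cluster_algebra s \<and>
       locally_acyclic s)"
proof -
  have s: "good s" by (rule is_seed_good[OF assms])
  show ?thesis
    using no_deep_points_iff[OF s, where 'k = 'k] nonsingular[OF s] finitely_generated[OF s] equals_upper[OF s]
      locally_acyclic_if_no_deep[OF s] by blast
qed

end
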